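(* Let $A\to B$ be a surjective morphism in $\mathbf{DGArt}_{\mathbb{K}}^{\le 0}$. Let $g_A\colon P_A\to R_A$ be a cofibration between flat objects in $\mathbf{CDGA}_A^{\le 0}$, and let $e_A\colon P_A\to P_A$ be a trivial idempotent in $\mathbf{CDGA}_A^{\le 0}$. Denote by $$g_B\colon P_B = P_A\otimes_A B\to R_A\otimes_AB = R_B, \qquad e_B\colon P_B\to P_B$$ the pushout cofibration $g_A\otimes_AB$ and the pushout idempotent $e_A\otimes_AB$ in $\mathbf{CDGA}_B^{\le 0}$. Let $f_B\colon R_B\to R_B$ be a trivial idempotent in $\mathbf{CDGA}_B^{\le 0}$ satisfying $f_Bg_B = g_Be_B$. Then there exists a trivial idempotent $f_A\colon R_A\to R_A$ in $\mathbf{CDGA}_{A}^{\le 0}$ lifting $f_B$ (i.e. $f_A\otimes_AB=f_B$) such that $f_Ag_A = g_Ae_A$.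
   Context: $\mathbb{K}$ is a field of characteristic $0$. $\mathbf{CDGA}_{\mathbb{K}}^{\le 0}$ is the category of (unital) differential graded commutative $\mathbb{K}$-algebras concentrated in non-positive degrees (differential of degree $+1$), with the projective model structure: weak equivalences are the quasi-isomorphisms, fibrations are the morphisms surjective in strictly negative degrees, cofibrations are the retracts of semifree extensions $A\to A[\{x_i\}]$ (polynomial extensions in an arbitrary number of variables of non-positive degree). For $A\in\mathbf{CDGA}_{\mathbb{K}}^{\le 0}$, $\mathbf{CDGA}_A^{\le 0}$ is the undercategory of morphisms $A\to X$ with the induced model structure. $\mathbf{DGArt}_{\mathbb{K}}^{\le 0}$ is the full subcategory of differential graded local Artin algebras with residue field $\mathbb{K}$: $A=\oplus A^i$ with $A^0$ a local Artin algebra with maximal ideal $\mathfrak{m}_{A^0}$ such that $\mathbb{K}\to A^0/\mathfrak{m}_{A^0}$ is an isomorphism, and $A$ a finitely generated graded $A^0$-module. An object $P$ of $\mathbf{CDGA}_A^{\le 0}$ is flat if $A\to P$ is flat, i.e. $-\otimes_AP\colon\mathbf{CDGA}_A^{\le 0}\to\mathbf{CDGA}_P^{\le 0}$ preserves pullback squares of trivial fibrations: for every trivial fibration $C\to D$ and every morphism $E\to D$ in $\mathbf{CDGA}_A^{\le 0}$, $C\otimes_AP\to D\otimes_AP$ is a trivial fibration and $(C\times_DE)\otimes_AP\to(C\otimes_AP)\times_{D\otimes_AP}(E\otimes_AP)$ is an isomorphism. An idempotent is an endomorphism $e$ with $e\circ e=e$; it is a trivial idempotent if it is also a weak equivalence.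 *)

theory Defs
  imports "HOL-Algebra.Module" "HOL-Algebra.QuotRing"
begin

section \<open>Graded-commutative algebras and commutative dg algebras over a ring of scalars\<close>

text \<open>
  A dg algebra is represented by its total space (a \<^typ>\<open>('k, 'u) module\<close> record with carrier in
  \<^typ>\<open>'u\<close>), its family of homogeneous components and its differential. An object of an
  undercategory carries in addition its structure morphism.

  The type \<^typ>\<open>'u\<close> is the universe: the category of dg algebras consists of all those whose carrier
  is a set of elements of \<^typ>\<open>'u\<close>, and every definition below that quantifies over objects of
  the category (universal properties, test objects for flatness, the semifree extensions of which a
  cofibration is a retract) ranges over this category. The type is arbitrary. If it contains a nonzero
  algebra over a field of characteristic 0 it is infinite, so that every algebra generated by at most
  \<open>|'u|\<close> elements over members of the universe has an isomorphic copy in the universe; in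
  particular pushouts, fibre products, free algebras and the factorizations of the model structure exist there.
\<close>

record ('k, 'u) dga = "('k, 'u) module" +
  grade :: "int \<Rightarrow> 'u set"
  differential :: "'u \<Rightarrow> 'u"

record ('k, 'u) under_dga = "('k, 'u) dga" +
  unit_map :: "'u \<Rightarrow> 'u"

definition signed :: "('u, 'm) ring_scheme \<Rightarrow> int \<Rightarrow> 'u \<Rightarrow> 'u"
  \<comment> \<open>\<open>(-1)^i x\<close>\<close>
  where "signed A i x = (if even i then x else \<ominus>\<^bsub>A\<^esub> x)"

text \<open>The differential plays no role in the following locale.\<close>

locale graded_comm_algebra = module K A + ring A
  for K :: "('k, 'm) ring_scheme" and A :: "('k, 'u, 'z) dga_scheme" +
  assumes smult_mult_left:
      "\<lbrakk>a \<in> carrier K; x \<in> carrier A; y \<in> carrier A\<rbrakk>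
        \<Longrightarrow> (a \<odot>\<^bsub>A\<^esub> x) \<otimes>\<^bsub>A\<^esub> y = a \<odot>\<^bsub>A\<^esub> (x \<otimes>\<^bsub>A\<^esub> y)"
    and smult_mult_right:
      "\<lbrakk>a \<in> carrier K; x \<in> carrier A; y \<in> carrier A\<rbrakk>
        \<Longrightarrow> x \<otimes>\<^bsub>A\<^esub> (a \<odot>\<^bsub>A\<^esub> y) = a \<odot>\<^bsub>A\<^esub> (x \<otimes>\<^bsub>A\<^esub> y)"
    and grade_submodule: "submodule (grade A i) K A"
    and grade_direct_sum:
      "x \<in> carrier A \<Longrightarrow>
        \<exists>!c. (\<forall>i. c i \<in> grade A i) \<and> finite {i. c i \<noteq> \<zero>\<^bsub>A\<^esub>} \<and>
             x = finsum A c {i. c i \<noteq> \<zero>\<^bsub>A\<^esub>}"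
    and one_grade: "\<one>\<^bsub>A\<^esub> \<in> grade A 0"
    and mult_grade:
      "\<lbrakk>x \<in> grade A i; y \<in> grade A j\<rbrakk> \<Longrightarrow> x \<otimes>\<^bsub>A\<^esub> y \<in> grade A (i + j)"
    and graded_comm:
      "\<lbrakk>x \<in> grade A i; y \<in> grade A j\<rbrakk>
        \<Longrightarrow> x \<otimes>\<^bsub>A\<^esub> y = signed A (i * j) (y \<otimes>\<^bsub>A\<^esub> x)"

locale cdga = graded_comm_algebra K A
  for K :: "('k, 'm) ring_scheme" and A :: "('k, 'u, 'z) dga_scheme" +
  assumes nonpositive: "i > 0 \<Longrightarrow> grade A i = {\<zero>\<^bsub>A\<^esub>}"
    and diff_grade: "x \<in> grade A i \<Longrightarrow> differential A x \<in> grade A (i + 1)"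
    and diff_add:
      "\<lbrakk>x \<in> carrier A; y \<in> carrier A\<rbrakk>
        \<Longrightarrow> differential A (x \<oplus>\<^bsub>A\<^esub> y) = differential A x \<oplus>\<^bsub>A\<^esub> differential A y"
    and diff_smult:
      "\<lbrakk>a \<in> carrier K; x \<in> carrier A\<rbrakk>
        \<Longrightarrow> differential A (a \<odot>\<^bsub>A\<^esub> x) = a \<odot>\<^bsub>A\<^esub> differential A x"
    and diff_diff: "x \<in> carrier A \<Longrightarrow> differential A (differential A x) = \<zero>\<^bsub>A\<^esub>"
    and leibniz:
      "\<lbrakk>x \<in> grade A i; y \<in> carrier A\<rbrakk>
        \<Longrightarrow> differential A (x \<otimes>\<^bsub>A\<^esub> y) =
            (differential A x \<otimes>\<^bsub>A\<^esub> y) \<oplus>\<^bsub>A\<^esub> signed A i (x \<otimes>\<^bsub>A\<^esub> differential A y)"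

text \<open>Morphisms are functions on the type that are relevant only on the carrier.\<close>

definition graded_hom ::
  "('k, 'm) ring_scheme \<Rightarrow> ('k, 'u, 'y) dga_scheme \<Rightarrow> ('k, 'u, 'z) dga_scheme \<Rightarrow> ('u \<Rightarrow> 'u) set"
  where "graded_hom K A B = {f \<in> ring_hom A B.
      (\<forall>a\<in>carrier K. \<forall>x\<in>carrier A. f (a \<odot>\<^bsub>A\<^esub> x) = a \<odot>\<^bsub>B\<^esub> f x) \<and>
      (\<forall>i. f ` grade A i \<subseteq> grade B i)}"

definition cdga_hom ::
  "('k, 'm) ring_scheme \<Rightarrow> ('k, 'u, 'y) dga_scheme \<Rightarrow> ('k, 'u, 'z) dga_scheme \<Rightarrow> ('u \<Rightarrow> 'u) set"
  where "cdga_hom K A B = {f \<in> graded_hom K A B.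
      \<forall>x\<in>carrier A. f (differential A x) = differential B (f x)}"


section \<open>The model structure\<close>

definition cocycles :: "('k, 'u, 'z) dga_scheme \<Rightarrow> int \<Rightarrow> 'u set"
  where "cocycles A i = {x \<in> grade A i. differential A x = \<zero>\<^bsub>A\<^esub>}"

definition coboundaries :: "('k, 'u, 'z) dga_scheme \<Rightarrow> int \<Rightarrow> 'u set"
  where "coboundaries A i = differential A ` grade A (i - 1)"

definition cohomology :: "('k, 'u, 'z) dga_scheme \<Rightarrow> int \<Rightarrow> 'u set monoid"
  where "cohomology A i = A\<lparr>carrier := cocycles A i\<rparr> A_Mod coboundaries A i"

text \<open>On the class of a cocycle \<open>z\<close>, all the cosets in this union are the class of \<open>f z\<close>.\<close>

definition cohomology_map :: "('k, 'u, 'z) dga_scheme \<Rightarrow> int \<Rightarrow> ('u \<Rightarrow> 'u) \<Rightarrow> 'u set \<Rightarrow> 'u set"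
  where "cohomology_map B i f S = (\<Union>x\<in>S. coboundaries B i +>\<^bsub>B\<^esub> f x)"

definition weak_equivalence ::
  "('k, 'u, 'y) dga_scheme \<Rightarrow> ('k, 'u, 'z) dga_scheme \<Rightarrow> ('u \<Rightarrow> 'u) \<Rightarrow> bool"
  where "weak_equivalence A B f \<longleftrightarrow>
    (\<forall>i. cohomology_map B i f \<in> iso (cohomology A i) (cohomology B i))"

definition fibration ::
  "('k, 'u, 'y) dga_scheme \<Rightarrow> ('k, 'u, 'z) dga_scheme \<Rightarrow> ('u \<Rightarrow> 'u) \<Rightarrow> bool"
  where "fibration A B f \<longleftrightarrow> (\<forall>i<0. f ` grade A i = grade B i)"

definition trivial_fibration ::
  "('k, 'u, 'y) dga_scheme \<Rightarrow> ('k, 'u, 'z) dga_scheme \<Rightarrow> ('u \<Rightarrow> 'u) \<Rightarrow> bool"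
  where "trivial_fibration A B f \<longleftrightarrow> fibration A B f \<and> weak_equivalence A B f"

text \<open>
  \<open>Y\<close> is, as a graded-commutative algebra (differentials disregarded), the polynomial extension
  \<open>X[{x | x \<in> S}]\<close> in the variables \<open>x \<in> S\<close> of degree \<open>deg x\<close>, i.e.\ the free
  graded-commutative \<open>X\<close>-algebra on \<open>S\<close>. Being free, odd variables square to zero.
\<close>

definition polynomial_extension ::
  "('k, 'm) ring_scheme \<Rightarrow> ('k, 'u, 'y) dga_scheme \<Rightarrow> ('k, 'u, 'z) dga_scheme \<Rightarrow> ('u \<Rightarrow> 'u)
    \<Rightarrow> 'u set \<Rightarrow> ('u \<Rightarrow> int) \<Rightarrow> bool"
  where "polynomial_extension K X Y h S deg \<longleftrightarrow>
    h \<in> graded_hom K X Y \<and> (\<forall>x\<in>S. x \<in> grade Y (deg x)) \<and>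
    (\<forall>W :: ('k, 'u) dga. \<forall>\<phi> v.
      graded_comm_algebra K W \<and> \<phi> \<in> graded_hom K X W \<and> (\<forall>x\<in>S. v x \<in> grade W (deg x)) \<longrightarrow>
      (\<exists>\<psi>\<in>graded_hom K Y W. (\<forall>a\<in>carrier X. \<psi> (h a) = \<phi> a) \<and> (\<forall>x\<in>S. \<psi> x = v x) \<and>
        (\<forall>\<psi>'\<in>graded_hom K Y W.
          (\<forall>a\<in>carrier X. \<psi>' (h a) = \<phi> a) \<and> (\<forall>x\<in>S. \<psi>' x = v x) \<longrightarrow>
          (\<forall>y\<in>carrier Y. \<psi>' y = \<psi> y))))"

definition semifree_extension ::
  "('k, 'm) ring_scheme \<Rightarrow> ('k, 'u, 'y) dga_scheme \<Rightarrow> ('k, 'u, 'z) dga_scheme \<Rightarrow> ('u \<Rightarrow> 'u) \<Rightarrow> bool"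
  where "semifree_extension K X Y h \<longleftrightarrow>
    cdga K X \<and> cdga K Y \<and> h \<in> cdga_hom K X Y \<and>
    (\<exists>S deg. (\<forall>x\<in>S. deg x \<le> 0) \<and> polynomial_extension K X Y h S deg)"

text \<open>Retracts are taken in the category of morphisms. A morphism of an undercategory is a
  cofibration if and only if the underlying morphism is one, so no base algebra appears here.\<close>

definition cofibration ::
  "('k, 'm) ring_scheme \<Rightarrow> ('k, 'u, 'y) dga_scheme \<Rightarrow> ('k, 'u, 'z) dga_scheme \<Rightarrow> ('u \<Rightarrow> 'u) \<Rightarrow> bool"
  where "cofibration K X Y g \<longleftrightarrow>
    (\<exists>(X' :: ('k, 'u) dga) (Y' :: ('k, 'u) dga) h s r t q.
      semifree_extension K X' Y' h \<and>
      s \<in> cdga_hom K X X' \<and> r \<in> cdga_hom K X' X \<and> (\<forall>x\<in>carrier X. r (s x) = x) \<and>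
      t \<in> cdga_hom K Y Y' \<and> q \<in> cdga_hom K Y' Y \<and> (\<forall>y\<in>carrier Y. q (t y) = y) \<and>
      (\<forall>x\<in>carrier X. h (s x) = t (g x)) \<and> (\<forall>x\<in>carrier X'. g (r x) = q (h x)))"


section \<open>Undercategories and base change\<close>

definition under_obj ::
  "('k, 'm) ring_scheme \<Rightarrow> ('k, 'u, 'y) dga_scheme \<Rightarrow> ('k, 'u) under_dga \<Rightarrow> bool"
  where "under_obj K A X \<longleftrightarrow> cdga K A \<and> cdga K X \<and> unit_map X \<in> cdga_hom K A X"

definition under_hom ::
  "('k, 'm) ring_scheme \<Rightarrow> ('k, 'u, 'y) dga_scheme \<Rightarrow> ('k, 'u) under_dga \<Rightarrow> ('k, 'u) under_dga
    \<Rightarrow> ('u \<Rightarrow> 'u) set"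
  where "under_hom K A X Y =
    {f \<in> cdga_hom K X Y. \<forall>a\<in>carrier A. f (unit_map X a) = unit_map Y a}"

definition trivial_idempotent ::
  "('k, 'm) ring_scheme \<Rightarrow> ('k, 'u, 'y) dga_scheme \<Rightarrow> ('k, 'u) under_dga \<Rightarrow> ('u \<Rightarrow> 'u) \<Rightarrow> bool"
  where "trivial_idempotent K A X e \<longleftrightarrow>
    e \<in> under_hom K A X X \<and> (\<forall>x\<in>carrier X. e (e x) = e x) \<and> weak_equivalence X X e"

text \<open>
  For objects \<open>X\<close> and \<open>P\<close> under \<open>A\<close>, the object \<open>Z\<close> under \<open>P\<close>, together with
  the canonical morphism \<open>\<iota> : X \<rightarrow> Z\<close>, is \<open>X \<otimes>\<^sub>A P\<close>, the pushout of
  \<open>X\<close> and \<open>P\<close> over \<open>A\<close>.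
\<close>

definition base_change ::
  "('k, 'm) ring_scheme \<Rightarrow> ('k, 'u, 'y) dga_scheme \<Rightarrow> ('k, 'u) under_dga \<Rightarrow> ('k, 'u) under_dga
    \<Rightarrow> ('k, 'u) under_dga \<Rightarrow> ('u \<Rightarrow> 'u) \<Rightarrow> bool"
  where "base_change K A P X Z \<iota> \<longleftrightarrow>
    under_obj K A P \<and> under_obj K A X \<and> under_obj K P Z \<and> \<iota> \<in> cdga_hom K X Z \<and>
    (\<forall>a\<in>carrier A. \<iota> (unit_map X a) = unit_map Z (unit_map P a)) \<and>
    (\<forall>W :: ('k, 'u) dga. \<forall>\<phi> \<psi>.
      cdga K W \<and> \<phi> \<in> cdga_hom K X W \<and> \<psi> \<in> cdga_hom K P W \<and>
      (\<forall>a\<in>carrier A. \<phi> (unit_map X a) = \<psi> (unit_map P a)) \<longrightarrow>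
      (\<exists>\<theta>\<in>cdga_hom K Z W.
        (\<forall>x\<in>carrier X. \<theta> (\<iota> x) = \<phi> x) \<and> (\<forall>p\<in>carrier P. \<theta> (unit_map Z p) = \<psi> p) \<and>
        (\<forall>\<theta>'\<in>cdga_hom K Z W.
          (\<forall>x\<in>carrier X. \<theta>' (\<iota> x) = \<phi> x) \<and> (\<forall>p\<in>carrier P. \<theta>' (unit_map Z p) = \<psi> p) \<longrightarrow>
          (\<forall>z\<in>carrier Z. \<theta>' z = \<theta> z))))"

text \<open>
  \<open>f'\<close> is the morphism \<open>f \<otimes>\<^sub>A P : X \<otimes>\<^sub>A P \<rightarrow> Y \<otimes>\<^sub>A P\<close> under \<open>P\<close> induced by
  \<open>f : X \<rightarrow> Y\<close>, where \<open>Z, \<iota>\<close> and \<open>Z', \<iota>'\<close> are the base changes of \<open>X\<close> and \<open>Y\<close>. By the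
  universal property, the conditions determine \<open>f'\<close> on the carrier of \<open>Z\<close>.
\<close>

definition base_change_map ::
  "('k, 'm) ring_scheme \<Rightarrow> ('k, 'u) under_dga \<Rightarrow> ('k, 'u) under_dga
    \<Rightarrow> ('k, 'u) under_dga \<Rightarrow> ('u \<Rightarrow> 'u) \<Rightarrow> ('k, 'u) under_dga \<Rightarrow> ('u \<Rightarrow> 'u)
    \<Rightarrow> ('u \<Rightarrow> 'u) \<Rightarrow> ('u \<Rightarrow> 'u) \<Rightarrow> bool"
  where "base_change_map K P X Z \<iota> Z' \<iota>' f f' \<longleftrightarrow>
    f' \<in> under_hom K P Z Z' \<and> (\<forall>x\<in>carrier X. f' (\<iota> x) = \<iota>' (f x))"

text \<open>The last condition says that the canonical morphism \<open>F \<rightarrow> C \<times>\<^sub>D E\<close> is an isomorphism.\<close>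

definition pullback_square ::
  "('k, 'm) ring_scheme \<Rightarrow> ('k, 'u, 'y) dga_scheme \<Rightarrow> ('k, 'u) under_dga \<Rightarrow> ('k, 'u) under_dga
    \<Rightarrow> ('k, 'u) under_dga \<Rightarrow> ('k, 'u) under_dga \<Rightarrow> ('u \<Rightarrow> 'u) \<Rightarrow> ('u \<Rightarrow> 'u)
    \<Rightarrow> ('u \<Rightarrow> 'u) \<Rightarrow> ('u \<Rightarrow> 'u) \<Rightarrow> bool"
  where "pullback_square K A F C E D u v p q \<longleftrightarrow>
    under_obj K A F \<and> under_obj K A C \<and> under_obj K A E \<and> under_obj K A D \<and>
    u \<in> under_hom K A F C \<and> v \<in> under_hom K A F E \<and>
    p \<in> under_hom K A C D \<and> q \<in> under_hom K A E D \<and>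
    bij_betw (\<lambda>x. (u x, v x)) (carrier F)
      {(c, e). c \<in> carrier C \<and> e \<in> carrier E \<and> p c = q e}"

definition flat ::
  "('k, 'm) ring_scheme \<Rightarrow> ('k, 'u, 'y) dga_scheme \<Rightarrow> ('k, 'u) under_dga \<Rightarrow> bool"
  where "flat K A P \<longleftrightarrow> under_obj K A P \<and>
    (\<forall>F C E D u v p q F' \<iota>F C' \<iota>C E' \<iota>E D' \<iota>D u' v' p' q'.
      pullback_square K A F C E D u v p q \<and> trivial_fibration C D p \<and>
      base_change K A P F F' \<iota>F \<and> base_change K A P C C' \<iota>C \<and>
      base_change K A P E E' \<iota>E \<and> base_change K A P D D' \<iota>D \<and>
      base_change_map K P F F' \<iota>F C' \<iota>C u u' \<and> base_change_map K P F F' \<iota>F E' \<iota>E v v' \<and>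
      base_change_map K P C C' \<iota>C D' \<iota>D p p' \<and> base_change_map K P E E' \<iota>E D' \<iota>D q q' \<longrightarrow>
      trivial_fibration C' D' p' \<and> pullback_square K P F' C' E' D' u' v' p' q')"


section \<open>Differential graded local Artin algebras\<close>

definition artinian_ring :: "('u, 'm) ring_scheme \<Rightarrow> bool"
  where "artinian_ring R \<longleftrightarrow> cring R \<and>
    (\<forall>I :: nat \<Rightarrow> 'u set. (\<forall>n. ideal (I n) R \<and> I (Suc n) \<subseteq> I n) \<longrightarrow> (\<exists>n. \<forall>m\<ge>n. I m = I n))"

definition dg_artin :: "('k, 'm) ring_scheme \<Rightarrow> ('k, 'u, 'y) dga_scheme \<Rightarrow> bool"
  where "dg_artin K A \<longleftrightarrow> cdga K A \<and>
    (let A0 = A\<lparr>carrier := grade A 0\<rparr> in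
      artinian_ring A0 \<and>
      (\<exists>M. maximalideal M A0 \<and> (\<forall>M'. maximalideal M' A0 \<longrightarrow> M' = M) \<and>
        (\<lambda>a. M +>\<^bsub>A0\<^esub> (a \<odot>\<^bsub>A\<^esub> \<one>\<^bsub>A\<^esub>)) \<in> ring_iso K (A0 Quot M))) \<and>
    (\<exists>S. finite S \<and> S \<subseteq> (\<Union>i. grade A i) \<and>
      (\<forall>x\<in>carrier A. \<exists>c\<in>S \<rightarrow> grade A 0. x = (\<Oplus>\<^bsub>A\<^esub>s\<in>S. c s \<otimes>\<^bsub>A\<^esub> s)))"

end

theory Submission
  imports Defs "HOL-Algebra.UnivPoly"
begin

text \<open>
  Write \<open>R\<close>, \<open>P\<close> for the algebras over \<open>A\<close>, \<open>I\<close> for the kernel of \<open>A \<rightarrow> B\<close>, and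
  \<open>\<iota>\<close> for the canonical map from \<open>R\<close> to its base change. Since \<open>A \<rightarrow> B\<close> is surjective, \<open>\<iota>\<close> is
  surjective with kernel \<open>I R\<close> (\<open>base_change_surjective\<close>, \<open>base_change_kernel\<close>). An idempotent is a
  quasi-isomorphism if and only if its kernel is acyclic (\<open>weak_equivalence_kernel\<close>,
  \<open>weak_equivalenceI\<close>). The proof first constructs an endomorphism \<open>h\<close> of \<open>R\<close> that has all
  required properties except that it is idempotent only modulo \<open>I R\<close>, and then makes it idempotent.

  \<^bold>\<open>Making \<open>h\<close> idempotent.\<close> Suppose that \<open>h\<close> is a dg endomorphism of \<open>R\<close> with \<open>h g = g e\<close> and
  \<open>\<iota> h = f \<iota>\<close>, injective on cohomology, where \<open>f\<close> is the given idempotent over \<open>B\<close>. Then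
  \<open>h (1 - h)\<close> is \<open>A\<close>-linear and maps \<open>R\<close> into \<open>I R\<close>. The ideal \<open>I\<close> is nilpotent because \<open>A\<close> is Artin
  (\<open>dg_artin_products_vanish\<close>), so that some power of \<open>h (1 - h)\<close> vanishes
  (\<open>linear_into_nilpotent_ideal\<close>) and \<open>R\<close> is the direct sum of the image and the kernel of \<open>h^k\<close> for
  some \<open>k\<close>, by Fitting's lemma. The image is a subalgebra and the kernel is an ideal, so the projection onto
  the image is a dg algebra morphism (\<open>fitting_idempotent\<close>); this is the idempotent sought. It agrees with
  \<open>g e\<close> on the image of \<open>g\<close>, because \<open>h\<close> fixes \<open>g e\<close>, and reduces to \<open>f\<close>, because \<open>h\<close> does
  so. Its kernel, the kernel of \<open>h^k\<close>, is acyclic because \<open>h\<close> is injective on cohomology.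

  \<^bold>\<open>Constructing \<open>h\<close>.\<close> The lifting property of the cofibration \<open>g\<close> cannot be used against \<open>\<iota>\<close>, which is
  in general not a quasi-isomorphism. It is used against an algebra of paths instead
  (\<open>lifted_endomorphism\<close>). Let \<open>J\<close> be the ideal of \<open>R\<close> generated by \<open>g\<close> of the kernel of \<open>e\<close>, and
  let \<open>W\<close> consist of the polynomial paths in \<open>R[t, dt]\<close> that start at an element on which \<open>f \<iota>\<close> and
  \<open>\<iota>\<close> agree and all of whose other coefficients are killed by \<open>f \<iota>\<close>, modulo the paths that start at
  \<open>0\<close> and have coefficients in \<open>J\<close>. Evaluation at \<open>1\<close> is a surjective quasi-isomorphism \<open>W \<rightarrow> R/J\<close>
  (\<open>acyclic_surjection_ev\<close>): its kernel is controlled by integration over \<open>[0, 1]\<close>, by the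
  acyclicity of \<open>J\<close>, and by the acyclicity of the kernel of \<open>f\<close>. Hence \<open>R \<rightarrow> R/J\<close> lifts to \<open>R \<rightarrow> W\<close>,
  with the constant paths \<open>g e\<close> prescribed on \<open>P\<close>, and \<open>h x\<close> is the starting point of the path
  attached to \<open>x\<close>. On such a path \<open>f \<iota>\<close> takes at the end the value that \<open>\<iota>\<close> takes at the start, which
  gives \<open>f \<iota> = \<iota> h\<close>; and the path is a homotopy, modulo \<open>J\<close>, from \<open>h\<close> to the identity, which makes \<open>h\<close>
  injective on cohomology.

  That \<open>J\<close> is acyclic is left properness of the model structure (\<open>cofibration_ideal_acyclic\<close>). For a polynomial
  extension \<open>Y\<close> of \<open>X\<close> and dg ideals \<open>M \<subseteq> L\<close> of \<open>X\<close> with \<open>L/M\<close> acyclic it says that \<open>LY/MY\<close>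
  is acyclic (\<open>vspan_acyclic\<close>). Polynomial extensions are only given by their universal property, so this is
  proved with derivations of \<open>Y\<close>, which are algebra morphisms to dual numbers
  (\<open>derivation_extension\<close>): Euler's formula for the derivation that counts variables reduces the number of
  variables one by one. Characteristic \<open>0\<close> enters there and in the integration of polynomials.
\<close>

section \<open>Homogeneous components and Koszul signs\<close>

inductive_set additive_span :: "('a, 'm) ring_scheme \<Rightarrow> 'a set \<Rightarrow> 'a set" for A T where
  zero: "\<zero>\<^bsub>A\<^esub> \<in> additive_span A T"
| base: "x \<in> T \<Longrightarrow> x \<in> additive_span A T"
| add: "\<lbrakk>x \<in> additive_span A T; y \<in> additive_span A T\<rbrakk> \<Longrightarrow> x \<oplus>\<^bsub>A\<^esub> y \<in> additive_span A T"

lemma (in abelian_group) finsum_support_superset: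
  assumes "finite F" "{i. c i \<noteq> \<zero>} \<subseteq> F" "\<And>i. c i \<in> carrier G"
  shows "finsum G c {i. c i \<noteq> \<zero>} = finsum G c F"
  using assms by (intro add.finprod_mono_neutral_cong_left) auto

text \<open>
  Spanning gives the existence of a decomposition, and the projections \<open>p\<close> recover its terms. The
  gradings of dual numbers, subquotients and polynomial algebras below are obtained in this way.
\<close>

lemma (in abelian_group) direct_sumI:
  fixes H :: "int \<Rightarrow> 'a set"
  assumes sub: "\<And>i. H i \<subseteq> carrier G" and z: "\<And>i. \<zero> \<in> H i"
    and p_in: "\<And>i x. x \<in> carrier G \<Longrightarrow> p i x \<in> H i"
    and p_add: "\<And>i x y. \<lbrakk>x \<in> carrier G; y \<in> carrier G\<rbrakk> \<Longrightarrow> p i (x \<oplus> y) = p i x \<oplus> p i y"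
    and p_proj: "\<And>i j x. x \<in> H i \<Longrightarrow> p j x = (if j = i then x else \<zero>)"
    and span: "carrier G \<subseteq> additive_span G (\<Union>i. H i)" and x: "x \<in> carrier G"
  shows "\<exists>!c. (\<forall>i. c i \<in> H i) \<and> finite {i. c i \<noteq> \<zero>} \<and> x = finsum G c {i. c i \<noteq> \<zero>}"
proof -
  have pc: "p i x \<in> carrier G" if "x \<in> carrier G" for i x using p_in[OF that] sub by blast
  have p0: "p i \<zero> = \<zero>" for i using p_proj[OF z] by simp
  have ex: "x \<in> carrier G \<and> finite {i. p i x \<noteq> \<zero>} \<and> x = finsum G (\<lambda>i. p i x) {i. p i x \<noteq> \<zero>}"
    if "x \<in> additive_span G (\<Union>i. H i)" for x
    using that
  proof induction
    case zero
    then show ?case by (simp add: p0)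
  next
    case (base x)
    then obtain j where j: "x \<in> H j" by blast
    have c: "x \<in> carrier G" using j sub by blast
    have s: "{i. (if i = j then x else \<zero>) \<noteq> \<zero>} \<subseteq> {j}" by auto
    have "finsum G (\<lambda>i. if i = j then x else \<zero>) {i. (if i = j then x else \<zero>) \<noteq> \<zero>}
      = finsum G (\<lambda>i. if i = j then x else \<zero>) {j}"
      by (rule finsum_support_superset) (use c s in auto)
    then show ?case using c finite_subset[OF s] p_proj[OF j] by simp
  next
    case (add x y)
    let ?F = "{i. p i x \<noteq> \<zero>} \<union> {i. p i y \<noteq> \<zero>}"
    have fin: "finite ?F" using add by simp
    have c: "x \<in> carrier G" "y \<in> carrier G" using add by auto
    have s: "{i. p i (x \<oplus> y) \<noteq> \<zero>} \<subseteq> ?F" using p_add c by auto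
    have "finsum G (\<lambda>i. p i (x \<oplus> y)) {i. p i (x \<oplus> y) \<noteq> \<zero>} = finsum G (\<lambda>i. p i (x \<oplus> y)) ?F"
      by (rule finsum_support_superset) (use fin s c pc in auto)
    also have "\<dots> = finsum G (\<lambda>i. p i x \<oplus> p i y) ?F" by (simp add: p_add c)
    also have "\<dots> = finsum G (\<lambda>i. p i x) ?F \<oplus> finsum G (\<lambda>i. p i y) ?F"
      by (rule finsum_addf) (use pc c in auto)
    also have "finsum G (\<lambda>i. p i x) ?F = finsum G (\<lambda>i. p i x) {i. p i x \<noteq> \<zero>}"
      by (rule finsum_support_superset[symmetric]) (use fin c pc in auto)
    also have "finsum G (\<lambda>i. p i y) ?F = finsum G (\<lambda>i. p i y) {i. p i y \<noteq> \<zero>}"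
      by (rule finsum_support_superset[symmetric]) (use fin c pc in auto)
    finally show ?case using add s fin finite_subset by (metis a_closed)
  qed
  have p_sum: "p j (finsum G c F) = (if j \<in> F then c j else \<zero>)"
    if "finite F" "\<And>i. c i \<in> H i" for F c j
    using that
  proof (induction F rule: finite_induct)
    case empty
    then show ?case by (simp add: p0)
  next
    case (insert k F)
    have c: "c i \<in> carrier G" for i using insert sub by blast
    have "p j (finsum G c (insert k F)) = p j (c k) \<oplus> p j (finsum G c F)"
      using insert c by (simp add: p_add)
    then show ?case using insert c p_proj[OF insert(4)] by auto
  qed
  show ?thesis
  proof
    show "(\<forall>i. p i x \<in> H i) \<and> finite {i. p i x \<noteq> \<zero>} \<and> x = finsum G (\<lambda>i. p i x) {i. p i x \<noteq> \<zero>}"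
      using ex[of x] x span p_in by blast
  next
    fix c assume c: "(\<forall>i. c i \<in> H i) \<and> finite {i. c i \<noteq> \<zero>} \<and> x = finsum G c {i. c i \<noteq> \<zero>}"
    show "c = (\<lambda>i. p i x)"
    proof
      fix j
      have "p j (finsum G c {i. c i \<noteq> \<zero>}) = c j" using p_sum[of "{i. c i \<noteq> \<zero>}" c j] c by auto
      then show "c j = p j x" using c by simp
    qed
  qed
qed

definition hcomp :: "('k, 'u, 'z) dga_scheme \<Rightarrow> int \<Rightarrow> 'u \<Rightarrow> 'u" where
  "hcomp A i x = (THE c. (\<forall>i. c i \<in> grade A i) \<and> finite {i. c i \<noteq> \<zero>\<^bsub>A\<^esub>} \<and>
             x = finsum A c {i. c i \<noteq> \<zero>\<^bsub>A\<^esub>}) i"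

context graded_comm_algebra
begin

lemma grade_closed: "x \<in> grade A i \<Longrightarrow> x \<in> carrier A"
  using submoduleE(1)[OF grade_submodule] by blast

lemma grade_zero [simp]: "\<zero>\<^bsub>A\<^esub> \<in> grade A i"
proof -
  interpret submodule "grade A i" K A by (rule grade_submodule)
  show ?thesis using one_closed by simp
qed

lemma grade_add: "\<lbrakk>x \<in> grade A i; y \<in> grade A i\<rbrakk> \<Longrightarrow> x \<oplus>\<^bsub>A\<^esub> y \<in> grade A i"
  using submoduleE(5)[OF grade_submodule] by blast

lemma grade_neg: "x \<in> grade A i \<Longrightarrow> \<ominus>\<^bsub>A\<^esub> x \<in> grade A i"
  using submoduleE(3)[OF grade_submodule] by blast

lemma grade_smult: "\<lbrakk>a \<in> carrier K; x \<in> grade A i\<rbrakk> \<Longrightarrow> a \<odot>\<^bsub>A\<^esub> x \<in> grade A i"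
  using submoduleE(4)[OF grade_submodule] by blast

lemma grade_minus: "\<lbrakk>x \<in> grade A i; y \<in> grade A i\<rbrakk> \<Longrightarrow> x \<ominus>\<^bsub>A\<^esub> y \<in> grade A i"
  unfolding a_minus_def by (intro grade_add grade_neg)

lemma signed_closed [simp]: "x \<in> carrier A \<Longrightarrow> signed A i x \<in> carrier A"
  by (simp add: signed_def)

lemma grade_signed: "x \<in> grade A i \<Longrightarrow> signed A j x \<in> grade A i"
  by (simp add: signed_def grade_neg)

lemma hcomp_props:
  assumes "x \<in> carrier A"
  shows "hcomp A i x \<in> grade A i" "finite {i. hcomp A i x \<noteq> \<zero>\<^bsub>A\<^esub>}"
    "x = finsum A (\<lambda>i. hcomp A i x) {i. hcomp A i x \<noteq> \<zero>\<^bsub>A\<^esub>}"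
  using theI'[OF grade_direct_sum[OF assms]] unfolding hcomp_def by auto

lemma hcomp_unique:
  assumes "x \<in> carrier A" "\<And>i. c i \<in> grade A i" "finite F" "{i. c i \<noteq> \<zero>\<^bsub>A\<^esub>} \<subseteq> F" "x = finsum A c F"
  shows "hcomp A i x = c i"
proof -
  have "finsum A c {i. c i \<noteq> \<zero>\<^bsub>A\<^esub>} = finsum A c F"
    by (rule finsum_support_superset) (use assms grade_closed in blast)+
  then have "(\<forall>i. c i \<in> grade A i) \<and> finite {i. c i \<noteq> \<zero>\<^bsub>A\<^esub>} \<and> x = finsum A c {i. c i \<noteq> \<zero>\<^bsub>A\<^esub>}"
    using assms(2,5) finite_subset[OF assms(4,3)] by simp
  then show ?thesis
    unfolding hcomp_def by (rule fun_cong[OF the1_equality[OF grade_direct_sum[OF assms(1)]]])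
qed

lemma hcomp_grade: "x \<in> carrier A \<Longrightarrow> hcomp A i x \<in> grade A i"
  by (rule hcomp_props)

lemma hcomp_closed [simp]: "x \<in> carrier A \<Longrightarrow> hcomp A i x \<in> carrier A"
  using hcomp_props(1) grade_closed by blast

lemma hcomp_homogeneous:
  assumes "x \<in> grade A i"
  shows "hcomp A j x = (if j = i then x else \<zero>\<^bsub>A\<^esub>)"
proof (rule hcomp_unique[where F = "{i}"])
  show x: "x \<in> carrier A" by (rule grade_closed) (rule assms)
  show "x = (\<Oplus>\<^bsub>A\<^esub>j\<in>{i}. if j = i then x else \<zero>\<^bsub>A\<^esub>)" using x by simp
  show "(if k = i then x else \<zero>\<^bsub>A\<^esub>) \<in> grade A k" for k using assms by simp
  show "{k. (if k = i then x else \<zero>\<^bsub>A\<^esub>) \<noteq> \<zero>\<^bsub>A\<^esub>} \<subseteq> {i}" by auto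
qed simp

lemma hcomp_add:
  assumes "x \<in> carrier A" "y \<in> carrier A"
  shows "hcomp A i (x \<oplus>\<^bsub>A\<^esub> y) = hcomp A i x \<oplus>\<^bsub>A\<^esub> hcomp A i y"
proof -
  let ?F = "{i. hcomp A i x \<noteq> \<zero>\<^bsub>A\<^esub>} \<union> {i. hcomp A i y \<noteq> \<zero>\<^bsub>A\<^esub>}"
  have fin: "finite ?F" using hcomp_props(2) assms by simp
  have "finsum A (\<lambda>i. hcomp A i x) ?F = x" "finsum A (\<lambda>i. hcomp A i y) ?F = y"
    using finsum_support_superset[OF fin, of "\<lambda>i. hcomp A i x"]
      finsum_support_superset[OF fin, of "\<lambda>i. hcomp A i y"]
      hcomp_props(3)[OF assms(1), symmetric] hcomp_props(3)[OF assms(2), symmetric] assms by simp_all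
  then have "x \<oplus>\<^bsub>A\<^esub> y = finsum A (\<lambda>i. hcomp A i x \<oplus>\<^bsub>A\<^esub> hcomp A i y) ?F"
    using finsum_addf[of "\<lambda>i. hcomp A i x" ?F "\<lambda>i. hcomp A i y"] assms by (simp add: Pi_def)
  then show ?thesis
    by (intro hcomp_unique[where F = ?F] grade_add hcomp_grade) (use fin assms in auto)
qed

lemma carrier_additive_span: "carrier A \<subseteq> additive_span A (\<Union>i. grade A i)"
proof
  fix x assume x: "x \<in> carrier A"
  have "finite F \<Longrightarrow> finsum A (\<lambda>i. hcomp A i x) F \<in> additive_span A (\<Union>i. grade A i)" for F
  proof (induction F rule: finite_induct)
    case (insert j F)
    have "hcomp A j x \<in> additive_span A (\<Union>i. grade A i)"
      using hcomp_grade[OF x] by (intro additive_span.base) blast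
    then show ?case using insert x by (simp add: additive_span.add)
  qed (simp add: additive_span.zero)
  then show "x \<in> additive_span A (\<Union>i. grade A i)" using hcomp_props[OF x] by metis
qed

lemma graded_induct [consumes 1, case_names zero hom add]:
  assumes "x \<in> carrier A" "P \<zero>\<^bsub>A\<^esub>" "\<And>i x. x \<in> grade A i \<Longrightarrow> P x"
    "\<And>x y. \<lbrakk>x \<in> carrier A; y \<in> carrier A; P x; P y\<rbrakk> \<Longrightarrow> P (x \<oplus>\<^bsub>A\<^esub> y)"
  shows "P x"
proof -
  have "x \<in> additive_span A (\<Union>i. grade A i)" using assms(1) carrier_additive_span by blast
  then have "x \<in> carrier A \<and> P x"
    by induction (use assms grade_closed in auto)
  then show ?thesis by simp
qed

lemma hcomp_ext:
  assumes "x \<in> carrier A" "y \<in> carrier A" "\<And>i. hcomp A i x = hcomp A i y"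
  shows "x = y"
proof -
  have "(\<lambda>i. hcomp A i x) = (\<lambda>i. hcomp A i y)" using assms(3) by (rule ext)
  then show ?thesis using hcomp_props(3)[OF assms(1)] hcomp_props(3)[OF assms(2)] by metis
qed

lemma hcomp_zero [simp]: "hcomp A i \<zero>\<^bsub>A\<^esub> = \<zero>\<^bsub>A\<^esub>"
  using hcomp_homogeneous[of "\<zero>\<^bsub>A\<^esub>" i i] by simp

lemma hcomp_additive_map:
  assumes cl: "\<And>x. x \<in> carrier A \<Longrightarrow> f x \<in> carrier A"
    and add: "\<And>x y. \<lbrakk>x \<in> carrier A; y \<in> carrier A\<rbrakk> \<Longrightarrow> f (x \<oplus>\<^bsub>A\<^esub> y) = f x \<oplus>\<^bsub>A\<^esub> f y"
    and gr: "\<And>i x. x \<in> grade A i \<Longrightarrow> f x \<in> grade A (i + n)" and x: "x \<in> carrier A"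
  shows "hcomp A (i + n) (f x) = f (hcomp A i x)"
proof -
  have f0: "f \<zero>\<^bsub>A\<^esub> = \<zero>\<^bsub>A\<^esub>" using add[of "\<zero>\<^bsub>A\<^esub>" "\<zero>\<^bsub>A\<^esub>"] cl[of "\<zero>\<^bsub>A\<^esub>"]
    by (metis M.zero_closed l_zero add.r_cancel_one)
  show ?thesis using x
  proof (induction rule: graded_induct)
    case (hom j x)
    then show ?case using hcomp_homogeneous[OF hom] hcomp_homogeneous[OF gr[OF hom]] f0 by simp
  qed (simp_all add: f0 hcomp_add add cl)
qed

lemma hcomp_neg: "x \<in> carrier A \<Longrightarrow> hcomp A i (\<ominus>\<^bsub>A\<^esub> x) = \<ominus>\<^bsub>A\<^esub> hcomp A i x"
  using hcomp_additive_map[of "\<lambda>x. \<ominus>\<^bsub>A\<^esub> x" 0 x i] by (simp add: minus_add grade_neg)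

lemma hcomp_minus: "\<lbrakk>x \<in> carrier A; y \<in> carrier A\<rbrakk>
  \<Longrightarrow> hcomp A i (x \<ominus>\<^bsub>A\<^esub> y) = hcomp A i x \<ominus>\<^bsub>A\<^esub> hcomp A i y"
  unfolding a_minus_def by (simp add: hcomp_add hcomp_neg)

lemma hcomp_smult: "\<lbrakk>k \<in> carrier K; x \<in> carrier A\<rbrakk> \<Longrightarrow> hcomp A i (k \<odot>\<^bsub>A\<^esub> x) = k \<odot>\<^bsub>A\<^esub> hcomp A i x"
  using hcomp_additive_map[of "\<lambda>x. k \<odot>\<^bsub>A\<^esub> x" 0 x i] by (simp add: smult_r_distr grade_smult)

lemma hcomp_mult_homogeneous:
  "\<lbrakk>a \<in> grade A n; x \<in> carrier A\<rbrakk> \<Longrightarrow> hcomp A (i + n) (a \<otimes>\<^bsub>A\<^esub> x) = a \<otimes>\<^bsub>A\<^esub> hcomp A i x"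
  using grade_closed[of a n] mult_grade[of a n]
  by (intro hcomp_additive_map[of "\<lambda>x. a \<otimes>\<^bsub>A\<^esub> x"]) (simp_all add: r_distr Groups.add.commute[of _ n])

end

lemma signed_even [simp]: "even i \<Longrightarrow> signed A i x = x"
  by (simp add: signed_def)

lemma signed_cong: "even (i - j) \<Longrightarrow> signed A i x = signed A j x"
  by (auto simp: signed_def)

context graded_comm_algebra
begin

lemma signed_zero [simp]: "signed A i \<zero>\<^bsub>A\<^esub> = \<zero>\<^bsub>A\<^esub>"
  by (simp add: signed_def)

lemma signed_add:
  "\<lbrakk>x \<in> carrier A; y \<in> carrier A\<rbrakk> \<Longrightarrow> signed A i (x \<oplus>\<^bsub>A\<^esub> y) = signed A i x \<oplus>\<^bsub>A\<^esub> signed A i y"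
  by (simp add: signed_def minus_add)

lemma signed_signed: "x \<in> carrier A \<Longrightarrow> signed A i (signed A j x) = signed A (i + j) x"
  by (simp add: signed_def)

lemma signed_mult_left:
  "\<lbrakk>x \<in> carrier A; y \<in> carrier A\<rbrakk> \<Longrightarrow> signed A i x \<otimes>\<^bsub>A\<^esub> y = signed A i (x \<otimes>\<^bsub>A\<^esub> y)"
  by (simp add: signed_def l_minus)

lemma signed_mult_right:
  "\<lbrakk>x \<in> carrier A; y \<in> carrier A\<rbrakk> \<Longrightarrow> x \<otimes>\<^bsub>A\<^esub> signed A i y = signed A i (x \<otimes>\<^bsub>A\<^esub> y)"
  by (simp add: signed_def r_minus)

lemma signed_smult:
  "\<lbrakk>k \<in> carrier K; x \<in> carrier A\<rbrakk> \<Longrightarrow> signed A i (k \<odot>\<^bsub>A\<^esub> x) = k \<odot>\<^bsub>A\<^esub> signed A i x"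
  by (simp add: signed_def smult_r_minus)

end

text \<open>
  The automorphism \<open>x \<mapsto> (-1)^(m |x|) x\<close>, the sign picked up when a symbol of degree \<open>m\<close> moves past
  \<open>x\<close>. The product of dual numbers is a total function, so this is needed on inhomogeneous elements as well.
\<close>

definition twist :: "('k, 'u, 'z) dga_scheme \<Rightarrow> int \<Rightarrow> 'u \<Rightarrow> 'u" where
  "twist A m x = (\<Oplus>\<^bsub>A\<^esub>i\<in>{i. hcomp A i x \<noteq> \<zero>\<^bsub>A\<^esub>}. signed A (m * i) (hcomp A i x))"

context graded_comm_algebra
begin

lemma twist_eq:
  assumes "finite F" "{i. hcomp A i x \<noteq> \<zero>\<^bsub>A\<^esub>} \<subseteq> F" "x \<in> carrier A"
  shows "twist A m x = (\<Oplus>\<^bsub>A\<^esub>i\<in>F. signed A (m * i) (hcomp A i x))"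
  unfolding twist_def using assms
  by (intro add.finprod_mono_neutral_cong_left) auto

lemma twist_closed [simp]: "x \<in> carrier A \<Longrightarrow> twist A m x \<in> carrier A"
  unfolding twist_def by (intro finsum_closed) simp

lemma twist_homogeneous:
  assumes "x \<in> grade A i" shows "twist A m x = signed A (m * i) x"
proof -
  have x: "x \<in> carrier A" by (rule grade_closed) (rule assms)
  have "twist A m x = (\<Oplus>\<^bsub>A\<^esub>j\<in>{i}. signed A (m * j) (hcomp A j x))"
    by (rule twist_eq) (use x hcomp_homogeneous[OF assms] in auto)
  then show ?thesis using x hcomp_homogeneous[OF assms] by simp
qed

lemma twist_zero [simp]: "twist A m \<zero>\<^bsub>A\<^esub> = \<zero>\<^bsub>A\<^esub>"
  using twist_homogeneous[OF grade_zero] by simp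

lemma twist_add:
  assumes "x \<in> carrier A" "y \<in> carrier A"
  shows "twist A m (x \<oplus>\<^bsub>A\<^esub> y) = twist A m x \<oplus>\<^bsub>A\<^esub> twist A m y"
proof -
  let ?F = "{i. hcomp A i x \<noteq> \<zero>\<^bsub>A\<^esub>} \<union> {i. hcomp A i y \<noteq> \<zero>\<^bsub>A\<^esub>}"
  have fin: "finite ?F" using hcomp_props(2) assms by simp
  have "twist A m (x \<oplus>\<^bsub>A\<^esub> y) = (\<Oplus>\<^bsub>A\<^esub>i\<in>?F. signed A (m * i) (hcomp A i (x \<oplus>\<^bsub>A\<^esub> y)))"
    by (rule twist_eq) (use fin assms in \<open>auto simp: hcomp_add\<close>)
  also have "\<dots> = (\<Oplus>\<^bsub>A\<^esub>i\<in>?F. signed A (m * i) (hcomp A i x) \<oplus>\<^bsub>A\<^esub> signed A (m * i) (hcomp A i y))"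
    using assms by (simp add: hcomp_add signed_add)
  also have "\<dots> = (\<Oplus>\<^bsub>A\<^esub>i\<in>?F. signed A (m * i) (hcomp A i x)) \<oplus>\<^bsub>A\<^esub> (\<Oplus>\<^bsub>A\<^esub>i\<in>?F. signed A (m * i) (hcomp A i y))"
    using assms by (intro finsum_addf) auto
  also have "(\<Oplus>\<^bsub>A\<^esub>i\<in>?F. signed A (m * i) (hcomp A i x)) = twist A m x"
    by (rule twist_eq[symmetric]) (use fin assms in auto)
  also have "(\<Oplus>\<^bsub>A\<^esub>i\<in>?F. signed A (m * i) (hcomp A i y)) = twist A m y"
    by (rule twist_eq[symmetric]) (use fin assms in auto)
  finally show ?thesis .
qed

lemma twist_smult:
  assumes "k \<in> carrier K" "x \<in> carrier A"
  shows "twist A m (k \<odot>\<^bsub>A\<^esub> x) = k \<odot>\<^bsub>A\<^esub> twist A m x"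
  using assms(2)
proof (induction rule: graded_induct)
  case (hom i x)
  then show ?case
    using twist_homogeneous[OF grade_smult[OF assms(1) hom]] twist_homogeneous[OF hom]
      signed_smult[OF assms(1) grade_closed[OF hom]] by simp
qed (use assms(1) in \<open>simp_all add: twist_add smult_r_distr\<close>)

lemma twist_mult:
  assumes "x \<in> carrier A" "y \<in> carrier A"
  shows "twist A m (x \<otimes>\<^bsub>A\<^esub> y) = twist A m x \<otimes>\<^bsub>A\<^esub> twist A m y"
  using assms(1)
proof (induction rule: graded_induct)
  case (hom i x)
  note x = grade_closed[OF hom]
  show ?case using assms(2)
  proof (induction rule: graded_induct)
    case (hom j y)
    note y = grade_closed[OF hom]
    show ?case
      using twist_homogeneous[OF mult_grade[OF \<open>x \<in> grade A i\<close> hom]] twist_homogeneous[OF hom]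
        twist_homogeneous[OF \<open>x \<in> grade A i\<close>] x y
      by (simp add: signed_mult_left signed_mult_right signed_signed distrib_left Groups.add.commute)
  qed (use x in \<open>simp_all add: twist_add r_distr\<close>)
qed (use assms(2) in \<open>simp_all add: twist_add l_distr\<close>)

lemma twist_one [simp]: "twist A m \<one>\<^bsub>A\<^esub> = \<one>\<^bsub>A\<^esub>"
  using twist_homogeneous[OF one_grade] by simp

end

section \<open>Dual numbers\<close>

text \<open>
  The algebra of dual numbers over \<open>A\<close>: the pair \<open>(a, b)\<close> stands for \<open>a + \<epsilon> b\<close>, where \<open>\<epsilon>\<close> has degree
  \<open>- m\<close> and square \<open>0\<close>. A map \<open>y \<mapsto> y + \<epsilon> (D y)\<close> into it is multiplicative exactly if \<open>D\<close> is
  a derivation of degree \<open>m\<close>; for \<open>m = - 1\<close> the symbol \<open>\<epsilon>\<close> serves as the form \<open>dt\<close>. Only the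
  underlying graded algebra is meant, and the differential is a dummy value.
\<close>

definition eps_ext :: "('k, 'u, 'z) dga_scheme \<Rightarrow> int \<Rightarrow> ('k, 'u \<times> 'u) dga" where
  "eps_ext A m =
    \<lparr>carrier = carrier A \<times> carrier A,
     mult = \<lambda>x y. (fst x \<otimes>\<^bsub>A\<^esub> fst y, (snd x \<otimes>\<^bsub>A\<^esub> fst y) \<oplus>\<^bsub>A\<^esub> (twist A m (fst x) \<otimes>\<^bsub>A\<^esub> snd y)),
     one = (\<one>\<^bsub>A\<^esub>, \<zero>\<^bsub>A\<^esub>), zero = (\<zero>\<^bsub>A\<^esub>, \<zero>\<^bsub>A\<^esub>),
     add = \<lambda>x y. (fst x \<oplus>\<^bsub>A\<^esub> fst y, snd x \<oplus>\<^bsub>A\<^esub> snd y),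
     smult = \<lambda>k x. (k \<odot>\<^bsub>A\<^esub> fst x, k \<odot>\<^bsub>A\<^esub> snd x),
     grade = \<lambda>i. grade A i \<times> grade A (i + m),
     differential = \<lambda>x. x\<rparr>"

lemma eps_ext_simps [simp]:
  "carrier (eps_ext A m) = carrier A \<times> carrier A"
  "x \<otimes>\<^bsub>eps_ext A m\<^esub> y
    = (fst x \<otimes>\<^bsub>A\<^esub> fst y, (snd x \<otimes>\<^bsub>A\<^esub> fst y) \<oplus>\<^bsub>A\<^esub> (twist A m (fst x) \<otimes>\<^bsub>A\<^esub> snd y))"
  "\<one>\<^bsub>eps_ext A m\<^esub> = (\<one>\<^bsub>A\<^esub>, \<zero>\<^bsub>A\<^esub>)" "\<zero>\<^bsub>eps_ext A m\<^esub> = (\<zero>\<^bsub>A\<^esub>, \<zero>\<^bsub>A\<^esub>)"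
  "x \<oplus>\<^bsub>eps_ext A m\<^esub> y = (fst x \<oplus>\<^bsub>A\<^esub> fst y, snd x \<oplus>\<^bsub>A\<^esub> snd y)"
  "k \<odot>\<^bsub>eps_ext A m\<^esub> x = (k \<odot>\<^bsub>A\<^esub> fst x, k \<odot>\<^bsub>A\<^esub> snd x)"
  "grade (eps_ext A m) i = grade A i \<times> grade A (i + m)"
  by (simp_all add: eps_ext_def)

context graded_comm_algebra
begin

lemma eps_ext_ring: "ring (eps_ext A m)"
proof (rule ringI)
  show "abelian_group (eps_ext A m)"
  proof (rule abelian_groupI)
    fix x assume "x \<in> carrier (eps_ext A m)"
    then show "\<exists>y\<in>carrier (eps_ext A m). y \<oplus>\<^bsub>eps_ext A m\<^esub> x = \<zero>\<^bsub>eps_ext A m\<^esub>"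
      by (intro bexI[of _ "(\<ominus>\<^bsub>A\<^esub> fst x, \<ominus>\<^bsub>A\<^esub> snd x)"]) (auto simp: l_neg)
  qed (auto simp: a_ac)
  show "monoid (eps_ext A m)"
    by (rule monoidI) (auto simp: m_assoc l_distr r_distr a_assoc twist_mult)
qed (auto simp: l_distr r_distr twist_add a_ac)

lemma eps_ext_graded_comm_algebra: "graded_comm_algebra K (eps_ext A m)"
proof -
  interpret E: ring "eps_ext A m" by (rule eps_ext_ring)
  have Emod: "module K (eps_ext A m)"
    by (rule moduleI) (auto simp: R.is_cring E.abelian_group_axioms smult_l_distr smult_r_distr smult_assoc1)
  have neg: "\<ominus>\<^bsub>eps_ext A m\<^esub> x = (\<ominus>\<^bsub>A\<^esub> fst x, \<ominus>\<^bsub>A\<^esub> snd x)" if "x \<in> carrier A \<times> carrier A" for x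
    by (rule E.minus_equality) (use that in \<open>auto simp: l_neg\<close>)
  have sgn: "signed (eps_ext A m) i x = (signed A i (fst x), signed A i (snd x))" if "x \<in> carrier A \<times> carrier A" for x i
    using neg[OF that] by (simp add: signed_def)
  have gr: "grade A i \<times> grade A (i + m) \<subseteq> carrier A \<times> carrier A" for i using grade_closed by blast
  show ?thesis
  proof (intro graded_comm_algebra.intro graded_comm_algebra_axioms.intro Emod eps_ext_ring)
    fix a x y assume a: "a \<in> carrier K" and "x \<in> carrier (eps_ext A m)" "y \<in> carrier (eps_ext A m)"
    then show "(a \<odot>\<^bsub>eps_ext A m\<^esub> x) \<otimes>\<^bsub>eps_ext A m\<^esub> y = a \<odot>\<^bsub>eps_ext A m\<^esub> (x \<otimes>\<^bsub>eps_ext A m\<^esub> y)"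
      "x \<otimes>\<^bsub>eps_ext A m\<^esub> (a \<odot>\<^bsub>eps_ext A m\<^esub> y) = a \<odot>\<^bsub>eps_ext A m\<^esub> (x \<otimes>\<^bsub>eps_ext A m\<^esub> y)"
      by (auto simp: smult_mult_left smult_mult_right twist_smult smult_r_distr)
  next
    fix i show "submodule (grade (eps_ext A m) i) K (eps_ext A m)"
      using gr grade_neg grade_add grade_smult
      by (intro module.submoduleI[OF Emod]) (auto simp: neg grade_closed)
  next
    fix x assume x: "x \<in> carrier (eps_ext A m)"
    show "\<exists>!c. (\<forall>i. c i \<in> grade (eps_ext A m) i) \<and> finite {i. c i \<noteq> \<zero>\<^bsub>eps_ext A m\<^esub>} \<and>
             x = finsum (eps_ext A m) c {i. c i \<noteq> \<zero>\<^bsub>eps_ext A m\<^esub>}"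
    proof (rule E.direct_sumI[where p = "\<lambda>i x. (hcomp A i (fst x), hcomp A (i + m) (snd x))"])
      have l: "(a, \<zero>\<^bsub>A\<^esub>) \<in> additive_span (eps_ext A m) (\<Union>i. grade (eps_ext A m) i)" if "a \<in> carrier A" for a
        using that
      proof (induction rule: graded_induct)
        case zero
        show ?case using additive_span.zero[of "eps_ext A m"] by simp
      next
        case (hom i x)
        then show ?case by (intro additive_span.base UN_I[of i]) auto
      next
        case (add x y)
        then show ?case using additive_span.add[OF add(3,4)] by simp
      qed
      have r: "(\<zero>\<^bsub>A\<^esub>, a) \<in> additive_span (eps_ext A m) (\<Union>i. grade (eps_ext A m) i)" if "a \<in> carrier A" for a
        using that
      proof (induction rule: graded_induct)
        case zero
        show ?case using additive_span.zero[of "eps_ext A m"] by simp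
      next
        case (hom i x)
        then show ?case by (intro additive_span.base UN_I[of "i - m"]) auto
      next
        case (add x y)
        then show ?case using additive_span.add[OF add(3,4)] by simp
      qed
      show "carrier (eps_ext A m) \<subseteq> additive_span (eps_ext A m) (\<Union>i. grade (eps_ext A m) i)"
      proof
        fix x assume "x \<in> carrier (eps_ext A m)"
        then show "x \<in> additive_span (eps_ext A m) (\<Union>i. grade (eps_ext A m) i)"
          using additive_span.add[OF l[of "fst x"] r[of "snd x"]] by auto
      qed
      fix i j x assume "x \<in> grade (eps_ext A m) i"
      then show "(hcomp A j (fst x), hcomp A (j + m) (snd x)) = (if j = i then x else \<zero>\<^bsub>eps_ext A m\<^esub>)"
        by (auto simp: hcomp_homogeneous)
    qed (use x gr in \<open>auto simp: hcomp_grade hcomp_add\<close>)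
  next
    show "\<one>\<^bsub>eps_ext A m\<^esub> \<in> grade (eps_ext A m) 0" by (simp add: one_grade)
  next
    fix x y i j assume x: "x \<in> grade (eps_ext A m) i" and y: "y \<in> grade (eps_ext A m) j"
    obtain a b where ab: "x = (a, b)" "a \<in> grade A i" "b \<in> grade A (i + m)" using x by auto
    obtain c e where ce: "y = (c, e)" "c \<in> grade A j" "e \<in> grade A (j + m)" using y by auto
    note cl = ab(2,3)[THEN grade_closed] ce(2,3)[THEN grade_closed]
    have tw: "twist A m a = signed A (m * i) a" "twist A m c = signed A (m * j) c"
      using twist_homogeneous ab(2) ce(2) by blast+
    have "b \<otimes>\<^bsub>A\<^esub> c \<in> grade A (i + j + m)" using mult_grade[OF ab(3) ce(2)] by (simp add: ac_simps)
    moreover have "signed A (m * i) a \<otimes>\<^bsub>A\<^esub> e \<in> grade A (i + j + m)"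
      using mult_grade[OF grade_signed[OF ab(2)] ce(3)] by (simp add: ac_simps)
    ultimately show "x \<otimes>\<^bsub>eps_ext A m\<^esub> y \<in> grade (eps_ext A m) (i + j)"
      using mult_grade[OF ab(2) ce(2)] by (simp add: ab ce tw grade_add)
    have 1: "a \<otimes>\<^bsub>A\<^esub> c = signed A (i * j) (c \<otimes>\<^bsub>A\<^esub> a)" by (rule graded_comm[OF ab(2) ce(2)])
    have 2: "b \<otimes>\<^bsub>A\<^esub> c = signed A (i * j) (signed A (m * j) c \<otimes>\<^bsub>A\<^esub> b)"
      using graded_comm[OF ab(3) ce(2)] cl by (simp add: signed_mult_left signed_signed algebra_simps)
    have 3: "signed A (m * i) a \<otimes>\<^bsub>A\<^esub> e = signed A (i * j) (e \<otimes>\<^bsub>A\<^esub> a)"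
      using graded_comm[OF ab(2) ce(3)] cl
      by (simp add: signed_mult_left signed_signed) (rule signed_cong, simp add: algebra_simps)
    have 4: "signed A (i * j) (e \<otimes>\<^bsub>A\<^esub> a \<oplus>\<^bsub>A\<^esub> signed A (m * j) c \<otimes>\<^bsub>A\<^esub> b)
      = signed A (i * j) (e \<otimes>\<^bsub>A\<^esub> a) \<oplus>\<^bsub>A\<^esub> signed A (i * j) (signed A (m * j) c \<otimes>\<^bsub>A\<^esub> b)"
      by (rule signed_add) (use cl in auto)
    show "x \<otimes>\<^bsub>eps_ext A m\<^esub> y = signed (eps_ext A m) (i * j) (y \<otimes>\<^bsub>eps_ext A m\<^esub> x)"
      using cl by (simp add: ab ce tw sgn 4 1 2 3 a_comm)
  qed
qed

end

section \<open>Subquotients\<close>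

text \<open>
  The structure that the values of \<open>c\<close> on \<open>W\<close> inherit from \<open>A\<close>. If the fibres of \<open>c\<close> are the cosets of an ideal
  \<open>J\<close> of a subalgebra \<open>W\<close>, this is the algebra \<open>W/J\<close>, realised inside the target type of \<open>c\<close>. In
  this way subalgebras (\<open>J = 0\<close>), quotients (\<open>W = A\<close>) and copies in another type (\<open>c\<close> injective)
  become members of one universe, as required of test objects in universal properties.
\<close>

definition image_dga :: "('k, 'u, 'z) dga_scheme \<Rightarrow> 'u set \<Rightarrow> ('u \<Rightarrow> 'v) \<Rightarrow> ('k, 'v) dga" where
  "image_dga A W c = (let s = inv_into W c in
    \<lparr>carrier = c ` W, mult = \<lambda>x y. c (s x \<otimes>\<^bsub>A\<^esub> s y), one = c \<one>\<^bsub>A\<^esub>, zero = c \<zero>\<^bsub>A\<^esub>,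
     add = \<lambda>x y. c (s x \<oplus>\<^bsub>A\<^esub> s y), smult = \<lambda>k x. c (k \<odot>\<^bsub>A\<^esub> s x),
     grade = \<lambda>i. c ` (W \<inter> grade A i), differential = \<lambda>x. c (differential A (s x))\<rparr>)"

locale subquotient = graded_comm_algebra K A
  for K :: "('k, 'm) ring_scheme" and A :: "('k, 'u, 'z) dga_scheme" +
  fixes W J :: "'u set" and c :: "'u \<Rightarrow> 'v"
  assumes W_closed: "W \<subseteq> carrier A" and W_one: "\<one>\<^bsub>A\<^esub> \<in> W"
    and W_add: "\<lbrakk>x \<in> W; y \<in> W\<rbrakk> \<Longrightarrow> x \<oplus>\<^bsub>A\<^esub> y \<in> W"
    and W_mult: "\<lbrakk>x \<in> W; y \<in> W\<rbrakk> \<Longrightarrow> x \<otimes>\<^bsub>A\<^esub> y \<in> W"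
    and W_smult: "\<lbrakk>k \<in> carrier K; x \<in> W\<rbrakk> \<Longrightarrow> k \<odot>\<^bsub>A\<^esub> x \<in> W"
    and W_hcomp: "x \<in> W \<Longrightarrow> hcomp A i x \<in> W"
    and J_sub: "J \<subseteq> W" and J_zero: "\<zero>\<^bsub>A\<^esub> \<in> J"
    and J_add: "\<lbrakk>x \<in> J; y \<in> J\<rbrakk> \<Longrightarrow> x \<oplus>\<^bsub>A\<^esub> y \<in> J"
    and J_smult: "\<lbrakk>k \<in> carrier K; x \<in> J\<rbrakk> \<Longrightarrow> k \<odot>\<^bsub>A\<^esub> x \<in> J"
    and J_lmult: "\<lbrakk>x \<in> W; y \<in> J\<rbrakk> \<Longrightarrow> x \<otimes>\<^bsub>A\<^esub> y \<in> J"
    and J_rmult: "\<lbrakk>x \<in> J; y \<in> W\<rbrakk> \<Longrightarrow> x \<otimes>\<^bsub>A\<^esub> y \<in> J"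
    and J_hcomp: "x \<in> J \<Longrightarrow> hcomp A i x \<in> J"
    and c_eq_iff: "\<lbrakk>x \<in> W; y \<in> W\<rbrakk> \<Longrightarrow> c x = c y \<longleftrightarrow> x \<ominus>\<^bsub>A\<^esub> y \<in> J"
begin

abbreviation Q :: "('k, 'v) dga" where "Q \<equiv> image_dga A W c"

lemma W_carrier: "x \<in> W \<Longrightarrow> x \<in> carrier A" using W_closed by blast

lemma J_W: "x \<in> J \<Longrightarrow> x \<in> W" using J_sub by blast

lemma J_carrier: "x \<in> J \<Longrightarrow> x \<in> carrier A" using J_W W_carrier by blast

lemma W_zero: "\<zero>\<^bsub>A\<^esub> \<in> W" using J_zero J_W by blast

lemma minus_one_smult: "x \<in> carrier A \<Longrightarrow> (\<ominus>\<^bsub>K\<^esub> \<one>\<^bsub>K\<^esub>) \<odot>\<^bsub>A\<^esub> x = \<ominus>\<^bsub>A\<^esub> x"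
  using smult_l_minus[of "\<one>\<^bsub>K\<^esub>" x] smult_one by simp

lemma W_neg: "x \<in> W \<Longrightarrow> \<ominus>\<^bsub>A\<^esub> x \<in> W"
  using W_smult[of "\<ominus>\<^bsub>K\<^esub> \<one>\<^bsub>K\<^esub>" x] W_carrier[of x] by (simp add: minus_one_smult)

lemma J_neg: "x \<in> J \<Longrightarrow> \<ominus>\<^bsub>A\<^esub> x \<in> J"
  using J_smult[of "\<ominus>\<^bsub>K\<^esub> \<one>\<^bsub>K\<^esub>" x] J_carrier[of x] by (simp add: minus_one_smult)

lemma sec_in: "x \<in> W \<Longrightarrow> inv_into W c (c x) \<in> W" by (simp add: inv_into_into)

lemma sec_cong:
  assumes "x \<in> W"
  obtains j where "j \<in> J" "inv_into W c (c x) = j \<oplus>\<^bsub>A\<^esub> x"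
proof
  have "c (inv_into W c (c x)) = c x" by (rule f_inv_into_f) (use assms in blast)
  then show "inv_into W c (c x) \<ominus>\<^bsub>A\<^esub> x \<in> J" using c_eq_iff sec_in assms by simp
  show "inv_into W c (c x) = inv_into W c (c x) \<ominus>\<^bsub>A\<^esub> x \<oplus>\<^bsub>A\<^esub> x"
    using W_carrier[OF assms] W_carrier[OF sec_in[OF assms]] by (simp add: a_minus_def a_assoc l_neg)
qed

lemma c_eqI:
  assumes "x \<in> W" "j \<in> J" shows "c (j \<oplus>\<^bsub>A\<^esub> x) = c x"
proof -
  have "j \<oplus>\<^bsub>A\<^esub> x \<ominus>\<^bsub>A\<^esub> x = j" using W_carrier[OF assms(1)] J_carrier[OF assms(2)]
    by (simp add: a_minus_def a_assoc r_neg)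
  then show ?thesis using c_eq_iff[of "j \<oplus>\<^bsub>A\<^esub> x" x] assms W_add J_W by simp
qed

lemma carrier_Q [simp]: "carrier Q = c ` W"
  and one_Q: "\<one>\<^bsub>Q\<^esub> = c \<one>\<^bsub>A\<^esub>" and zero_Q: "\<zero>\<^bsub>Q\<^esub> = c \<zero>\<^bsub>A\<^esub>"
  and grade_Q [simp]: "grade Q i = c ` (W \<inter> grade A i)"
  by (simp_all add: image_dga_def Let_def)

lemma add_Q: assumes "x \<in> W" "y \<in> W" shows "c x \<oplus>\<^bsub>Q\<^esub> c y = c (x \<oplus>\<^bsub>A\<^esub> y)"
proof -
  obtain j where j: "j \<in> J" "inv_into W c (c x) = j \<oplus>\<^bsub>A\<^esub> x" by (rule sec_cong[OF assms(1)])
  obtain k where k: "k \<in> J" "inv_into W c (c y) = k \<oplus>\<^bsub>A\<^esub> y" by (rule sec_cong[OF assms(2)])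
  have "(j \<oplus>\<^bsub>A\<^esub> x) \<oplus>\<^bsub>A\<^esub> (k \<oplus>\<^bsub>A\<^esub> y) = (j \<oplus>\<^bsub>A\<^esub> k) \<oplus>\<^bsub>A\<^esub> (x \<oplus>\<^bsub>A\<^esub> y)"
    using J_carrier[OF j(1)] J_carrier[OF k(1)] assms[THEN W_carrier] by (simp add: a_ac)
  then show ?thesis using c_eqI[OF W_add[OF assms] J_add[OF j(1) k(1)]]
    by (simp add: image_dga_def Let_def j k)
qed

lemma mult_Q: assumes "x \<in> W" "y \<in> W" shows "c x \<otimes>\<^bsub>Q\<^esub> c y = c (x \<otimes>\<^bsub>A\<^esub> y)"
proof -
  obtain j where j: "j \<in> J" "inv_into W c (c x) = j \<oplus>\<^bsub>A\<^esub> x" by (rule sec_cong[OF assms(1)])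
  obtain k where k: "k \<in> J" "inv_into W c (c y) = k \<oplus>\<^bsub>A\<^esub> y" by (rule sec_cong[OF assms(2)])
  have "(j \<oplus>\<^bsub>A\<^esub> x) \<otimes>\<^bsub>A\<^esub> (k \<oplus>\<^bsub>A\<^esub> y)
    = (j \<otimes>\<^bsub>A\<^esub> (k \<oplus>\<^bsub>A\<^esub> y) \<oplus>\<^bsub>A\<^esub> x \<otimes>\<^bsub>A\<^esub> k) \<oplus>\<^bsub>A\<^esub> x \<otimes>\<^bsub>A\<^esub> y"
    using J_carrier[OF j(1)] J_carrier[OF k(1)] assms[THEN W_carrier] by (simp add: l_distr r_distr a_ac)
  moreover have "j \<otimes>\<^bsub>A\<^esub> (k \<oplus>\<^bsub>A\<^esub> y) \<oplus>\<^bsub>A\<^esub> x \<otimes>\<^bsub>A\<^esub> k \<in> J"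
    using j k assms J_W by (intro J_add J_rmult J_lmult W_add) auto
  ultimately show ?thesis using c_eqI[OF W_mult[OF assms]]
    by (simp add: image_dga_def Let_def j k)
qed

lemma smult_Q: assumes "k \<in> carrier K" "x \<in> W" shows "k \<odot>\<^bsub>Q\<^esub> c x = c (k \<odot>\<^bsub>A\<^esub> x)"
proof -
  obtain j where j: "j \<in> J" "inv_into W c (c x) = j \<oplus>\<^bsub>A\<^esub> x" by (rule sec_cong[OF assms(2)])
  have "k \<odot>\<^bsub>A\<^esub> (j \<oplus>\<^bsub>A\<^esub> x) = k \<odot>\<^bsub>A\<^esub> j \<oplus>\<^bsub>A\<^esub> k \<odot>\<^bsub>A\<^esub> x"
    using J_carrier[OF j(1)] assms W_carrier by (simp add: smult_r_distr)
  then show ?thesis using c_eqI[OF W_smult[OF assms] J_smult[OF assms(1) j(1)]]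
    by (simp add: image_dga_def Let_def j)
qed

lemmas Q_simps = one_Q zero_Q add_Q mult_Q smult_Q

lemma ring_Q: "ring Q"
proof (rule ringI)
  show "abelian_group Q"
  proof (rule abelian_groupI)
    fix x assume "x \<in> carrier Q"
    then obtain a where a: "a \<in> W" "x = c a" by auto
    show "\<exists>y\<in>carrier Q. y \<oplus>\<^bsub>Q\<^esub> x = \<zero>\<^bsub>Q\<^esub>"
      by (rule bexI[of _ "c (\<ominus>\<^bsub>A\<^esub> a)"]) (use a W_neg W_carrier in \<open>simp_all add: Q_simps l_neg\<close>)
  qed (auto simp: Q_simps W_add W_zero W_carrier a_ac)
  show "monoid Q"
    by (rule monoidI) (auto simp: Q_simps W_mult W_one W_carrier m_assoc)
qed (auto simp: Q_simps W_mult W_add W_carrier l_distr r_distr)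

lemma module_Q: "module K Q"
proof -
  interpret QQ: ring Q by (rule ring_Q)
  show ?thesis
    by (rule moduleI)
      (auto simp: R.is_cring QQ.abelian_group_axioms Q_simps W_smult W_add W_carrier
        smult_l_distr smult_r_distr smult_assoc1)
qed

lemma neg_Q: "x \<in> W \<Longrightarrow> \<ominus>\<^bsub>Q\<^esub> c x = c (\<ominus>\<^bsub>A\<^esub> x)"
proof -
  interpret QQ: ring Q by (rule ring_Q)
  show "x \<in> W \<Longrightarrow> \<ominus>\<^bsub>Q\<^esub> c x = c (\<ominus>\<^bsub>A\<^esub> x)"
    by (rule QQ.minus_equality) (auto simp: Q_simps W_neg W_carrier l_neg)
qed

lemma signed_Q: "x \<in> W \<Longrightarrow> signed Q i (c x) = c (signed A i x)"
  by (simp add: signed_def neg_Q)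

lemma c_hcomp_cong:
  assumes "x \<in> W" "y \<in> W" "c x = c y" shows "c (hcomp A i x) = c (hcomp A i y)"
proof -
  have "x \<ominus>\<^bsub>A\<^esub> y \<in> J" using c_eq_iff assms by simp
  then have "hcomp A i x \<ominus>\<^bsub>A\<^esub> hcomp A i y \<in> J" using J_hcomp hcomp_minus assms W_carrier by metis
  then show ?thesis using c_eq_iff W_hcomp assms by simp
qed

lemma W_span: assumes "x \<in> W" shows "c x \<in> additive_span Q (\<Union>i. c ` (W \<inter> grade A i))"
proof -
  have "finite F \<Longrightarrow> finsum A (\<lambda>i. hcomp A i x) F \<in> W \<and>
    c (finsum A (\<lambda>i. hcomp A i x) F) \<in> additive_span Q (\<Union>i. c ` (W \<inter> grade A i))" for F
  proof (induction F rule: finite_induct)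
    case empty
    then show ?case using additive_span.zero[of Q] by (simp add: zero_Q W_zero)
  next
    case (insert j F)
    have 1: "hcomp A j x \<in> W \<inter> grade A j" using W_hcomp hcomp_grade assms W_carrier by blast
    then have "c (hcomp A j x) \<in> additive_span Q (\<Union>i. c ` (W \<inter> grade A i))"
      by (intro additive_span.base) blast
    from additive_span.add[OF this insert(3)[THEN conjunct2]]
    show ?case using insert 1 W_carrier[OF assms] by (simp add: add_Q W_add)
  qed
  then show ?thesis using hcomp_props[OF W_carrier[OF assms]] by metis
qed

lemma graded_comm_algebra_Q: "graded_comm_algebra K Q"
proof (intro graded_comm_algebra.intro graded_comm_algebra_axioms.intro module_Q ring_Q)
  interpret QQ: ring Q by (rule ring_Q)
  fix a x y assume "a \<in> carrier K" "x \<in> carrier Q" "y \<in> carrier Q"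
  then show "(a \<odot>\<^bsub>Q\<^esub> x) \<otimes>\<^bsub>Q\<^esub> y = a \<odot>\<^bsub>Q\<^esub> (x \<otimes>\<^bsub>Q\<^esub> y)"
    "x \<otimes>\<^bsub>Q\<^esub> (a \<odot>\<^bsub>Q\<^esub> y) = a \<odot>\<^bsub>Q\<^esub> (x \<otimes>\<^bsub>Q\<^esub> y)"
    by (auto simp: Q_simps W_smult W_mult W_carrier smult_mult_left smult_mult_right)
next
  fix i
  show "submodule (grade Q i) K Q"
    by (intro module.submoduleI[OF module_Q])
      (auto simp: Q_simps neg_Q W_smult W_add W_neg W_zero grade_smult grade_add grade_neg intro!: imageI)
next
  interpret QQ: ring Q by (rule ring_Q)
  fix x assume x: "x \<in> carrier Q"
  let ?p = "\<lambda>i x. c (hcomp A i (inv_into W c x))"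
  have p: "?p i (c a) = c (hcomp A i a)" if "a \<in> W" for a i
    by (rule c_hcomp_cong) (use that sec_in f_inv_into_f[of "c a" c W] in auto)
  show "\<exists>!d. (\<forall>i. d i \<in> grade Q i) \<and> finite {i. d i \<noteq> \<zero>\<^bsub>Q\<^esub>} \<and> x = finsum Q d {i. d i \<noteq> \<zero>\<^bsub>Q\<^esub>}"
  proof (rule QQ.direct_sumI[where p = ?p])
    fix i x assume "x \<in> carrier Q"
    then obtain a where a: "a \<in> W" "x = c a" by auto
    then show "?p i x \<in> grade Q i" using p hcomp_grade W_carrier W_hcomp by auto
  next
    fix i x y assume "x \<in> carrier Q" "y \<in> carrier Q"
    then obtain a b where a: "a \<in> W" "x = c a" "b \<in> W" "y = c b" by auto
    then show "?p i (x \<oplus>\<^bsub>Q\<^esub> y) = ?p i x \<oplus>\<^bsub>Q\<^esub> ?p i y"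
      by (simp add: p add_Q W_add W_hcomp hcomp_add W_carrier)
  next
    fix i j x assume "x \<in> grade Q i"
    then obtain a where a: "a \<in> W" "a \<in> grade A i" "x = c a" by auto
    then show "?p j x = (if j = i then x else \<zero>\<^bsub>Q\<^esub>)"
      using hcomp_homogeneous[OF a(2)] by (simp add: p zero_Q)
  next
    show "\<zero>\<^bsub>Q\<^esub> \<in> grade Q i" for i using W_zero by (simp add: zero_Q)
  qed (use x W_span in auto)
next
  show "\<one>\<^bsub>Q\<^esub> \<in> grade Q 0" using W_one one_grade by (simp add: one_Q)
next
  fix x y i j assume "x \<in> grade Q i" "y \<in> grade Q j"
  then obtain a b where ab: "a \<in> W" "a \<in> grade A i" "x = c a" "b \<in> W" "b \<in> grade A j" "y = c b"
    by auto
  show "x \<otimes>\<^bsub>Q\<^esub> y \<in> grade Q (i + j)"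
    using ab W_mult mult_grade by (auto simp: mult_Q intro!: imageI)
  show "x \<otimes>\<^bsub>Q\<^esub> y = signed Q (i * j) (y \<otimes>\<^bsub>Q\<^esub> x)"
    using graded_comm[OF ab(2,5)] ab(1,4) by (simp add: ab(3,6) mult_Q W_mult signed_Q)
qed

end

text \<open>
  Unlike in a nonpositively graded algebra, components of positive degree may occur: the form \<open>dt\<close> has
  degree \<open>1\<close>.
\<close>

locale graded_dga = graded_comm_algebra K A
  for K :: "('k, 'm) ring_scheme" and A :: "('k, 'u, 'z) dga_scheme" +
  assumes d_grade: "x \<in> grade A i \<Longrightarrow> differential A x \<in> grade A (i + 1)"
    and d_closed: "x \<in> carrier A \<Longrightarrow> differential A x \<in> carrier A"
    and d_add: "\<lbrakk>x \<in> carrier A; y \<in> carrier A\<rbrakk>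
        \<Longrightarrow> differential A (x \<oplus>\<^bsub>A\<^esub> y) = differential A x \<oplus>\<^bsub>A\<^esub> differential A y"
    and d_smult: "\<lbrakk>a \<in> carrier K; x \<in> carrier A\<rbrakk>
        \<Longrightarrow> differential A (a \<odot>\<^bsub>A\<^esub> x) = a \<odot>\<^bsub>A\<^esub> differential A x"
    and d_d: "x \<in> carrier A \<Longrightarrow> differential A (differential A x) = \<zero>\<^bsub>A\<^esub>"
    and d_leibniz: "\<lbrakk>x \<in> grade A i; y \<in> carrier A\<rbrakk>
        \<Longrightarrow> differential A (x \<otimes>\<^bsub>A\<^esub> y) =
            (differential A x \<otimes>\<^bsub>A\<^esub> y) \<oplus>\<^bsub>A\<^esub> signed A i (x \<otimes>\<^bsub>A\<^esub> differential A y)"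

lemma (in cdga) differential_zero: "differential A \<zero>\<^bsub>A\<^esub> = \<zero>\<^bsub>A\<^esub>"
  using diff_smult[of "\<zero>\<^bsub>K\<^esub>" "\<zero>\<^bsub>A\<^esub>"] diff_grade[OF grade_zero, of 0] grade_closed by simp

sublocale cdga \<subseteq> graded_dga
proof
  fix x assume "x \<in> carrier A"
  then show "differential A x \<in> carrier A"
    by (induction rule: graded_induct)
      (auto simp: differential_zero diff_add dest: diff_grade grade_closed)
qed (auto intro: diff_grade diff_add diff_smult diff_diff leibniz)

context graded_dga
begin

lemma d_zero [simp]: "differential A \<zero>\<^bsub>A\<^esub> = \<zero>\<^bsub>A\<^esub>"
  using d_smult[of "\<zero>\<^bsub>K\<^esub>" "\<zero>\<^bsub>A\<^esub>"] d_closed by simp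

lemma d_neg: "x \<in> carrier A \<Longrightarrow> differential A (\<ominus>\<^bsub>A\<^esub> x) = \<ominus>\<^bsub>A\<^esub> differential A x"
  using d_add[of "\<ominus>\<^bsub>A\<^esub> x" x] d_closed by (intro minus_equality[symmetric]) (auto simp: l_neg)

lemma d_minus: "\<lbrakk>x \<in> carrier A; y \<in> carrier A\<rbrakk>
    \<Longrightarrow> differential A (x \<ominus>\<^bsub>A\<^esub> y) = differential A x \<ominus>\<^bsub>A\<^esub> differential A y"
  by (simp add: a_minus_def d_add d_neg)

lemma d_signed: "x \<in> carrier A \<Longrightarrow> differential A (signed A i x) = signed A i (differential A x)"
  by (simp add: signed_def d_neg)

lemma hcomp_d: "x \<in> carrier A \<Longrightarrow> hcomp A (i + 1) (differential A x) = differential A (hcomp A i x)"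
  by (rule hcomp_additive_map) (auto simp: d_closed d_add intro: d_grade)

end

locale dg_subquotient = graded_dga K A + subquotient K A W J c
  for K :: "('k, 'm) ring_scheme" and A :: "('k, 'u, 'z) dga_scheme"
    and W J and c :: "'u \<Rightarrow> 'v" +
  assumes W_d: "x \<in> W \<Longrightarrow> differential A x \<in> W" and J_d: "x \<in> J \<Longrightarrow> differential A x \<in> J"
begin

lemma d_Q: assumes "x \<in> W" shows "differential Q (c x) = c (differential A x)"
proof -
  obtain j where j: "j \<in> J" "inv_into W c (c x) = j \<oplus>\<^bsub>A\<^esub> x" by (rule sec_cong[OF assms])
  have "differential A (j \<oplus>\<^bsub>A\<^esub> x) = differential A j \<oplus>\<^bsub>A\<^esub> differential A x"
    using J_carrier[OF j(1)] W_carrier[OF assms] by (rule d_add)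
  then show ?thesis using c_eqI[OF W_d[OF assms] J_d[OF j(1)]]
    by (simp add: image_dga_def Let_def j)
qed

lemma graded_dga_Q: "graded_dga K Q"
proof (intro graded_dga.intro graded_comm_algebra_Q graded_dga_axioms.intro)
  fix x i assume "x \<in> grade Q i"
  then show "differential Q x \<in> grade Q (i + 1)" using W_d d_grade by (auto simp: d_Q)
next
  fix x y i assume x: "x \<in> grade Q i" and y: "y \<in> carrier Q"
  obtain a where a: "a \<in> W" "a \<in> grade A i" "x = c a" using x by auto
  obtain b where b: "b \<in> W" "y = c b" using y by auto
  have s: "signed A i (a \<otimes>\<^bsub>A\<^esub> differential A b) \<in> W"
    using a b by (simp add: signed_def W_mult W_d W_neg)
  show "differential Q (x \<otimes>\<^bsub>Q\<^esub> y) =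
            (differential Q x \<otimes>\<^bsub>Q\<^esub> y) \<oplus>\<^bsub>Q\<^esub> signed Q i (x \<otimes>\<^bsub>Q\<^esub> differential Q y)"
    using a b s d_leibniz[OF a(2) W_carrier[OF b(1)]] by (simp add: d_Q mult_Q W_mult W_d signed_Q add_Q)
qed (auto simp: d_Q Q_simps W_d W_add W_smult W_carrier d_add d_smult d_d)

end

section \<open>Morphisms between algebras in different types\<close>

lemma (in abelian_group) minus_eq_zero_iff:
  "\<lbrakk>x \<in> carrier G; y \<in> carrier G\<rbrakk> \<Longrightarrow> x \<ominus> y = \<zero> \<longleftrightarrow> x = y"
  by (metis a_minus_def add.inv_closed add.inv_equality add.inv_inv r_neg)

definition ghom ::
  "('k, 'm) ring_scheme \<Rightarrow> ('k, 'u, 'y) dga_scheme \<Rightarrow> ('k, 'v, 'z) dga_scheme \<Rightarrow> ('u \<Rightarrow> 'v) set"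
  where "ghom K A B = {f \<in> ring_hom A B.
      (\<forall>a\<in>carrier K. \<forall>x\<in>carrier A. f (a \<odot>\<^bsub>A\<^esub> x) = a \<odot>\<^bsub>B\<^esub> f x) \<and>
      (\<forall>i. f ` grade A i \<subseteq> grade B i)}"

lemma graded_hom_eq_ghom: "graded_hom K A B = ghom K A B"
  by (simp add: graded_hom_def ghom_def)

lemma cdga_hom_ghom: "f \<in> cdga_hom K A B \<Longrightarrow> f \<in> ghom K A B"
  by (simp add: cdga_hom_def graded_hom_eq_ghom)

lemma cdga_hom_d: "f \<in> cdga_hom K A B \<Longrightarrow> x \<in> carrier A \<Longrightarrow> f (differential A x) = differential B (f x)"
  by (simp add: cdga_hom_def)

lemma ghomI:
  assumes "\<And>x. x \<in> carrier A \<Longrightarrow> f x \<in> carrier B"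
    "\<And>x y. \<lbrakk>x \<in> carrier A; y \<in> carrier A\<rbrakk> \<Longrightarrow> f (x \<otimes>\<^bsub>A\<^esub> y) = f x \<otimes>\<^bsub>B\<^esub> f y"
    "\<And>x y. \<lbrakk>x \<in> carrier A; y \<in> carrier A\<rbrakk> \<Longrightarrow> f (x \<oplus>\<^bsub>A\<^esub> y) = f x \<oplus>\<^bsub>B\<^esub> f y"
    "f \<one>\<^bsub>A\<^esub> = \<one>\<^bsub>B\<^esub>"
    "\<And>k x. \<lbrakk>k \<in> carrier K; x \<in> carrier A\<rbrakk> \<Longrightarrow> f (k \<odot>\<^bsub>A\<^esub> x) = k \<odot>\<^bsub>B\<^esub> f x"
    "\<And>i x. x \<in> grade A i \<Longrightarrow> f x \<in> grade B i"
  shows "f \<in> ghom K A B"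
  using assms by (auto simp: ghom_def ring_hom_def)

lemma ghom_closed: "f \<in> ghom K A B \<Longrightarrow> x \<in> carrier A \<Longrightarrow> f x \<in> carrier B"
  and ghom_mult: "f \<in> ghom K A B \<Longrightarrow> x \<in> carrier A \<Longrightarrow> y \<in> carrier A \<Longrightarrow> f (x \<otimes>\<^bsub>A\<^esub> y) = f x \<otimes>\<^bsub>B\<^esub> f y"
  and ghom_add: "f \<in> ghom K A B \<Longrightarrow> x \<in> carrier A \<Longrightarrow> y \<in> carrier A \<Longrightarrow> f (x \<oplus>\<^bsub>A\<^esub> y) = f x \<oplus>\<^bsub>B\<^esub> f y"
  and ghom_one: "f \<in> ghom K A B \<Longrightarrow> f \<one>\<^bsub>A\<^esub> = \<one>\<^bsub>B\<^esub>"
  and ghom_smult: "f \<in> ghom K A B \<Longrightarrow> k \<in> carrier K \<Longrightarrow> x \<in> carrier A \<Longrightarrow> f (k \<odot>\<^bsub>A\<^esub> x) = k \<odot>\<^bsub>B\<^esub> f x"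
  by (auto simp: ghom_def ring_hom_def)

lemma ghom_grade: "f \<in> ghom K A B \<Longrightarrow> x \<in> grade A i \<Longrightarrow> f x \<in> grade B i"
  unfolding ghom_def by blast

lemma ghom_zero:
  assumes "f \<in> ghom K A B" "ring A" "ring B" shows "f \<zero>\<^bsub>A\<^esub> = \<zero>\<^bsub>B\<^esub>"
  using assms by (auto simp: ghom_def intro: ring_hom_zero)

lemma ghom_neg:
  assumes f: "f \<in> ghom K A B" and "ring A" "ring B" and x: "x \<in> carrier A"
  shows "f (\<ominus>\<^bsub>A\<^esub> x) = \<ominus>\<^bsub>B\<^esub> f x"
proof -
  interpret A: ring A by fact
  interpret B: ring B by fact
  have "f (\<ominus>\<^bsub>A\<^esub> x) \<oplus>\<^bsub>B\<^esub> f x = \<zero>\<^bsub>B\<^esub>"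
    using ghom_add[OF f, of "\<ominus>\<^bsub>A\<^esub> x" x] ghom_zero[OF f] assms by (simp add: A.l_neg)
  then show ?thesis using ghom_closed[OF f] x by (intro B.minus_equality[symmetric]) auto
qed

lemma ghom_minus:
  assumes f: "f \<in> ghom K A B" and "ring A" "ring B" and x: "x \<in> carrier A" "y \<in> carrier A"
  shows "f (x \<ominus>\<^bsub>A\<^esub> y) = f x \<ominus>\<^bsub>B\<^esub> f y"
proof -
  interpret A: ring A by fact
  show ?thesis using assms by (simp add: a_minus_def ghom_add ghom_neg)
qed

lemma ghom_signed:
  assumes "f \<in> ghom K A B" "ring A" "ring B" "x \<in> carrier A"
  shows "f (signed A i x) = signed B i (f x)"
  using assms by (simp add: signed_def ghom_neg)

lemma ghom_hcomp:
  assumes f: "f \<in> ghom K A B" and A: "graded_comm_algebra K A" and B: "graded_comm_algebra K B"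
    and x: "x \<in> carrier A"
  shows "f (hcomp A i x) = hcomp B i (f x)"
proof -
  interpret A: graded_comm_algebra K A by fact
  interpret B: graded_comm_algebra K B by fact
  note z = ghom_zero[OF f A.ring_axioms B.ring_axioms]
  show ?thesis using x
  proof (induction rule: A.graded_induct)
    case (hom j x)
    then show ?case
      using A.hcomp_homogeneous[OF hom] B.hcomp_homogeneous[OF ghom_grade[OF f hom]] z by simp
  qed (simp_all add: z A.hcomp_add B.hcomp_add ghom_add[OF f] ghom_closed[OF f])
qed

lemma ghom_comp: "\<lbrakk>f \<in> ghom K A B; g \<in> ghom K B C\<rbrakk> \<Longrightarrow> (\<lambda>x. g (f x)) \<in> ghom K A C"
  by (rule ghomI) (simp_all add: ghom_closed ghom_mult ghom_add ghom_one ghom_smult ghom_grade)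

lemma (in subquotient) c_ghom:
  "\<lbrakk>f \<in> ghom K B A; f ` carrier B \<subseteq> W; \<And>i. grade B i \<subseteq> carrier B\<rbrakk> \<Longrightarrow> (\<lambda>x. c (f x)) \<in> ghom K B Q"
  by (rule ghomI)
    (auto simp: ghom_mult ghom_add ghom_one ghom_smult Q_simps image_subset_iff subset_iff dest: ghom_grade intro!: imageI)

lemma (in graded_comm_algebra) id_ghom: "(\<lambda>x. x) \<in> ghom K A A"
  by (rule ghomI) auto

lemma (in graded_comm_algebra) subquotient_inj:
  assumes "inj_on c (carrier A)"
  shows "subquotient K A (carrier A) {\<zero>\<^bsub>A\<^esub>} c"
proof
  fix x y assume "x \<in> carrier A" "y \<in> carrier A"
  then show "c x = c y \<longleftrightarrow> x \<ominus>\<^bsub>A\<^esub> y \<in> {\<zero>\<^bsub>A\<^esub>}"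
    using inj_on_eq_iff[OF assms] by (simp add: minus_eq_zero_iff)
qed auto

section \<open>Polynomial extensions\<close>

text \<open>
  A homogeneous ideal, given by its homogeneous parts. It is two-sided by graded commutativity.
\<close>

definition graded_ideal :: "('k, 'u, 'z) dga_scheme \<Rightarrow> (int \<Rightarrow> 'u set) \<Rightarrow> bool" where
  "graded_ideal A L \<longleftrightarrow> (\<forall>i. L i \<subseteq> grade A i \<and> \<zero>\<^bsub>A\<^esub> \<in> L i \<and> (\<forall>x\<in>L i. \<forall>y\<in>L i. x \<oplus>\<^bsub>A\<^esub> y \<in> L i) \<and>
     (\<forall>j. \<forall>a\<in>grade A j. \<forall>x\<in>L i. a \<otimes>\<^bsub>A\<^esub> x \<in> L (j + i)))"

lemma (in graded_comm_algebra) graded_ideal_grade: "graded_ideal A (grade A)"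
  by (simp add: graded_ideal_def grade_add mult_grade)

lemma (in graded_comm_algebra)
  assumes "graded_ideal A L" "x \<in> L i"
  shows graded_ideal_smult: "k \<in> carrier K \<Longrightarrow> k \<odot>\<^bsub>A\<^esub> x \<in> L i"
    and graded_ideal_neg: "\<ominus>\<^bsub>A\<^esub> x \<in> L i"
proof -
  have x: "x \<in> carrier A" using assms grade_closed[of x i] unfolding graded_ideal_def by blast
  show s: "k \<odot>\<^bsub>A\<^esub> x \<in> L i" if k: "k \<in> carrier K" for k
  proof -
    have "(k \<odot>\<^bsub>A\<^esub> \<one>\<^bsub>A\<^esub>) \<otimes>\<^bsub>A\<^esub> x \<in> L (0 + i)"
      using assms grade_smult[OF k one_grade] unfolding graded_ideal_def by blast
    then show ?thesis using k x by (simp add: smult_mult_left)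
  qed
  have "\<ominus>\<^bsub>A\<^esub> \<one>\<^bsub>A\<^esub> \<otimes>\<^bsub>A\<^esub> x \<in> L (0 + i)"
    using assms grade_neg[OF one_grade] unfolding graded_ideal_def by blast
  then show "\<ominus>\<^bsub>A\<^esub> x \<in> L i" using x by (simp add: l_minus)
qed

text \<open>
  Sums of monomials \<open>x\<^sub>1 \<cdots> x\<^sub>r h(l)\<close> of degree \<open>i\<close> with variables in \<open>S\<close>, coefficient \<open>l\<close> in \<open>L\<close>,
  and weight \<open>\<omega> x\<^sub>1 + \<cdots> + \<omega> x\<^sub>r \<le> n\<close>. For an ideal \<open>L\<close> of \<open>X\<close> this is the extended ideal
  \<open>L Y\<close> with a filtration. Three weights occur: weight \<open>1\<close> counts the variables, weight \<open>- deg x\<close> compares the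
  differential with its leading part, and weight \<open>0\<close> forgets the filtration.
\<close>

inductive var_span :: "('k, 'u, 'z) dga_scheme \<Rightarrow> ('x \<Rightarrow> 'u) \<Rightarrow> 'u set \<Rightarrow> ('u \<Rightarrow> int) \<Rightarrow> ('u \<Rightarrow> nat)
    \<Rightarrow> (int \<Rightarrow> 'x set) \<Rightarrow> int \<Rightarrow> nat \<Rightarrow> 'u \<Rightarrow> bool" for Y h S deg \<omega> L where
  zero: "var_span Y h S deg \<omega> L i n \<zero>\<^bsub>Y\<^esub>"
| base: "l \<in> L i \<Longrightarrow> var_span Y h S deg \<omega> L i n (h l)"
| var: "\<lbrakk>x \<in> S; var_span Y h S deg \<omega> L i n y\<rbrakk> \<Longrightarrow> var_span Y h S deg \<omega> L (deg x + i) (\<omega> x + n) (x \<otimes>\<^bsub>Y\<^esub> y)"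
| add: "\<lbrakk>var_span Y h S deg \<omega> L i n y; var_span Y h S deg \<omega> L i n z\<rbrakk>
    \<Longrightarrow> var_span Y h S deg \<omega> L i n (y \<oplus>\<^bsub>Y\<^esub> z)"

locale semifree = X: cdga K X + Y: cdga K Y
  for K :: "('k, 'm) ring_scheme" and X Y :: "('k, 'u) dga" +
  fixes h :: "'u \<Rightarrow> 'u" and S :: "'u set" and deg :: "'u \<Rightarrow> int"
  assumes h_dg: "h \<in> cdga_hom K X Y" and deg_nonpos: "x \<in> S \<Longrightarrow> deg x \<le> 0"
    and poly: "polynomial_extension K X Y h S deg"
    and inf: "infinite (UNIV :: 'u set)"
begin

lemmas h = cdga_hom_ghom[OF h_dg]

lemmas h_simps = ghom_closed[OF h] ghom_mult[OF h] ghom_add[OF h] ghom_one[OF h] ghom_smult[OF h]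
  ghom_zero[OF h X.ring_axioms Y.ring_axioms] ghom_neg[OF h X.ring_axioms Y.ring_axioms]
  ghom_signed[OF h X.ring_axioms Y.ring_axioms] cdga_hom_d[OF h_dg]

lemma var_grade: "x \<in> S \<Longrightarrow> x \<in> grade Y (deg x)"
  using poly by (simp add: polynomial_extension_def)

lemma var_closed: "x \<in> S \<Longrightarrow> x \<in> carrier Y"
  using var_grade Y.grade_closed by blast

lemma universal_same_type:
  assumes "graded_comm_algebra K (W :: ('k, 'u) dga)" "\<phi> \<in> ghom K X W" "\<And>x. x \<in> S \<Longrightarrow> v x \<in> grade W (deg x)"
  obtains \<psi> where "\<psi> \<in> ghom K Y W" "\<And>a. a \<in> carrier X \<Longrightarrow> \<psi> (h a) = \<phi> a" "\<And>x. x \<in> S \<Longrightarrow> \<psi> x = v x"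
    "\<And>\<psi>' y. \<lbrakk>\<psi>' \<in> ghom K Y W; \<And>a. a \<in> carrier X \<Longrightarrow> \<psi>' (h a) = \<phi> a; \<And>x. x \<in> S \<Longrightarrow> \<psi>' x = v x;
      y \<in> carrier Y\<rbrakk> \<Longrightarrow> \<psi>' y = \<psi> y"
proof -
  have "\<exists>\<psi>\<in>graded_hom K Y W. (\<forall>a\<in>carrier X. \<psi> (h a) = \<phi> a) \<and> (\<forall>x\<in>S. \<psi> x = v x) \<and>
        (\<forall>\<psi>'\<in>graded_hom K Y W. (\<forall>a\<in>carrier X. \<psi>' (h a) = \<phi> a) \<and> (\<forall>x\<in>S. \<psi>' x = v x) \<longrightarrow>
          (\<forall>y\<in>carrier Y. \<psi>' y = \<psi> y))"
    using poly assms unfolding polynomial_extension_def graded_hom_eq_ghom by blast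
  then obtain \<psi> where \<psi>: "\<psi> \<in> ghom K Y W" "\<forall>a\<in>carrier X. \<psi> (h a) = \<phi> a" "\<forall>x\<in>S. \<psi> x = v x"
    "\<forall>\<psi>'\<in>ghom K Y W. (\<forall>a\<in>carrier X. \<psi>' (h a) = \<phi> a) \<and> (\<forall>x\<in>S. \<psi>' x = v x) \<longrightarrow>
          (\<forall>y\<in>carrier Y. \<psi>' y = \<psi> y)"
    unfolding graded_hom_eq_ghom by (elim bexE conjE) (rule that)
  show thesis
  proof (rule that[OF \<psi>(1)])
    fix \<psi>' y assume "\<psi>' \<in> ghom K Y W" "\<And>a. a \<in> carrier X \<Longrightarrow> \<psi>' (h a) = \<phi> a"
      "\<And>x. x \<in> S \<Longrightarrow> \<psi>' x = v x" "y \<in> carrier Y"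
    then show "\<psi>' y = \<psi> y" using \<psi>(4) by simp
  qed (use \<psi>(2,3) in auto)
qed

text \<open>
  The definition of a polynomial extension tests against algebras in the universe. An algebra in another
  type is as good, if it can be copied into the universe.
\<close>

lemma universal:
  assumes W: "graded_comm_algebra K (W :: ('k, 'v) dga)" and code: "inj_on (code :: 'v \<Rightarrow> 'u) (carrier W)"
    and \<phi>: "\<phi> \<in> ghom K X W" and v: "\<And>x. x \<in> S \<Longrightarrow> v x \<in> grade W (deg x)"
  obtains \<psi> where "\<psi> \<in> ghom K Y W" "\<And>a. a \<in> carrier X \<Longrightarrow> \<psi> (h a) = \<phi> a" "\<And>x. x \<in> S \<Longrightarrow> \<psi> x = v x"
proof -
  interpret W: graded_comm_algebra K W by fact
  interpret I: subquotient K W "carrier W" "{\<zero>\<^bsub>W\<^esub>}" code by (rule W.subquotient_inj[OF code])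
  have dec: "inv_into (carrier W) code (code x) = x" if "x \<in> carrier W" for x
    using inv_into_f_f[OF code that] .
  have \<phi>': "(\<lambda>x. code (\<phi> x)) \<in> ghom K X I.Q"
    by (rule I.c_ghom[OF \<phi>]) (use ghom_closed[OF \<phi>] X.grade_closed in auto)
  have v': "code (v x) \<in> grade I.Q (deg x)" if "x \<in> S" for x
    using v[OF that] W.grade_closed by auto
  obtain \<psi> where \<psi>: "\<psi> \<in> ghom K Y I.Q" "\<And>a. a \<in> carrier X \<Longrightarrow> \<psi> (h a) = code (\<phi> a)"
    "\<And>x. x \<in> S \<Longrightarrow> \<psi> x = code (v x)"
    by (rule universal_same_type[OF I.graded_comm_algebra_Q \<phi>' v'], assumption) (rule that)
  have inv: "inv_into (carrier W) code \<in> ghom K I.Q W"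
    by (rule ghomI) (auto simp: I.Q_simps dec W.grade_closed)
  show thesis
  proof (rule that)
    show "(\<lambda>y. inv_into (carrier W) code (\<psi> y)) \<in> ghom K Y W" by (rule ghom_comp[OF \<psi>(1) inv])
  qed (use \<psi> dec ghom_closed[OF \<phi>] W.grade_closed[OF v] in auto)
qed

abbreviation wspan :: "('u \<Rightarrow> nat) \<Rightarrow> (int \<Rightarrow> 'u set) \<Rightarrow> int \<Rightarrow> nat \<Rightarrow> 'u \<Rightarrow> bool" where
  "wspan \<equiv> var_span Y h S deg"

abbreviation vspan :: "(int \<Rightarrow> 'u set) \<Rightarrow> int \<Rightarrow> 'u \<Rightarrow> bool" where
  "vspan L i \<equiv> wspan (\<lambda>_. 0) L i 0"

context
  fixes L assumes L: "graded_ideal X L"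
begin

lemma L_grade: "l \<in> L i \<Longrightarrow> l \<in> grade X i" using L by (auto simp: graded_ideal_def)

lemma L_closed: "l \<in> L i \<Longrightarrow> l \<in> carrier X" using L_grade X.grade_closed by blast

lemma wspan_grade: "wspan \<omega> L i n y \<Longrightarrow> y \<in> grade Y i"
  by (induction rule: var_span.induct)
    (auto intro: Y.mult_grade var_grade Y.grade_add ghom_grade[OF h] L_grade)

lemma wspan_closed: "wspan \<omega> L i n y \<Longrightarrow> y \<in> carrier Y"
  using wspan_grade Y.grade_closed by blast

lemma wspan_smult: "wspan \<omega> L i n y \<Longrightarrow> k \<in> carrier K \<Longrightarrow> wspan \<omega> L i n (k \<odot>\<^bsub>Y\<^esub> y)"
proof (induction rule: var_span.induct)
  case (zero i n)
  then show ?case by (simp add: var_span.zero)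
next
  case (base l i n)
  have "k \<odot>\<^bsub>X\<^esub> l \<in> L i" by (rule X.graded_ideal_smult[OF L base(1)]) (rule base(2))
  then have "wspan \<omega> L i n (h (k \<odot>\<^bsub>X\<^esub> l))" by (rule var_span.base)
  then show ?case using L_closed[OF base(1)] base(2) by (simp add: h_simps)
next
  case (var x i n y)
  then show ?case using var_span.var[OF var(1) var(3)] var_closed wspan_closed
    by (simp add: Y.smult_mult_right)
next
  case (add i n y z)
  then show ?case using var_span.add[OF add(3,4)] wspan_closed by (simp add: Y.smult_r_distr)
qed

lemma wspan_neg: "wspan \<omega> L i n y \<Longrightarrow> wspan \<omega> L i n (\<ominus>\<^bsub>Y\<^esub> y)"
  using wspan_smult[of \<omega> i n y "\<ominus>\<^bsub>K\<^esub> \<one>\<^bsub>K\<^esub>"] wspan_closed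
  by (simp add: Y.smult_l_minus Y.smult_one)

lemma wspan_minus: "wspan \<omega> L i n y \<Longrightarrow> wspan \<omega> L i n z \<Longrightarrow> wspan \<omega> L i n (y \<ominus>\<^bsub>Y\<^esub> z)"
  unfolding a_minus_def by (intro var_span.add wspan_neg)

lemma wspan_signed: "wspan \<omega> L i n y \<Longrightarrow> wspan \<omega> L i n (signed Y j y)"
  by (simp add: signed_def wspan_neg)

lemma wspan_mono: "wspan \<omega> L i n y \<Longrightarrow> n \<le> n' \<Longrightarrow> wspan \<omega> L i n' y"
proof (induction arbitrary: n' rule: var_span.induct)
  case (var x i n y)
  have "wspan \<omega> L i (n' - \<omega> x) y" by (rule var(3)) (use var(4) in simp)
  from var_span.var[where \<omega> = \<omega>, OF var(1) this] show ?case using var(4) by simp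
qed (auto intro: var_span.intros)

lemma wspan_vspan: "wspan \<omega> L i n y \<Longrightarrow> vspan L i y"
proof (induction rule: var_span.induct)
  case (var x i n y)
  from var_span.var[OF var(1) var(3)] show ?case by simp
qed (auto intro: var_span.intros)

lemma vspan_wspan: "vspan L i y \<Longrightarrow> \<exists>n. wspan \<omega> L i n y"
proof (induction i "0::nat" y rule: var_span.induct)
  case (add i y z)
  then obtain n m where "wspan \<omega> L i n y" "wspan \<omega> L i m z" by blast
  then have "wspan \<omega> L i (max n m) y" "wspan \<omega> L i (max n m) z" using wspan_mono by simp_all
  then show ?case by (intro exI[of _ "max n m"] var_span.add)
qed (auto intro: var_span.intros)

lemma wspan_coeff_mult:
  assumes c: "c \<in> grade X k" shows "wspan \<omega> L i n y \<Longrightarrow> wspan \<omega> L (k + i) n (h c \<otimes>\<^bsub>Y\<^esub> y)"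
proof (induction rule: var_span.induct)
  case (zero i n)
  then show ?case using X.grade_closed[OF c] by (simp add: var_span.zero h_simps)
next
  case (base l i n)
  have "c \<otimes>\<^bsub>X\<^esub> l \<in> L (k + i)" using L c base unfolding graded_ideal_def by blast
  then have "wspan \<omega> L (k + i) n (h (c \<otimes>\<^bsub>X\<^esub> l))" by (rule var_span.base)
  then show ?case using L_closed[OF base] X.grade_closed[OF c] by (simp add: h_simps)
next
  case (var x i n y)
  note cl = var_closed[OF var(1)] wspan_closed[OF var(2)] h_simps(1)[OF X.grade_closed[OF c]]
  have "h c \<otimes>\<^bsub>Y\<^esub> (x \<otimes>\<^bsub>Y\<^esub> y) = (h c \<otimes>\<^bsub>Y\<^esub> x) \<otimes>\<^bsub>Y\<^esub> y" using cl by (simp add: Y.m_assoc)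
  also have "h c \<otimes>\<^bsub>Y\<^esub> x = signed Y (k * deg x) (x \<otimes>\<^bsub>Y\<^esub> h c)"
    by (rule Y.graded_comm[OF ghom_grade[OF h c] var_grade[OF var(1)]])
  also have "signed Y (k * deg x) (x \<otimes>\<^bsub>Y\<^esub> h c) \<otimes>\<^bsub>Y\<^esub> y = signed Y (k * deg x) (x \<otimes>\<^bsub>Y\<^esub> (h c \<otimes>\<^bsub>Y\<^esub> y))"
    using cl by (simp add: Y.signed_mult_left Y.m_assoc)
  finally show ?case
    using wspan_signed[OF var_span.var[OF var(1) var(3)], of "k * deg x"] by (simp add: ac_simps)
next
  case (add i n y z)
  then show ?case using var_span.add[OF add(3,4)] wspan_closed X.grade_closed[OF c] by (simp add: Y.r_distr h_simps)
qed

end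

lemmas wspan_all = wspan_closed[OF X.graded_ideal_grade]

lemma wspan_mult:
  assumes L: "graded_ideal X L" and z: "wspan \<omega> L j m z"
  shows "wspan \<omega> (grade X) i n y \<Longrightarrow> wspan \<omega> L (i + j) (n + m) (y \<otimes>\<^bsub>Y\<^esub> z)"
proof (induction rule: var_span.induct)
  case (zero i n)
  then show ?case using wspan_closed[OF L z] by (simp add: var_span.zero)
next
  case (base l i n)
  have "wspan \<omega> L (i + j) m (h l \<otimes>\<^bsub>Y\<^esub> z)" by (rule wspan_coeff_mult[OF L base z])
  then show ?case by (rule wspan_mono[OF L]) simp
next
  case (var x i n y)
  then show ?case
    using var_span.var[OF var(1) var(3)] var_closed[OF var(1)] wspan_closed[OF L z] wspan_all[OF var(2)]
    by (simp add: Y.m_assoc ac_simps)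
next
  case (add i n y y')
  then show ?case
    using var_span.add[OF add(3,4)] wspan_all[OF add(1)] wspan_all[OF add(2)] wspan_closed[OF L z]
    by (simp add: Y.l_distr)
qed

lemmas vspan_all = wspan_grade[OF X.graded_ideal_grade] wspan_closed[OF X.graded_ideal_grade]

lemma endo_unique:
  assumes f: "f \<in> ghom K Y Y" "\<And>a. a \<in> carrier X \<Longrightarrow> f (h a) = h a" "\<And>x. x \<in> S \<Longrightarrow> f x = x"
    and y: "y \<in> carrier Y"
  shows "f y = y"
proof -
  have "\<exists>\<psi>\<in>graded_hom K Y Y. (\<forall>a\<in>carrier X. \<psi> (h a) = h a) \<and> (\<forall>x\<in>S. \<psi> x = x) \<and>
        (\<forall>\<psi>'\<in>graded_hom K Y Y. (\<forall>a\<in>carrier X. \<psi>' (h a) = h a) \<and> (\<forall>x\<in>S. \<psi>' x = x) \<longrightarrow>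
          (\<forall>y\<in>carrier Y. \<psi>' y = \<psi> y))"
    by (rule poly[unfolded polynomial_extension_def, THEN conjunct2, THEN conjunct2, THEN spec[of _ Y],
        THEN spec[of _ h], THEN spec[of _ "\<lambda>x. x"], THEN mp])
      (use Y.graded_comm_algebra_axioms h var_grade in \<open>simp add: graded_hom_eq_ghom\<close>)
  then obtain \<chi> where \<chi>: "\<forall>\<psi>'\<in>ghom K Y Y. (\<forall>a\<in>carrier X. \<psi>' (h a) = h a) \<and> (\<forall>x\<in>S. \<psi>' x = x) \<longrightarrow>
          (\<forall>y\<in>carrier Y. \<psi>' y = \<chi> y)"
    unfolding graded_hom_eq_ghom by (elim bexE conjE) (rule that)
  have "f y = \<chi> y" using \<chi> f y by simp
  moreover have "y = \<chi> y" using bspec[OF \<chi> Y.id_ghom] y by simp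
  ultimately show ?thesis by simp
qed

text \<open>The subalgebra generated by the coefficients and the variables satisfies the universal
  property, so that it is everything.\<close>

lemma grade_eq_vspan: "y \<in> grade Y i \<longleftrightarrow> vspan (grade X) i y"
proof
  let ?W = "additive_span Y (\<Union>i. {y. vspan (grade X) i y})"
  note gi = X.graded_ideal_grade
  have cl: "y \<in> carrier Y" if "y \<in> ?W" for y using that
    by induction (use vspan_all in auto)
  interpret I: subquotient K Y ?W "{\<zero>\<^bsub>Y\<^esub>}" "\<lambda>x. x"
  proof
    show "\<one>\<^bsub>Y\<^esub> \<in> ?W"
      using var_span.base[of "\<one>\<^bsub>X\<^esub>" "grade X" 0 Y h S deg "\<lambda>_. 0" 0] X.one_grade h_simps(4)
      by (auto intro!: additive_span.base)
  next
    fix x y assume x: "x \<in> ?W" and y: "y \<in> ?W"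
    show "x \<otimes>\<^bsub>Y\<^esub> y \<in> ?W" using x
    proof induction
      case (base x)
      then obtain i where i: "vspan (grade X) i x" by blast
      show ?case using y
      proof induction
        case (base y)
        then obtain j where j: "vspan (grade X) j y" by blast
        show ?case using wspan_mult[OF gi j i] by (auto intro!: additive_span.base)
      next
        case (add y z)
        then show ?case using additive_span.add[OF add(3,4)] cl vspan_all i by (simp add: Y.r_distr)
      qed (use vspan_all i additive_span.zero[of Y] in auto)
    next
      case (add x z)
      then show ?case using additive_span.add[OF add(3,4)] cl y by (simp add: Y.l_distr)
    qed (use cl[OF y] additive_span.zero[of Y] in auto)
    show "x \<oplus>\<^bsub>Y\<^esub> y \<in> ?W" by (rule additive_span.add[OF x y])
    show "x = y \<longleftrightarrow> x \<ominus>\<^bsub>Y\<^esub> y \<in> {\<zero>\<^bsub>Y\<^esub>}" using cl x y by (simp add: Y.minus_eq_zero_iff)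
  next
    fix k x assume k: "k \<in> carrier K" and x: "x \<in> ?W"
    show "k \<odot>\<^bsub>Y\<^esub> x \<in> ?W" using x
    proof induction
      case (base x)
      then obtain i where "vspan (grade X) i x" by blast
      from wspan_smult[OF gi this k] show ?case by (auto intro!: additive_span.base)
    next
      case (add x y)
      then show ?case using additive_span.add[OF add(3,4)] cl k by (simp add: Y.smult_r_distr)
    qed (use k additive_span.zero[of Y] in auto)
  next
    fix x j assume x: "x \<in> ?W"
    show "hcomp Y j x \<in> ?W" using x
    proof induction
      case (base x)
      then obtain i where i: "vspan (grade X) i x" by blast
      then have "hcomp Y j x = (if j = i then x else \<zero>\<^bsub>Y\<^esub>)" by (intro Y.hcomp_homogeneous vspan_all)
      then show ?case using i additive_span.zero[of Y] by (auto intro!: additive_span.base)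
    next
      case (add x y)
      then show ?case using additive_span.add[OF add(3,4)] cl by (simp add: Y.hcomp_add)
    qed (use additive_span.zero[of Y] in auto)
  qed (use cl additive_span.zero[of Y] in auto)
  have hW: "h a \<in> ?W" if "a \<in> carrier X" for a using that
  proof (induction rule: X.graded_induct)
    case (hom i x)
    then show ?case by (auto intro!: additive_span.base var_span.base)
  qed (auto simp: h_simps intro: additive_span.intros)
  have SW: "x \<in> ?W" if x: "x \<in> S" for x
  proof -
    have "wspan (\<lambda>_. 0) (grade X) (deg x + 0) (0 + 0) (x \<otimes>\<^bsub>Y\<^esub> h \<one>\<^bsub>X\<^esub>)"
      by (rule var_span.var[where \<omega> = "\<lambda>_. 0"]) (intro var_span.intros x X.one_grade)+
    then show ?thesis using var_closed[OF x] by (auto simp: h_simps intro!: additive_span.base)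
  qed
  have h': "h \<in> ghom K X I.Q"
    by (rule I.c_ghom[OF h]) (use hW X.grade_closed in auto)
  have v': "x \<in> grade I.Q (deg x)" if "x \<in> S" for x
    using SW[OF that] var_grade[OF that] by simp
  obtain \<psi> where \<psi>: "\<psi> \<in> ghom K Y I.Q" "\<And>a. a \<in> carrier X \<Longrightarrow> \<psi> (h a) = h a" "\<And>x. x \<in> S \<Longrightarrow> \<psi> x = x"
    by (rule universal_same_type[OF I.graded_comm_algebra_Q h' v'], assumption) (rule that)
  have \<psi>': "\<psi> \<in> ghom K Y Y"
  proof -
    have "(\<lambda>x. x) \<in> ghom K I.Q Y" by (rule ghomI) (auto simp: I.Q_simps[simplified] cl)
    from ghom_comp[OF \<psi>(1) this] show ?thesis by simp
  qed
  assume y: "y \<in> grade Y i"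
  have "\<psi> y = y" by (rule endo_unique[OF \<psi>' \<psi>(2,3) Y.grade_closed[OF y]])
  then have yW: "y \<in> ?W" using ghom_closed[OF \<psi>(1) Y.grade_closed[OF y]] by simp
  have "vspan (grade X) i (hcomp Y i y)" using yW
  proof induction
    case (base x)
    then obtain j where j: "vspan (grade X) j x" by blast
    then have "hcomp Y i x = (if i = j then x else \<zero>\<^bsub>Y\<^esub>)" by (intro Y.hcomp_homogeneous vspan_all)
    then show ?case using j var_span.zero by auto
  next
    case (add x y)
    then show ?case using var_span.add[OF add(3,4)] cl by (simp add: Y.hcomp_add)
  qed (simp add: var_span.zero)
  then show "vspan (grade X) i y" using Y.hcomp_homogeneous[OF y] by simp
qed (rule vspan_all)

text \<open>Since all degrees are nonpositive, a monomial of degree \<open>i\<close> only involves variables of degree at least \<open>i\<close>.\<close>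

lemma grade_induct_above [consumes 2, case_names zero base var add]:
  assumes "y \<in> grade Y i" "n \<le> i"
    and "\<And>i. P i \<zero>\<^bsub>Y\<^esub>" "\<And>i c. c \<in> grade X i \<Longrightarrow> P i (h c)"
    and "\<And>i x y. \<lbrakk>x \<in> S; n \<le> deg x; n \<le> i; y \<in> grade Y i; P i y\<rbrakk> \<Longrightarrow> P (deg x + i) (x \<otimes>\<^bsub>Y\<^esub> y)"
    and "\<And>i y z. \<lbrakk>y \<in> grade Y i; z \<in> grade Y i; P i y; P i z\<rbrakk> \<Longrightarrow> P i (y \<oplus>\<^bsub>Y\<^esub> z)"
  shows "P i y"
proof -
  have "wspan (\<lambda>_. 0) (grade X) i m y \<Longrightarrow> y \<in> grade Y i \<and> (n \<le> i \<longrightarrow> P i y)" for m i y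
  proof (induction rule: var_span.induct)
    case (var x i m y)
    have "P (deg x + i) (x \<otimes>\<^bsub>Y\<^esub> y)" if n: "n \<le> deg x + i"
    proof (cases "i > 0")
      case True
      then have "y = \<zero>\<^bsub>Y\<^esub>" using var Y.nonpositive by blast
      then show ?thesis using assms(3) var_closed[OF var(1)] by simp
    next
      case False
      then show ?thesis using assms(5)[OF var(1)] var n deg_nonpos[OF var(1)] by simp
    qed
    then show ?case using var Y.mult_grade var_grade by blast
  next
    case (base l i m)
    then show ?case using assms(4) ghom_grade[OF h] by blast
  qed (use assms(3,6) Y.grade_add in auto)
  then show ?thesis using assms(1,2) grade_eq_vspan by blast
qed

lemma grade_induct [consumes 1, case_names zero base var add]:
  assumes "y \<in> grade Y i"
    and "\<And>i. P i \<zero>\<^bsub>Y\<^esub>" "\<And>i c. c \<in> grade X i \<Longrightarrow> P i (h c)"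
    and "\<And>i x y. \<lbrakk>x \<in> S; y \<in> grade Y i; P i y\<rbrakk> \<Longrightarrow> P (deg x + i) (x \<otimes>\<^bsub>Y\<^esub> y)"
    and "\<And>i y z. \<lbrakk>y \<in> grade Y i; z \<in> grade Y i; P i y; P i z\<rbrakk> \<Longrightarrow> P i (y \<oplus>\<^bsub>Y\<^esub> z)"
  shows "P i y"
  using assms(1) order_refl[of i]
  by (induction rule: grade_induct_above) (use assms(2-5) in auto)

lemma hom_eq_above:
  assumes W: "graded_comm_algebra K W" and f: "f \<in> ghom K Y W" and g: "g \<in> ghom K Y W"
    and "\<And>a. a \<in> carrier X \<Longrightarrow> f (h a) = g (h a)" "\<And>x. \<lbrakk>x \<in> S; n \<le> deg x\<rbrakk> \<Longrightarrow> f x = g x"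
    and "y \<in> grade Y i" "n \<le> i"
  shows "f y = g y"
  using assms(6,7)
proof (induction rule: grade_induct_above)
  case (zero i)
  interpret W: graded_comm_algebra K W by fact
  show ?case using ghom_zero[OF f Y.ring_axioms W.ring_axioms] ghom_zero[OF g Y.ring_axioms W.ring_axioms] by simp
qed (use assms(4,5) X.grade_closed Y.grade_closed var_closed ghom_mult[OF f] ghom_mult[OF g]
   ghom_add[OF f] ghom_add[OF g] in auto)

end

section \<open>Derivations of a polynomial extension\<close>

text \<open>
  Dual numbers over an algebra of the universe can be copied into the universe.
\<close>

lemma infinite_pair_injection:
  includes cardinal_syntax
  assumes "infinite (UNIV :: 'u set)"
  obtains c :: "'u \<times> 'u \<Rightarrow> 'u" where "inj c"
proof -
  have "|UNIV \<times> UNIV :: ('u \<times> 'u) set| =o |UNIV :: 'u set|"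
    by (rule card_of_Times_same_infinite) (rule assms)
  then have "|UNIV \<times> UNIV :: ('u \<times> 'u) set| \<le>o |UNIV :: 'u set|" by (rule ordIso_imp_ordLeq)
  then have "\<exists>c. inj_on c (UNIV \<times> UNIV :: ('u \<times> 'u) set) \<and> c ` (UNIV \<times> UNIV) \<subseteq> (UNIV :: 'u set)"
    unfolding card_of_ordLeq .
  then obtain c :: "'u \<times> 'u \<Rightarrow> 'u" where "inj_on c (UNIV \<times> UNIV)" by blast
  then show thesis using that by simp
qed

definition derivation :: "('k, 'm) ring_scheme \<Rightarrow> ('k, 'u, 'z) dga_scheme \<Rightarrow> int \<Rightarrow> ('u \<Rightarrow> 'u) \<Rightarrow> bool" where
  "derivation K A m D \<longleftrightarrow> (\<forall>i. \<forall>x\<in>grade A i. D x \<in> grade A (i + m)) \<and>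
    (\<forall>x\<in>carrier A. D x \<in> carrier A) \<and>
    (\<forall>x\<in>carrier A. \<forall>y\<in>carrier A. D (x \<oplus>\<^bsub>A\<^esub> y) = D x \<oplus>\<^bsub>A\<^esub> D y) \<and>
    (\<forall>k\<in>carrier K. \<forall>x\<in>carrier A. D (k \<odot>\<^bsub>A\<^esub> x) = k \<odot>\<^bsub>A\<^esub> D x) \<and>
    (\<forall>i. \<forall>x\<in>grade A i. \<forall>y\<in>carrier A. D (x \<otimes>\<^bsub>A\<^esub> y) = (D x \<otimes>\<^bsub>A\<^esub> y) \<oplus>\<^bsub>A\<^esub> signed A (m * i) (x \<otimes>\<^bsub>A\<^esub> D y))"

lemma
  assumes "derivation K A m D"
  shows derivation_closed: "x \<in> carrier A \<Longrightarrow> D x \<in> carrier A"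
    and derivation_add: "x \<in> carrier A \<Longrightarrow> y \<in> carrier A \<Longrightarrow> D (x \<oplus>\<^bsub>A\<^esub> y) = D x \<oplus>\<^bsub>A\<^esub> D y"
    and derivation_smult: "k \<in> carrier K \<Longrightarrow> x \<in> carrier A \<Longrightarrow> D (k \<odot>\<^bsub>A\<^esub> x) = k \<odot>\<^bsub>A\<^esub> D x"
    and derivation_mult: "x \<in> grade A i \<Longrightarrow> y \<in> carrier A
      \<Longrightarrow> D (x \<otimes>\<^bsub>A\<^esub> y) = (D x \<otimes>\<^bsub>A\<^esub> y) \<oplus>\<^bsub>A\<^esub> signed A (m * i) (x \<otimes>\<^bsub>A\<^esub> D y)"
  using assms unfolding derivation_def by blast+

lemma (in graded_comm_algebra)
  assumes D: "derivation K A m D"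
  shows derivation_zero: "D \<zero>\<^bsub>A\<^esub> = \<zero>\<^bsub>A\<^esub>"
    and derivation_neg: "x \<in> carrier A \<Longrightarrow> D (\<ominus>\<^bsub>A\<^esub> x) = \<ominus>\<^bsub>A\<^esub> D x"
    and derivation_minus: "x \<in> carrier A \<Longrightarrow> y \<in> carrier A \<Longrightarrow> D (x \<ominus>\<^bsub>A\<^esub> y) = D x \<ominus>\<^bsub>A\<^esub> D y"
    and derivation_signed: "x \<in> carrier A \<Longrightarrow> D (signed A j x) = signed A j (D x)"
proof -
  show z: "D \<zero>\<^bsub>A\<^esub> = \<zero>\<^bsub>A\<^esub>"
    using derivation_smult[OF D, of "\<zero>\<^bsub>K\<^esub>" "\<zero>\<^bsub>A\<^esub>"] derivation_closed[OF D] by simp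
  show n: "D (\<ominus>\<^bsub>A\<^esub> x) = \<ominus>\<^bsub>A\<^esub> D x" if "x \<in> carrier A" for x
    using derivation_add[OF D, of "\<ominus>\<^bsub>A\<^esub> x" x] derivation_closed[OF D] that z
    by (intro minus_equality[symmetric]) (auto simp: l_neg)
  show "D (x \<ominus>\<^bsub>A\<^esub> y) = D x \<ominus>\<^bsub>A\<^esub> D y" if "x \<in> carrier A" "y \<in> carrier A" for x y
    using that by (simp add: a_minus_def derivation_add[OF D] n)
  show "D (signed A j x) = signed A j (D x)" if "x \<in> carrier A" for x
    using that by (simp add: signed_def n)
qed

context semifree
begin

text \<open>
  A derivation \<open>D\<close> corresponds to the algebra morphism \<open>y \<mapsto> y + \<epsilon> (D y)\<close> to the dual numbers over \<open>Y\<close>, and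
  the universal property allows one to prescribe such a morphism on coefficients and variables. That its
  first component is the identity is the uniqueness part of the universal property.
\<close>

lemma derivation_extension:
  assumes D0g: "\<And>i c. c \<in> grade X i \<Longrightarrow> D0 c \<in> grade Y (i + m)"
    and D0a: "\<And>c c'. \<lbrakk>c \<in> carrier X; c' \<in> carrier X\<rbrakk> \<Longrightarrow> D0 (c \<oplus>\<^bsub>X\<^esub> c') = D0 c \<oplus>\<^bsub>Y\<^esub> D0 c'"
    and D0s: "\<And>k c. \<lbrakk>k \<in> carrier K; c \<in> carrier X\<rbrakk> \<Longrightarrow> D0 (k \<odot>\<^bsub>X\<^esub> c) = k \<odot>\<^bsub>Y\<^esub> D0 c"
    and D0l: "\<And>i c c'. \<lbrakk>c \<in> grade X i; c' \<in> carrier X\<rbrakk>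
      \<Longrightarrow> D0 (c \<otimes>\<^bsub>X\<^esub> c') = (D0 c \<otimes>\<^bsub>Y\<^esub> h c') \<oplus>\<^bsub>Y\<^esub> signed Y (m * i) (h c \<otimes>\<^bsub>Y\<^esub> D0 c')"
    and v: "\<And>x. x \<in> S \<Longrightarrow> v x \<in> grade Y (deg x + m)"
  obtains D where "derivation K Y m D" "\<And>c. c \<in> carrier X \<Longrightarrow> D (h c) = D0 c" "\<And>x. x \<in> S \<Longrightarrow> D x = v x"
proof -
  let ?W = "eps_ext Y m"
  interpret W: graded_comm_algebra K ?W by (rule Y.eps_ext_graded_comm_algebra)
  have D0z: "D0 \<zero>\<^bsub>X\<^esub> = \<zero>\<^bsub>Y\<^esub>"
    using D0s[of "\<zero>\<^bsub>K\<^esub>" "\<zero>\<^bsub>X\<^esub>"] Y.grade_closed[OF D0g[OF X.grade_zero]] by simp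
  have D0c: "D0 c \<in> carrier Y" if "c \<in> carrier X" for c
    using that by (induction rule: X.graded_induct) (auto simp: D0z D0a dest: Y.grade_closed[OF D0g])
  have D0m: "D0 (c \<otimes>\<^bsub>X\<^esub> c') = (D0 c \<otimes>\<^bsub>Y\<^esub> h c') \<oplus>\<^bsub>Y\<^esub> (twist Y m (h c) \<otimes>\<^bsub>Y\<^esub> D0 c')"
    if "c \<in> carrier X" "c' \<in> carrier X" for c c'
    using that(1)
  proof (induction rule: X.graded_induct)
    case zero
    then show ?case using that D0z D0c by (simp add: h_simps)
  next
    case (hom i c)
    then show ?case using D0l[OF hom that(2)] D0c that X.grade_closed[OF hom]
      by (simp add: Y.twist_homogeneous[OF ghom_grade[OF h hom]] Y.signed_mult_left h_simps)
  next
    case (add c d)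
    then show ?case using D0c that
      by (simp add: D0a X.l_distr Y.l_distr Y.twist_add h_simps Y.a_ac)
  qed
  have "D0 \<one>\<^bsub>X\<^esub> = D0 \<one>\<^bsub>X\<^esub> \<oplus>\<^bsub>Y\<^esub> D0 \<one>\<^bsub>X\<^esub>"
    using D0m[of "\<one>\<^bsub>X\<^esub>" "\<one>\<^bsub>X\<^esub>"] D0c by (simp add: h_simps)
  then have D01: "D0 \<one>\<^bsub>X\<^esub> = \<zero>\<^bsub>Y\<^esub>" using D0c[of "\<one>\<^bsub>X\<^esub>"] by simp
  have \<phi>: "(\<lambda>c. (h c, D0 c)) \<in> ghom K X ?W"
    by (rule ghomI) (auto simp: h_simps D0c D0m D0a D01 D0s D0g intro: ghom_grade[OF h])
  have v': "(x, v x) \<in> grade ?W (deg x)" if "x \<in> S" for x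
    using that by (simp add: var_grade v)
  obtain code :: "'u \<times> 'u \<Rightarrow> 'u" where code: "inj code" by (rule infinite_pair_injection[OF inf])
  obtain \<psi> where \<psi>: "\<psi> \<in> ghom K Y ?W" "\<And>a. a \<in> carrier X \<Longrightarrow> \<psi> (h a) = (h a, D0 a)"
    "\<And>x. x \<in> S \<Longrightarrow> \<psi> x = (x, v x)"
    by (rule universal[OF W.graded_comm_algebra_axioms inj_on_subset[OF code subset_UNIV] \<phi> v'], assumption)
      (rule that)
  have "(\<lambda>w. fst w) \<in> ghom K ?W Y" by (rule ghomI) auto
  from ghom_comp[OF \<psi>(1) this] have f: "(\<lambda>y. fst (\<psi> y)) \<in> ghom K Y Y" .
  have fst: "fst (\<psi> y) = y" if "y \<in> carrier Y" for y
    by (rule endo_unique[OF f _ _ that]) (simp_all add: \<psi>)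
  show thesis
  proof (rule that[of "\<lambda>y. snd (\<psi> y)"])
    have "snd (\<psi> x) \<in> grade Y (i + m)" if "x \<in> grade Y i" for x i
      using ghom_grade[OF \<psi>(1) that] by auto
    moreover have "snd (\<psi> x) \<in> carrier Y" if "x \<in> carrier Y" for x
      using ghom_closed[OF \<psi>(1) that] by auto
    ultimately show "derivation K Y m (\<lambda>y. snd (\<psi> y))"
      using Y.grade_closed
      by (auto simp: derivation_def ghom_add[OF \<psi>(1)] ghom_smult[OF \<psi>(1)] ghom_mult[OF \<psi>(1)] fst
        Y.twist_homogeneous Y.signed_mult_left)
  qed (simp_all add: \<psi>)
qed

lemma coefficient_linear_derivation:
  assumes v: "\<And>x. x \<in> S \<Longrightarrow> v x \<in> grade Y (deg x + m)"
  obtains D where "derivation K Y m D" "\<And>c. c \<in> carrier X \<Longrightarrow> D (h c) = \<zero>\<^bsub>Y\<^esub>" "\<And>x. x \<in> S \<Longrightarrow> D x = v x"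
  by (rule derivation_extension[of "\<lambda>_. \<zero>\<^bsub>Y\<^esub>" m v]) (use v that in \<open>auto simp: h_simps dest: X.grade_closed\<close>)

text \<open>
  The leading part of the differential of \<open>Y\<close> for the filtration by the total degree of the variables.
\<close>

definition d0 :: "'u \<Rightarrow> 'u" where
  "d0 = (SOME D. derivation K Y 1 D \<and> (\<forall>c\<in>carrier X. D (h c) = h (differential X c)) \<and> (\<forall>x\<in>S. D x = \<zero>\<^bsub>Y\<^esub>))"

lemma d0: "derivation K Y 1 d0" "c \<in> carrier X \<Longrightarrow> d0 (h c) = h (differential X c)" "x \<in> S \<Longrightarrow> d0 x = \<zero>\<^bsub>Y\<^esub>"
proof -
  obtain D where "derivation K Y 1 D" "\<And>c. c \<in> carrier X \<Longrightarrow> D (h c) = h (differential X c)" "\<And>x. x \<in> S \<Longrightarrow> D x = \<zero>\<^bsub>Y\<^esub>"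
  proof (rule derivation_extension[of "\<lambda>c. h (differential X c)" 1 "\<lambda>_. \<zero>\<^bsub>Y\<^esub>"])
    fix i c c' assume "c \<in> grade X i" "c' \<in> carrier X"
    then show "h (differential X (c \<otimes>\<^bsub>X\<^esub> c'))
      = (h (differential X c) \<otimes>\<^bsub>Y\<^esub> h c') \<oplus>\<^bsub>Y\<^esub> signed Y (1 * i) (h c \<otimes>\<^bsub>Y\<^esub> h (differential X c'))"
      using X.grade_closed[of c i] X.d_closed[of c] X.d_closed[of c']
      by (simp add: X.d_leibniz h_simps(1-4,6-8))
  qed (auto simp: X.d_add X.d_smult X.d_closed h_simps(1-8) intro: ghom_grade[OF h] X.d_grade)
  then have "\<exists>D. derivation K Y 1 D \<and> (\<forall>c\<in>carrier X. D (h c) = h (differential X c)) \<and> (\<forall>x\<in>S. D x = \<zero>\<^bsub>Y\<^esub>)"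
    by blast
  from someI_ex[OF this] show "derivation K Y 1 d0" "c \<in> carrier X \<Longrightarrow> d0 (h c) = h (differential X c)" "x \<in> S \<Longrightarrow> d0 x = \<zero>\<^bsub>Y\<^esub>"
    unfolding d0_def by auto
qed

definition partial :: "'u \<Rightarrow> 'u \<Rightarrow> 'u" where
  "partial x = (SOME D. derivation K Y (- deg x) D \<and> (\<forall>c\<in>carrier X. D (h c) = \<zero>\<^bsub>Y\<^esub>) \<and>
    (\<forall>z\<in>S. D z = (if z = x then \<one>\<^bsub>Y\<^esub> else \<zero>\<^bsub>Y\<^esub>)))"

lemma partial:
  assumes "x \<in> S"
  shows "derivation K Y (- deg x) (partial x)" "c \<in> carrier X \<Longrightarrow> partial x (h c) = \<zero>\<^bsub>Y\<^esub>"
    "z \<in> S \<Longrightarrow> partial x z = (if z = x then \<one>\<^bsub>Y\<^esub> else \<zero>\<^bsub>Y\<^esub>)"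
proof -
  obtain D where "derivation K Y (- deg x) D" "\<And>c. c \<in> carrier X \<Longrightarrow> D (h c) = \<zero>\<^bsub>Y\<^esub>"
    "\<And>z. z \<in> S \<Longrightarrow> D z = (if z = x then \<one>\<^bsub>Y\<^esub> else \<zero>\<^bsub>Y\<^esub>)"
    by (rule coefficient_linear_derivation[of "\<lambda>z. if z = x then \<one>\<^bsub>Y\<^esub> else \<zero>\<^bsub>Y\<^esub>" "- deg x"])
      (auto simp: Y.one_grade)
  then have "\<exists>D. derivation K Y (- deg x) D \<and> (\<forall>c\<in>carrier X. D (h c) = \<zero>\<^bsub>Y\<^esub>) \<and>
    (\<forall>z\<in>S. D z = (if z = x then \<one>\<^bsub>Y\<^esub> else \<zero>\<^bsub>Y\<^esub>))" by blast
  from someI_ex[OF this] show "derivation K Y (- deg x) (partial x)" "c \<in> carrier X \<Longrightarrow> partial x (h c) = \<zero>\<^bsub>Y\<^esub>"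
    "z \<in> S \<Longrightarrow> partial x z = (if z = x then \<one>\<^bsub>Y\<^esub> else \<zero>\<^bsub>Y\<^esub>)"
    unfolding partial_def by auto
qed

definition nat_K :: "nat \<Rightarrow> 'k" where "nat_K n = [n] \<cdot>\<^bsub>K\<^esub> \<one>\<^bsub>K\<^esub>"

lemma nat_K_closed [simp]: "nat_K n \<in> carrier K"
  by (simp add: nat_K_def)

lemma nat_K_0 [simp]: "nat_K 0 = \<zero>\<^bsub>K\<^esub>" by (simp add: nat_K_def)

lemma nat_K_1 [simp]: "nat_K (Suc 0) = \<one>\<^bsub>K\<^esub>" by (simp add: nat_K_def)

lemma nat_K_add: "nat_K (a + b) = nat_K a \<oplus>\<^bsub>K\<^esub> nat_K b"
  by (simp add: nat_K_def X.R.add.nat_pow_mult)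

text \<open>
  The Euler derivation: a monomial of weight \<open>w\<close> is an eigenvector with eigenvalue \<open>w\<close>.
\<close>

definition euler :: "('u \<Rightarrow> nat) \<Rightarrow> 'u \<Rightarrow> 'u" where
  "euler \<omega> = (SOME D. derivation K Y 0 D \<and> (\<forall>c\<in>carrier X. D (h c) = \<zero>\<^bsub>Y\<^esub>) \<and>
    (\<forall>x\<in>S. D x = nat_K (\<omega> x) \<odot>\<^bsub>Y\<^esub> x))"

lemma euler:
  shows "derivation K Y 0 (euler \<omega>)" "c \<in> carrier X \<Longrightarrow> euler \<omega> (h c) = \<zero>\<^bsub>Y\<^esub>"
    "x \<in> S \<Longrightarrow> euler \<omega> x = nat_K (\<omega> x) \<odot>\<^bsub>Y\<^esub> x"
proof -
  obtain D where "derivation K Y 0 D" "\<And>c. c \<in> carrier X \<Longrightarrow> D (h c) = \<zero>\<^bsub>Y\<^esub>"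
    "\<And>x. x \<in> S \<Longrightarrow> D x = nat_K (\<omega> x) \<odot>\<^bsub>Y\<^esub> x"
    by (rule coefficient_linear_derivation[of "\<lambda>x. nat_K (\<omega> x) \<odot>\<^bsub>Y\<^esub> x" 0])
      (auto intro: Y.grade_smult var_grade)
  then have "\<exists>D. derivation K Y 0 D \<and> (\<forall>c\<in>carrier X. D (h c) = \<zero>\<^bsub>Y\<^esub>) \<and>
    (\<forall>x\<in>S. D x = nat_K (\<omega> x) \<odot>\<^bsub>Y\<^esub> x)" by blast
  from someI_ex[OF this] show "derivation K Y 0 (euler \<omega>)" "c \<in> carrier X \<Longrightarrow> euler \<omega> (h c) = \<zero>\<^bsub>Y\<^esub>"
    "x \<in> S \<Longrightarrow> euler \<omega> x = nat_K (\<omega> x) \<odot>\<^bsub>Y\<^esub> x"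
    unfolding euler_def by auto
qed

end

section \<open>Acyclicity of extended ideals\<close>

lemma (in abelian_group) diff_add_diff:
  "\<lbrakk>a \<in> carrier G; b \<in> carrier G; c \<in> carrier G; e \<in> carrier G\<rbrakk>
    \<Longrightarrow> (a \<ominus> c) \<oplus> (b \<ominus> e) = (a \<oplus> b) \<ominus> (c \<oplus> e)"
  by (simp add: a_minus_def minus_add a_ac)

context semifree begin

lemma d0_var: "x \<in> S \<Longrightarrow> y \<in> carrier Y \<Longrightarrow> d0 (x \<otimes>\<^bsub>Y\<^esub> y) = signed Y (deg x) (x \<otimes>\<^bsub>Y\<^esub> d0 y)"
  using derivation_mult[OF d0(1) var_grade] derivation_closed[OF d0(1)] var_closed by (simp add: d0(3))

lemma euler_var:
  "x \<in> S \<Longrightarrow> y \<in> carrier Y \<Longrightarrow> euler \<omega> (x \<otimes>\<^bsub>Y\<^esub> y) = nat_K (\<omega> x) \<odot>\<^bsub>Y\<^esub> (x \<otimes>\<^bsub>Y\<^esub> y) \<oplus>\<^bsub>Y\<^esub> x \<otimes>\<^bsub>Y\<^esub> euler \<omega> y"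
  using derivation_mult[OF euler(1) var_grade] derivation_closed[OF euler(1)] var_closed
  by (simp add: euler(3) Y.smult_mult_left)

lemma partial_var:
  assumes "x \<in> S" "z \<in> S" "y \<in> carrier Y"
  shows "partial x (z \<otimes>\<^bsub>Y\<^esub> y) = (if z = x then y else \<zero>\<^bsub>Y\<^esub>) \<oplus>\<^bsub>Y\<^esub> signed Y (deg x * deg z) (z \<otimes>\<^bsub>Y\<^esub> partial x y)"
  using derivation_mult[OF partial(1)[OF assms(1)] var_grade[OF assms(2)] assms(3)] partial(3)[OF assms(1,2)]
    signed_cong[of "- deg x * deg z" "deg x * deg z" Y] assms(3) by simp

lemmas d0_simps = derivation_closed[OF d0(1)] derivation_add[OF d0(1)] derivation_smult[OF d0(1)]
  Y.derivation_zero[OF d0(1)] Y.derivation_neg[OF d0(1)] Y.derivation_minus[OF d0(1)] Y.derivation_signed[OF d0(1)] d0_var d0(2)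

lemmas euler_simps = derivation_closed[OF euler(1)] derivation_add[OF euler(1)] derivation_smult[OF euler(1)]
  Y.derivation_zero[OF euler(1)] Y.derivation_neg[OF euler(1)] Y.derivation_minus[OF euler(1)] Y.derivation_signed[OF euler(1)] euler_var euler(2)

text \<open>
  The graded commutator of the two derivations vanishes on coefficients and on variables.
\<close>

lemma partial_d0:
  assumes x: "x \<in> S" and y: "y \<in> grade Y i"
  shows "d0 (partial x y) = signed Y (deg x) (partial x (d0 y))"
  using y
proof (induction rule: grade_induct)
  case (zero i)
  then show ?case by (simp add: Y.derivation_zero[OF partial(1)[OF x]] d0_simps)
next
  case (base i c)
  then show ?case using X.grade_closed[OF base] X.d_closed by (simp add: partial[OF x] d0_simps)
next
  case (var i z y)
  note cl = var_closed[OF var(1)] Y.grade_closed[OF var(2)]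
    derivation_closed[OF partial(1)[OF x]] derivation_closed[OF d0(1)]
  let ?\<delta> = "\<lambda>y. if z = x then y else \<zero>\<^bsub>Y\<^esub>"
  have "d0 (partial x (z \<otimes>\<^bsub>Y\<^esub> y))
    = d0 (?\<delta> y) \<oplus>\<^bsub>Y\<^esub> signed Y (deg x * deg z) (signed Y (deg z) (z \<otimes>\<^bsub>Y\<^esub> signed Y (deg x) (partial x (d0 y))))"
    using cl var by (simp only: partial_var x d0_simps Y.signed_closed Y.zero_closed Y.m_closed split: if_split) simp
  also have "\<dots> = d0 (?\<delta> y) \<oplus>\<^bsub>Y\<^esub> signed Y (deg x + deg z + deg x * deg z) (z \<otimes>\<^bsub>Y\<^esub> partial x (d0 y))"
    using cl by (simp add: Y.signed_mult_right Y.signed_signed ac_simps)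
  also have "d0 (?\<delta> y) = signed Y (deg x + deg z) (?\<delta> (d0 y))"
    using cl by (simp add: d0_simps)
  also have "signed Y (deg x + deg z) (?\<delta> (d0 y))
      \<oplus>\<^bsub>Y\<^esub> signed Y (deg x + deg z + deg x * deg z) (z \<otimes>\<^bsub>Y\<^esub> partial x (d0 y))
    = signed Y (deg x) (signed Y (deg z) (?\<delta> (d0 y) \<oplus>\<^bsub>Y\<^esub> signed Y (deg x * deg z) (z \<otimes>\<^bsub>Y\<^esub> partial x (d0 y))))"
    using cl by (simp only: Y.signed_signed Y.signed_add Y.signed_closed Y.zero_closed Y.m_closed split: if_split)
      (simp add: ac_simps)
  also have "\<dots> = signed Y (deg x) (partial x (d0 (z \<otimes>\<^bsub>Y\<^esub> y)))"
    using cl var by (simp only: d0_simps Y.derivation_signed[OF partial(1)[OF x]] partial_var x Y.m_closed)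
  finally show ?case .
next
  case (add i y z)
  note cl = Y.grade_closed[OF add(1)] Y.grade_closed[OF add(2)]
    derivation_closed[OF partial(1)[OF x]] derivation_closed[OF d0(1)]
  show ?case using add cl by (simp add: derivation_add[OF partial(1)[OF x]] d0_simps Y.signed_add)
qed

text \<open>
  The sum runs over the variables that occur in \<open>y\<close>. The additional terms for a larger set \<open>F'\<close> vanish, and the
  claim includes them so that the sets for two summands can be merged.
\<close>

lemma euler_formula:
  assumes "y \<in> grade Y i"
  shows "\<exists>F. finite F \<and> F \<subseteq> S \<and> (\<forall>F'. finite F' \<and> F \<subseteq> F' \<and> F' \<subseteq> S \<longrightarrow>
    euler (\<lambda>_. 1) y = (\<Oplus>\<^bsub>Y\<^esub>x\<in>F'. x \<otimes>\<^bsub>Y\<^esub> partial x y))"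
  using assms
proof (induction rule: grade_induct)
  case (zero i)
  have "(\<Oplus>\<^bsub>Y\<^esub>x\<in>F'. x \<otimes>\<^bsub>Y\<^esub> partial x \<zero>\<^bsub>Y\<^esub>) = (\<Oplus>\<^bsub>Y\<^esub>x\<in>F'. \<zero>\<^bsub>Y\<^esub>)" if "F' \<subseteq> S" for F'
    by (rule Y.finsum_cong') (use that var_closed in \<open>auto simp: Y.derivation_zero[OF partial(1)]\<close>)
  then show ?case by (intro exI[of _ "{}"]) (simp add: euler_simps)
next
  case (base i c)
  have "(\<Oplus>\<^bsub>Y\<^esub>x\<in>F'. x \<otimes>\<^bsub>Y\<^esub> partial x (h c)) = (\<Oplus>\<^bsub>Y\<^esub>x\<in>F'. \<zero>\<^bsub>Y\<^esub>)" if "F' \<subseteq> S" for F'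
    by (rule Y.finsum_cong') (use that var_closed X.grade_closed[OF base] partial(2) in auto)
  then show ?case using X.grade_closed[OF base] by (intro exI[of _ "{}"]) (simp add: euler_simps)
next
  case (var i z y)
  obtain F where F: "finite F" "F \<subseteq> S" "\<forall>F'. finite F' \<and> F \<subseteq> F' \<and> F' \<subseteq> S \<longrightarrow>
    euler (\<lambda>_. 1) y = (\<Oplus>\<^bsub>Y\<^esub>x\<in>F'. x \<otimes>\<^bsub>Y\<^esub> partial x y)" using var(3) by blast
  note cl = var_closed[OF var(1)] Y.grade_closed[OF var(2)]
  show ?case
  proof (intro exI[of _ "insert z F"] conjI allI impI)
    fix F' assume F': "finite F' \<and> insert z F \<subseteq> F' \<and> F' \<subseteq> S"
    have e: "x \<otimes>\<^bsub>Y\<^esub> partial x (z \<otimes>\<^bsub>Y\<^esub> y) = (if x = z then z \<otimes>\<^bsub>Y\<^esub> y else \<zero>\<^bsub>Y\<^esub>) \<oplus>\<^bsub>Y\<^esub> z \<otimes>\<^bsub>Y\<^esub> (x \<otimes>\<^bsub>Y\<^esub> partial x y)"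
      if x: "x \<in> S" for x
    proof -
      note cl' = cl var_closed[OF x] derivation_closed[OF partial(1)[OF x] cl(2)]
      have "x \<otimes>\<^bsub>Y\<^esub> (z \<otimes>\<^bsub>Y\<^esub> partial x y) = signed Y (deg x * deg z) (z \<otimes>\<^bsub>Y\<^esub> (x \<otimes>\<^bsub>Y\<^esub> partial x y))"
        using Y.graded_comm[OF var_grade[OF x] var_grade[OF var(1)]] cl'
        by (simp add: Y.m_assoc[symmetric] Y.signed_mult_left)
      then show ?thesis using cl'
        by (simp add: partial_var x var(1) Y.r_distr Y.signed_mult_right Y.signed_signed)
    qed
    have pc: "x \<otimes>\<^bsub>Y\<^esub> partial x y \<in> carrier Y" if "x \<in> F'" for x
      using that F' var_closed derivation_closed[OF partial(1) cl(2)] by blast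
    have "(\<Oplus>\<^bsub>Y\<^esub>x\<in>F'. x \<otimes>\<^bsub>Y\<^esub> partial x (z \<otimes>\<^bsub>Y\<^esub> y))
      = (\<Oplus>\<^bsub>Y\<^esub>x\<in>F'. (if x = z then z \<otimes>\<^bsub>Y\<^esub> y else \<zero>\<^bsub>Y\<^esub>) \<oplus>\<^bsub>Y\<^esub> z \<otimes>\<^bsub>Y\<^esub> (x \<otimes>\<^bsub>Y\<^esub> partial x y))"
      by (rule Y.finsum_cong') (use F' e cl pc in auto)
    also have "\<dots> = (\<Oplus>\<^bsub>Y\<^esub>x\<in>F'. if x = z then z \<otimes>\<^bsub>Y\<^esub> y else \<zero>\<^bsub>Y\<^esub>) \<oplus>\<^bsub>Y\<^esub> (\<Oplus>\<^bsub>Y\<^esub>x\<in>F'. z \<otimes>\<^bsub>Y\<^esub> (x \<otimes>\<^bsub>Y\<^esub> partial x y))"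
      by (rule Y.finsum_addf) (use cl pc in auto)
    also have "(\<Oplus>\<^bsub>Y\<^esub>x\<in>F'. if x = z then z \<otimes>\<^bsub>Y\<^esub> y else \<zero>\<^bsub>Y\<^esub>) = z \<otimes>\<^bsub>Y\<^esub> y"
      using Y.finsum_singleton[of z F' "\<lambda>_. z \<otimes>\<^bsub>Y\<^esub> y"] F' cl by (simp add: eq_commute[of z])
    also have "(\<Oplus>\<^bsub>Y\<^esub>x\<in>F'. z \<otimes>\<^bsub>Y\<^esub> (x \<otimes>\<^bsub>Y\<^esub> partial x y)) = z \<otimes>\<^bsub>Y\<^esub> euler (\<lambda>_. 1) y"
      using Y.finsum_rdistr[of F' z "\<lambda>x. x \<otimes>\<^bsub>Y\<^esub> partial x y"] F(3)[rule_format, of F'] F' cl pc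
      by (simp add: Pi_def)
    finally show "euler (\<lambda>_. 1) (z \<otimes>\<^bsub>Y\<^esub> y) = (\<Oplus>\<^bsub>Y\<^esub>x\<in>F'. x \<otimes>\<^bsub>Y\<^esub> partial x (z \<otimes>\<^bsub>Y\<^esub> y))"
      using cl var(1) by (simp add: euler_simps Y.smult_one)
  qed (use F var(1) in auto)
next
  case (add i y z)
  obtain F where F: "finite F" "F \<subseteq> S" "\<forall>F'. finite F' \<and> F \<subseteq> F' \<and> F' \<subseteq> S \<longrightarrow>
    euler (\<lambda>_. 1) y = (\<Oplus>\<^bsub>Y\<^esub>x\<in>F'. x \<otimes>\<^bsub>Y\<^esub> partial x y)" using add(3) by blast
  obtain G where G: "finite G" "G \<subseteq> S" "\<forall>F'. finite F' \<and> G \<subseteq> F' \<and> F' \<subseteq> S \<longrightarrow>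
    euler (\<lambda>_. 1) z = (\<Oplus>\<^bsub>Y\<^esub>x\<in>F'. x \<otimes>\<^bsub>Y\<^esub> partial x z)" using add(4) by blast
  note cl = Y.grade_closed[OF add(1)] Y.grade_closed[OF add(2)]
  show ?case
  proof (intro exI[of _ "F \<union> G"] conjI allI impI)
    fix F' assume F': "finite F' \<and> F \<union> G \<subseteq> F' \<and> F' \<subseteq> S"
    have pc: "x \<in> carrier Y" "partial x y \<in> carrier Y" "partial x z \<in> carrier Y" if "x \<in> F'" for x
      using that F' var_closed derivation_closed[OF partial(1) cl(1)] derivation_closed[OF partial(1) cl(2)] by blast+
    have "(\<Oplus>\<^bsub>Y\<^esub>x\<in>F'. x \<otimes>\<^bsub>Y\<^esub> partial x (y \<oplus>\<^bsub>Y\<^esub> z))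
      = (\<Oplus>\<^bsub>Y\<^esub>x\<in>F'. x \<otimes>\<^bsub>Y\<^esub> partial x y \<oplus>\<^bsub>Y\<^esub> x \<otimes>\<^bsub>Y\<^esub> partial x z)"
      by (rule Y.finsum_cong') (use F' pc cl derivation_add[OF partial(1)] in \<open>auto simp: Y.r_distr subset_iff\<close>)
    also have "\<dots> = (\<Oplus>\<^bsub>Y\<^esub>x\<in>F'. x \<otimes>\<^bsub>Y\<^esub> partial x y) \<oplus>\<^bsub>Y\<^esub> (\<Oplus>\<^bsub>Y\<^esub>x\<in>F'. x \<otimes>\<^bsub>Y\<^esub> partial x z)"
      by (rule Y.finsum_addf) (use pc in auto)
    finally show "euler (\<lambda>_. 1) (y \<oplus>\<^bsub>Y\<^esub> z) = (\<Oplus>\<^bsub>Y\<^esub>x\<in>F'. x \<otimes>\<^bsub>Y\<^esub> partial x (y \<oplus>\<^bsub>Y\<^esub> z))"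
      using F(3)[rule_format, of F'] G(3)[rule_format, of F'] F' cl by (simp add: euler_simps)
  qed (use F G in auto)
qed

context
  fixes L assumes L: "graded_ideal X L"
begin

lemma d0_wspan:
  assumes "\<And>i l. l \<in> L i \<Longrightarrow> differential X l \<in> L (i + 1)"
  shows "wspan \<omega> L i n y \<Longrightarrow> wspan \<omega> L (i + 1) n (d0 y)"
proof (induction rule: var_span.induct)
  case (base l i n)
  then show ?case using var_span.base[of "differential X l" L "i+1" Y h S deg \<omega> n] assms[OF base] L_closed[OF L base]
    by (simp add: d0_simps)
next
  case (var x i n y)
  then show ?case using wspan_signed[OF L var_span.var[OF var(1) var(3)]] wspan_closed[OF L var(2)]
    by (simp add: d0_simps ac_simps)
next
  case (add i n y z)
  then show ?case using var_span.add[OF add(3,4)] wspan_closed[OF L] by (simp add: d0_simps)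
qed (simp add: d0_simps var_span.zero)

lemma euler_wspan: "wspan \<omega> L i n y \<Longrightarrow> wspan \<omega> L i n (euler \<omega>' y)"
proof (induction rule: var_span.induct)
  case (base l i n)
  then show ?case using L_closed[OF L base] by (simp add: euler_simps var_span.zero)
next
  case (var x i n y)
  have "wspan \<omega> L (deg x + i) (\<omega> x + n) (nat_K (\<omega>' x) \<odot>\<^bsub>Y\<^esub> (x \<otimes>\<^bsub>Y\<^esub> y))"
    by (intro wspan_smult[OF L] var_span.var var nat_K_closed)
  from var_span.add[OF this var_span.var[OF var(1) var(3)]]
  show ?case using var wspan_closed[OF L var(2)] by (simp add: euler_simps)
next
  case (add i n y z)
  then show ?case using var_span.add[OF add(3,4)] wspan_closed[OF L] by (simp add: euler_simps)
qed (simp add: euler_simps var_span.zero)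

lemma partial_wspan:
  assumes x: "x \<in> S"
  shows "wspan (\<lambda>_. 1) L i n y \<Longrightarrow> (n = 0 \<longrightarrow> partial x y = \<zero>\<^bsub>Y\<^esub>) \<and>
    (n > 0 \<longrightarrow> wspan (\<lambda>_. 1) L (i - deg x) (n - 1) (partial x y))"
proof (induction rule: var_span.induct)
  case (zero i n)
  then show ?case by (simp add: Y.derivation_zero[OF partial(1)[OF x]] var_span.zero)
next
  case (base l i n)
  then show ?case using L_closed[OF L base] by (simp add: partial[OF x] var_span.zero)
next
  case (var z i n y)
  have 1: "wspan (\<lambda>_. 1) L (deg z + i - deg x) n (if z = x then y else \<zero>\<^bsub>Y\<^esub>)"
    using var(2) by (simp add: var_span.zero)
  have 2: "wspan (\<lambda>_. 1) L (deg z + i - deg x) n (z \<otimes>\<^bsub>Y\<^esub> partial x y)"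
  proof (cases n)
    case 0
    then show ?thesis using var var_closed by (simp add: var_span.zero)
  next
    case (Suc m)
    then have "wspan (\<lambda>_. 1) L (i - deg x) m (partial x y)" using var(3) by simp
    from var_span.var[where \<omega> = "\<lambda>_. 1", OF var(1) this] show ?thesis using Suc by (simp add: algebra_simps)
  qed
  show ?case using var_span.add[OF 1 wspan_signed[OF L 2]] wspan_closed[OF L var(2)]
    by (simp add: partial_var x var(1))
next
  case (add i n y z)
  then show ?case using var_span.add wspan_closed[OF L add(1)] wspan_closed[OF L add(2)]
    by (auto simp: derivation_add[OF partial(1)[OF x]])
qed

text \<open>
  The component of maximal weight is split off as an eigenvector of the Euler derivation. Weight components
  are not available by definition, since the monomials are not known to be independent.
\<close>

lemma wspan_split:
  "wspan \<omega> L i n y \<Longrightarrow> \<exists>z. wspan \<omega> L i n z \<and> euler \<omega> z = nat_K n \<odot>\<^bsub>Y\<^esub> z \<and> (n = 0 \<longrightarrow> y = z) \<and>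
     (n > 0 \<longrightarrow> wspan \<omega> L i (n - 1) (y \<ominus>\<^bsub>Y\<^esub> z))"
proof (induction rule: var_span.induct)
  case (zero i n)
  show ?case by (intro exI[of _ "\<zero>\<^bsub>Y\<^esub>"]) (simp add: euler_simps var_span.zero a_minus_def)
next
  case (base l i n)
  show ?case
  proof (cases "n = 0")
    case True
    then show ?thesis using L_closed[OF L base] base
      by (intro exI[of _ "h l"]) (simp add: euler_simps var_span.base h_simps)
  next
    case False
    then show ?thesis using L_closed[OF L base] base
      by (intro exI[of _ "\<zero>\<^bsub>Y\<^esub>"]) (simp add: euler_simps var_span.base var_span.zero h_simps a_minus_def)
  qed
next
  case (var x i n y)
  then obtain z where z: "wspan \<omega> L i n z" "euler \<omega> z = nat_K n \<odot>\<^bsub>Y\<^esub> z" "n = 0 \<longrightarrow> y = z"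
    "n > 0 \<longrightarrow> wspan \<omega> L i (n - 1) (y \<ominus>\<^bsub>Y\<^esub> z)" by blast
  note cl = var_closed[OF var(1)] wspan_closed[OF L var(2)] wspan_closed[OF L z(1)]
  have e: "x \<otimes>\<^bsub>Y\<^esub> y \<ominus>\<^bsub>Y\<^esub> x \<otimes>\<^bsub>Y\<^esub> z = x \<otimes>\<^bsub>Y\<^esub> (y \<ominus>\<^bsub>Y\<^esub> z)"
    using cl by (simp add: a_minus_def Y.r_distr Y.r_minus)
  have "wspan \<omega> L (deg x + i) (\<omega> x + n - 1) (x \<otimes>\<^bsub>Y\<^esub> (y \<ominus>\<^bsub>Y\<^esub> z))"
  proof (cases n)
    case 0
    then show ?thesis using z cl by (simp add: a_minus_def Y.r_neg var_span.zero)
  next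
    case (Suc m)
    then have "wspan \<omega> L i m (y \<ominus>\<^bsub>Y\<^esub> z)" using z by simp
    from var_span.var[OF var(1) this] show ?thesis using Suc by simp
  qed
  then show ?case using var_span.var[OF var(1) z(1)] var(1) cl z
    by (intro exI[of _ "x \<otimes>\<^bsub>Y\<^esub> z"])
      (simp add: e euler_simps Y.smult_mult_right nat_K_add Y.smult_l_distr)
next
  case (add i n y z)
  then obtain y' z' where y': "wspan \<omega> L i n y'" "euler \<omega> y' = nat_K n \<odot>\<^bsub>Y\<^esub> y'" "n = 0 \<longrightarrow> y = y'"
    "n > 0 \<longrightarrow> wspan \<omega> L i (n - 1) (y \<ominus>\<^bsub>Y\<^esub> y')"
    and z': "wspan \<omega> L i n z'" "euler \<omega> z' = nat_K n \<odot>\<^bsub>Y\<^esub> z'" "n = 0 \<longrightarrow> z = z'"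
    "n > 0 \<longrightarrow> wspan \<omega> L i (n - 1) (z \<ominus>\<^bsub>Y\<^esub> z')" by blast
  note cl = wspan_closed[OF L add(1)] wspan_closed[OF L add(2)] wspan_closed[OF L y'(1)] wspan_closed[OF L z'(1)]
  have e: "(y \<oplus>\<^bsub>Y\<^esub> z) \<ominus>\<^bsub>Y\<^esub> (y' \<oplus>\<^bsub>Y\<^esub> z') = (y \<ominus>\<^bsub>Y\<^esub> y') \<oplus>\<^bsub>Y\<^esub> (z \<ominus>\<^bsub>Y\<^esub> z')"
    using cl by algebra
  show ?case using var_span.add[OF y'(1) z'(1)] y' z' cl
    by (intro exI[of _ "y' \<oplus>\<^bsub>Y\<^esub> z'"])
      (auto simp: e euler_simps Y.smult_r_distr intro: var_span.add)
qed

lemma wspan_number_zero: "wspan (\<lambda>_. 1) L i n y \<Longrightarrow> n = 0 \<Longrightarrow> \<exists>l\<in>L i. y = h l"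
proof (induction rule: var_span.induct)
  case (zero i n)
  have "\<zero>\<^bsub>X\<^esub> \<in> L i" using L unfolding graded_ideal_def by blast
  then show ?case using h_simps(6) by metis
next
  case (add i n y z)
  then obtain a b where ab: "a \<in> L i" "y = h a" "b \<in> L i" "z = h b" by blast
  then have "a \<oplus>\<^bsub>X\<^esub> b \<in> L i" using L unfolding graded_ideal_def by blast
  then show ?case using ab L_closed[OF L] by (intro bexI[of _ "a \<oplus>\<^bsub>X\<^esub> b"]) (simp_all add: h_simps)
qed auto

end

text \<open>Eigenvectors for different eigenvalues are independent modulo a subspace that is stable under
  the Euler derivation; this uses characteristic \<open>0\<close>.\<close>

lemma wspan_separate:
  assumes K: "field K" "\<And>n. n > 0 \<Longrightarrow> nat_K n \<noteq> \<zero>\<^bsub>K\<^esub>"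
    and L: "graded_ideal X L" and M: "graded_ideal X M"
  shows "\<lbrakk>z \<in> carrier Y; euler \<omega> z = nat_K N \<odot>\<^bsub>Y\<^esub> z; wspan \<omega> L i n y; n < N; vspan M i (z \<oplus>\<^bsub>Y\<^esub> y)\<rbrakk>
    \<Longrightarrow> vspan M i z"
proof (induction n arbitrary: z y)
  have inv: "vspan M i z" if "z \<in> carrier Y" "n > 0" "vspan M i (nat_K n \<odot>\<^bsub>Y\<^esub> z)" for z n
  proof -
    interpret K: field K by fact
    have u: "nat_K n \<in> Units K" using K.field_Units K(2)[OF that(2)] by simp
    have "vspan M i (inv\<^bsub>K\<^esub> nat_K n \<odot>\<^bsub>Y\<^esub> (nat_K n \<odot>\<^bsub>Y\<^esub> z))"
      by (rule wspan_smult[OF M that(3)]) (use u in simp)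
    also have "inv\<^bsub>K\<^esub> nat_K n \<odot>\<^bsub>Y\<^esub> (nat_K n \<odot>\<^bsub>Y\<^esub> z) = z"
      using u that(1) by (simp add: Y.smult_assoc1[symmetric] Y.smult_one)
    finally show ?thesis .
  qed
  have diff: "nat_K N \<odot>\<^bsub>Y\<^esub> z \<ominus>\<^bsub>Y\<^esub> nat_K n \<odot>\<^bsub>Y\<^esub> z = nat_K (N - n) \<odot>\<^bsub>Y\<^esub> z" if "n < N" "z \<in> carrier Y" for n z
  proof -
    have "nat_K N = nat_K (N - n) \<oplus>\<^bsub>K\<^esub> nat_K n" using nat_K_add[of "N - n" n] that by simp
    then show ?thesis using that(2)
      by (simp add: Y.smult_l_distr a_minus_def Y.a_assoc Y.r_neg)
  qed
  { case 0
    have "vspan M i (euler \<omega> (z \<oplus>\<^bsub>Y\<^esub> y))" by (rule euler_wspan[OF M]) (rule 0)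
    moreover have "euler \<omega> y = \<zero>\<^bsub>Y\<^esub>" using wspan_split[OF L 0(3)] wspan_closed[OF L 0(3)] by auto
    ultimately have "vspan M i (nat_K N \<odot>\<^bsub>Y\<^esub> z)" using 0 wspan_closed[OF L 0(3)] by (simp add: euler_simps)
    then show ?case using inv 0 by simp
  next
    case (Suc n)
    obtain t where t: "wspan \<omega> L i (Suc n) t" "euler \<omega> t = nat_K (Suc n) \<odot>\<^bsub>Y\<^esub> t" "wspan \<omega> L i n (y \<ominus>\<^bsub>Y\<^esub> t)"
      using wspan_split[OF L Suc(4)] by auto
    let ?\<kappa> = "nat_K (Suc n)" let ?z = "nat_K (N - Suc n) \<odot>\<^bsub>Y\<^esub> z" let ?q = "y \<ominus>\<^bsub>Y\<^esub> t"
    let ?r = "euler \<omega> ?q \<ominus>\<^bsub>Y\<^esub> ?\<kappa> \<odot>\<^bsub>Y\<^esub> ?q"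
    note cl = Suc(2) wspan_closed[OF L Suc(4)] wspan_closed[OF L t(1)]
    \<comment> \<open>Applying the Euler derivation minus \<open>n + 1\<close> to \<open>z + y\<close> kills the component \<open>t\<close> and multiplies \<open>z\<close> by \<open>N - (n + 1)\<close>.\<close>
    have s: "vspan M i (euler \<omega> (z \<oplus>\<^bsub>Y\<^esub> y) \<ominus>\<^bsub>Y\<^esub> ?\<kappa> \<odot>\<^bsub>Y\<^esub> (z \<oplus>\<^bsub>Y\<^esub> y))"
      by (intro wspan_minus[OF M] euler_wspan[OF M] wspan_smult[OF M] Suc(6) nat_K_closed)
    have c4: "nat_K N \<odot>\<^bsub>Y\<^esub> z \<in> carrier Y" "?\<kappa> \<odot>\<^bsub>Y\<^esub> z \<in> carrier Y" "euler \<omega> y \<in> carrier Y" "?\<kappa> \<odot>\<^bsub>Y\<^esub> y \<in> carrier Y"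
      "?\<kappa> \<odot>\<^bsub>Y\<^esub> t \<in> carrier Y"
      using cl by (auto simp: euler_simps)
    have "?r = (euler \<omega> y \<ominus>\<^bsub>Y\<^esub> ?\<kappa> \<odot>\<^bsub>Y\<^esub> t) \<ominus>\<^bsub>Y\<^esub> (?\<kappa> \<odot>\<^bsub>Y\<^esub> y \<ominus>\<^bsub>Y\<^esub> ?\<kappa> \<odot>\<^bsub>Y\<^esub> t)"
      using cl t(2) by (simp add: euler_simps a_minus_def Y.smult_r_distr Y.smult_r_minus)
    also have "\<dots> = euler \<omega> y \<ominus>\<^bsub>Y\<^esub> ?\<kappa> \<odot>\<^bsub>Y\<^esub> y" using c4(3-5) by algebra
    finally have r: "?r = euler \<omega> y \<ominus>\<^bsub>Y\<^esub> ?\<kappa> \<odot>\<^bsub>Y\<^esub> y" .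
    have "euler \<omega> (z \<oplus>\<^bsub>Y\<^esub> y) \<ominus>\<^bsub>Y\<^esub> ?\<kappa> \<odot>\<^bsub>Y\<^esub> (z \<oplus>\<^bsub>Y\<^esub> y)
      = (nat_K N \<odot>\<^bsub>Y\<^esub> z \<oplus>\<^bsub>Y\<^esub> euler \<omega> y) \<ominus>\<^bsub>Y\<^esub> (?\<kappa> \<odot>\<^bsub>Y\<^esub> z \<oplus>\<^bsub>Y\<^esub> ?\<kappa> \<odot>\<^bsub>Y\<^esub> y)"
      using cl Suc(3) by (simp add: euler_simps Y.smult_r_distr)
    also have "\<dots> = (nat_K N \<odot>\<^bsub>Y\<^esub> z \<ominus>\<^bsub>Y\<^esub> ?\<kappa> \<odot>\<^bsub>Y\<^esub> z) \<oplus>\<^bsub>Y\<^esub> (euler \<omega> y \<ominus>\<^bsub>Y\<^esub> ?\<kappa> \<odot>\<^bsub>Y\<^esub> y)"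
      using c4 by algebra
    also have "\<dots> = ?z \<oplus>\<^bsub>Y\<^esub> ?r" using diff[OF Suc(5) cl(1)] r by simp
    finally have "euler \<omega> (z \<oplus>\<^bsub>Y\<^esub> y) \<ominus>\<^bsub>Y\<^esub> ?\<kappa> \<odot>\<^bsub>Y\<^esub> (z \<oplus>\<^bsub>Y\<^esub> y) = ?z \<oplus>\<^bsub>Y\<^esub> ?r" .
    with s have s': "vspan M i (?z \<oplus>\<^bsub>Y\<^esub> ?r)" by simp
    have "vspan M i ?z"
    proof (rule Suc(1)[OF _ _ _ _ s'])
      show "wspan \<omega> L i n ?r"
        by (intro wspan_minus[OF L] euler_wspan[OF L] wspan_smult[OF L] t nat_K_closed)
      show "euler \<omega> ?z = nat_K N \<odot>\<^bsub>Y\<^esub> ?z"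
        using cl Suc(3) by (simp add: euler_simps Y.smult_assoc1[symmetric] X.R.m_comm)
    qed (use cl Suc(5) in auto)
    from inv[OF Suc(2) _ this] show ?case using Suc(5) by simp }
qed

lemma euler_d0:
  assumes "y \<in> grade Y i" shows "euler \<omega> (d0 y) = d0 (euler \<omega> y)"
  using assms
proof (induction rule: grade_induct)
  case (var i x y)
  note cl = var_closed[OF var(1)] Y.grade_closed[OF var(2)]
  show ?case using cl var(1,3)
    by (simp add: d0_simps euler_simps Y.signed_add Y.signed_smult)
qed (simp_all add: d0_simps euler_simps X.grade_closed X.d_closed Y.grade_closed)

text \<open>
  All variables are sent to \<open>0\<close>. This shows that an element of \<open>X\<close> that lies in \<open>M Y\<close> lies in \<open>M\<close>.
\<close>

lemma augmentation:
  obtains \<epsilon> where "\<epsilon> \<in> ghom K Y X" "\<And>c. c \<in> carrier X \<Longrightarrow> \<epsilon> (h c) = c"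
    "\<And>M i y. graded_ideal X M \<Longrightarrow> vspan M i y \<Longrightarrow> \<epsilon> y \<in> M i"
proof -
  obtain \<epsilon> where \<epsilon>: "\<epsilon> \<in> ghom K Y X" "\<And>c. c \<in> carrier X \<Longrightarrow> \<epsilon> (h c) = c" "\<And>x. x \<in> S \<Longrightarrow> \<epsilon> x = \<zero>\<^bsub>X\<^esub>"
    by (rule universal_same_type[OF X.graded_comm_algebra_axioms X.id_ghom, of "\<lambda>_. \<zero>\<^bsub>X\<^esub>"]) (simp, rule that)
  have "\<epsilon> y \<in> M i" if M: "graded_ideal X M" and y: "wspan (\<lambda>_. 0) M i n y" for M i n y
    using y
  proof (induction rule: var_span.induct)
    case (zero i n)
    then show ?case using M ghom_zero[OF \<epsilon>(1) Y.ring_axioms X.ring_axioms] unfolding graded_ideal_def by simp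
  next
    case (base l i n)
    then show ?case using L_closed[OF M base] \<epsilon>(2) by simp
  next
    case (var x i n y)
    then show ?case using M wspan_closed[OF M var(2)] ghom_closed[OF \<epsilon>(1)] var_closed[OF var(1)]
      unfolding graded_ideal_def by (simp add: ghom_mult[OF \<epsilon>(1)] \<epsilon>(3))
  next
    case (add i n y z)
    then show ?case using M wspan_closed[OF M add(1)] wspan_closed[OF M add(2)]
      unfolding graded_ideal_def by (simp add: ghom_add[OF \<epsilon>(1)])
  qed
  then show thesis using that \<epsilon>(1,2) by blast
qed

lemma partial_vspan:
  assumes M: "graded_ideal X M" and x: "x \<in> S" and y: "vspan M i y"
  shows "vspan M (i - deg x) (partial x y)"
proof -
  obtain n where n: "wspan (\<lambda>_. 1) M i n y" using vspan_wspan[OF M y] by blast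
  show ?thesis
  proof (cases "n = 0")
    case True
    then show ?thesis using partial_wspan[OF M x n] by (simp add: var_span.zero)
  next
    case False
    then show ?thesis using partial_wspan[OF M x n] wspan_vspan[OF M] by blast
  qed
qed

text \<open>
  Coefficients have nonpositive degree, so the variables of a monomial of degree \<open>i\<close> have total degree at least
  \<open>i\<close>.
\<close>

lemma degree_wspan:
  assumes "y \<in> grade Y i" shows "wspan (\<lambda>x. nat (- deg x)) (grade X) i (nat (- i)) y"
  using assms
proof (induction rule: grade_induct)
  case (var i x y)
  show ?case
  proof (cases "i > 0")
    case True
    then have "y = \<zero>\<^bsub>Y\<^esub>" using var(2) Y.nonpositive by blast
    then show ?thesis using var_closed[OF var(1)] by (simp add: var_span.zero)
  next
    case False
    then have "nat (- deg x) + nat (- i) = nat (- (deg x + i))" using deg_nonpos[OF var(1)] by simp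
    then show ?thesis using var_span.var[where \<omega> = "\<lambda>x. nat (- deg x)", OF var(1) var(3)] by simp
  qed
qed (auto intro: var_span.intros)

text \<open>The differential of a variable has larger degree, so it only involves monomials of smaller weight.\<close>

lemma d_minus_d0:
  assumes L: "graded_ideal X L" and \<omega>: "\<omega> = (\<lambda>x. nat (- deg x))"
  shows "wspan \<omega> L i n y \<Longrightarrow> (n = 0 \<longrightarrow> differential Y y = d0 y) \<and>
    (n > 0 \<longrightarrow> wspan \<omega> L (i + 1) (n - 1) (differential Y y \<ominus>\<^bsub>Y\<^esub> d0 y))"
proof (induction rule: var_span.induct)
  case (zero i n)
  then show ?case by (simp add: d0_simps a_minus_def var_span.zero)
next
  case (base l i n)
  then show ?case using L_closed[OF L base] h_simps(9) h_simps(1)[OF X.d_closed]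
    by (simp add: d0_simps a_minus_def Y.r_neg var_span.zero)
next
  case (add i n y z)
  note cl = wspan_closed[OF L add(1)] wspan_closed[OF L add(2)]
  have "differential Y (y \<oplus>\<^bsub>Y\<^esub> z) \<ominus>\<^bsub>Y\<^esub> d0 (y \<oplus>\<^bsub>Y\<^esub> z)
    = (differential Y y \<oplus>\<^bsub>Y\<^esub> differential Y z) \<ominus>\<^bsub>Y\<^esub> (d0 y \<oplus>\<^bsub>Y\<^esub> d0 z)"
    using cl by (simp add: Y.d_add d0_simps)
  also have "\<dots> = (differential Y y \<ominus>\<^bsub>Y\<^esub> d0 y) \<oplus>\<^bsub>Y\<^esub> (differential Y z \<ominus>\<^bsub>Y\<^esub> d0 z)"
    using Y.d_closed[OF cl(1)] Y.d_closed[OF cl(2)] d0_simps(1)[OF cl(1)] d0_simps(1)[OF cl(2)] by algebra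
  finally show ?case using add(3,4) cl by (auto simp: Y.d_add d0_simps intro: var_span.add)
next
  case (var x i n y)
  note cl = wspan_closed[OF L var(2)] var_closed[OF var(1)]
  note cl' = Y.d_closed[OF cl(1)] Y.d_closed[OF cl(2)] d0_simps(1)[OF cl(1)]
  have "differential Y (x \<otimes>\<^bsub>Y\<^esub> y) \<ominus>\<^bsub>Y\<^esub> d0 (x \<otimes>\<^bsub>Y\<^esub> y)
    = (differential Y x \<otimes>\<^bsub>Y\<^esub> y \<oplus>\<^bsub>Y\<^esub> signed Y (deg x) (x \<otimes>\<^bsub>Y\<^esub> differential Y y)) \<ominus>\<^bsub>Y\<^esub> signed Y (deg x) (x \<otimes>\<^bsub>Y\<^esub> d0 y)"
    using cl var(1) by (simp add: Y.d_leibniz[OF var_grade[OF var(1)]] d0_simps)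
  also have "\<dots> = differential Y x \<otimes>\<^bsub>Y\<^esub> y \<oplus>\<^bsub>Y\<^esub> (signed Y (deg x) (x \<otimes>\<^bsub>Y\<^esub> differential Y y) \<ominus>\<^bsub>Y\<^esub> signed Y (deg x) (x \<otimes>\<^bsub>Y\<^esub> d0 y))"
    using cl cl' by (simp add: a_minus_def Y.a_assoc)
  also have "signed Y (deg x) (x \<otimes>\<^bsub>Y\<^esub> differential Y y) \<ominus>\<^bsub>Y\<^esub> signed Y (deg x) (x \<otimes>\<^bsub>Y\<^esub> d0 y)
      = signed Y (deg x) (x \<otimes>\<^bsub>Y\<^esub> (differential Y y \<ominus>\<^bsub>Y\<^esub> d0 y))"
    using cl cl' by (simp add: signed_def a_minus_def Y.r_distr Y.r_minus Y.minus_add)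
  finally have e: "differential Y (x \<otimes>\<^bsub>Y\<^esub> y) \<ominus>\<^bsub>Y\<^esub> d0 (x \<otimes>\<^bsub>Y\<^esub> y)
    = differential Y x \<otimes>\<^bsub>Y\<^esub> y \<oplus>\<^bsub>Y\<^esub> signed Y (deg x) (x \<otimes>\<^bsub>Y\<^esub> (differential Y y \<ominus>\<^bsub>Y\<^esub> d0 y))" .
  have dx: "differential Y x \<in> grade Y (deg x + 1)" by (rule Y.d_grade[OF var_grade[OF var(1)]])
  have A: "\<omega> x + n > 0 \<longrightarrow> wspan \<omega> L (deg x + i + 1) (\<omega> x + n - 1) (differential Y x \<otimes>\<^bsub>Y\<^esub> y)"
    and A0: "\<omega> x + n = 0 \<longrightarrow> differential Y x = \<zero>\<^bsub>Y\<^esub>"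
  proof -
    have *: "differential Y x = \<zero>\<^bsub>Y\<^esub>" if "\<omega> x = 0"
      using that deg_nonpos[OF var(1)] dx Y.nonpositive[of 1] \<omega> by simp
    have "wspan \<omega> L (deg x + 1 + i) (nat (- (deg x + 1)) + n) (differential Y x \<otimes>\<^bsub>Y\<^esub> y)"
      by (rule wspan_mult[OF L var(2)]) (use degree_wspan[OF dx] in \<open>simp add: \<omega>\<close>)
    then have **: "wspan \<omega> L (deg x + i + 1) (\<omega> x + n - 1) (differential Y x \<otimes>\<^bsub>Y\<^esub> y)" if "\<omega> x > 0"
    proof -
      have "deg x + 1 + i = deg x + i + 1" "nat (- (deg x + 1)) + n = \<omega> x + n - 1"
        using that by (simp_all add: \<omega>)
      then show ?thesis using \<open>wspan \<omega> L (deg x + 1 + i) _ _\<close> by (simp only:)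
    qed
    show "\<omega> x + n > 0 \<longrightarrow> wspan \<omega> L (deg x + i + 1) (\<omega> x + n - 1) (differential Y x \<otimes>\<^bsub>Y\<^esub> y)"
      using * ** cl by (cases "\<omega> x = 0") (simp_all add: var_span.zero)
    show "\<omega> x + n = 0 \<longrightarrow> differential Y x = \<zero>\<^bsub>Y\<^esub>" using * by simp
  qed
  have B: "wspan \<omega> L (deg x + i + 1) (\<omega> x + n - 1) (x \<otimes>\<^bsub>Y\<^esub> (differential Y y \<ominus>\<^bsub>Y\<^esub> d0 y))"
  proof (cases n)
    case 0
    then show ?thesis using var(3) cl cl' by (simp add: a_minus_def Y.r_neg var_span.zero)
  next
    case (Suc m)
    then have "wspan \<omega> L (i + 1) m (differential Y y \<ominus>\<^bsub>Y\<^esub> d0 y)" using var(3) by simp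
    from var_span.var[OF var(1) this] show ?thesis using Suc by (simp add: algebra_simps)
  qed
  have "\<omega> x + n > 0 \<longrightarrow> wspan \<omega> L (deg x + i + 1) (\<omega> x + n - 1) (differential Y (x \<otimes>\<^bsub>Y\<^esub> y) \<ominus>\<^bsub>Y\<^esub> d0 (x \<otimes>\<^bsub>Y\<^esub> y))"
    unfolding e using A wspan_signed[OF L B] by (auto intro: var_span.add)
  moreover have "\<omega> x + n = 0 \<longrightarrow> differential Y (x \<otimes>\<^bsub>Y\<^esub> y) = d0 (x \<otimes>\<^bsub>Y\<^esub> y)"
    using A0 var(3) cl cl' Y.d_leibniz[OF var_grade[OF var(1)]] var(1) by (simp add: d0_simps)
  ultimately show ?case by simp
qed

lemma vspan_d:
  assumes M: "graded_ideal X M" and dM: "\<And>i l. l \<in> M i \<Longrightarrow> differential X l \<in> M (i + 1)" and y: "vspan M i y"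
  shows "vspan M (i + 1) (differential Y y)"
proof -
  let ?\<omega> = "\<lambda>x. nat (- deg x)"
  obtain n where n: "wspan ?\<omega> M i n y" using vspan_wspan[OF M y] by blast
  note cl = wspan_closed[OF M n]
  have 1: "vspan M (i + 1) (d0 y)" by (rule d0_wspan[OF M dM y])
  have "vspan M (i + 1) (differential Y y \<ominus>\<^bsub>Y\<^esub> d0 y)"
  proof (cases "n = 0")
    case True
    then show ?thesis using d_minus_d0[OF M refl n] d0_simps(1)[OF cl] by (simp add: a_minus_def Y.r_neg var_span.zero)
  next
    case False
    then show ?thesis using d_minus_d0[OF M refl n] wspan_vspan[OF M] by blast
  qed
  from var_span.add[OF this 1] show ?thesis
    using Y.d_closed[OF cl] d0_simps(1)[OF cl] by (simp add: a_minus_def Y.a_assoc Y.l_neg)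
qed

text \<open>
  Let \<open>M \<subseteq> L\<close> be dg ideals of \<open>X\<close> such that \<open>L/M\<close> is acyclic. Then \<open>L Y/M Y\<close> is acyclic. The
  quotients are not formed; cocycles and coboundaries are considered modulo \<open>M\<close> and \<open>M Y\<close>. The claim is
  first proved for \<open>d0\<close> in place of the differential.
\<close>

context
  fixes L M :: "int \<Rightarrow> 'u set"
  assumes K: "field K" "\<And>n. n > 0 \<Longrightarrow> nat_K n \<noteq> \<zero>\<^bsub>K\<^esub>"
    and L: "graded_ideal X L" and M: "graded_ideal X M" and M_le_L: "\<And>i. M i \<subseteq> L i"
    and dL: "\<And>i l. l \<in> L i \<Longrightarrow> differential X l \<in> L (i + 1)"
    and dM: "\<And>i l. l \<in> M i \<Longrightarrow> differential X l \<in> M (i + 1)"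
    and acyclic: "\<And>i l. \<lbrakk>l \<in> L i; differential X l \<in> M (i + 1)\<rbrakk> \<Longrightarrow> \<exists>l'\<in>L (i - 1). l \<ominus>\<^bsub>X\<^esub> differential X l' \<in> M i"
begin

text \<open>
  Induction on the number of variables. If \<open>z\<close> is the component of \<open>y\<close> with \<open>n\<close> variables, then \<open>d0 z\<close> is the
  corresponding component of \<open>d0 y\<close>, so it lies in \<open>M Y\<close> as well. By Euler's formula \<open>n z\<close> is the sum of
  the terms \<open>x (\<partial>z/\<partial>x)\<close>, and each \<open>\<partial>z/\<partial>x\<close> is a cocycle modulo \<open>M Y\<close> with fewer variables, to which the
  induction hypothesis applies.
\<close>

lemma d0_acyclic:
  "\<lbrakk>wspan (\<lambda>_. 1) L i n y; vspan M (i + 1) (d0 y)\<rbrakk> \<Longrightarrow> \<exists>w. vspan L (i - 1) w \<and> vspan M i (y \<ominus>\<^bsub>Y\<^esub> d0 w)"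
proof (induction n arbitrary: i y)
  case 0
  obtain l where l: "l \<in> L i" "y = h l" using wspan_number_zero[OF L 0(1) refl] by blast
  note lc = L_closed[OF L l(1)]
  obtain \<epsilon> where \<epsilon>: "\<epsilon> \<in> ghom K Y X" "\<And>c. c \<in> carrier X \<Longrightarrow> \<epsilon> (h c) = c"
    "\<And>M i y. graded_ideal X M \<Longrightarrow> vspan M i y \<Longrightarrow> \<epsilon> y \<in> M i" using augmentation by blast
  have "vspan M (i + 1) (h (differential X l))" using 0(2) l lc by (simp add: d0_simps)
  then have "differential X l \<in> M (i + 1)" using \<epsilon>(2)[OF X.d_closed[OF lc]] \<epsilon>(3)[OF M] by fastforce
  then obtain l' where l': "l' \<in> L (i - 1)" "l \<ominus>\<^bsub>X\<^esub> differential X l' \<in> M i" using acyclic[OF l(1)] by blast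
  note lc' = L_closed[OF L l'(1)]
  have "h (l \<ominus>\<^bsub>X\<^esub> differential X l') = y \<ominus>\<^bsub>Y\<^esub> d0 (h l')"
    using l lc lc' X.d_closed[OF lc'] by (simp add: a_minus_def h_simps(1-8) d0_simps)
  moreover have "vspan M i (h (l \<ominus>\<^bsub>X\<^esub> differential X l'))" by (rule var_span.base) (rule l')
  moreover have "vspan L (i - 1) (h l')" by (rule var_span.base) (rule l')
  ultimately show ?case by (intro exI[of _ "h l'"]) simp
next
  case (Suc n)
  obtain z where z: "wspan (\<lambda>_. 1) L i (Suc n) z" "euler (\<lambda>_. 1) z = nat_K (Suc n) \<odot>\<^bsub>Y\<^esub> z"
    "wspan (\<lambda>_. 1) L i n (y \<ominus>\<^bsub>Y\<^esub> z)" using wspan_split[OF L Suc(2)] by auto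
  let ?y = "y \<ominus>\<^bsub>Y\<^esub> z"
  note cl = wspan_closed[OF L Suc(2)] wspan_closed[OF L z(1)]
  note dc = d0_simps(1)[OF cl(1)] d0_simps(1)[OF cl(2)]
  have "d0 z \<oplus>\<^bsub>Y\<^esub> (d0 y \<ominus>\<^bsub>Y\<^esub> d0 z) = d0 y" using dc by algebra
  then have yz: "d0 z \<oplus>\<^bsub>Y\<^esub> d0 ?y = d0 y" using cl by (simp add: d0_simps)
  have Mz: "vspan M (i + 1) (d0 z)"
  proof (rule wspan_separate[OF K L M])
    show "euler (\<lambda>_. 1) (d0 z) = nat_K (Suc n) \<odot>\<^bsub>Y\<^esub> d0 z"
      using euler_d0[OF wspan_grade[OF L z(1)]] z(2) cl by (simp add: d0_simps)
    show "wspan (\<lambda>_. 1) L (i + 1) n (d0 ?y)" by (rule d0_wspan[OF L dL z(3)])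
    show "vspan M (i + 1) (d0 z \<oplus>\<^bsub>Y\<^esub> d0 ?y)" using Suc(3) yz by simp
  qed (use dc in auto)
  have "vspan M (i + 1) (d0 y \<ominus>\<^bsub>Y\<^esub> d0 z)" by (rule wspan_minus[OF M Suc(3) Mz])
  then have "vspan M (i + 1) (d0 ?y)" using cl by (simp add: d0_simps)
  from Suc(1)[OF z(3) this] obtain w1 where w1: "vspan L (i - 1) w1" "vspan M i (?y \<ominus>\<^bsub>Y\<^esub> d0 w1)" by blast
  \<comment> \<open>The term of Euler's formula for the variable \<open>x\<close> is a coboundary modulo \<open>M Y\<close>.\<close>
  have px: "\<exists>w. vspan L (i - 1) w \<and> vspan M i (x \<otimes>\<^bsub>Y\<^esub> partial x z \<ominus>\<^bsub>Y\<^esub> d0 w)" if x: "x \<in> S" for x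
  proof -
    have p: "wspan (\<lambda>_. 1) L (i - deg x) n (partial x z)" using partial_wspan[OF L x z(1)] by simp
    have "vspan M (i + 1 - deg x) (signed Y (deg x) (partial x (d0 z)))"
      by (rule wspan_signed[OF M partial_vspan[OF M x Mz]])
    then have "vspan M (i - deg x + 1) (d0 (partial x z))"
      using partial_d0[OF x wspan_grade[OF L z(1)]] by (simp add: algebra_simps)
    from Suc(1)[OF p this] obtain w where w: "vspan L (i - deg x - 1) w" "vspan M (i - deg x) (partial x z \<ominus>\<^bsub>Y\<^esub> d0 w)"
      by blast
    note c = wspan_closed[OF L w(1)] wspan_closed[OF L p] var_closed[OF x]
    have "vspan L (deg x + (i - deg x - 1)) (signed Y (deg x) (x \<otimes>\<^bsub>Y\<^esub> w))"
      using wspan_signed[OF L var_span.var[OF x w(1)]] by simp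
    moreover have "vspan M (deg x + (i - deg x)) (x \<otimes>\<^bsub>Y\<^esub> (partial x z \<ominus>\<^bsub>Y\<^esub> d0 w))"
      using var_span.var[OF x w(2)] by simp
    moreover have "x \<otimes>\<^bsub>Y\<^esub> (partial x z \<ominus>\<^bsub>Y\<^esub> d0 w) = x \<otimes>\<^bsub>Y\<^esub> partial x z \<ominus>\<^bsub>Y\<^esub> d0 (signed Y (deg x) (x \<otimes>\<^bsub>Y\<^esub> w))"
      using c x by (simp add: d0_simps Y.signed_signed a_minus_def Y.r_distr Y.r_minus)
    ultimately show ?thesis by auto
  qed
  obtain F where F: "finite F" "F \<subseteq> S" "\<forall>F'. finite F' \<and> F \<subseteq> F' \<and> F' \<subseteq> S \<longrightarrow>
    euler (\<lambda>_. 1) z = (\<Oplus>\<^bsub>Y\<^esub>x\<in>F'. x \<otimes>\<^bsub>Y\<^esub> partial x z)"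
    using euler_formula[OF wspan_grade[OF L z(1)]] by blast
  have sums: "\<exists>w. vspan L (i - 1) w \<and> vspan M i ((\<Oplus>\<^bsub>Y\<^esub>x\<in>G. x \<otimes>\<^bsub>Y\<^esub> partial x z) \<ominus>\<^bsub>Y\<^esub> d0 w)" if "finite G" "G \<subseteq> S" for G
    using that
  proof (induction G rule: finite_induct)
    case empty
    then show ?case by (intro exI[of _ "\<zero>\<^bsub>Y\<^esub>"]) (simp add: var_span.zero d0_simps a_minus_def)
  next
    case (insert x G)
    have xS: "x \<in> S" using insert by simp
    obtain w where w: "vspan L (i - 1) w" "vspan M i ((\<Oplus>\<^bsub>Y\<^esub>x\<in>G. x \<otimes>\<^bsub>Y\<^esub> partial x z) \<ominus>\<^bsub>Y\<^esub> d0 w)"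
      using insert by blast
    obtain w' where w': "vspan L (i - 1) w'" "vspan M i (x \<otimes>\<^bsub>Y\<^esub> partial x z \<ominus>\<^bsub>Y\<^esub> d0 w')"
      using px[OF xS] by blast
    have pc: "x \<otimes>\<^bsub>Y\<^esub> partial x z \<in> carrier Y" if "x \<in> S" for x
      using var_closed derivation_closed[OF partial(1) cl(2)] that by blast
    let ?s = "\<Oplus>\<^bsub>Y\<^esub>x\<in>G. x \<otimes>\<^bsub>Y\<^esub> partial x z" and ?t = "x \<otimes>\<^bsub>Y\<^esub> partial x z"
    have c: "?s \<in> carrier Y" "?t \<in> carrier Y" "d0 w \<in> carrier Y" "d0 w' \<in> carrier Y"
      using pc insert wspan_closed[OF L w(1)] wspan_closed[OF L w'(1)] by (auto simp: d0_simps intro!: Y.finsum_closed)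
    have "(?t \<ominus>\<^bsub>Y\<^esub> d0 w') \<oplus>\<^bsub>Y\<^esub> (?s \<ominus>\<^bsub>Y\<^esub> d0 w) = (?t \<oplus>\<^bsub>Y\<^esub> ?s) \<ominus>\<^bsub>Y\<^esub> (d0 w' \<oplus>\<^bsub>Y\<^esub> d0 w)"
      using c by (simp add: Y.diff_add_diff)
    moreover have "?t \<oplus>\<^bsub>Y\<^esub> ?s = (\<Oplus>\<^bsub>Y\<^esub>x\<in>insert x G. x \<otimes>\<^bsub>Y\<^esub> partial x z)"
      using insert pc by (intro Y.finsum_insert[symmetric]) auto
    ultimately have "vspan M i ((\<Oplus>\<^bsub>Y\<^esub>x\<in>insert x G. x \<otimes>\<^bsub>Y\<^esub> partial x z) \<ominus>\<^bsub>Y\<^esub> d0 (w' \<oplus>\<^bsub>Y\<^esub> w))"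
      using var_span.add[OF w'(2) w(2)] wspan_closed[OF L w(1)] wspan_closed[OF L w'(1)] by (simp add: d0_simps)
    then show ?case using var_span.add[OF w'(1) w(1)] by blast
  qed
  have "euler (\<lambda>_. 1) z = (\<Oplus>\<^bsub>Y\<^esub>x\<in>F. x \<otimes>\<^bsub>Y\<^esub> partial x z)"
    by (rule F(3)[rule_format]) (use F(1,2) in blast)
  with sums[OF F(1,2)] obtain w2 where w2: "vspan L (i - 1) w2" "vspan M i (euler (\<lambda>_. 1) z \<ominus>\<^bsub>Y\<^esub> d0 w2)"
    by (elim exE conjE) (rule that, simp_all only:)
  let ?\<kappa> = "nat_K (Suc n)"
  have u: "?\<kappa> \<in> Units K" using field.field_Units[OF K(1)] K(2)[of "Suc n"] by simp
  let ?w2 = "inv\<^bsub>K\<^esub> ?\<kappa> \<odot>\<^bsub>Y\<^esub> w2"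
  have "vspan M i (inv\<^bsub>K\<^esub> ?\<kappa> \<odot>\<^bsub>Y\<^esub> (euler (\<lambda>_. 1) z \<ominus>\<^bsub>Y\<^esub> d0 w2))"
    by (rule wspan_smult[OF M w2(2)]) (use u in simp)
  also have "inv\<^bsub>K\<^esub> ?\<kappa> \<odot>\<^bsub>Y\<^esub> (euler (\<lambda>_. 1) z \<ominus>\<^bsub>Y\<^esub> d0 w2) = z \<ominus>\<^bsub>Y\<^esub> d0 ?w2"
    using u cl wspan_closed[OF L w2(1)] z(2)
    by (simp add: a_minus_def Y.smult_r_distr Y.smult_r_minus Y.smult_assoc1[symmetric] Y.smult_one d0_simps)
  finally have zM: "vspan M i (z \<ominus>\<^bsub>Y\<^esub> d0 ?w2)" .
  have w2L: "vspan L (i - 1) ?w2" by (rule wspan_smult[OF L w2(1)]) (use u in simp)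
  have c: "d0 w1 \<in> carrier Y" "d0 ?w2 \<in> carrier Y" "w1 \<in> carrier Y" "?w2 \<in> carrier Y"
    using wspan_closed[OF L w1(1)] wspan_closed[OF L w2L] by (auto simp: d0_simps(1))
  have "(?y \<ominus>\<^bsub>Y\<^esub> d0 w1) \<oplus>\<^bsub>Y\<^esub> (z \<ominus>\<^bsub>Y\<^esub> d0 ?w2) = y \<ominus>\<^bsub>Y\<^esub> (d0 w1 \<oplus>\<^bsub>Y\<^esub> d0 ?w2)"
    using c(1,2) cl by algebra
  then have "vspan M i (y \<ominus>\<^bsub>Y\<^esub> d0 (w1 \<oplus>\<^bsub>Y\<^esub> ?w2))"
    using var_span.add[OF w1(2) zM] c by (simp add: d0_simps(2))
  then show ?case using var_span.add[OF w1(1) w2L] by blast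
qed

text \<open>
  The primitive can be chosen of no larger weight than the cocycle: \<open>d0\<close> preserves weights, so components of
  larger weight are mapped into \<open>M Y\<close> and can be dropped.
\<close>

lemma d0_acyclic_bounded:
  assumes z: "wspan \<omega> L i k z" and "vspan M (i + 1) (d0 z)"
  shows "\<exists>w. wspan \<omega> L (i - 1) k w \<and> vspan M i (z \<ominus>\<^bsub>Y\<^esub> d0 w)"
proof -
  obtain m where "wspan (\<lambda>_. 1) L i m z" using vspan_wspan[OF L wspan_vspan[OF L z]] by blast
  then obtain w where w: "vspan L (i - 1) w" "vspan M i (z \<ominus>\<^bsub>Y\<^esub> d0 w)" using d0_acyclic assms(2) by blast
  obtain n where "wspan \<omega> L (i - 1) n w" using vspan_wspan[OF L w(1)] by blast
  then show ?thesis using w(2)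
  proof (induction n arbitrary: w)
    case 0
    then show ?case using wspan_mono[OF L] by blast
  next
    case (Suc n)
    show ?case
    proof (cases "Suc n \<le> k")
      case True
      then show ?thesis using Suc wspan_mono[OF L] by blast
    next
      case False
      obtain t where t: "wspan \<omega> L (i - 1) (Suc n) t" "euler \<omega> t = nat_K (Suc n) \<odot>\<^bsub>Y\<^esub> t"
        "wspan \<omega> L (i - 1) n (w \<ominus>\<^bsub>Y\<^esub> t)" using wspan_split[OF L Suc(2)] by auto
      note cl = wspan_closed[OF L Suc(2)] wspan_closed[OF L t(1)] wspan_closed[OF L z]
      note dc = d0_simps(1)[OF cl(1)] d0_simps(1)[OF cl(2)]
      have "vspan M i (\<ominus>\<^bsub>Y\<^esub> d0 t)"
      proof (rule wspan_separate[OF K L M])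
        show "euler \<omega> (\<ominus>\<^bsub>Y\<^esub> d0 t) = nat_K (Suc n) \<odot>\<^bsub>Y\<^esub> (\<ominus>\<^bsub>Y\<^esub> d0 t)"
          using euler_d0[OF wspan_grade[OF L t(1)]] t(2) cl dc by (simp add: d0_simps euler_simps Y.smult_r_minus)
        have "wspan \<omega> L i n (d0 (w \<ominus>\<^bsub>Y\<^esub> t))" using d0_wspan[OF L dL t(3)] by simp
        then show "wspan \<omega> L i n (z \<ominus>\<^bsub>Y\<^esub> d0 (w \<ominus>\<^bsub>Y\<^esub> t))"
          by (intro wspan_minus[OF L] wspan_mono[OF L z]) (use False in simp_all)
        have "\<ominus>\<^bsub>Y\<^esub> d0 t \<oplus>\<^bsub>Y\<^esub> (z \<ominus>\<^bsub>Y\<^esub> (d0 w \<ominus>\<^bsub>Y\<^esub> d0 t)) = z \<ominus>\<^bsub>Y\<^esub> d0 w"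
          using dc cl(3) by algebra
        then show "vspan M i (\<ominus>\<^bsub>Y\<^esub> d0 t \<oplus>\<^bsub>Y\<^esub> (z \<ominus>\<^bsub>Y\<^esub> d0 (w \<ominus>\<^bsub>Y\<^esub> t)))"
          using Suc(3) cl by (simp add: d0_simps)
      qed (use dc in auto)
      from wspan_minus[OF M Suc(3) this] have "vspan M i (z \<ominus>\<^bsub>Y\<^esub> d0 (w \<ominus>\<^bsub>Y\<^esub> t))"
      proof -
        have "(z \<ominus>\<^bsub>Y\<^esub> d0 w) \<ominus>\<^bsub>Y\<^esub> (\<ominus>\<^bsub>Y\<^esub> d0 t) = z \<ominus>\<^bsub>Y\<^esub> (d0 w \<ominus>\<^bsub>Y\<^esub> d0 t)" using dc cl(3) by algebra
        then show ?thesis using \<open>vspan M i ((z \<ominus>\<^bsub>Y\<^esub> d0 w) \<ominus>\<^bsub>Y\<^esub> (\<ominus>\<^bsub>Y\<^esub> d0 t))\<close> cl by (simp add: d0_simps)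
      qed
      then show ?thesis by (rule Suc(1)[OF t(3)])
    qed
  qed
qed

text \<open>
  Since the differential and \<open>d0\<close> agree up to terms of smaller weight, the component \<open>z\<close> of largest weight of a
  cocycle modulo \<open>M Y\<close> is a cocycle for \<open>d0\<close> modulo \<open>M Y\<close>. Subtracting the differential of a primitive of \<open>z\<close> leaves a cocycle of
  smaller weight. In the base case, weight \<open>0\<close>, the two differentials agree.
\<close>

lemma wspan_acyclic:
  assumes \<omega>: "\<omega> = (\<lambda>x. nat (- deg x))"
  shows "\<lbrakk>wspan \<omega> L i k y; vspan M (i + 1) (differential Y y)\<rbrakk>
    \<Longrightarrow> \<exists>w. vspan L (i - 1) w \<and> vspan M i (y \<ominus>\<^bsub>Y\<^esub> differential Y w)"
proof (induction k arbitrary: y)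
  case 0
  then have "vspan M (i + 1) (d0 y)" using d_minus_d0[OF L \<omega> 0(1)] by simp
  then obtain w where w: "wspan \<omega> L (i - 1) 0 w" "vspan M i (y \<ominus>\<^bsub>Y\<^esub> d0 w)" using d0_acyclic_bounded 0(1) by blast
  then show ?case using d_minus_d0[OF L \<omega> w(1)] wspan_vspan[OF L w(1)] by auto
next
  case (Suc k)
  obtain z where z: "wspan \<omega> L i (Suc k) z" "euler \<omega> z = nat_K (Suc k) \<odot>\<^bsub>Y\<^esub> z" "wspan \<omega> L i k (y \<ominus>\<^bsub>Y\<^esub> z)"
    using wspan_split[OF L Suc(2)] by auto
  let ?y = "y \<ominus>\<^bsub>Y\<^esub> z" and ?d = "differential Y"
  note cl = wspan_closed[OF L Suc(2)] wspan_closed[OF L z(1)]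
  note dc = d0_simps(1)[OF cl(1)] d0_simps(1)[OF cl(2)] Y.d_closed[OF cl(1)]
  have dd: "wspan \<omega> L (i + 1) k (?d y \<ominus>\<^bsub>Y\<^esub> d0 y)" using d_minus_d0[OF L \<omega> Suc(2)] by simp
  have "vspan M (i + 1) (d0 z)"
  proof (rule wspan_separate[OF K L M])
    show "euler \<omega> (d0 z) = nat_K (Suc k) \<odot>\<^bsub>Y\<^esub> d0 z"
      using euler_d0[OF wspan_grade[OF L z(1)]] z(2) cl by (simp add: d0_simps)
    show "wspan \<omega> L (i + 1) k (d0 ?y \<oplus>\<^bsub>Y\<^esub> (?d y \<ominus>\<^bsub>Y\<^esub> d0 y))"
      by (intro var_span.add dd d0_wspan[OF L dL z(3)])
    have "d0 z \<oplus>\<^bsub>Y\<^esub> ((d0 y \<ominus>\<^bsub>Y\<^esub> d0 z) \<oplus>\<^bsub>Y\<^esub> (?d y \<ominus>\<^bsub>Y\<^esub> d0 y)) = ?d y" using dc by algebra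
    then show "vspan M (i + 1) (d0 z \<oplus>\<^bsub>Y\<^esub> (d0 ?y \<oplus>\<^bsub>Y\<^esub> (?d y \<ominus>\<^bsub>Y\<^esub> d0 y)))" using Suc(3) cl by (simp add: d0_simps)
  qed (use dc in auto)
  then obtain w where w: "wspan \<omega> L (i - 1) (Suc k) w" "vspan M i (z \<ominus>\<^bsub>Y\<^esub> d0 w)"
    using d0_acyclic_bounded z(1) by blast
  note wc = wspan_closed[OF L w(1)]
  note wdc = Y.d_closed[OF wc] d0_simps(1)[OF wc]
  let ?y2 = "?y \<ominus>\<^bsub>Y\<^esub> (?d w \<ominus>\<^bsub>Y\<^esub> d0 w)" and ?u = "z \<ominus>\<^bsub>Y\<^esub> d0 w"
  have "wspan \<omega> L i k (?d w \<ominus>\<^bsub>Y\<^esub> d0 w)" using d_minus_d0[OF L \<omega> w(1)] by simp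
  then have y2: "wspan \<omega> L i k ?y2" by (rule wspan_minus[OF L z(3)])
  have e: "?y2 \<oplus>\<^bsub>Y\<^esub> ?u = y \<ominus>\<^bsub>Y\<^esub> ?d w" using cl wdc by algebra
  note y2c = wspan_closed[OF L y2] wspan_closed[OF M w(2)]
  have "?d (?y2 \<oplus>\<^bsub>Y\<^esub> ?u) = ?d y" unfolding e using cl wdc wc dc Y.d_d[OF wc] by (simp add: a_minus_def Y.d_add Y.d_neg)
  then have "?d y = ?d ?y2 \<oplus>\<^bsub>Y\<^esub> ?d ?u" using Y.d_add[OF y2c] by simp
  then have "?d ?y2 = ?d y \<ominus>\<^bsub>Y\<^esub> ?d ?u"
    using Y.d_closed[OF y2c(1)] Y.d_closed[OF y2c(2)] by (simp add: a_minus_def Y.a_assoc Y.r_neg)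
  moreover have "vspan M (i + 1) (?d y \<ominus>\<^bsub>Y\<^esub> ?d ?u)" by (rule wspan_minus[OF M Suc(3) vspan_d[OF M dM w(2)]])
  ultimately have "vspan M (i + 1) (?d ?y2)" by simp
  from Suc(1)[OF y2 this] obtain v where v: "vspan L (i - 1) v" "vspan M i (?y2 \<ominus>\<^bsub>Y\<^esub> ?d v)" by blast
  note vc = wspan_closed[OF L v(1)]
  have "(?y2 \<ominus>\<^bsub>Y\<^esub> ?d v) \<oplus>\<^bsub>Y\<^esub> ?u = (?y2 \<oplus>\<^bsub>Y\<^esub> ?u) \<ominus>\<^bsub>Y\<^esub> ?d v"
    using y2c Y.d_closed[OF vc] by algebra
  also have "\<dots> = y \<ominus>\<^bsub>Y\<^esub> ?d (w \<oplus>\<^bsub>Y\<^esub> v)"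
    unfolding e using cl wdc Y.d_closed[OF vc] wc vc by (simp add: Y.d_add a_minus_def Y.minus_add Y.a_assoc)
  finally have "vspan M i (y \<ominus>\<^bsub>Y\<^esub> ?d (w \<oplus>\<^bsub>Y\<^esub> v))" using var_span.add[OF v(2) w(2)] by simp
  then show ?case using var_span.add[OF wspan_vspan[OF L w(1)] v(1)] by blast
qed

theorem vspan_acyclic:
  assumes "vspan L i y" "vspan M (i + 1) (differential Y y)"
  shows "\<exists>w. vspan L (i - 1) w \<and> vspan M i (y \<ominus>\<^bsub>Y\<^esub> differential Y w)"
  using vspan_wspan[OF L assms(1)] wspan_acyclic[OF refl _ assms(2)] by blast

end

end

section \<open>Lifting against surjective quasi-isomorphisms\<close>

definition dghom ::
  "('k, 'm) ring_scheme \<Rightarrow> ('k, 'u, 'y) dga_scheme \<Rightarrow> ('k, 'v, 'z) dga_scheme \<Rightarrow> ('u \<Rightarrow> 'v) set"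
  where "dghom K A B = {f \<in> ghom K A B. \<forall>x\<in>carrier A. f (differential A x) = differential B (f x)}"

lemma cdga_hom_eq_dghom: "cdga_hom K A B = dghom K A B"
  by (simp add: cdga_hom_def dghom_def graded_hom_eq_ghom)

lemma dghom_ghom: "f \<in> dghom K A B \<Longrightarrow> f \<in> ghom K A B"
  and dghom_d: "f \<in> dghom K A B \<Longrightarrow> x \<in> carrier A \<Longrightarrow> f (differential A x) = differential B (f x)"
  by (auto simp: dghom_def)

lemma dghom_comp: "\<lbrakk>f \<in> dghom K A B; g \<in> dghom K B C\<rbrakk> \<Longrightarrow> (\<lambda>x. g (f x)) \<in> dghom K A C"
  by (auto simp: dghom_def ghom_closed intro: ghom_comp)

text \<open>Surjective quasi-isomorphisms, characterised by lifting of cocycles along with a primitive of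
  their image.\<close>

definition acyclic_surjection ::
  "('k, 'u, 'y) dga_scheme \<Rightarrow> ('k, 'v, 'z) dga_scheme \<Rightarrow> ('u \<Rightarrow> 'v) \<Rightarrow> bool" where
  "acyclic_surjection W T f \<longleftrightarrow> (\<forall>n w t. w \<in> grade W (n + 1) \<and> differential W w = \<zero>\<^bsub>W\<^esub> \<and> t \<in> grade T n \<and>
    differential T t = f w \<longrightarrow> (\<exists>w'\<in>grade W n. differential W w' = w \<and> f w' = t))"

lemma acyclic_surjectionD:
  assumes "acyclic_surjection W T f" "w \<in> grade W (n + 1)" "differential W w = \<zero>\<^bsub>W\<^esub>" "t \<in> grade T n"
    "differential T t = f w"
  obtains w' where "w' \<in> grade W n" "differential W w' = w" "f w' = t"
  using assms unfolding acyclic_surjection_def by blast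

context semifree
begin

text \<open>
  The lift is determined by its values \<open>v\<close> on the variables. These are chosen in order of decreasing degree: the
  differential of a variable only involves variables of larger degree, so the value on a variable is
  constrained by values that have been chosen before.
\<close>

context
  fixes W :: "('k, 'v) dga" and T :: "('k, 'w, 'z) dga_scheme" and code :: "'v \<Rightarrow> 'u" and \<phi> ev q
  assumes W: "graded_dga K W" and T: "graded_dga K T" and code: "inj_on code (carrier W)"
    and \<phi>: "\<phi> \<in> dghom K X W" and ev: "ev \<in> dghom K W T" and q: "q \<in> dghom K Y T"
    and square: "\<And>a. a \<in> carrier X \<Longrightarrow> ev (\<phi> a) = q (h a)"
    and acyclic_surj: "acyclic_surjection W T ev"
begin

interpretation W: graded_dga K W by (rule W)
interpretation T: graded_dga K T by (rule T)

definition extends :: "('u \<Rightarrow> 'v) \<Rightarrow> ('u \<Rightarrow> 'v) \<Rightarrow> bool" where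
  "extends v \<psi> \<longleftrightarrow> \<psi> \<in> ghom K Y W \<and> (\<forall>a\<in>carrier X. \<psi> (h a) = \<phi> a) \<and> (\<forall>x\<in>S. \<psi> x = v x)"

text \<open>
  Compatibility with the differential and with \<open>ev\<close> on the variables of degree greater than \<open>- n\<close>; this is no
  condition for \<open>n = 0\<close>.
\<close>

definition admissible :: "nat \<Rightarrow> ('u \<Rightarrow> 'v) \<Rightarrow> bool" where
  "admissible n \<psi> \<longleftrightarrow> (\<forall>x\<in>S. 1 - int n \<le> deg x \<longrightarrow>
     differential W (\<psi> x) = \<psi> (differential Y x) \<and> ev (\<psi> x) = q x)"

lemma extends_exists:
  assumes "\<And>x. x \<in> S \<Longrightarrow> v x \<in> grade W (deg x)" obtains \<psi> where "extends v \<psi>"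
proof -
  obtain \<psi> where "\<psi> \<in> ghom K Y W" "\<And>a. a \<in> carrier X \<Longrightarrow> \<psi> (h a) = \<phi> a" "\<And>x. x \<in> S \<Longrightarrow> \<psi> x = v x"
    by (rule universal[OF W.graded_comm_algebra_axioms code dghom_ghom[OF \<phi>] assms], assumption) (rule that)
  then show thesis using that[of \<psi>] by (simp add: extends_def)
qed

lemma extends_eq_above:
  assumes "extends v \<psi>" "extends v' \<psi>'" "\<And>x. \<lbrakk>x \<in> S; n \<le> deg x\<rbrakk> \<Longrightarrow> v x = v' x" "y \<in> grade Y i" "n \<le> i"
  shows "\<psi> y = \<psi>' y"
  by (rule hom_eq_above[OF W.graded_comm_algebra_axioms _ _ _ _ assms(4,5)])
    (use assms(1-3) in \<open>auto simp: extends_def\<close>)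

lemma admissible_above:
  assumes e: "extends v \<psi>" and a: "admissible n \<psi>" and y: "y \<in> grade Y i" "1 - int n \<le> i"
  shows "differential W (\<psi> y) = \<psi> (differential Y y) \<and> ev (\<psi> y) = q y"
  using y
proof (induction rule: grade_induct_above)
  have \<psi>: "\<psi> \<in> ghom K Y W" using e by (simp add: extends_def)
  note g = ghom_zero[OF \<psi> Y.ring_axioms W.ring_axioms] ghom_closed[OF \<psi>] ghom_mult[OF \<psi>] ghom_add[OF \<psi>]
    ghom_signed[OF \<psi> Y.ring_axioms W.ring_axioms]
  note eq = ghom_zero[OF dghom_ghom[OF ev] W.ring_axioms T.ring_axioms]
    ghom_zero[OF dghom_ghom[OF q] Y.ring_axioms T.ring_axioms] ghom_mult[OF dghom_ghom[OF ev]]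
    ghom_mult[OF dghom_ghom[OF q]] ghom_add[OF dghom_ghom[OF ev]] ghom_add[OF dghom_ghom[OF q]]
  { case (zero i)
    show ?case by (simp add: g eq)
  next
    case (base i c)
    note c = X.grade_closed[OF base]
    have "\<psi> (differential Y (h c)) = \<phi> (differential X c)"
      using e X.d_closed[OF c] c by (simp add: extends_def h_simps(9)[symmetric])
    then show ?case using e c square[OF c] dghom_d[OF \<phi> c] by (simp add: extends_def)
  next
    case (var i x y)
    note cl = var_closed[OF var(1)] Y.grade_closed[OF var(4)]
    have "differential W (\<psi> x \<otimes>\<^bsub>W\<^esub> \<psi> y)
      = differential W (\<psi> x) \<otimes>\<^bsub>W\<^esub> \<psi> y \<oplus>\<^bsub>W\<^esub> signed W (deg x) (\<psi> x \<otimes>\<^bsub>W\<^esub> differential W (\<psi> y))"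
      using cl by (intro W.d_leibniz ghom_grade[OF \<psi>] var_grade var(1)) (simp add: g)
    moreover have "differential W (\<psi> x) = \<psi> (differential Y x)" "ev (\<psi> x) = q x"
      using a var(1,2) by (auto simp: admissible_def)
    ultimately show ?case using var(5) cl Y.d_closed Y.d_leibniz[OF var_grade[OF var(1)] cl(2)]
      by (simp add: g eq)
  next
    case (add i y z)
    then show ?case using Y.grade_closed[OF add(1)] Y.grade_closed[OF add(2)]
      by (simp add: g eq W.d_add Y.d_add Y.d_closed) }
qed

lemma admissible_step:
  assumes e: "extends v \<psi>" and v: "\<And>x. x \<in> S \<Longrightarrow> v x \<in> grade W (deg x)" and a: "admissible n \<psi>"
  obtains v' \<psi>' where "extends v' \<psi>'" "\<And>x. x \<in> S \<Longrightarrow> v' x \<in> grade W (deg x)" "admissible (Suc n) \<psi>'"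
    "\<And>x. \<lbrakk>x \<in> S; 1 - int n \<le> deg x\<rbrakk> \<Longrightarrow> v' x = v x"
proof -
  have \<psi>: "\<psi> \<in> ghom K Y W" using e by (simp add: extends_def)
  have ex: "\<exists>w\<in>grade W (deg x). differential W w = \<psi> (differential Y x) \<and> ev w = q x"
    if x: "x \<in> S" "deg x = - int n" for x
  proof -
    have dx: "differential Y x \<in> grade Y (deg x + 1)" by (rule Y.d_grade[OF var_grade[OF x(1)]])
    note ab = admissible_above[OF e a dx]
    have "ev (\<psi> (differential Y x)) = q (differential Y x)" "differential W (\<psi> (differential Y x)) = \<psi> (differential Y (differential Y x))"
      using ab x(2) by simp_all
    then show ?thesis
      using acyclic_surjectionD[OF acyclic_surj ghom_grade[OF \<psi> dx] _ ghom_grade[OF dghom_ghom[OF q] var_grade[OF x(1)]]]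
        dghom_d[OF q var_closed[OF x(1)]] Y.d_d[OF var_closed[OF x(1)]]
        ghom_zero[OF \<psi> Y.ring_axioms W.ring_axioms] by metis
  qed
  define v' where "v' x = (if deg x = - int n
    then SOME w. w \<in> grade W (deg x) \<and> differential W w = \<psi> (differential Y x) \<and> ev w = q x else v x)" for x
  have v'n: "v' x \<in> grade W (deg x) \<and> differential W (v' x) = \<psi> (differential Y x) \<and> ev (v' x) = q x"
    if "x \<in> S" "deg x = - int n" for x
    using someI_ex[of "\<lambda>w. w \<in> grade W (deg x) \<and> differential W w = \<psi> (differential Y x) \<and> ev w = q x"] ex[OF that] that
    unfolding v'_def by auto
  have v': "v' x \<in> grade W (deg x)" if "x \<in> S" for x
    using v'n[OF that] v[OF that] by (cases "deg x = - int n") (auto simp: v'_def)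
  obtain \<psi>' where e': "extends v' \<psi>'" by (rule extends_exists[OF v'])
  have eq: "v' x = v x" if "x \<in> S" "1 - int n \<le> deg x" for x using that by (simp add: v'_def)
  show thesis
  proof (rule that[OF e' v' _ eq])
    show "admissible (Suc n) \<psi>'"
      unfolding admissible_def
    proof (intro ballI impI)
      fix x assume x: "x \<in> S" "1 - int (Suc n) \<le> deg x"
      have dx: "differential Y x \<in> grade Y (deg x + 1)" by (rule Y.d_grade[OF var_grade[OF x(1)]])
      have same: "\<psi>' (differential Y x) = \<psi> (differential Y x)"
        by (rule extends_eq_above[OF e' e eq dx]) (use x in auto)
      have vx: "\<psi>' x = v' x" "\<psi> x = v x" using e e' x(1) by (auto simp: extends_def)
      show "differential W (\<psi>' x) = \<psi>' (differential Y x) \<and> ev (\<psi>' x) = q x"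
      proof (cases "deg x = - int n")
        case True
        then show ?thesis using v'n[OF x(1)] same vx by simp
      next
        case False
        then have "1 - int n \<le> deg x" using x(2) by simp
        then show ?thesis using a x(1) same vx eq[OF x(1)] unfolding admissible_def by auto
      qed
    qed
  qed auto
qed

lemma lifting_exists:
  obtains \<psi> where "\<psi> \<in> dghom K Y W" "\<And>a. a \<in> carrier X \<Longrightarrow> \<psi> (h a) = \<phi> a" "\<And>y. y \<in> carrier Y \<Longrightarrow> ev (\<psi> y) = q y"
proof -
  let ?P = "\<lambda>n (v, \<psi>). extends v \<psi> \<and> (\<forall>x\<in>S. v x \<in> grade W (deg x)) \<and> admissible n \<psi>"
  let ?Q = "\<lambda>n (v, \<psi>) (v', \<psi>' :: 'u \<Rightarrow> 'v). \<forall>x\<in>S. 1 - int n \<le> deg x \<longrightarrow> v' x = v x"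
  have "\<exists>F. \<forall>n. ?P n (F n) \<and> ?Q n (F n) (F (Suc n))"
  proof (rule dependent_nat_choice)
    obtain \<psi> where "extends (\<lambda>_. \<zero>\<^bsub>W\<^esub>) \<psi>" using extends_exists[of "\<lambda>_. \<zero>\<^bsub>W\<^esub>"] by auto
    moreover have "admissible 0 \<psi>" using deg_nonpos by (force simp: admissible_def)
    ultimately show "\<exists>p. ?P 0 p" by (intro exI[of _ "(\<lambda>_. \<zero>\<^bsub>W\<^esub>, \<psi>)"]) simp
  next
    fix p n assume p: "?P n p"
    obtain v \<psi> where vp: "p = (v, \<psi>)" by fastforce
    obtain v' \<psi>' where "extends v' \<psi>'" "\<And>x. x \<in> S \<Longrightarrow> v' x \<in> grade W (deg x)" "admissible (Suc n) \<psi>'"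
      "\<And>x. \<lbrakk>x \<in> S; 1 - int n \<le> deg x\<rbrakk> \<Longrightarrow> v' x = v x"
      using admissible_step[of v \<psi> n] p unfolding vp by auto
    then show "\<exists>p'. ?P (Suc n) p' \<and> ?Q n p p'" unfolding vp by (intro exI[of _ "(v', \<psi>')"]) simp
  qed
  then obtain F where "\<forall>n. ?P n (F n) \<and> ?Q n (F n) (F (Suc n))" by (rule exE)
  then have F: "?P n (F n)" "?Q n (F n) (F (Suc n))" for n by simp_all
  define v where "v n = fst (F n)" for n
  define \<psi> where "\<psi> n = snd (F n)" for n
  have e: "extends (v n) (\<psi> n)" and g: "\<And>x. x \<in> S \<Longrightarrow> v n x \<in> grade W (deg x)" and a: "admissible n (\<psi> n)" for n
    using F(1)[of n] by (auto simp: v_def \<psi>_def split: prod.splits)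
  have stab: "v m x = v n x" if "n \<le> m" "x \<in> S" "1 - int n \<le> deg x" for n m x
    using that(1)
  proof (induction m rule: dec_induct)
    case (step m)
    then show ?case using F(2)[of m] that by (auto simp: v_def split: prod.splits)
  qed simp
  \<comment> \<open>The choices stabilise: the value on \<open>x\<close> no longer changes from stage \<open>1 - deg x\<close> on.\<close>
  define V where "V x = v (nat (1 - deg x)) x" for x
  obtain \<Psi> where \<Psi>: "extends V \<Psi>" using extends_exists[of V] g by (auto simp: V_def)
  have Vv: "V x = v n x" if "x \<in> S" "1 - int n \<le> deg x" for x n
    unfolding V_def using that by (intro stab[symmetric]) auto
  have adm: "admissible n \<Psi>" for n
    unfolding admissible_def
  proof (intro ballI impI)
    fix x assume x: "x \<in> S"
    let ?n = "nat (1 - deg x)"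
    have dx: "differential Y x \<in> grade Y (deg x + 1)" by (rule Y.d_grade[OF var_grade[OF x]])
    have n: "1 - int ?n \<le> deg x" by simp
    have "\<Psi> (differential Y x) = \<psi> ?n (differential Y x)"
      by (rule extends_eq_above[OF \<Psi> e Vv dx]) (use n in auto)
    moreover have "\<Psi> x = \<psi> ?n x" using \<Psi> e[of ?n] x Vv[OF x n] by (simp add: extends_def)
    ultimately show "differential W (\<Psi> x) = \<Psi> (differential Y x) \<and> ev (\<Psi> x) = q x"
      using a[of ?n] x n unfolding admissible_def by auto
  qed
  have \<Psi>g: "\<Psi> \<in> ghom K Y W" using \<Psi> by (simp add: extends_def)
  have all: "differential W (\<Psi> y) = \<Psi> (differential Y y) \<and> ev (\<Psi> y) = q y" if "y \<in> carrier Y" for y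
    using that
  proof (induction rule: Y.graded_induct)
    case zero
    then show ?case using ghom_zero[OF \<Psi>g Y.ring_axioms W.ring_axioms]
        ghom_zero[OF dghom_ghom[OF ev] W.ring_axioms T.ring_axioms]
        ghom_zero[OF dghom_ghom[OF q] Y.ring_axioms T.ring_axioms] by simp
  next
    case (hom i y)
    show ?case by (rule admissible_above[OF \<Psi> adm[of "nat (1 - i)"] hom]) simp
  next
    case (add x y)
    then show ?case
      by (simp add: ghom_add[OF \<Psi>g] W.d_add Y.d_add Y.d_closed ghom_closed[OF \<Psi>g]
        ghom_add[OF dghom_ghom[OF ev]] ghom_add[OF dghom_ghom[OF q]])
  qed
  show thesis
    by (rule that[of \<Psi>]) (use \<Psi> all in \<open>auto simp: dghom_def extends_def\<close>)
qed

end
end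

text \<open>
  The lifting property passes from a semifree extension to its retract \<open>g\<close>.
\<close>

lemma cofibration_lifting:
  fixes W :: "('k, 'v) dga" and code :: "'v \<Rightarrow> 'u" and P :: "('k, 'u, 'y) dga_scheme" and R :: "('k, 'u, 'z) dga_scheme"
  assumes cof: "cofibration K P R g" and inf: "infinite (UNIV :: 'u set)"
    and W: "graded_dga K W" and T: "graded_dga K T" and code: "inj_on code (carrier W)"
    and \<phi>: "\<phi> \<in> dghom K P W" and ev: "ev \<in> dghom K W T" and p: "p \<in> dghom K R T"
    and square: "\<And>a. a \<in> carrier P \<Longrightarrow> ev (\<phi> a) = p (g a)"
    and acyclic_surj: "acyclic_surjection W T ev"
  obtains \<sigma> where "\<sigma> \<in> dghom K R W" "\<And>a. a \<in> carrier P \<Longrightarrow> \<sigma> (g a) = \<phi> a" "\<And>y. y \<in> carrier R \<Longrightarrow> ev (\<sigma> y) = p y"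
proof -
  obtain X Y :: "('k, 'u) dga" and h s r t q where
    semi: "semifree_extension K X Y h" and
    s: "s \<in> dghom K P X" and r: "r \<in> dghom K X P" and rs: "\<forall>x\<in>carrier P. r (s x) = x" and
    t: "t \<in> dghom K R Y" and q: "q \<in> dghom K Y R" and qt: "\<forall>y\<in>carrier R. q (t y) = y" and
    hs: "\<forall>x\<in>carrier P. h (s x) = t (g x)" and gr: "\<forall>x\<in>carrier X. g (r x) = q (h x)"
    using cof unfolding cofibration_def cdga_hom_eq_dghom by blast
  obtain S deg where "semifree K X Y h S deg"
    using semi inf unfolding semifree_extension_def semifree_def semifree_axioms_def by blast
  then interpret semifree K X Y h S deg .
  obtain \<psi> where \<psi>: "\<psi> \<in> dghom K Y W" "\<And>a. a \<in> carrier X \<Longrightarrow> \<psi> (h a) = \<phi> (r a)"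
    "\<And>y. y \<in> carrier Y \<Longrightarrow> ev (\<psi> y) = p (q y)"
  proof (rule lifting_exists[OF W T code dghom_comp[OF r \<phi>] ev dghom_comp[OF q p] _ acyclic_surj])
    fix a assume "a \<in> carrier X"
    then show "ev (\<phi> (r a)) = p (q (h a))" using square ghom_closed[OF dghom_ghom[OF r]] gr by simp
  qed (rule that)
  show thesis
  proof (rule that[OF dghom_comp[OF t \<psi>(1)]])
    fix a assume "a \<in> carrier P"
    then show "\<psi> (t (g a)) = \<phi> a" using hs rs \<psi>(2) ghom_closed[OF dghom_ghom[OF s]] by metis
  next
    fix y assume "y \<in> carrier R"
    then show "ev (\<psi> (t y)) = p y" using \<psi>(3) ghom_closed[OF dghom_ghom[OF t]] qt by simp
  qed
qed

section \<open>Generated ideals and left properness\<close>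

inductive ideal_gen :: "('k, 'u, 'z) dga_scheme \<Rightarrow> (int \<Rightarrow> 'u set) \<Rightarrow> int \<Rightarrow> 'u \<Rightarrow> bool" for A G where
  zero: "ideal_gen A G i \<zero>\<^bsub>A\<^esub>"
| base: "x \<in> G i \<Longrightarrow> ideal_gen A G i x"
| mult: "\<lbrakk>a \<in> grade A j; ideal_gen A G i x\<rbrakk> \<Longrightarrow> ideal_gen A G (j + i) (a \<otimes>\<^bsub>A\<^esub> x)"
| add: "\<lbrakk>ideal_gen A G i x; ideal_gen A G i y\<rbrakk> \<Longrightarrow> ideal_gen A G i (x \<oplus>\<^bsub>A\<^esub> y)"

lemma (in graded_comm_algebra) ideal_gen_grade:
  assumes G: "\<And>i. G i \<subseteq> grade A i" shows "ideal_gen A G i x \<Longrightarrow> x \<in> grade A i"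
  by (induction rule: ideal_gen.induct) (use G in \<open>auto intro: mult_grade grade_add\<close>)

lemma (in graded_comm_algebra) graded_ideal_gen:
  assumes "\<And>i. G i \<subseteq> grade A i" shows "graded_ideal A (\<lambda>i. {x. ideal_gen A G i x})"
  unfolding graded_ideal_def using ideal_gen_grade[of G, OF assms] by (auto intro: ideal_gen.intros)

lemma (in graded_dga) ideal_gen_d:
  assumes G: "\<And>i. G i \<subseteq> grade A i" and dG: "\<And>i x. x \<in> G i \<Longrightarrow> differential A x \<in> G (i + 1)"
  shows "ideal_gen A G i x \<Longrightarrow> ideal_gen A G (i + 1) (differential A x)"
proof (induction rule: ideal_gen.induct)
  case (zero i)
  then show ?case by (simp add: ideal_gen.zero)
next
  case (base x i)
  then show ?case by (intro ideal_gen.base dG)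
next
  case (mult a j i x)
  note gi = graded_ideal_gen[of G, OF G]
  note x = grade_closed[OF ideal_gen_grade[of G, OF G mult(2)]]
  have "ideal_gen A G (j + i + 1) (differential A a \<otimes>\<^bsub>A\<^esub> x)"
    using ideal_gen.mult[OF d_grade[OF mult(1)] mult(2)] by (simp add: algebra_simps)
  moreover have "ideal_gen A G (j + i + 1) (signed A j (a \<otimes>\<^bsub>A\<^esub> differential A x))"
    using ideal_gen.mult[OF mult(1) mult(3)] graded_ideal_neg[OF gi, of _ "j + i + 1"]
    by (simp add: signed_def algebra_simps)
  ultimately show ?case using d_leibniz[OF mult(1) x] ideal_gen.add by metis
next
  case (add i x y)
  then show ?case using ideal_gen.add[OF add(3,4)] grade_closed ideal_gen_grade[of G, OF G] by (metis d_add)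
qed

text \<open>
  Left properness: the quotient of \<open>P\<close> by the acyclic ideal \<open>N\<close> is a quasi-isomorphism, hence so is its pushout
  along the cofibration \<open>g\<close>, and the kernel of the latter is generated by \<open>g N\<close>. If \<open>g\<close> is a retract
  of a semifree extension \<open>h\<close> of \<open>X\<close>, with retraction \<open>r : X \<rightarrow> P\<close>, then \<open>N\<close> is the quotient of the
  ideals \<open>L = {x. r x \<in> N}\<close> and \<open>M = ker r\<close> of \<open>X\<close>, and the extension of these two ideals along
  \<open>h\<close> is governed by \<open>vspan_acyclic\<close>.
\<close>

lemma cofibration_ideal_acyclic:
  fixes P :: "('k, 'u, 'y) dga_scheme" and R :: "('k, 'u, 'z) dga_scheme"
  assumes K: "field K" "\<And>n :: nat. n > 0 \<Longrightarrow> [n] \<cdot>\<^bsub>K\<^esub> \<one>\<^bsub>K\<^esub> \<noteq> \<zero>\<^bsub>K\<^esub>" and inf: "infinite (UNIV :: 'u set)"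
    and P: "cdga K P" and R: "cdga K R" and g: "g \<in> dghom K P R" and cof: "cofibration K P R g"
    and N: "graded_ideal P N" and dN: "\<And>i n. n \<in> N i \<Longrightarrow> differential P n \<in> N (i + 1)"
    and acyc: "\<And>i n. \<lbrakk>n \<in> N i; differential P n = \<zero>\<^bsub>P\<^esub>\<rbrakk> \<Longrightarrow> \<exists>n'\<in>N (i - 1). differential P n' = n"
    and j: "ideal_gen R (\<lambda>i. g ` N i) i j" "differential R j = \<zero>\<^bsub>R\<^esub>"
  shows "\<exists>j'. ideal_gen R (\<lambda>i. g ` N i) (i - 1) j' \<and> differential R j' = j"
proof -
  interpret P: cdga K P by fact
  interpret R: cdga K R by fact
  obtain X Y :: "('k, 'u) dga" and h s r t q where
    semi: "semifree_extension K X Y h" and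
    s: "s \<in> dghom K P X" and r: "r \<in> dghom K X P" and rs: "\<forall>x\<in>carrier P. r (s x) = x" and
    t: "t \<in> dghom K R Y" and q: "q \<in> dghom K Y R" and qt: "\<forall>y\<in>carrier R. q (t y) = y" and
    hs: "\<forall>x\<in>carrier P. h (s x) = t (g x)" and gr: "\<forall>x\<in>carrier X. g (r x) = q (h x)"
    using cof unfolding cofibration_def cdga_hom_eq_dghom by blast
  obtain S deg where "semifree K X Y h S deg"
    using semi inf unfolding semifree_extension_def semifree_def semifree_axioms_def by blast
  then interpret semifree K X Y h S deg .
  note r_simps = ghom_closed[OF dghom_ghom[OF r]] ghom_mult[OF dghom_ghom[OF r]] ghom_add[OF dghom_ghom[OF r]]
    ghom_zero[OF dghom_ghom[OF r] X.ring_axioms P.ring_axioms] dghom_d[OF r]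
    ghom_minus[OF dghom_ghom[OF r] X.ring_axioms P.ring_axioms]
  note t_simps = ghom_closed[OF dghom_ghom[OF t]] ghom_mult[OF dghom_ghom[OF t]] ghom_add[OF dghom_ghom[OF t]]
    ghom_zero[OF dghom_ghom[OF t] R.ring_axioms Y.ring_axioms] dghom_d[OF t]
  note q_simps = ghom_closed[OF dghom_ghom[OF q]] ghom_mult[OF dghom_ghom[OF q]] ghom_add[OF dghom_ghom[OF q]]
    ghom_zero[OF dghom_ghom[OF q] Y.ring_axioms R.ring_axioms] dghom_d[OF q]
    ghom_minus[OF dghom_ghom[OF q] Y.ring_axioms R.ring_axioms]
  have NP: "n \<in> grade P i" if "n \<in> N i" for n i using N that unfolding graded_ideal_def by blast
  have gNR: "g ` N i \<subseteq> grade R i" for i using NP ghom_grade[OF dghom_ghom[OF g]] by blast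
  let ?I = "ideal_gen R (\<lambda>i. g ` N i)"
  note I_grade = R.ideal_gen_grade[of "\<lambda>i. g ` N i", OF gNR]
  \<comment> \<open>The section \<open>t\<close> maps the ideal generated by \<open>g N\<close> into \<open>L Y\<close>, and \<open>q\<close> maps \<open>L Y\<close> back and kills \<open>M Y\<close>.\<close>
  define L where "L i = {x \<in> grade X i. r x \<in> N i}" for i
  define M where "M i = {x \<in> grade X i. r x = \<zero>\<^bsub>P\<^esub>}" for i
  have N_mult: "a \<otimes>\<^bsub>P\<^esub> n \<in> N (j + i)" if "a \<in> grade P j" "n \<in> N i" for a n i j
    using N that unfolding graded_ideal_def by blast
  have L: "graded_ideal X L"
  proof -
    have "\<zero>\<^bsub>P\<^esub> \<in> N i" "\<lbrakk>x \<in> N i; y \<in> N i\<rbrakk> \<Longrightarrow> x \<oplus>\<^bsub>P\<^esub> y \<in> N i" for i x y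
      using N unfolding graded_ideal_def by blast+
    moreover have "a \<otimes>\<^bsub>X\<^esub> x \<in> L (j + i)" if "a \<in> grade X j" "x \<in> L i" for a x i j
      using that N_mult[OF ghom_grade[OF dghom_ghom[OF r] that(1)], of "r x" i] X.mult_grade X.grade_closed
      by (auto simp: L_def r_simps)
    ultimately show ?thesis
      unfolding graded_ideal_def L_def by (auto simp: r_simps X.grade_closed intro: X.grade_add)
  qed
  have M: "graded_ideal X M"
    unfolding graded_ideal_def M_def
    by (auto simp: r_simps X.grade_closed intro: X.grade_add X.mult_grade)
  have tI: "vspan L i (t x)" if "?I i x" for i x
    using that
  proof (induction rule: ideal_gen.induct)
    case (zero i)
    then show ?case by (simp add: t_simps var_span.zero)
  next
    case (base x i)
    then obtain n where n: "n \<in> N i" "x = g n" by blast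
    have nc: "n \<in> carrier P" using NP[OF n(1)] P.grade_closed by blast
    have "s n \<in> L i" using n NP ghom_grade[OF dghom_ghom[OF s]] rs nc by (auto simp: L_def)
    then have "vspan L i (h (s n))" by (rule var_span.base)
    then show ?case using hs nc n by simp
  next
    case (mult a j i x)
    have "vspan (grade X) j (t a)" using ghom_grade[OF dghom_ghom[OF t] mult(1)] grade_eq_vspan by blast
    from wspan_mult[OF L mult(3) this] show ?case
      using R.grade_closed[OF mult(1)] R.grade_closed[OF I_grade[OF mult(2)]] by (simp add: t_simps)
  next
    case (add i x y)
    then show ?case using var_span.add[OF add(3,4)] R.grade_closed[OF I_grade[OF add(1)]]
        R.grade_closed[OF I_grade[OF add(2)]] by (simp add: t_simps)
  qed
  have qL: "?I i (q y)" if "wspan (\<lambda>_. 0) L i n y" for i n y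
    using that
  proof (induction rule: var_span.induct)
    case (base l i n)
    then have l: "r l \<in> N i" "l \<in> carrier X" using X.grade_closed by (auto simp: L_def)
    have "?I i (g (r l))" by (rule ideal_gen.base) (rule imageI[OF l(1)])
    then show ?case using gr l(2) by simp
  next
    case (var x i n y)
    then show ?case
      using ideal_gen.mult[OF ghom_grade[OF dghom_ghom[OF q] var_grade[OF var(1)]] var(3)]
        var_closed[OF var(1)] wspan_closed[OF L var(2)] by (simp add: q_simps)
  next
    case (add i n y z)
    then show ?case using ideal_gen.add[OF add(3,4)] wspan_closed[OF L add(1)] wspan_closed[OF L add(2)]
      by (simp add: q_simps)
  qed (simp add: q_simps ideal_gen.zero)
  have qM: "q y = \<zero>\<^bsub>R\<^esub>" if "wspan (\<lambda>_. 0) M i n y" for i n y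
    using that
  proof (induction rule: var_span.induct)
    case (base l i n)
    then have "r l = \<zero>\<^bsub>P\<^esub>" "l \<in> carrier X" using X.grade_closed by (auto simp: M_def)
    then show ?case using gr ghom_zero[OF dghom_ghom[OF g] P.ring_axioms R.ring_axioms] by auto
  next
    case (var x i n y)
    then show ?case
      using var_closed[OF var(1)] wspan_closed[OF M var(2)] by (simp add: q_simps)
  next
    case (add i n y z)
    then show ?case using wspan_closed[OF M add(1)] wspan_closed[OF M add(2)]
      by (simp add: q_simps)
  qed (simp add: q_simps)
  have jc: "j \<in> carrier R" using I_grade[OF j(1)] R.grade_closed by blast
  have "\<exists>w. vspan L (i - 1) w \<and> vspan M i (t j \<ominus>\<^bsub>Y\<^esub> differential Y w)"
  proof (rule vspan_acyclic[OF K(1) _ L M _ _ _ _ tI[OF j(1)]])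
    show "nat_K n \<noteq> \<zero>\<^bsub>K\<^esub>" if "n > 0" for n using K(2)[OF that] by (simp add: nat_K_def)
    show "M i \<subseteq> L i" for i using N unfolding M_def L_def graded_ideal_def by auto
    show "differential X l \<in> L (i + 1)" if "l \<in> L i" for i l
      using that X.d_grade dN X.grade_closed by (auto simp: L_def r_simps)
    show "differential X l \<in> M (i + 1)" if "l \<in> M i" for i l
      using that X.d_grade X.grade_closed by (auto simp: M_def r_simps)
    show "vspan M (i + 1) (differential Y (t j))"
      using j(2) t_simps(4) by (simp add: dghom_d[OF t jc, symmetric] var_span.zero)
    show "\<exists>l'\<in>L (i - 1). l \<ominus>\<^bsub>X\<^esub> differential X l' \<in> M i"
      if l: "l \<in> L i" "differential X l \<in> M (i + 1)" for i l
    proof -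
      have lx: "l \<in> grade X i" "l \<in> carrier X" "r l \<in> N i" using l X.grade_closed by (auto simp: L_def)
      have "differential P (r l) = \<zero>\<^bsub>P\<^esub>" using l(2) lx by (simp add: M_def r_simps)
      then obtain n where n: "n \<in> N (i - 1)" "differential P n = r l" using acyc[OF lx(3)] by blast
      have nc: "n \<in> grade P (i - 1)" "n \<in> carrier P" using NP[OF n(1)] P.grade_closed by auto
      have sn: "s n \<in> grade X (i - 1)" "s n \<in> carrier X" "r (s n) = n"
        using ghom_grade[OF dghom_ghom[OF s] nc(1)] X.grade_closed rs nc by auto
      have "differential X (s n) \<in> grade X i" using X.d_grade[OF sn(1)] by simp
      then have "l \<ominus>\<^bsub>X\<^esub> differential X (s n) \<in> grade X i" using lx(1) by (intro X.grade_minus)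
      moreover have "r (l \<ominus>\<^bsub>X\<^esub> differential X (s n)) = \<zero>\<^bsub>P\<^esub>"
        using lx sn n X.d_closed[OF sn(2)] r_simps(1)[OF lx(2)] by (simp add: r_simps(5,6) P.minus_eq_zero_iff)
      ultimately show ?thesis using sn n by (intro bexI[of _ "s n"]) (auto simp: L_def M_def)
    qed
  qed
  then obtain w where w: "vspan L (i - 1) w" "vspan M i (t j \<ominus>\<^bsub>Y\<^esub> differential Y w)" by blast
  note wc = wspan_closed[OF L w(1)]
  have "q (t j \<ominus>\<^bsub>Y\<^esub> differential Y w) = \<zero>\<^bsub>R\<^esub>" by (rule qM[OF w(2)])
  then have "j \<ominus>\<^bsub>R\<^esub> differential R (q w) = \<zero>\<^bsub>R\<^esub>"
    using qt jc wc Y.d_closed[OF wc] t_simps(1)[OF jc] by (simp add: q_simps(5,6))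
  then have "differential R (q w) = j"
    using jc R.d_closed[OF q_simps(1)[OF wc]] by (simp add: R.minus_eq_zero_iff)
  then show ?thesis using qL[OF w(1)] by blast
qed

section \<open>Quotients by graded ideals\<close>

text \<open>
  Cosets are represented by chosen elements, so that a quotient of \<open>A\<close> lies in the same type as \<open>A\<close>.
\<close>

definition quotient_rep :: "('k, 'u, 'z) dga_scheme \<Rightarrow> 'u set \<Rightarrow> 'u set \<Rightarrow> 'u \<Rightarrow> 'u" where
  "quotient_rep A W J x = (SOME y. y \<in> W \<and> y \<ominus>\<^bsub>A\<^esub> x \<in> J)"

lemma (in graded_comm_algebra)
  assumes J: "\<zero>\<^bsub>A\<^esub> \<in> J" "\<And>x y. \<lbrakk>x \<in> J; y \<in> J\<rbrakk> \<Longrightarrow> x \<oplus>\<^bsub>A\<^esub> y \<in> J" "\<And>k x. \<lbrakk>k \<in> carrier K; x \<in> J\<rbrakk> \<Longrightarrow> k \<odot>\<^bsub>A\<^esub> x \<in> J"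
    and W: "J \<subseteq> W" "W \<subseteq> carrier A" and x: "x \<in> W"
  shows quotient_rep_in: "quotient_rep A W J x \<in> W"
    and quotient_rep_eq_iff: "y \<in> W \<Longrightarrow> quotient_rep A W J x = quotient_rep A W J y \<longleftrightarrow> x \<ominus>\<^bsub>A\<^esub> y \<in> J"
proof -
  have neg: "\<ominus>\<^bsub>A\<^esub> x \<in> J" if "x \<in> J" for x
  proof -
    have "x \<in> carrier A" using that W by blast
    then show ?thesis using J(3)[of "\<ominus>\<^bsub>K\<^esub> \<one>\<^bsub>K\<^esub>" x] that by (simp add: smult_l_minus smult_one)
  qed
  have r: "quotient_rep A W J x \<in> W \<and> quotient_rep A W J x \<ominus>\<^bsub>A\<^esub> x \<in> J" if x: "x \<in> W" for x
  proof -
    have "x \<in> W \<and> x \<ominus>\<^bsub>A\<^esub> x \<in> J" using x W J(1) by (auto simp: a_minus_def r_neg subset_iff)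
    then show ?thesis unfolding quotient_rep_def by (rule someI)
  qed
  then show "quotient_rep A W J x \<in> W" using x by auto
  assume y: "y \<in> W"
  have c: "x \<in> carrier A" "y \<in> carrier A" using x y W by auto
  show "quotient_rep A W J x = quotient_rep A W J y \<longleftrightarrow> x \<ominus>\<^bsub>A\<^esub> y \<in> J"
  proof
    assume xy: "x \<ominus>\<^bsub>A\<^esub> y \<in> J"
    have "z \<ominus>\<^bsub>A\<^esub> x \<in> J \<longleftrightarrow> z \<ominus>\<^bsub>A\<^esub> y \<in> J" if "z \<in> W" for z
    proof -
      have z: "z \<in> carrier A" using that W by blast
      have "z \<ominus>\<^bsub>A\<^esub> y = (z \<ominus>\<^bsub>A\<^esub> x) \<oplus>\<^bsub>A\<^esub> (x \<ominus>\<^bsub>A\<^esub> y)" "z \<ominus>\<^bsub>A\<^esub> x = (z \<ominus>\<^bsub>A\<^esub> y) \<oplus>\<^bsub>A\<^esub> (\<ominus>\<^bsub>A\<^esub> (x \<ominus>\<^bsub>A\<^esub> y))"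
        using z c by algebra+
      then show ?thesis using J(2) xy neg[OF xy] by metis
    qed
    then show "quotient_rep A W J x = quotient_rep A W J y" unfolding quotient_rep_def by metis
  next
    assume e: "quotient_rep A W J x = quotient_rep A W J y"
    let ?r = "quotient_rep A W J x"
    have rc: "?r \<in> carrier A" using r[OF x] W by blast
    have "x \<ominus>\<^bsub>A\<^esub> y = (?r \<ominus>\<^bsub>A\<^esub> y) \<oplus>\<^bsub>A\<^esub> (\<ominus>\<^bsub>A\<^esub> (?r \<ominus>\<^bsub>A\<^esub> x))" using rc c by algebra
    then show "x \<ominus>\<^bsub>A\<^esub> y \<in> J" using r[OF x] r[OF y] e neg J(2) by metis
  qed
qed

definition total_ideal :: "('k, 'u, 'z) dga_scheme \<Rightarrow> (int \<Rightarrow> 'u set) \<Rightarrow> 'u set" where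
  "total_ideal A H = {x \<in> carrier A. \<forall>i. hcomp A i x \<in> H i}"

context graded_comm_algebra
begin

context
  fixes H assumes H: "graded_ideal A H"
begin

lemma H_simps: "x \<in> H i \<Longrightarrow> x \<in> grade A i" "\<zero>\<^bsub>A\<^esub> \<in> H i" "\<lbrakk>x \<in> H i; y \<in> H i\<rbrakk> \<Longrightarrow> x \<oplus>\<^bsub>A\<^esub> y \<in> H i"
  "\<lbrakk>a \<in> grade A j; x \<in> H i\<rbrakk> \<Longrightarrow> a \<otimes>\<^bsub>A\<^esub> x \<in> H (j + i)"
  using H unfolding graded_ideal_def by blast+

lemma total_ideal_homogeneous: "x \<in> grade A i \<Longrightarrow> x \<in> total_ideal A H \<longleftrightarrow> x \<in> H i"
  using grade_closed[of x i] hcomp_homogeneous[of x i] H_simps(2) by (auto simp: total_ideal_def)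

lemma total_ideal_carrier: "x \<in> total_ideal A H \<Longrightarrow> x \<in> carrier A"
  by (simp add: total_ideal_def)

lemma total_ideal_add: "\<lbrakk>x \<in> total_ideal A H; y \<in> total_ideal A H\<rbrakk> \<Longrightarrow> x \<oplus>\<^bsub>A\<^esub> y \<in> total_ideal A H"
  by (simp add: total_ideal_def hcomp_add H_simps)

lemma total_ideal_hcomp: "x \<in> total_ideal A H \<Longrightarrow> hcomp A i x \<in> total_ideal A H"
  using total_ideal_homogeneous[OF hcomp_grade] by (simp add: total_ideal_def)

lemma total_ideal_subquotient:
  "subquotient K A (carrier A) (total_ideal A H) (quotient_rep A (carrier A) (total_ideal A H))"
proof
  fix x y
  { assume "x \<in> total_ideal A H" "y \<in> total_ideal A H"
    then show "x \<oplus>\<^bsub>A\<^esub> y \<in> total_ideal A H" by (rule total_ideal_add) }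
  { assume x: "x \<in> carrier A" and y: "y \<in> total_ideal A H"
    show "x \<otimes>\<^bsub>A\<^esub> y \<in> total_ideal A H" using x
    proof (induction rule: graded_induct)
      case zero
      then show ?case using total_ideal_carrier[OF y] by (simp add: total_ideal_def H_simps)
    next
      case (hom j a)
      have "hcomp A i (a \<otimes>\<^bsub>A\<^esub> y) \<in> H i" for i
        using hcomp_mult_homogeneous[OF hom total_ideal_carrier[OF y], of "i - j"]
          H_simps(4)[OF hom, of "hcomp A (i - j) y" "i - j"] y by (simp add: total_ideal_def)
      then show ?case using grade_closed[OF hom] total_ideal_carrier[OF y] by (simp add: total_ideal_def)
    next
      case (add a b)
      then show ?case using total_ideal_add total_ideal_carrier[OF y] by (simp add: l_distr)
    qed }
  { assume x: "x \<in> total_ideal A H" and y: "y \<in> carrier A"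
    note xc = total_ideal_carrier[OF x]
    show "x \<otimes>\<^bsub>A\<^esub> y \<in> total_ideal A H" using y
    proof (induction rule: graded_induct)
      case zero
      then show ?case using xc by (simp add: total_ideal_def H_simps)
    next
      case (hom j a)
      have "hcomp A i (x \<otimes>\<^bsub>A\<^esub> a) \<in> H i" for i
      proof -
        have "hcomp A (i - j + j) (x \<otimes>\<^bsub>A\<^esub> a) = hcomp A (i - j) x \<otimes>\<^bsub>A\<^esub> a"
          by (rule hcomp_additive_map[where f = "\<lambda>x. x \<otimes>\<^bsub>A\<^esub> a"])
            (use grade_closed[OF hom] mult_grade[OF _ hom] xc in \<open>auto simp: l_distr\<close>)
        also have "\<dots> = signed A ((i - j) * j) (a \<otimes>\<^bsub>A\<^esub> hcomp A (i - j) x)"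
          by (rule graded_comm[OF hcomp_grade[OF xc] hom])
        finally show ?thesis
          using H_simps(4)[OF hom, of "hcomp A (i - j) x" "i - j"] x graded_ideal_neg[OF H]
          by (auto simp: total_ideal_def signed_def)
      qed
      then show ?case using grade_closed[OF hom] xc by (simp add: total_ideal_def)
    next
      case (add a b)
      then show ?case using total_ideal_add xc by (simp add: r_distr)
    qed }
  { fix k assume "k \<in> carrier K" "x \<in> total_ideal A H"
    then show "k \<odot>\<^bsub>A\<^esub> x \<in> total_ideal A H"
      by (auto simp: total_ideal_def hcomp_smult graded_ideal_smult[OF H]) }
  note sm = this
  { fix i assume "x \<in> total_ideal A H" then show "hcomp A i x \<in> total_ideal A H" by (rule total_ideal_hcomp) }
  { assume "x \<in> carrier A" "y \<in> carrier A"
    then show "quotient_rep A (carrier A) (total_ideal A H) x = quotient_rep A (carrier A) (total_ideal A H) y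
      \<longleftrightarrow> x \<ominus>\<^bsub>A\<^esub> y \<in> total_ideal A H"
      by (intro quotient_rep_eq_iff)
        (auto simp: total_ideal_def hcomp_add hcomp_smult H_simps graded_ideal_smult[OF H]) }
qed (auto simp: total_ideal_def H_simps)

end
end

lemma (in graded_dga) total_ideal_dg_subquotient:
  assumes H: "graded_ideal A H" and dH: "\<And>i x. x \<in> H i \<Longrightarrow> differential A x \<in> H (i + 1)"
  shows "dg_subquotient K A (carrier A) (total_ideal A H) (quotient_rep A (carrier A) (total_ideal A H))"
proof (intro dg_subquotient.intro dg_subquotient_axioms.intro total_ideal_subquotient[OF H] graded_dga_axioms)
  fix x assume x: "x \<in> total_ideal A H"
  have "hcomp A i (differential A x) \<in> H i" for i
    using hcomp_d[of x "i - 1"] dH[of "hcomp A (i - 1) x" "i - 1"] x by (simp add: total_ideal_def)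
  then show "differential A x \<in> total_ideal A H" using x d_closed by (simp add: total_ideal_def)
qed (rule d_closed)

text \<open>
  Morphisms that kill the ideal descend to the subquotient; the value at a class is computed at the representative
  \<open>inv_into W c y\<close>.
\<close>

lemma (in subquotient) factor_ghom:
  assumes f: "f \<in> ghom K A B" and B: "graded_comm_algebra K B" and J: "\<And>x. x \<in> J \<Longrightarrow> f x = \<zero>\<^bsub>B\<^esub>"
  shows "(\<lambda>y. f (inv_into W c y)) \<in> ghom K Q B" "x \<in> W \<Longrightarrow> f (inv_into W c (c x)) = f x"
proof -
  interpret B: graded_comm_algebra K B by fact
  have e: "f (inv_into W c (c x)) = f x" if x: "x \<in> W" for x
  proof -
    obtain j where j: "j \<in> J" "inv_into W c (c x) = j \<oplus>\<^bsub>A\<^esub> x" by (rule sec_cong[OF x])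
    then show ?thesis using ghom_add[OF f J_carrier[OF j(1)] W_carrier[OF x]] J[OF j(1)]
        ghom_closed[OF f W_carrier[OF x]] by simp
  qed
  then show "x \<in> W \<Longrightarrow> f (inv_into W c (c x)) = f x" by blast
  show "(\<lambda>y. f (inv_into W c y)) \<in> ghom K Q B"
    by (rule ghomI)
      (auto simp: e Q_simps W_mult W_add W_one W_smult W_carrier ghom_closed[OF f] ghom_mult[OF f]
        ghom_add[OF f] ghom_one[OF f] ghom_smult[OF f] intro: ghom_grade[OF f])
qed

lemma (in dg_subquotient) factor_dghom:
  assumes f: "f \<in> dghom K A B" and B: "graded_comm_algebra K B" and J: "\<And>x. x \<in> J \<Longrightarrow> f x = \<zero>\<^bsub>B\<^esub>"
  shows "(\<lambda>y. f (inv_into W c y)) \<in> dghom K Q B"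
  using factor_ghom[OF dghom_ghom[OF f] B J] dghom_d[OF f W_carrier] W_d
  by (auto simp: dghom_def d_Q)

lemma (in dg_subquotient) c_dghom:
  assumes f: "f \<in> dghom K B A" and "f ` carrier B \<subseteq> W" "\<And>i. grade B i \<subseteq> carrier B"
  shows "(\<lambda>x. c (f x)) \<in> dghom K B Q"
  using c_ghom[OF dghom_ghom[OF f] assms(2,3)] dghom_d[OF f] assms(2) d_Q by (auto simp: dghom_def)

lemma (in graded_dga) id_dghom: "(\<lambda>x. x) \<in> dghom K A A"
  by (simp add: dghom_def id_ghom)

section \<open>Polynomials in a central variable\<close>

text \<open>
  Polynomials over \<open>A\<close> in a variable of degree \<open>0\<close>. The ring is that of the univariate polynomials
  \<open>UP A\<close>, which is an algebra over \<open>A\<close> and has to be regarded as an algebra over \<open>K\<close>.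
\<close>

definition poly_dga :: "('k, 'u, 'z) dga_scheme \<Rightarrow> ((nat \<Rightarrow> 'u) \<Rightarrow> (nat \<Rightarrow> 'u)) \<Rightarrow> ('k, nat \<Rightarrow> 'u) dga" where
  "poly_dga A D = \<lparr>carrier = carrier (UP A), mult = mult (UP A), one = one (UP A), zero = zero (UP A), add = add (UP A),
     smult = \<lambda>k f n. k \<odot>\<^bsub>A\<^esub> f n, grade = \<lambda>i. {f \<in> carrier (UP A). \<forall>n. f n \<in> grade A i}, differential = D\<rparr>"

lemma carrier_poly: "carrier (poly_dga A D) = up A"
  and zero_poly: "\<zero>\<^bsub>poly_dga A D\<^esub> = (\<lambda>n. \<zero>\<^bsub>A\<^esub>)"
  and one_poly: "\<one>\<^bsub>poly_dga A D\<^esub> = (\<lambda>n. if n = 0 then \<one>\<^bsub>A\<^esub> else \<zero>\<^bsub>A\<^esub>)"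
  and add_poly: "\<lbrakk>f \<in> up A; g \<in> up A\<rbrakk> \<Longrightarrow> f \<oplus>\<^bsub>poly_dga A D\<^esub> g = (\<lambda>n. f n \<oplus>\<^bsub>A\<^esub> g n)"
  and mult_poly: "\<lbrakk>f \<in> up A; g \<in> up A\<rbrakk> \<Longrightarrow> f \<otimes>\<^bsub>poly_dga A D\<^esub> g = (\<lambda>n. \<Oplus>\<^bsub>A\<^esub>i\<in>{..n}. f i \<otimes>\<^bsub>A\<^esub> g (n - i))"
  and smult_poly: "k \<odot>\<^bsub>poly_dga A D\<^esub> f = (\<lambda>n. k \<odot>\<^bsub>A\<^esub> f n)"
  and grade_poly: "grade (poly_dga A D) i = {f \<in> up A. \<forall>n. f n \<in> grade A i}"
  and differential_poly: "differential (poly_dga A D) = D"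
  by (simp_all add: poly_dga_def UP_def)

lemmas poly_simps = carrier_poly zero_poly one_poly add_poly mult_poly smult_poly grade_poly differential_poly

lemma up_closed: "f \<in> up A \<Longrightarrow> f n \<in> carrier A"
  by (auto simp: up_def)

lemma up_iff: "f \<in> up A \<longleftrightarrow> (\<forall>n. f n \<in> carrier A) \<and> (\<exists>n. \<forall>m>n. f m = \<zero>\<^bsub>A\<^esub>)"
  unfolding up_def bound_def by auto

lemma up_pointwise:
  assumes "f \<in> up A" "\<And>n. g n \<in> carrier B" "\<And>n. f n = \<zero>\<^bsub>A\<^esub> \<Longrightarrow> g n = \<zero>\<^bsub>B\<^esub>"
  shows "g \<in> up B"
  using assms unfolding up_iff by metis

context graded_comm_algebra
begin

lemma ring_poly: "ring (poly_dga A D)"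
proof -
  interpret PR: ring "UP A" by (rule UP_ring.UP_ring) (simp add: UP_ring_def ring_axioms)
  have [simp]: "carrier (poly_dga A D) = carrier (UP A)" "mult (poly_dga A D) = mult (UP A)"
    "one (poly_dga A D) = one (UP A)" "zero (poly_dga A D) = zero (UP A)" "add (poly_dga A D) = add (UP A)"
    by (simp_all add: poly_dga_def)
  show ?thesis
  proof (rule ringI)
    show "abelian_group (poly_dga A D)"
    proof (rule abelian_groupI)
      fix x assume "x \<in> carrier (poly_dga A D)"
      then show "\<exists>y\<in>carrier (poly_dga A D). y \<oplus>\<^bsub>poly_dga A D\<^esub> x = \<zero>\<^bsub>poly_dga A D\<^esub>"
        using PR.l_neg[of x] PR.a_inv_closed[of x] by auto
    qed (simp_all add: PR.a_ac)
    show "monoid (poly_dga A D)"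
      by (rule monoidI) (simp_all add: PR.m_assoc)
  qed (simp_all add: PR.l_distr PR.r_distr)
qed

lemma neg_poly: assumes "f \<in> up A" shows "\<ominus>\<^bsub>poly_dga A D\<^esub> f = (\<lambda>n. \<ominus>\<^bsub>A\<^esub> f n)"
proof -
  interpret P: ring "poly_dga A D" by (rule ring_poly)
  have n: "(\<lambda>n. \<ominus>\<^bsub>A\<^esub> f n) \<in> up A" by (rule up_pointwise[OF assms]) (auto simp: up_closed[OF assms])
  show ?thesis
    by (rule P.minus_equality) (use assms n in \<open>simp_all add: poly_simps l_neg up_closed[OF assms]\<close>)
qed

lemma signed_poly: "f \<in> up A \<Longrightarrow> signed (poly_dga A D) i f = (\<lambda>n. signed A i (f n))"
  by (simp add: signed_def neg_poly)

lemma additive_finsum: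
  assumes "\<And>x. x \<in> carrier A \<Longrightarrow> \<delta> x \<in> carrier A" "\<delta> \<zero>\<^bsub>A\<^esub> = \<zero>\<^bsub>A\<^esub>"
    "\<And>x y. \<lbrakk>x \<in> carrier A; y \<in> carrier A\<rbrakk> \<Longrightarrow> \<delta> (x \<oplus>\<^bsub>A\<^esub> y) = \<delta> x \<oplus>\<^bsub>A\<^esub> \<delta> y"
    and "finite F" "\<And>i. i \<in> F \<Longrightarrow> f i \<in> carrier A"
  shows "\<delta> (\<Oplus>\<^bsub>A\<^esub>i\<in>F. f i) = (\<Oplus>\<^bsub>A\<^esub>i\<in>F. \<delta> (f i))"
  using assms(4,5)
proof (induction F rule: finite_induct)
  case (insert x F)
  then have "f \<in> F \<rightarrow> carrier A" "(\<lambda>i. \<delta> (f i)) \<in> F \<rightarrow> carrier A" using assms(1) by auto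
  then show ?case using insert assms(1,3) by (simp add: finsum_closed)
qed (simp add: assms(2))

lemma signed_finsum:
  "finite F \<Longrightarrow> (\<And>i. i \<in> F \<Longrightarrow> f i \<in> carrier A) \<Longrightarrow> signed A j (\<Oplus>\<^bsub>A\<^esub>i\<in>F. f i) = (\<Oplus>\<^bsub>A\<^esub>i\<in>F. signed A j (f i))"
  by (rule additive_finsum[of "signed A j"]) (auto simp: signed_add)

lemma poly_graded_comm_algebra: "graded_comm_algebra K (poly_dga A D)"
proof -
  interpret P: ring "poly_dga A D" by (rule ring_poly)
  have sm: "(\<lambda>n. k \<odot>\<^bsub>A\<^esub> f n) \<in> up A" if "k \<in> carrier K" "f \<in> up A" for k f
    by (rule up_pointwise[OF that(2)]) (use that in \<open>auto simp: up_closed\<close>)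
  have ad: "(\<lambda>n. f n \<oplus>\<^bsub>A\<^esub> g n) \<in> up A" if "f \<in> up A" "g \<in> up A" for f g
    using up_add_closed[OF that] .
  have ng: "(\<lambda>n. \<ominus>\<^bsub>A\<^esub> f n) \<in> up A" if "f \<in> up A" for f
    by (rule up_pointwise[OF that]) (use that in \<open>auto simp: up_closed\<close>)
  have Pmod: "module K (poly_dga A D)"
    by (rule moduleI)
      (auto simp: R.is_cring P.abelian_group_axioms poly_simps sm ad up_closed smult_l_distr smult_r_distr smult_assoc1)
  have hc: "(\<lambda>n. hcomp A i (f n)) \<in> up A" if "f \<in> up A" for f i
    by (rule up_pointwise[OF that]) (use that in \<open>auto simp: up_closed\<close>)
  show ?thesis
  proof (intro graded_comm_algebra.intro graded_comm_algebra_axioms.intro Pmod ring_poly)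
    fix a f g assume a: "a \<in> carrier K" and f: "f \<in> carrier (poly_dga A D)" and g: "g \<in> carrier (poly_dga A D)"
    have fs: "a \<odot>\<^bsub>A\<^esub> (\<Oplus>\<^bsub>A\<^esub>i\<in>{..n}. f i \<otimes>\<^bsub>A\<^esub> g (n - i)) = (\<Oplus>\<^bsub>A\<^esub>i\<in>{..n}. a \<odot>\<^bsub>A\<^esub> (f i \<otimes>\<^bsub>A\<^esub> g (n - i)))" for n
      by (rule additive_finsum[of "\<lambda>x. a \<odot>\<^bsub>A\<^esub> x"]) (use a f g in \<open>auto simp: smult_r_distr poly_simps up_closed\<close>)
    show "(a \<odot>\<^bsub>poly_dga A D\<^esub> f) \<otimes>\<^bsub>poly_dga A D\<^esub> g = a \<odot>\<^bsub>poly_dga A D\<^esub> (f \<otimes>\<^bsub>poly_dga A D\<^esub> g)"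
      "f \<otimes>\<^bsub>poly_dga A D\<^esub> (a \<odot>\<^bsub>poly_dga A D\<^esub> g) = a \<odot>\<^bsub>poly_dga A D\<^esub> (f \<otimes>\<^bsub>poly_dga A D\<^esub> g)"
      using a f g fs by (simp_all add: poly_simps sm up_closed smult_mult_left smult_mult_right)
  next
    fix i show "submodule (grade (poly_dga A D) i) K (poly_dga A D)"
      by (intro module.submoduleI[OF Pmod])
        (auto simp: poly_simps sm ad ng neg_poly intro: grade_add grade_smult grade_neg P.zero_closed[unfolded poly_simps])
  next
    fix f assume f: "f \<in> carrier (poly_dga A D)"
    show "\<exists>!c. (\<forall>i. c i \<in> grade (poly_dga A D) i) \<and> finite {i. c i \<noteq> \<zero>\<^bsub>poly_dga A D\<^esub>} \<and>
             f = finsum (poly_dga A D) c {i. c i \<noteq> \<zero>\<^bsub>poly_dga A D\<^esub>}"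
    proof (rule P.direct_sumI[where p = "\<lambda>i f n. hcomp A i (f n)"])
      let ?S = "additive_span (poly_dga A D) (\<Union>i. grade (poly_dga A D) i)"
      let ?m = "\<lambda>a n k. if k = n then a else \<zero>\<^bsub>A\<^esub>"
      have mu: "?m a n \<in> up A" if "a \<in> carrier A" for a n using that unfolding up_iff by auto
      have m: "?m a n \<in> ?S" if "a \<in> carrier A" for a n
        using that
      proof (induction rule: graded_induct)
        case zero
        show ?case using additive_span.zero[of "poly_dga A D"] by (simp add: poly_simps)
      next
        case (hom i x)
        then show ?case using mu[OF grade_closed[OF hom]] by (intro additive_span.base UN_I[of i]) (auto simp: poly_simps)
      next
        case (add x y)
        have "?m x n \<oplus>\<^bsub>poly_dga A D\<^esub> ?m y n = ?m (x \<oplus>\<^bsub>A\<^esub> y) n"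
          using add mu by (auto simp: poly_simps)
        then show ?case using additive_span.add[OF add(3,4)] by simp
      qed
      have bounded: "f \<in> ?S" if "f \<in> up A" "\<forall>k\<ge>N. f k = \<zero>\<^bsub>A\<^esub>" for f N
        using that
      proof (induction N arbitrary: f)
        case 0
        then have "f = (\<lambda>_. \<zero>\<^bsub>A\<^esub>)" by auto
        then show ?case using additive_span.zero[of "poly_dga A D"] by (simp add: poly_simps)
      next
        case (Suc N)
        let ?f = "\<lambda>k. if k = N then \<zero>\<^bsub>A\<^esub> else f k"
        have u: "?f \<in> up A" by (rule up_pointwise[OF Suc(2)]) (auto simp: up_closed[OF Suc(2)])
        have "?f \<in> ?S" by (rule Suc(1)[OF u]) (use Suc(3) in \<open>simp add: Suc_le_eq\<close>)
        from additive_span.add[OF this m[OF up_closed[OF Suc(2)], of N N]]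
        show ?case
        proof -
          have "?f \<oplus>\<^bsub>poly_dga A D\<^esub> ?m (f N) N = f"
            using u mu[OF up_closed[OF Suc(2)]] up_closed[OF Suc(2)] by (auto simp: poly_simps)
          then show ?thesis using \<open>?f \<oplus>\<^bsub>poly_dga A D\<^esub> ?m (f N) N \<in> ?S\<close> by simp
        qed
      qed
      show "carrier (poly_dga A D) \<subseteq> ?S"
      proof
        fix g assume "g \<in> carrier (poly_dga A D)"
        then have g: "g \<in> up A" by (simp add: carrier_poly)
        then obtain n where "\<forall>m>n. g m = \<zero>\<^bsub>A\<^esub>" unfolding up_iff by blast
        then show "g \<in> ?S" by (intro bounded[OF g, of "Suc n"]) (simp add: Suc_le_eq)
      qed
    next
      fix i j g assume g: "g \<in> grade (poly_dga A D) i"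
      then have "hcomp A j (g n) = (if j = i then g n else \<zero>\<^bsub>A\<^esub>)" for n
        by (intro hcomp_homogeneous) (simp add: poly_simps)
      then show "(\<lambda>n. hcomp A j (g n)) = (if j = i then g else \<zero>\<^bsub>poly_dga A D\<^esub>)"
        by (simp add: poly_simps)
    qed (use f in \<open>auto simp: poly_simps hc hcomp_grade hcomp_add up_closed intro: P.zero_closed[unfolded poly_simps]\<close>)
  next
    show "\<one>\<^bsub>poly_dga A D\<^esub> \<in> grade (poly_dga A D) 0"
      using P.one_closed one_grade by (auto simp: poly_simps)
  next
    fix f g i j assume f: "f \<in> grade (poly_dga A D) i" and g: "g \<in> grade (poly_dga A D) j"
    have fu: "f \<in> up A" "\<And>n. f n \<in> grade A i" and gu: "g \<in> up A" "\<And>n. g n \<in> grade A j"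
      using f g by (auto simp: poly_simps)
    have sum: "(\<Oplus>\<^bsub>A\<^esub>k\<in>F. u k) \<in> grade A l" if "finite F" "\<And>k. k \<in> F \<Longrightarrow> u k \<in> grade A l" for F u l
      using that
    proof (induction F rule: finite_induct)
      case (insert x F)
      then have "u \<in> F \<rightarrow> carrier A" "u x \<in> carrier A" using grade_closed by blast+
      then show ?case using insert grade_add by simp
    qed simp
    show "f \<otimes>\<^bsub>poly_dga A D\<^esub> g \<in> grade (poly_dga A D) (i + j)"
      using fu gu up_mult_closed[OF fu(1) gu(1)] by (auto simp: poly_simps intro!: sum mult_grade)
    show "f \<otimes>\<^bsub>poly_dga A D\<^esub> g = signed (poly_dga A D) (i * j) (g \<otimes>\<^bsub>poly_dga A D\<^esub> f)"
    proof -
      have "(\<Oplus>\<^bsub>A\<^esub>k\<in>{..n}. f k \<otimes>\<^bsub>A\<^esub> g (n - k)) = signed A (i * j) (\<Oplus>\<^bsub>A\<^esub>k\<in>{..n}. g k \<otimes>\<^bsub>A\<^esub> f (n - k))" for n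
      proof -
        have b: "inj_on (\<lambda>k. n - k) {..n}" by (auto simp: inj_on_def)
        moreover have "(\<lambda>k. n - k) ` {..n} = {..n}"
          by (rule endo_inj_surj) (use b in auto)
        ultimately have b: "inj_on (\<lambda>k. n - k) {..n}" "(\<lambda>k. n - k) ` {..n} = {..n}" by auto
        have "signed A (i * j) (\<Oplus>\<^bsub>A\<^esub>k\<in>{..n}. g k \<otimes>\<^bsub>A\<^esub> f (n - k)) = (\<Oplus>\<^bsub>A\<^esub>k\<in>{..n}. signed A (i * j) (g k \<otimes>\<^bsub>A\<^esub> f (n - k)))"
          by (rule signed_finsum) (auto simp: up_closed[OF fu(1)] up_closed[OF gu(1)])
        also have "\<dots> = (\<Oplus>\<^bsub>A\<^esub>k\<in>(\<lambda>k. n - k) ` {..n}. signed A (i * j) (g k \<otimes>\<^bsub>A\<^esub> f (n - k)))" by (simp add: b)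
        also have "\<dots> = (\<Oplus>\<^bsub>A\<^esub>k\<in>{..n}. signed A (i * j) (g (n - k) \<otimes>\<^bsub>A\<^esub> f (n - (n - k))))"
          by (rule finsum_reindex) (use b in \<open>auto simp: up_closed[OF fu(1)] up_closed[OF gu(1)]\<close>)
        also have "\<dots> = (\<Oplus>\<^bsub>A\<^esub>k\<in>{..n}. f k \<otimes>\<^bsub>A\<^esub> g (n - k))"
          by (rule finsum_cong') (auto simp: up_closed[OF fu(1)] up_closed[OF gu(1)] graded_comm[OF fu(2) gu(2)])
        finally show ?thesis by simp
      qed
      then show ?thesis using fu(1) gu(1) up_mult_closed[OF gu(1) fu(1)] by (simp add: poly_simps signed_poly)
    qed
  qed
qed

end

section \<open>Polynomial paths\<close>

text \<open>
  Polynomial forms on the interval with values in \<open>A\<close>. The entry \<open>(a, b)\<close> at \<open>n\<close> of a sequence stands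
  for \<open>t^n (a + dt b)\<close>, whose differential is
  \<open>t^n (d a) + n t^(n-1) dt a - t^n dt (d b)\<close>.
\<close>

definition path_diff :: "('k, 'm) ring_scheme \<Rightarrow> ('k, 'u, 'z) dga_scheme \<Rightarrow> (nat \<Rightarrow> 'u \<times> 'u) \<Rightarrow> (nat \<Rightarrow> 'u \<times> 'u)" where
  "path_diff K A f = (\<lambda>n. (differential A (fst (f n)),
     (([Suc n] \<cdot>\<^bsub>K\<^esub> \<one>\<^bsub>K\<^esub>) \<odot>\<^bsub>A\<^esub> fst (f (Suc n))) \<ominus>\<^bsub>A\<^esub> differential A (snd (f n))))"

definition path_dga :: "('k, 'm) ring_scheme \<Rightarrow> ('k, 'u, 'z) dga_scheme \<Rightarrow> ('k, nat \<Rightarrow> 'u \<times> 'u) dga" where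
  "path_dga K A = poly_dga (eps_ext A (- 1)) (path_diff K A)"

context graded_comm_algebra
begin

lemma hcomp_eqI:
  assumes "\<And>x y. \<lbrakk>x \<in> carrier A; y \<in> carrier A\<rbrakk> \<Longrightarrow> p (x \<oplus>\<^bsub>A\<^esub> y) = p x \<oplus>\<^bsub>A\<^esub> p y"
    and hom: "\<And>j x. x \<in> grade A j \<Longrightarrow> p x = (if j = i then x else \<zero>\<^bsub>A\<^esub>)" and "x \<in> carrier A"
  shows "hcomp A i x = p x"
  using assms(3)
proof (induction rule: graded_induct)
  case zero
  show ?case using hom[OF grade_zero, of i] by simp
next
  case (hom j x)
  then show ?case using assms(2)[OF hom] hcomp_homogeneous[OF hom] by simp
qed (simp add: hcomp_add assms(1))

lemma hcomp_twist: "x \<in> carrier A \<Longrightarrow> hcomp A i (twist A m x) = signed A (m * i) (hcomp A i x)"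
proof (induction rule: graded_induct)
  case (hom j x)
  then show ?case using hcomp_homogeneous[OF grade_signed[OF hom]] hcomp_homogeneous[OF hom]
    by (simp add: twist_homogeneous[OF hom])
qed (simp_all add: twist_add hcomp_add signed_add)

lemma neg_eps: "x \<in> carrier A \<times> carrier A \<Longrightarrow> \<ominus>\<^bsub>eps_ext A m\<^esub> x = (\<ominus>\<^bsub>A\<^esub> fst x, \<ominus>\<^bsub>A\<^esub> snd x)"
proof -
  interpret E: ring "eps_ext A m" by (rule eps_ext_ring)
  show "x \<in> carrier A \<times> carrier A \<Longrightarrow> \<ominus>\<^bsub>eps_ext A m\<^esub> x = (\<ominus>\<^bsub>A\<^esub> fst x, \<ominus>\<^bsub>A\<^esub> snd x)"
    by (rule E.minus_equality) (auto simp: l_neg)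
qed

lemma signed_eps: "x \<in> carrier A \<times> carrier A \<Longrightarrow> signed (eps_ext A m) i x = (signed A i (fst x), signed A i (snd x))"
  by (simp add: signed_def neg_eps)

lemma hcomp_eps:
  assumes "x \<in> carrier (eps_ext A m)"
  shows "hcomp (eps_ext A m) i x = (hcomp A i (fst x), hcomp A (i + m) (snd x))"
proof -
  interpret E: graded_comm_algebra K "eps_ext A m" by (rule eps_ext_graded_comm_algebra)
  show ?thesis by (rule E.hcomp_eqI[OF _ _ assms]) (auto simp: hcomp_add hcomp_homogeneous)
qed

lemma hcomp_poly:
  assumes "f \<in> up A" shows "hcomp (poly_dga A D) i f = (\<lambda>n. hcomp A i (f n))"
proof -
  interpret P: graded_comm_algebra K "poly_dga A D" by (rule poly_graded_comm_algebra)
  show ?thesis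
  proof (rule P.hcomp_eqI)
    fix j g assume g: "g \<in> grade (poly_dga A D) j"
    then have "hcomp A i (g n) = (if i = j then g n else \<zero>\<^bsub>A\<^esub>)" for n
      by (intro hcomp_homogeneous) (simp add: poly_simps)
    then show "(\<lambda>n. hcomp A i (g n)) = (if j = i then g else \<zero>\<^bsub>poly_dga A D\<^esub>)" by (simp add: poly_simps)
  next
    fix x y assume xy: "x \<in> carrier (poly_dga A D)" "y \<in> carrier (poly_dga A D)"
    have "(\<lambda>n. hcomp A i (z n)) \<in> up A" if "z \<in> up A" for z
      by (rule up_pointwise[OF that]) (use up_closed[OF that] in auto)
    then show "(\<lambda>n. hcomp A i ((x \<oplus>\<^bsub>poly_dga A D\<^esub> y) n)) = (\<lambda>n. hcomp A i (x n)) \<oplus>\<^bsub>poly_dga A D\<^esub> (\<lambda>n. hcomp A i (y n))"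
      using xy up_closed[of x A] up_closed[of y A] by (simp add: poly_simps hcomp_add)
  qed (simp add: assms poly_simps)
qed

lemma finsum_eps:
  assumes "finite F" "\<And>i. i \<in> F \<Longrightarrow> u i \<in> carrier A \<times> carrier A"
  shows "finsum (eps_ext A m) u F = ((\<Oplus>\<^bsub>A\<^esub>i\<in>F. fst (u i)), (\<Oplus>\<^bsub>A\<^esub>i\<in>F. snd (u i)))"
proof -
  interpret E: ring "eps_ext A m" by (rule eps_ext_ring)
  show ?thesis using assms
  proof (induction F rule: finite_induct)
    case (insert x F)
    have "(\<lambda>i. fst (u i)) \<in> F \<rightarrow> carrier A" "(\<lambda>i. snd (u i)) \<in> F \<rightarrow> carrier A" "u \<in> F \<rightarrow> carrier (eps_ext A m)"
      "u x \<in> carrier A \<times> carrier A" using insert(4) by (auto simp: mem_Times_iff)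
    then show ?case using insert by (simp add: mem_Times_iff)
  qed simp
qed

end

lemma path_simps:
  "carrier (path_dga K A) = up (eps_ext A (- 1))" "differential (path_dga K A) = path_diff K A"
  "f \<in> grade (path_dga K A) i \<longleftrightarrow> f \<in> up (eps_ext A (- 1)) \<and> (\<forall>n. fst (f n) \<in> grade A i \<and> snd (f n) \<in> grade A (i - 1))"
  "\<zero>\<^bsub>path_dga K A\<^esub> = (\<lambda>n. (\<zero>\<^bsub>A\<^esub>, \<zero>\<^bsub>A\<^esub>))"
  by (auto simp: path_dga_def poly_simps mem_Times_iff)

lemma path_smult: "k \<odot>\<^bsub>path_dga K A\<^esub> f = (\<lambda>n. (k \<odot>\<^bsub>A\<^esub> fst (f n), k \<odot>\<^bsub>A\<^esub> snd (f n)))"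
  by (simp add: path_dga_def poly_simps)

lemma path_one: "\<one>\<^bsub>path_dga K A\<^esub> = (\<lambda>n. if n = 0 then (\<one>\<^bsub>A\<^esub>, \<zero>\<^bsub>A\<^esub>) else (\<zero>\<^bsub>A\<^esub>, \<zero>\<^bsub>A\<^esub>))"
  by (auto simp: path_dga_def poly_simps)

lemma path_add: "\<lbrakk>f \<in> up (eps_ext A (- 1)); g \<in> up (eps_ext A (- 1))\<rbrakk> \<Longrightarrow>
    f \<oplus>\<^bsub>path_dga K A\<^esub> g = (\<lambda>n. (fst (f n) \<oplus>\<^bsub>A\<^esub> fst (g n), snd (f n) \<oplus>\<^bsub>A\<^esub> snd (g n)))"
  by (simp add: path_dga_def poly_simps)

lemma up_eps_iff: "f \<in> up (eps_ext A m) \<longleftrightarrow> (\<forall>n. fst (f n) \<in> carrier A \<and> snd (f n) \<in> carrier A) \<and>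
    (\<exists>n. \<forall>k>n. f k = (\<zero>\<^bsub>A\<^esub>, \<zero>\<^bsub>A\<^esub>))"
  by (simp add: up_iff mem_Times_iff)

context graded_dga
begin

lemma path_mult:
  assumes "f \<in> up (eps_ext A (- 1))" "g \<in> up (eps_ext A (- 1))"
  shows "f \<otimes>\<^bsub>path_dga K A\<^esub> g = (\<lambda>n. ((\<Oplus>\<^bsub>A\<^esub>k\<in>{..n}. fst (f k) \<otimes>\<^bsub>A\<^esub> fst (g (n - k))),
    (\<Oplus>\<^bsub>A\<^esub>k\<in>{..n}. (snd (f k) \<otimes>\<^bsub>A\<^esub> fst (g (n - k))) \<oplus>\<^bsub>A\<^esub> (twist A (- 1) (fst (f k)) \<otimes>\<^bsub>A\<^esub> snd (g (n - k))))))"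
  using assms unfolding path_dga_def mult_poly[OF assms]
  by (subst finsum_eps) (auto simp: up_eps_iff)

lemma path_hcomp: "f \<in> up (eps_ext A (- 1)) \<Longrightarrow>
  hcomp (path_dga K A) i f = (\<lambda>n. (hcomp A i (fst (f n)), hcomp A (i - 1) (snd (f n))))"
  using graded_comm_algebra.hcomp_poly[OF eps_ext_graded_comm_algebra[of "- 1"], of f "path_diff K A" i]
    up_closed[of f "eps_ext A (- 1)"]
  by (simp add: path_dga_def hcomp_eps)

lemma path_signed: "f \<in> up (eps_ext A (- 1)) \<Longrightarrow>
  signed (path_dga K A) i f = (\<lambda>n. (signed A i (fst (f n)), signed A i (snd (f n))))"
  using graded_comm_algebra.signed_poly[OF eps_ext_graded_comm_algebra[of "- 1"], of f "path_diff K A" i]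
    up_closed[of f "eps_ext A (- 1)"]
  by (simp add: path_dga_def signed_eps)

lemma path_graded_comm_algebra: "graded_comm_algebra K (path_dga K A)"
  unfolding path_dga_def by (rule graded_comm_algebra.poly_graded_comm_algebra[OF eps_ext_graded_comm_algebra])

lemma path_diff_up:
  assumes "f \<in> up (eps_ext A (- 1))" shows "path_diff K A f \<in> up (eps_ext A (- 1))"
proof -
  obtain n where "\<forall>k>n. f k = (\<zero>\<^bsub>A\<^esub>, \<zero>\<^bsub>A\<^esub>)" using assms unfolding up_eps_iff by blast
  then have "\<forall>k>n. path_diff K A f k = (\<zero>\<^bsub>A\<^esub>, \<zero>\<^bsub>A\<^esub>)" by (simp add: path_diff_def a_minus_def)
  then show ?thesis using assms unfolding up_eps_iff by (auto simp: path_diff_def d_closed)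
qed

text \<open>
  The coefficient of \<open>t^n\<close> in the product rule for the derivative with respect to \<open>t\<close>.
\<close>

lemma finsum_derivative:
  assumes a: "\<And>n. a n \<in> carrier A" and c: "\<And>n. c n \<in> carrier A"
  defines "\<kappa> \<equiv> \<lambda>n. [n] \<cdot>\<^bsub>K\<^esub> \<one>\<^bsub>K\<^esub>"
  shows "\<kappa> (Suc n) \<odot>\<^bsub>A\<^esub> (\<Oplus>\<^bsub>A\<^esub>k\<in>{..Suc n}. a k \<otimes>\<^bsub>A\<^esub> c (Suc n - k))
    = (\<Oplus>\<^bsub>A\<^esub>k\<in>{..n}. (\<kappa> (Suc k) \<odot>\<^bsub>A\<^esub> a (Suc k)) \<otimes>\<^bsub>A\<^esub> c (n - k))
      \<oplus>\<^bsub>A\<^esub> (\<Oplus>\<^bsub>A\<^esub>k\<in>{..n}. a k \<otimes>\<^bsub>A\<^esub> (\<kappa> (Suc (n - k)) \<odot>\<^bsub>A\<^esub> c (Suc (n - k))))"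
proof -
  have \<kappa>: "\<kappa> n \<in> carrier K" "\<kappa> 0 = \<zero>\<^bsub>K\<^esub>" for n by (simp_all add: \<kappa>_def)
  have \<kappa>_add: "\<kappa> (m + n) = \<kappa> m \<oplus>\<^bsub>K\<^esub> \<kappa> n" for m n by (simp add: \<kappa>_def R.add.nat_pow_mult)
  let ?t = "\<lambda>k. a k \<otimes>\<^bsub>A\<^esub> c (Suc n - k)"
  have t: "?t k \<in> carrier A" for k using a c by simp
  have "\<kappa> (Suc n) \<odot>\<^bsub>A\<^esub> (\<Oplus>\<^bsub>A\<^esub>k\<in>{..Suc n}. ?t k) = (\<Oplus>\<^bsub>A\<^esub>k\<in>{..Suc n}. \<kappa> (Suc n) \<odot>\<^bsub>A\<^esub> ?t k)"
    by (rule additive_finsum[of "\<lambda>x. \<kappa> (Suc n) \<odot>\<^bsub>A\<^esub> x"]) (auto simp: t \<kappa> smult_r_distr)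
  also have "\<dots> = (\<Oplus>\<^bsub>A\<^esub>k\<in>{..Suc n}. \<kappa> k \<odot>\<^bsub>A\<^esub> ?t k \<oplus>\<^bsub>A\<^esub> \<kappa> (Suc n - k) \<odot>\<^bsub>A\<^esub> ?t k)"
  proof (rule finsum_cong')
    fix k assume "k \<in> {..Suc n}"
    then have "\<kappa> (Suc n) = \<kappa> k \<oplus>\<^bsub>K\<^esub> \<kappa> (Suc n - k)" using \<kappa>_add[of k "Suc n - k"] by simp
    then show "\<kappa> (Suc n) \<odot>\<^bsub>A\<^esub> ?t k = \<kappa> k \<odot>\<^bsub>A\<^esub> ?t k \<oplus>\<^bsub>A\<^esub> \<kappa> (Suc n - k) \<odot>\<^bsub>A\<^esub> ?t k"
      using t[of k] \<kappa> by (simp add: smult_l_distr)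
  qed (use t \<kappa> in auto)
  also have "\<dots> = (\<Oplus>\<^bsub>A\<^esub>k\<in>{..Suc n}. \<kappa> k \<odot>\<^bsub>A\<^esub> ?t k) \<oplus>\<^bsub>A\<^esub> (\<Oplus>\<^bsub>A\<^esub>k\<in>{..Suc n}. \<kappa> (Suc n - k) \<odot>\<^bsub>A\<^esub> ?t k)"
    by (rule finsum_addf) (use t \<kappa> in auto)
  also have "(\<Oplus>\<^bsub>A\<^esub>k\<in>{..Suc n}. \<kappa> k \<odot>\<^bsub>A\<^esub> ?t k) = (\<Oplus>\<^bsub>A\<^esub>k\<in>{..n}. (\<kappa> (Suc k) \<odot>\<^bsub>A\<^esub> a (Suc k)) \<otimes>\<^bsub>A\<^esub> c (n - k))"
    using t \<kappa> a c by (subst finsum_Suc2) (auto simp: smult_mult_left)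
  also have "(\<Oplus>\<^bsub>A\<^esub>k\<in>{..Suc n}. \<kappa> (Suc n - k) \<odot>\<^bsub>A\<^esub> ?t k)
    = (\<Oplus>\<^bsub>A\<^esub>k\<in>{..n}. a k \<otimes>\<^bsub>A\<^esub> (\<kappa> (Suc (n - k)) \<odot>\<^bsub>A\<^esub> c (Suc (n - k))))"
  proof -
    have "(\<Oplus>\<^bsub>A\<^esub>k\<in>{..Suc n}. \<kappa> (Suc n - k) \<odot>\<^bsub>A\<^esub> ?t k) = (\<Oplus>\<^bsub>A\<^esub>k\<in>{..n}. \<kappa> (Suc n - k) \<odot>\<^bsub>A\<^esub> ?t k)"
      using t[of "Suc n"] t \<kappa> by (subst finsum_Suc) (auto intro!: l_zero finsum_closed)
    also have "\<dots> = (\<Oplus>\<^bsub>A\<^esub>k\<in>{..n}. a k \<otimes>\<^bsub>A\<^esub> (\<kappa> (Suc (n - k)) \<odot>\<^bsub>A\<^esub> c (Suc (n - k))))"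
      by (rule finsum_cong') (use a c \<kappa> in \<open>auto simp: smult_mult_right Suc_diff_le\<close>)
    finally show ?thesis .
  qed
  finally show ?thesis .
qed

lemma path_leibniz:
  assumes f: "f \<in> grade (path_dga K A) i" and g: "g \<in> up (eps_ext A (- 1))"
  shows "path_diff K A (f \<otimes>\<^bsub>path_dga K A\<^esub> g) = (path_diff K A f \<otimes>\<^bsub>path_dga K A\<^esub> g)
     \<oplus>\<^bsub>path_dga K A\<^esub> signed (path_dga K A) i (f \<otimes>\<^bsub>path_dga K A\<^esub> path_diff K A g)"
proof -
  interpret P: graded_comm_algebra K "path_dga K A" by (rule path_graded_comm_algebra)
  define a where "a n = fst (f n)" for n
  define b where "b n = snd (f n)" for n
  define a' where "a' n = fst (g n)" for n
  define b' where "b' n = snd (g n)" for n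
  define \<kappa> where "\<kappa> n = [n] \<cdot>\<^bsub>K\<^esub> \<one>\<^bsub>K\<^esub>" for n :: nat
  have fu: "f \<in> up (eps_ext A (- 1))" using f by (simp add: path_simps)
  have gr: "a n \<in> grade A i" "b n \<in> grade A (i - 1)" for n using f by (simp_all add: path_simps a_def b_def)
  have cl [simp]: "a n \<in> carrier A" "b n \<in> carrier A" "a' n \<in> carrier A" "b' n \<in> carrier A" "\<kappa> n \<in> carrier K" for n
    using fu g by (simp_all add: up_eps_iff a_def b_def a'_def b'_def \<kappa>_def)
  note d_closed [simp]
  have tw: "twist A (- 1) (a n) = signed A i (a n)" "twist A (- 1) (differential A (a n)) = signed A (i + 1) (differential A (a n))" for n
    using twist_homogeneous[OF gr(1)] twist_homogeneous[OF d_grade[OF gr(1)]] signed_cong[of "- i" i A]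
      signed_cong[of "- (i + 1)" "i + 1" A] by (simp_all)
  have Df: "path_diff K A f = (\<lambda>n. (differential A (a n), \<kappa> (Suc n) \<odot>\<^bsub>A\<^esub> a (Suc n) \<ominus>\<^bsub>A\<^esub> differential A (b n)))"
    and Dg: "path_diff K A g = (\<lambda>n. (differential A (a' n), \<kappa> (Suc n) \<odot>\<^bsub>A\<^esub> a' (Suc n) \<ominus>\<^bsub>A\<^esub> differential A (b' n)))"
    by (simp_all add: path_diff_def a_def b_def a'_def b'_def \<kappa>_def)
  have fg: "f \<otimes>\<^bsub>path_dga K A\<^esub> g = (\<lambda>n. ((\<Oplus>\<^bsub>A\<^esub>k\<in>{..n}. a k \<otimes>\<^bsub>A\<^esub> a' (n - k)),
    (\<Oplus>\<^bsub>A\<^esub>k\<in>{..n}. b k \<otimes>\<^bsub>A\<^esub> a' (n - k) \<oplus>\<^bsub>A\<^esub> signed A i (a k) \<otimes>\<^bsub>A\<^esub> b' (n - k))))"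
    using path_mult[OF fu g] by (simp add: tw[unfolded a_def] a_def b_def a'_def b'_def)
  have Dfg: "path_diff K A f \<otimes>\<^bsub>path_dga K A\<^esub> g = (\<lambda>n. ((\<Oplus>\<^bsub>A\<^esub>k\<in>{..n}. differential A (a k) \<otimes>\<^bsub>A\<^esub> a' (n - k)),
    (\<Oplus>\<^bsub>A\<^esub>k\<in>{..n}. (\<kappa> (Suc k) \<odot>\<^bsub>A\<^esub> a (Suc k) \<ominus>\<^bsub>A\<^esub> differential A (b k)) \<otimes>\<^bsub>A\<^esub> a' (n - k)
       \<oplus>\<^bsub>A\<^esub> signed A (i + 1) (differential A (a k)) \<otimes>\<^bsub>A\<^esub> b' (n - k))))"
    unfolding path_mult[OF path_diff_up[OF fu] g] unfolding Df by (simp add: tw a'_def b'_def)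
  have fDg: "f \<otimes>\<^bsub>path_dga K A\<^esub> path_diff K A g = (\<lambda>n. ((\<Oplus>\<^bsub>A\<^esub>k\<in>{..n}. a k \<otimes>\<^bsub>A\<^esub> differential A (a' (n - k))),
    (\<Oplus>\<^bsub>A\<^esub>k\<in>{..n}. b k \<otimes>\<^bsub>A\<^esub> differential A (a' (n - k)) \<oplus>\<^bsub>A\<^esub>
       signed A i (a k) \<otimes>\<^bsub>A\<^esub> (\<kappa> (Suc (n - k)) \<odot>\<^bsub>A\<^esub> a' (Suc (n - k)) \<ominus>\<^bsub>A\<^esub> differential A (b' (n - k))))))"
    unfolding path_mult[OF fu path_diff_up[OF g]] unfolding Dg by (simp add: tw[unfolded a_def] a_def b_def)
  have up1: "path_diff K A f \<otimes>\<^bsub>path_dga K A\<^esub> g \<in> up (eps_ext A (- 1))"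
    and up2: "f \<otimes>\<^bsub>path_dga K A\<^esub> path_diff K A g \<in> up (eps_ext A (- 1))"
    using P.m_closed fu g path_diff_up by (simp_all add: path_simps)
  have up3: "signed (path_dga K A) i (f \<otimes>\<^bsub>path_dga K A\<^esub> path_diff K A g) \<in> up (eps_ext A (- 1))"
    using P.signed_closed up2 by (simp add: path_simps)
  have dsum: "differential A (\<Oplus>\<^bsub>A\<^esub>k\<in>{..n}. u k) = (\<Oplus>\<^bsub>A\<^esub>k\<in>{..n}. differential A (u k))"
    if "\<And>k. u k \<in> carrier A" for u and n :: nat
    by (rule additive_finsum[of "differential A"]) (auto simp: d_add that)
  have 12: "differential A (\<Oplus>\<^bsub>A\<^esub>k\<in>{..n}. a k \<otimes>\<^bsub>A\<^esub> a' (n - k))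
      = (\<Oplus>\<^bsub>A\<^esub>k\<in>{..n}. differential A (a k) \<otimes>\<^bsub>A\<^esub> a' (n - k))
        \<oplus>\<^bsub>A\<^esub> signed A i (\<Oplus>\<^bsub>A\<^esub>k\<in>{..n}. a k \<otimes>\<^bsub>A\<^esub> differential A (a' (n - k))) \<and>
      \<kappa> (Suc n) \<odot>\<^bsub>A\<^esub> (\<Oplus>\<^bsub>A\<^esub>k\<in>{..Suc n}. a k \<otimes>\<^bsub>A\<^esub> a' (Suc n - k))
        \<ominus>\<^bsub>A\<^esub> differential A (\<Oplus>\<^bsub>A\<^esub>k\<in>{..n}. b k \<otimes>\<^bsub>A\<^esub> a' (n - k) \<oplus>\<^bsub>A\<^esub> signed A i (a k) \<otimes>\<^bsub>A\<^esub> b' (n - k))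
      = (\<Oplus>\<^bsub>A\<^esub>k\<in>{..n}. (\<kappa> (Suc k) \<odot>\<^bsub>A\<^esub> a (Suc k) \<ominus>\<^bsub>A\<^esub> differential A (b k)) \<otimes>\<^bsub>A\<^esub> a' (n - k)
       \<oplus>\<^bsub>A\<^esub> signed A (i + 1) (differential A (a k)) \<otimes>\<^bsub>A\<^esub> b' (n - k))
       \<oplus>\<^bsub>A\<^esub> signed A i (\<Oplus>\<^bsub>A\<^esub>k\<in>{..n}. b k \<otimes>\<^bsub>A\<^esub> differential A (a' (n - k)) \<oplus>\<^bsub>A\<^esub>
       signed A i (a k) \<otimes>\<^bsub>A\<^esub> (\<kappa> (Suc (n - k)) \<odot>\<^bsub>A\<^esub> a' (Suc (n - k)) \<ominus>\<^bsub>A\<^esub> differential A (b' (n - k))))" for n :: nat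
  proof -
    have "differential A (\<Oplus>\<^bsub>A\<^esub>k\<in>{..n}. a k \<otimes>\<^bsub>A\<^esub> a' (n - k))
      = (\<Oplus>\<^bsub>A\<^esub>k\<in>{..n}. differential A (a k) \<otimes>\<^bsub>A\<^esub> a' (n - k) \<oplus>\<^bsub>A\<^esub> signed A i (a k \<otimes>\<^bsub>A\<^esub> differential A (a' (n - k))))"
      by (simp add: dsum d_leibniz[OF gr(1)])
    also have "\<dots> = (\<Oplus>\<^bsub>A\<^esub>k\<in>{..n}. differential A (a k) \<otimes>\<^bsub>A\<^esub> a' (n - k))
        \<oplus>\<^bsub>A\<^esub> (\<Oplus>\<^bsub>A\<^esub>k\<in>{..n}. signed A i (a k \<otimes>\<^bsub>A\<^esub> differential A (a' (n - k))))"
      by (rule finsum_addf) auto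
    also have "(\<Oplus>\<^bsub>A\<^esub>k\<in>{..n}. signed A i (a k \<otimes>\<^bsub>A\<^esub> differential A (a' (n - k))))
        = signed A i (\<Oplus>\<^bsub>A\<^esub>k\<in>{..n}. a k \<otimes>\<^bsub>A\<^esub> differential A (a' (n - k)))"
      by (rule signed_finsum[symmetric]) auto
    finally have 1: "differential A (\<Oplus>\<^bsub>A\<^esub>k\<in>{..n}. a k \<otimes>\<^bsub>A\<^esub> a' (n - k))
      = (\<Oplus>\<^bsub>A\<^esub>k\<in>{..n}. differential A (a k) \<otimes>\<^bsub>A\<^esub> a' (n - k))
        \<oplus>\<^bsub>A\<^esub> signed A i (\<Oplus>\<^bsub>A\<^esub>k\<in>{..n}. a k \<otimes>\<^bsub>A\<^esub> differential A (a' (n - k)))" .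
    define t1 where "t1 k = (\<kappa> (Suc k) \<odot>\<^bsub>A\<^esub> a (Suc k)) \<otimes>\<^bsub>A\<^esub> a' (n - k)" for k
    define t2 where "t2 k = a k \<otimes>\<^bsub>A\<^esub> (\<kappa> (Suc (n - k)) \<odot>\<^bsub>A\<^esub> a' (Suc (n - k)))" for k
    define q where "q k = differential A (b k \<otimes>\<^bsub>A\<^esub> a' (n - k) \<oplus>\<^bsub>A\<^esub> signed A i (a k) \<otimes>\<^bsub>A\<^esub> b' (n - k))" for k
    define u where "u k = (\<kappa> (Suc k) \<odot>\<^bsub>A\<^esub> a (Suc k) \<ominus>\<^bsub>A\<^esub> differential A (b k)) \<otimes>\<^bsub>A\<^esub> a' (n - k)
       \<oplus>\<^bsub>A\<^esub> signed A (i + 1) (differential A (a k)) \<otimes>\<^bsub>A\<^esub> b' (n - k)" for k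
    define w where "w k = b k \<otimes>\<^bsub>A\<^esub> differential A (a' (n - k)) \<oplus>\<^bsub>A\<^esub>
       signed A i (a k) \<otimes>\<^bsub>A\<^esub> (\<kappa> (Suc (n - k)) \<odot>\<^bsub>A\<^esub> a' (Suc (n - k)) \<ominus>\<^bsub>A\<^esub> differential A (b' (n - k)))" for k
    have tc [simp]: "t1 k \<in> carrier A" "t2 k \<in> carrier A" "q k \<in> carrier A" "u k \<in> carrier A" "w k \<in> carrier A" for k
      by (simp_all add: t1_def t2_def q_def u_def w_def)
    have key: "t1 k \<oplus>\<^bsub>A\<^esub> t2 k \<oplus>\<^bsub>A\<^esub> \<ominus>\<^bsub>A\<^esub> q k = u k \<oplus>\<^bsub>A\<^esub> signed A i (w k)" for k
    proof -
      have q: "q k = (differential A (b k) \<otimes>\<^bsub>A\<^esub> a' (n - k) \<oplus>\<^bsub>A\<^esub> signed A (i - 1) (b k \<otimes>\<^bsub>A\<^esub> differential A (a' (n - k))))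
        \<oplus>\<^bsub>A\<^esub> (signed A i (differential A (a k) \<otimes>\<^bsub>A\<^esub> b' (n - k)) \<oplus>\<^bsub>A\<^esub> a k \<otimes>\<^bsub>A\<^esub> differential A (b' (n - k)))"
        unfolding q_def by (simp add: d_add signed_mult_left d_signed d_leibniz[OF gr(1)] d_leibniz[OF gr(2)] signed_add signed_signed)
      define x1 where "x1 = differential A (b k) \<otimes>\<^bsub>A\<^esub> a' (n - k)"
      define x2 where "x2 = b k \<otimes>\<^bsub>A\<^esub> differential A (a' (n - k))"
      define x3 where "x3 = differential A (a k) \<otimes>\<^bsub>A\<^esub> b' (n - k)"
      define x4 where "x4 = a k \<otimes>\<^bsub>A\<^esub> differential A (b' (n - k))"
      have xc: "x1 \<in> carrier A" "x2 \<in> carrier A" "x3 \<in> carrier A" "x4 \<in> carrier A"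
        by (simp_all add: x1_def x2_def x3_def x4_def)
      have uu: "u k = (t1 k \<ominus>\<^bsub>A\<^esub> x1) \<oplus>\<^bsub>A\<^esub> signed A (i + 1) x3"
        by (simp add: u_def t1_def x1_def x3_def a_minus_def l_distr l_minus signed_mult_left)
      have ww: "w k = x2 \<oplus>\<^bsub>A\<^esub> signed A i (t2 k \<ominus>\<^bsub>A\<^esub> x4)"
        by (cases "even i") (simp_all add: w_def t2_def x2_def x4_def a_minus_def r_distr r_minus l_minus signed_def minus_add)
      have qq: "q k = (x1 \<oplus>\<^bsub>A\<^esub> signed A (i - 1) x2) \<oplus>\<^bsub>A\<^esub> (signed A i x3 \<oplus>\<^bsub>A\<^esub> x4)"
        by (simp add: q x1_def x2_def x3_def x4_def)
      have "signed A i (w k) = signed A i x2 \<oplus>\<^bsub>A\<^esub> (t2 k \<ominus>\<^bsub>A\<^esub> x4)"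
        unfolding ww using xc by (simp add: signed_add signed_signed)
      then show ?thesis
        unfolding uu qq using xc tc(1,2)[of k]
        by (cases "even i") (simp_all add: signed_def a_minus_def minus_add a_ac)
    qed
    have "\<kappa> (Suc n) \<odot>\<^bsub>A\<^esub> (\<Oplus>\<^bsub>A\<^esub>k\<in>{..Suc n}. a k \<otimes>\<^bsub>A\<^esub> a' (Suc n - k))
        \<ominus>\<^bsub>A\<^esub> differential A (\<Oplus>\<^bsub>A\<^esub>k\<in>{..n}. b k \<otimes>\<^bsub>A\<^esub> a' (n - k) \<oplus>\<^bsub>A\<^esub> signed A i (a k) \<otimes>\<^bsub>A\<^esub> b' (n - k))
      = ((\<Oplus>\<^bsub>A\<^esub>k\<in>{..n}. t1 k) \<oplus>\<^bsub>A\<^esub> (\<Oplus>\<^bsub>A\<^esub>k\<in>{..n}. t2 k)) \<oplus>\<^bsub>A\<^esub> \<ominus>\<^bsub>A\<^esub> (\<Oplus>\<^bsub>A\<^esub>k\<in>{..n}. q k)"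
    proof -
      have "differential A (\<Oplus>\<^bsub>A\<^esub>k\<in>{..n}. b k \<otimes>\<^bsub>A\<^esub> a' (n - k) \<oplus>\<^bsub>A\<^esub> signed A i (a k) \<otimes>\<^bsub>A\<^esub> b' (n - k)) = (\<Oplus>\<^bsub>A\<^esub>k\<in>{..n}. q k)"
        unfolding q_def by (rule dsum) simp
      moreover have "\<kappa> (Suc n) \<odot>\<^bsub>A\<^esub> (\<Oplus>\<^bsub>A\<^esub>k\<in>{..Suc n}. a k \<otimes>\<^bsub>A\<^esub> a' (Suc n - k))
          = (\<Oplus>\<^bsub>A\<^esub>k\<in>{..n}. t1 k) \<oplus>\<^bsub>A\<^esub> (\<Oplus>\<^bsub>A\<^esub>k\<in>{..n}. t2 k)"
        unfolding t1_def t2_def \<kappa>_def by (rule finsum_derivative) simp_all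
      ultimately show ?thesis by (simp only: a_minus_def)
    qed
    also have "\<ominus>\<^bsub>A\<^esub> (\<Oplus>\<^bsub>A\<^esub>k\<in>{..n}. q k) = (\<Oplus>\<^bsub>A\<^esub>k\<in>{..n}. \<ominus>\<^bsub>A\<^esub> q k)"
      by (rule additive_finsum[of "\<lambda>x. \<ominus>\<^bsub>A\<^esub> x"]) (auto simp: minus_add)
    also have "((\<Oplus>\<^bsub>A\<^esub>k\<in>{..n}. t1 k) \<oplus>\<^bsub>A\<^esub> (\<Oplus>\<^bsub>A\<^esub>k\<in>{..n}. t2 k)) \<oplus>\<^bsub>A\<^esub> (\<Oplus>\<^bsub>A\<^esub>k\<in>{..n}. \<ominus>\<^bsub>A\<^esub> q k)
      = (\<Oplus>\<^bsub>A\<^esub>k\<in>{..n}. t1 k \<oplus>\<^bsub>A\<^esub> t2 k \<oplus>\<^bsub>A\<^esub> \<ominus>\<^bsub>A\<^esub> q k)"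
      by (simp add: finsum_addf Pi_def)
    also have "\<dots> = (\<Oplus>\<^bsub>A\<^esub>k\<in>{..n}. u k) \<oplus>\<^bsub>A\<^esub> (\<Oplus>\<^bsub>A\<^esub>k\<in>{..n}. signed A i (w k))"
      unfolding key by (rule finsum_addf) auto
    also have "(\<Oplus>\<^bsub>A\<^esub>k\<in>{..n}. signed A i (w k)) = signed A i (\<Oplus>\<^bsub>A\<^esub>k\<in>{..n}. w k)"
      by (rule signed_finsum[symmetric]) auto
    finally have 2: "\<kappa> (Suc n) \<odot>\<^bsub>A\<^esub> (\<Oplus>\<^bsub>A\<^esub>k\<in>{..Suc n}. a k \<otimes>\<^bsub>A\<^esub> a' (Suc n - k))
        \<ominus>\<^bsub>A\<^esub> differential A (\<Oplus>\<^bsub>A\<^esub>k\<in>{..n}. b k \<otimes>\<^bsub>A\<^esub> a' (n - k) \<oplus>\<^bsub>A\<^esub> signed A i (a k) \<otimes>\<^bsub>A\<^esub> b' (n - k))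
      = (\<Oplus>\<^bsub>A\<^esub>k\<in>{..n}. u k) \<oplus>\<^bsub>A\<^esub> signed A i (\<Oplus>\<^bsub>A\<^esub>k\<in>{..n}. w k)" .
    show ?thesis using 1 2 by (simp only: u_def w_def \<kappa>_def)
  qed
  have L: "path_diff K A (f \<otimes>\<^bsub>path_dga K A\<^esub> g) = (\<lambda>n. (differential A (\<Oplus>\<^bsub>A\<^esub>k\<in>{..n}. a k \<otimes>\<^bsub>A\<^esub> a' (n - k)),
      \<kappa> (Suc n) \<odot>\<^bsub>A\<^esub> (\<Oplus>\<^bsub>A\<^esub>k\<in>{..Suc n}. a k \<otimes>\<^bsub>A\<^esub> a' (Suc n - k))
        \<ominus>\<^bsub>A\<^esub> differential A (\<Oplus>\<^bsub>A\<^esub>k\<in>{..n}. b k \<otimes>\<^bsub>A\<^esub> a' (n - k) \<oplus>\<^bsub>A\<^esub> signed A i (a k) \<otimes>\<^bsub>A\<^esub> b' (n - k))))"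
    unfolding fg path_diff_def \<kappa>_def by (simp only: fst_conv snd_conv)
  show ?thesis
    unfolding path_add[OF up1 up3] unfolding path_signed[OF up2] unfolding L Dfg fDg fst_conv snd_conv
    using 12 by (intro ext) (simp only:)
qed

lemma path_graded_dga: "graded_dga K (path_dga K A)"
proof (intro graded_dga.intro path_graded_comm_algebra graded_dga_axioms.intro)
  fix f i assume f: "f \<in> grade (path_dga K A) i"
  then have "f \<in> up (eps_ext A (- 1))" by (simp add: path_simps)
  from path_diff_up[OF this] show "differential (path_dga K A) f \<in> grade (path_dga K A) (i + 1)"
    using f d_grade by (fastforce simp: path_simps path_diff_def intro!: grade_minus grade_smult)
next
  fix f assume "f \<in> carrier (path_dga K A)"
  then have f: "f \<in> up (eps_ext A (- 1))" by (simp add: path_simps)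
  show "differential (path_dga K A) f \<in> carrier (path_dga K A)" using path_diff_up[OF f] by (simp add: path_simps)
  show "differential (path_dga K A) (differential (path_dga K A) f) = \<zero>\<^bsub>path_dga K A\<^esub>"
    using f by (auto simp: path_simps path_diff_def up_eps_iff d_closed d_d d_add d_neg d_smult a_minus_def r_neg)
next
  fix f g assume "f \<in> carrier (path_dga K A)" "g \<in> carrier (path_dga K A)"
  then have fg: "f \<in> up (eps_ext A (- 1))" "g \<in> up (eps_ext A (- 1))" by (simp_all add: path_simps)
  have c: "fst (f n) \<in> carrier A" "snd (f n) \<in> carrier A" "fst (g n) \<in> carrier A" "snd (g n) \<in> carrier A" for n
    using fg by (simp_all add: up_eps_iff)
  show "differential (path_dga K A) (f \<oplus>\<^bsub>path_dga K A\<^esub> g)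
    = differential (path_dga K A) f \<oplus>\<^bsub>path_dga K A\<^esub> differential (path_dga K A) g"
    unfolding path_simps path_add[OF fg] path_add[OF path_diff_up[OF fg(1)] path_diff_up[OF fg(2)]]
    using c by (simp add: path_diff_def d_add smult_r_distr d_closed diff_add_diff)
next
  fix k f assume k: "k \<in> carrier K" and "f \<in> carrier (path_dga K A)"
  then have f: "f \<in> up (eps_ext A (- 1))" by (simp_all add: path_simps)
  have c: "fst (f n) \<in> carrier A" "snd (f n) \<in> carrier A" for n using f by (simp_all add: up_eps_iff)
  show "differential (path_dga K A) (k \<odot>\<^bsub>path_dga K A\<^esub> f) = k \<odot>\<^bsub>path_dga K A\<^esub> differential (path_dga K A) f"
    unfolding path_simps path_smult
    using c k by (simp add: path_diff_def d_smult smult_r_distr d_closed smult_assoc1[symmetric] R.m_comm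
      a_minus_def smult_r_minus)
next
  fix f g i assume "f \<in> grade (path_dga K A) i" "g \<in> carrier (path_dga K A)"
  then show "differential (path_dga K A) (f \<otimes>\<^bsub>path_dga K A\<^esub> g) =
      (differential (path_dga K A) f \<otimes>\<^bsub>path_dga K A\<^esub> g)
      \<oplus>\<^bsub>path_dga K A\<^esub> signed (path_dga K A) i (f \<otimes>\<^bsub>path_dga K A\<^esub> differential (path_dga K A) g)"
    using path_leibniz by (simp add: path_simps(1,2))
qed

definition path_start :: "(nat \<Rightarrow> 'u \<times> 'u) \<Rightarrow> 'u" where
  "path_start f = fst (f 0)"

text \<open>
  The value of the function part at \<open>t = 1\<close>.
\<close>

definition path_end :: "(nat \<Rightarrow> 'u \<times> 'u) \<Rightarrow> 'u" where
  "path_end f = (\<Oplus>\<^bsub>A\<^esub>n\<in>{n. fst (f n) \<noteq> \<zero>\<^bsub>A\<^esub>}. fst (f n))"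

lemma path_end_eq:
  assumes "f \<in> up (eps_ext A (- 1))" "\<And>k. k > n \<Longrightarrow> fst (f k) = \<zero>\<^bsub>A\<^esub>"
  shows "path_end f = (\<Oplus>\<^bsub>A\<^esub>k\<in>{..n}. fst (f k))"
  unfolding path_end_def
  by (rule add.finprod_mono_neutral_cong_left) (use assms in \<open>auto simp: up_eps_iff not_le[symmetric]\<close>)

lemma path_start_dghom: "path_start \<in> dghom K (path_dga K A) A"
proof -
  have "path_start \<in> ghom K (path_dga K A) A"
  proof (rule ghomI)
    fix f g assume "f \<in> carrier (path_dga K A)" "g \<in> carrier (path_dga K A)"
    then have fg: "f \<in> up (eps_ext A (- 1))" "g \<in> up (eps_ext A (- 1))" by (simp_all add: path_simps)
    show "path_start (f \<otimes>\<^bsub>path_dga K A\<^esub> g) = path_start f \<otimes>\<^bsub>A\<^esub> path_start g"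
      "path_start (f \<oplus>\<^bsub>path_dga K A\<^esub> g) = path_start f \<oplus>\<^bsub>A\<^esub> path_start g"
      using fg by (simp_all add: path_mult path_add path_start_def up_eps_iff)
  qed (auto simp: path_start_def path_simps path_smult path_one up_eps_iff)
  then show ?thesis by (simp add: dghom_def path_simps path_start_def path_diff_def)
qed

lemma path_end_dghom: "path_end \<in> dghom K (path_dga K A) A"
proof -
  have b: "\<exists>n. \<forall>k>n. fst (f k) = \<zero>\<^bsub>A\<^esub>" if "f \<in> up (eps_ext A (- 1))" for f
    using that unfolding up_eps_iff by (metis fst_conv)
  have c: "fst (f n) \<in> carrier A" if "f \<in> up (eps_ext A (- 1))" for f n using that by (simp add: up_eps_iff)
  have m: "path_end (f \<otimes>\<^bsub>path_dga K A\<^esub> g) = path_end f \<otimes>\<^bsub>A\<^esub> path_end g"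
    if f: "f \<in> up (eps_ext A (- 1))" and g: "g \<in> up (eps_ext A (- 1))" for f g
  proof -
    interpret P: graded_comm_algebra K "path_dga K A" by (rule path_graded_comm_algebra)
    obtain n where n: "\<And>k. k > n \<Longrightarrow> fst (f k) = \<zero>\<^bsub>A\<^esub>" using b[OF f] by blast
    obtain m where m: "\<And>k. k > m \<Longrightarrow> fst (g k) = \<zero>\<^bsub>A\<^esub>" using b[OF g] by blast
    have fg: "f \<otimes>\<^bsub>path_dga K A\<^esub> g \<in> up (eps_ext A (- 1))" using P.m_closed[of f g] f g by (simp add: path_simps)
    have z: "fst ((f \<otimes>\<^bsub>path_dga K A\<^esub> g) k) = \<zero>\<^bsub>A\<^esub>" if "k > n + m" for k
    proof -
      have "(\<Oplus>\<^bsub>A\<^esub>i\<in>{..k}. fst (f i) \<otimes>\<^bsub>A\<^esub> fst (g (k - i))) = (\<Oplus>\<^bsub>A\<^esub>i\<in>{..k}. \<zero>\<^bsub>A\<^esub>)"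
      proof (rule finsum_cong')
        fix i
        show "fst (f i) \<otimes>\<^bsub>A\<^esub> fst (g (k - i)) = \<zero>\<^bsub>A\<^esub>"
          using n[of i] m[of "k - i"] c[OF f] c[OF g] that by (cases "i > n") auto
      qed auto
      then show ?thesis by (simp add: path_mult[OF f g])
    qed
    have "path_end (f \<otimes>\<^bsub>path_dga K A\<^esub> g) = (\<Oplus>\<^bsub>A\<^esub>k\<in>{..n + m}. \<Oplus>\<^bsub>A\<^esub>i\<in>{..k}. fst (f i) \<otimes>\<^bsub>A\<^esub> fst (g (k - i)))"
      using path_end_eq[OF fg z] by (simp add: path_mult[OF f g])
    also have "\<dots> = (\<Oplus>\<^bsub>A\<^esub>i\<in>{..n}. fst (f i)) \<otimes>\<^bsub>A\<^esub> (\<Oplus>\<^bsub>A\<^esub>i\<in>{..m}. fst (g i))"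
      by (rule cauchy_product) (use n m c[OF f] c[OF g] in auto)
    finally show ?thesis using path_end_eq[OF f n] path_end_eq[OF g m] by simp
  qed
  have a: "path_end (f \<oplus>\<^bsub>path_dga K A\<^esub> g) = path_end f \<oplus>\<^bsub>A\<^esub> path_end g"
    if f: "f \<in> up (eps_ext A (- 1))" and g: "g \<in> up (eps_ext A (- 1))" for f g
  proof -
    interpret P: graded_comm_algebra K "path_dga K A" by (rule path_graded_comm_algebra)
    obtain n where n: "\<And>k. k > n \<Longrightarrow> fst (f k) = \<zero>\<^bsub>A\<^esub>" using b[OF f] by blast
    obtain m where m: "\<And>k. k > m \<Longrightarrow> fst (g k) = \<zero>\<^bsub>A\<^esub>" using b[OF g] by blast
    have fg: "f \<oplus>\<^bsub>path_dga K A\<^esub> g \<in> up (eps_ext A (- 1))" using P.a_closed[of f g] f g by (simp add: path_simps)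
    have "path_end (f \<oplus>\<^bsub>path_dga K A\<^esub> g) = (\<Oplus>\<^bsub>A\<^esub>k\<in>{..n + m}. fst (f k) \<oplus>\<^bsub>A\<^esub> fst (g k))"
      by (subst path_end_eq[OF fg, of "n + m"]) (use n m in \<open>auto simp: path_add[OF f g]\<close>)
    also have "\<dots> = (\<Oplus>\<^bsub>A\<^esub>k\<in>{..n + m}. fst (f k)) \<oplus>\<^bsub>A\<^esub> (\<Oplus>\<^bsub>A\<^esub>k\<in>{..n + m}. fst (g k))"
      by (rule finsum_addf) (use c[OF f] c[OF g] in auto)
    also have "(\<Oplus>\<^bsub>A\<^esub>k\<in>{..n + m}. fst (f k)) = path_end f" by (rule path_end_eq[OF f, symmetric]) (use n in auto)
    also have "(\<Oplus>\<^bsub>A\<^esub>k\<in>{..n + m}. fst (g k)) = path_end g" by (rule path_end_eq[OF g, symmetric]) (use m in auto)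
    finally show ?thesis .
  qed
  have lin: "path_end (\<lambda>n. (\<delta> (fst (f n)), e n)) = \<delta> (path_end f)"
    if f: "f \<in> up (eps_ext A (- 1))" and f': "(\<lambda>n. (\<delta> (fst (f n)), e n)) \<in> up (eps_ext A (- 1))"
      and \<delta>: "\<And>x. x \<in> carrier A \<Longrightarrow> \<delta> x \<in> carrier A" "\<delta> \<zero>\<^bsub>A\<^esub> = \<zero>\<^bsub>A\<^esub>"
        "\<And>x y. \<lbrakk>x \<in> carrier A; y \<in> carrier A\<rbrakk> \<Longrightarrow> \<delta> (x \<oplus>\<^bsub>A\<^esub> y) = \<delta> x \<oplus>\<^bsub>A\<^esub> \<delta> y" for f \<delta> e
  proof -
    obtain n where n: "\<And>k. k > n \<Longrightarrow> fst (f k) = \<zero>\<^bsub>A\<^esub>" using b[OF f] by blast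
    have "path_end (\<lambda>n. (\<delta> (fst (f n)), e n)) = (\<Oplus>\<^bsub>A\<^esub>k\<in>{..n}. \<delta> (fst (f k)))"
      by (subst path_end_eq[OF f', of n]) (use n \<delta> in auto)
    also have "\<dots> = \<delta> (\<Oplus>\<^bsub>A\<^esub>k\<in>{..n}. fst (f k))"
      by (rule additive_finsum[of \<delta>, symmetric]) (use \<delta> c[OF f] in auto)
    finally show ?thesis using path_end_eq[OF f n] by simp
  qed
  have "path_end \<in> ghom K (path_dga K A) A"
  proof (rule ghomI)
    fix f assume "f \<in> carrier (path_dga K A)"
    then show "path_end f \<in> carrier A" unfolding path_end_def by (intro finsum_closed) (auto simp: path_simps up_eps_iff)
  next
    interpret P: graded_comm_algebra K "path_dga K A" by (rule path_graded_comm_algebra)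
    have o: "\<one>\<^bsub>path_dga K A\<^esub> \<in> up (eps_ext A (- 1))" using P.one_closed by (simp add: path_simps)
    show "path_end \<one>\<^bsub>path_dga K A\<^esub> = \<one>\<^bsub>A\<^esub>"
      by (subst path_end_eq[OF o, of 0]) (auto simp: path_one)
  next
    interpret P: graded_comm_algebra K "path_dga K A" by (rule path_graded_comm_algebra)
    fix k f assume k: "k \<in> carrier K" and f: "f \<in> carrier (path_dga K A)"
    then have "(\<lambda>n. (k \<odot>\<^bsub>A\<^esub> fst (f n), k \<odot>\<^bsub>A\<^esub> snd (f n))) \<in> up (eps_ext A (- 1))"
      using P.smult_closed[OF k f] by (simp add: path_simps path_smult)
    then show "path_end (k \<odot>\<^bsub>path_dga K A\<^esub> f) = k \<odot>\<^bsub>A\<^esub> path_end f"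
      unfolding path_smult using f k by (intro lin) (auto simp: path_simps smult_r_distr)
  next
    fix i f assume f: "f \<in> grade (path_dga K A) i"
    have "finite F \<Longrightarrow> (\<Oplus>\<^bsub>A\<^esub>n\<in>F. fst (f n)) \<in> grade A i" for F
    proof (induction F rule: finite_induct)
      case (insert x F)
      have g: "fst (f n) \<in> grade A i" for n using f by (simp add: path_simps)
      then have "(\<lambda>n. fst (f n)) \<in> F \<rightarrow> carrier A" "fst (f x) \<in> carrier A" using grade_closed by blast+
      then show ?case using insert grade_add[OF g] by simp
    qed simp
    moreover have "finite {n. fst (f n) \<noteq> \<zero>\<^bsub>A\<^esub>}"
    proof -
      obtain n where "\<forall>k>n. fst (f k) = \<zero>\<^bsub>A\<^esub>" using b[of f] f by (simp add: path_simps) blast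
      then have "{n. fst (f n) \<noteq> \<zero>\<^bsub>A\<^esub>} \<subseteq> {..n}" by (auto simp: not_le[symmetric])
      then show ?thesis by (rule finite_subset) simp
    qed
    ultimately show "path_end f \<in> grade A i" by (simp add: path_end_def)
  qed (simp_all add: path_simps m a)
  moreover have "path_end (differential (path_dga K A) f) = differential A (path_end f)" if "f \<in> carrier (path_dga K A)" for f
  proof -
    have f: "f \<in> up (eps_ext A (- 1))" using that by (simp add: path_simps)
    show ?thesis using path_diff_up[OF f] unfolding path_simps(2) path_diff_def
      by (intro lin[OF f]) (auto simp: d_closed d_add)
  qed
  ultimately show ?thesis by (simp add: dghom_def)
qed

end

section \<open>Lifting along an algebra of paths\<close>

text \<open>
  Algebras of paths can be copied into the universe: a sequence with finite support is coded by its length and the list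
  of its entries.
\<close>

lemma finite_support_injection:
  fixes z :: 'v and c :: "'v \<Rightarrow> 'u"
  assumes inf: "infinite (UNIV :: 'u set)" and c: "inj c"
  obtains code :: "(nat \<Rightarrow> 'v) \<Rightarrow> 'u" where "inj_on code {f. \<exists>n. \<forall>m>n. f m = z}"
proof -
  obtain p :: "'u \<times> 'u \<Rightarrow> 'u" where p: "inj p" by (rule infinite_pair_injection[OF inf])
  obtain e :: "nat \<Rightarrow> 'u" where e: "inj e" using infinite_countable_subset[OF inf] by blast
  define fold where "fold xs = foldr (\<lambda>x u. p (c x, u)) xs (e 0)" for xs
  have fold: "length xs = length ys \<Longrightarrow> fold xs = fold ys \<Longrightarrow> xs = ys" for xs ys
    by (induction xs ys rule: list_induct2) (auto simp: fold_def dest: injD[OF p] injD[OF c])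
  define len where "len f = (LEAST n. \<forall>m>n. f m = z)" for f :: "nat \<Rightarrow> 'v"
  define lst where "lst f = map f [0..<Suc (len f)]" for f :: "nat \<Rightarrow> 'v"
  have len: "f m = z" if "\<exists>n. \<forall>m>n. f m = z" "m > len f" for f :: "nat \<Rightarrow> 'v" and m
    using LeastI_ex[OF that(1)] that(2) unfolding len_def by blast
  show thesis
  proof (rule that[of "\<lambda>f. p (e (len f), fold (lst f))"], rule inj_onI)
    fix f g :: "nat \<Rightarrow> 'v"
    assume f: "f \<in> {f. \<exists>n. \<forall>m>n. f m = z}" and g: "g \<in> {f. \<exists>n. \<forall>m>n. f m = z}"
      and "p (e (len f), fold (lst f)) = p (e (len g), fold (lst g))"
    then have l: "len f = len g" and "fold (lst f) = fold (lst g)" using injD[OF p] injD[OF e] by blast+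
    then have "lst f = lst g" by (intro fold) (simp_all add: lst_def)
    then have eq: "f m = g m" if "m \<le> len f" for m
      using that l by (auto simp: lst_def map_eq_conv)
    show "f = g"
    proof
      fix m show "f m = g m" using eq[of m] len[of f m] len[of g m] f g l by (cases "m \<le> len f") auto
    qed
  qed
qed

lemma (in abelian_monoid) finsum_in:
  assumes "finite F" "T \<subseteq> carrier G" "\<zero> \<in> T" "\<And>x y. \<lbrakk>x \<in> T; y \<in> T\<rbrakk> \<Longrightarrow> x \<oplus> y \<in> T" "\<And>i. i \<in> F \<Longrightarrow> f i \<in> T"
  shows "finsum G f F \<in> T"
  using assms(1,5)
proof (induction F rule: finite_induct)
  case (insert x F)
  then have "f \<in> F \<rightarrow> carrier G" "f x \<in> carrier G" using assms(2) by auto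
  then show ?case using insert assms(4) by simp
qed (simp add: assms(3))

text \<open>
  The situation abstracts the two morphisms \<open>\<iota>\<close> and \<open>\<phi> = f \<iota>\<close> for a trivial idempotent \<open>f\<close>, and an acyclic ideal
  \<open>H\<close>. The assumption \<open>correct\<close> is all that is used about \<open>f\<close>: an element whose differential
  lies in the equaliser of \<open>\<phi>\<close> and \<open>\<iota>\<close> can itself be moved into the equaliser by the differential of an
  element of the kernel of \<open>\<phi>\<close>.
\<close>

locale path_lifting = R: cdga K R + B: cdga K B
  for K :: "('k, 'm) ring_scheme" and R :: "('k, 'u, 'y) dga_scheme" and B :: "('k, 'v, 'z) dga_scheme" +
  fixes \<iota> \<phi> :: "'u \<Rightarrow> 'v" and H :: "int \<Rightarrow> 'u set"
  assumes field: "field K" and char_0: "\<And>n :: nat. n > 0 \<Longrightarrow> [n] \<cdot>\<^bsub>K\<^esub> \<one>\<^bsub>K\<^esub> \<noteq> \<zero>\<^bsub>K\<^esub>"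
    and \<iota>: "\<iota> \<in> dghom K R B" and \<phi>: "\<phi> \<in> dghom K R B"
    and H: "graded_ideal R H" and dH: "\<And>i x. x \<in> H i \<Longrightarrow> differential R x \<in> H (i + 1)"
    and \<phi>_H: "\<And>i x. x \<in> H i \<Longrightarrow> \<phi> x = \<zero>\<^bsub>B\<^esub>"
    and H_acyclic: "\<And>i x. \<lbrakk>x \<in> H i; differential R x = \<zero>\<^bsub>R\<^esub>\<rbrakk> \<Longrightarrow> \<exists>y\<in>H (i - 1). differential R y = x"
    and correct: "\<And>n \<rho>. \<lbrakk>\<rho> \<in> grade R n; \<phi> (differential R \<rho>) = \<iota> (differential R \<rho>)\<rbrakk>
      \<Longrightarrow> \<exists>\<nu>\<in>grade R (n - 1). \<phi> \<nu> = \<zero>\<^bsub>B\<^esub> \<and> \<phi> (\<rho> \<ominus>\<^bsub>R\<^esub> differential R \<nu>) = \<iota> (\<rho> \<ominus>\<^bsub>R\<^esub> differential R \<nu>)"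
begin

lemmas \<iota>_simps = ghom_closed[OF dghom_ghom[OF \<iota>]] ghom_mult[OF dghom_ghom[OF \<iota>]] ghom_add[OF dghom_ghom[OF \<iota>]]
  ghom_one[OF dghom_ghom[OF \<iota>]] ghom_smult[OF dghom_ghom[OF \<iota>]]
  ghom_zero[OF dghom_ghom[OF \<iota>] R.ring_axioms B.ring_axioms] dghom_d[OF \<iota>]
  ghom_hcomp[OF dghom_ghom[OF \<iota>] R.graded_comm_algebra_axioms B.graded_comm_algebra_axioms]

lemmas \<phi>_simps = ghom_closed[OF dghom_ghom[OF \<phi>]] ghom_mult[OF dghom_ghom[OF \<phi>]] ghom_add[OF dghom_ghom[OF \<phi>]]
  ghom_one[OF dghom_ghom[OF \<phi>]] ghom_smult[OF dghom_ghom[OF \<phi>]]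
  ghom_zero[OF dghom_ghom[OF \<phi>] R.ring_axioms B.ring_axioms] dghom_d[OF \<phi>]
  ghom_hcomp[OF dghom_ghom[OF \<phi>] R.graded_comm_algebra_axioms B.graded_comm_algebra_axioms]

text \<open>
  \<open>W0\<close> consists of the paths along which \<open>\<phi>\<close> behaves as if only the starting point mattered: the value of
  \<open>\<phi>\<close> at the end is the value of \<open>\<phi>\<close>, and of \<open>\<iota>\<close>, at the start. The ideal \<open>JJ\<close> is chosen
  such that the starting point in \<open>R\<close> and the end point in \<open>R/J\<close> are well defined on the quotient.
\<close>

definition J :: "'u set" where "J = total_ideal R H"
definition U :: "'u set" where "U = {x \<in> carrier R. \<phi> x = \<zero>\<^bsub>B\<^esub>}"
definition E :: "('k, 'u \<times> 'u) dga" where "E = eps_ext R (- 1)"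

definition W0 :: "(nat \<Rightarrow> 'u \<times> 'u) set" where
  "W0 = {f \<in> up E. \<phi> (fst (f 0)) = \<iota> (fst (f 0)) \<and> (\<forall>n. fst (f (Suc n)) \<in> U) \<and> (\<forall>n. snd (f n) \<in> U)}"
definition JJ :: "(nat \<Rightarrow> 'u \<times> 'u) set" where
  "JJ = {f \<in> up E. fst (f 0) = \<zero>\<^bsub>R\<^esub> \<and> (\<forall>n. fst (f (Suc n)) \<in> J) \<and> (\<forall>n. snd (f n) \<in> J)}"

abbreviation "Pa \<equiv> path_dga K R"
abbreviation "cW \<equiv> quotient_rep Pa W0 JJ"
abbreviation "cT \<equiv> quotient_rep R (carrier R) J"

sublocale T: dg_subquotient K R "carrier R" J cT
  unfolding J_def by (rule R.total_ideal_dg_subquotient[OF H dH])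

sublocale Pa: graded_dga K Pa by (rule R.path_graded_dga)

lemma J_homogeneous: "x \<in> grade R i \<Longrightarrow> x \<in> J \<longleftrightarrow> x \<in> H i"
  unfolding J_def by (rule R.total_ideal_homogeneous[OF H])

lemma J_U: "J \<subseteq> U"
proof
  fix x assume x: "x \<in> J"
  have eq: "hcomp B i (\<phi> x) = hcomp B i \<zero>\<^bsub>B\<^esub>" for i
    using x \<phi>_H[of "hcomp R i x" i] T.J_carrier[OF x] by (simp add: \<phi>_simps(8)[symmetric] J_def total_ideal_def)
  have "\<phi> x = \<zero>\<^bsub>B\<^esub>"
    by (rule B.hcomp_ext[OF \<phi>_simps(1)[OF T.J_carrier[OF x]] B.zero_closed eq])
  then show "x \<in> U" using T.J_carrier[OF x] by (simp add: U_def)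
qed

lemma J_twist: "x \<in> J \<Longrightarrow> twist R m x \<in> J"
  using R.graded_ideal_neg[OF H] by (auto simp: J_def total_ideal_def R.hcomp_twist signed_def)

lemma U_simps: "U \<subseteq> carrier R" "\<zero>\<^bsub>R\<^esub> \<in> U" "\<lbrakk>x \<in> U; y \<in> U\<rbrakk> \<Longrightarrow> x \<oplus>\<^bsub>R\<^esub> y \<in> U"
  "\<lbrakk>x \<in> U; y \<in> carrier R\<rbrakk> \<Longrightarrow> x \<otimes>\<^bsub>R\<^esub> y \<in> U" "\<lbrakk>x \<in> carrier R; y \<in> U\<rbrakk> \<Longrightarrow> x \<otimes>\<^bsub>R\<^esub> y \<in> U"
  "\<lbrakk>k \<in> carrier K; x \<in> U\<rbrakk> \<Longrightarrow> k \<odot>\<^bsub>R\<^esub> x \<in> U" "x \<in> U \<Longrightarrow> hcomp R i x \<in> U" "x \<in> U \<Longrightarrow> differential R x \<in> U"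
  "x \<in> U \<Longrightarrow> \<ominus>\<^bsub>R\<^esub> x \<in> U"
  by (auto simp: U_def \<phi>_simps R.d_closed ghom_neg[OF dghom_ghom[OF \<phi>] R.ring_axioms B.ring_axioms])

lemma U_minus: "\<lbrakk>x \<in> U; y \<in> U\<rbrakk> \<Longrightarrow> x \<ominus>\<^bsub>R\<^esub> y \<in> U" unfolding a_minus_def by (intro U_simps)

lemma J_minus: "\<lbrakk>x \<in> J; y \<in> J\<rbrakk> \<Longrightarrow> x \<ominus>\<^bsub>R\<^esub> y \<in> J" unfolding a_minus_def by (intro T.J_add T.J_neg)

lemma U_finsum: "finite F \<Longrightarrow> (\<And>i. i \<in> F \<Longrightarrow> f i \<in> U) \<Longrightarrow> finsum R f F \<in> U"
  by (rule R.finsum_in) (use U_simps in auto)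

lemma J_finsum: "finite F \<Longrightarrow> (\<And>i. i \<in> F \<Longrightarrow> f i \<in> J) \<Longrightarrow> finsum R f F \<in> J"
  by (rule R.finsum_in) (use T.J_carrier T.J_zero T.J_add in auto)

lemma up_E: "f \<in> up E \<Longrightarrow> fst (f n) \<in> carrier R" "f \<in> up E \<Longrightarrow> snd (f n) \<in> carrier R"
  by (simp_all add: E_def up_eps_iff)

lemma carrier_Pa: "carrier Pa = up E" by (simp add: path_simps E_def)

lemmas Pa_add = path_add[of _ R, folded E_def] and Pa_mult = R.path_mult[folded E_def]
  and Pa_hcomp = R.path_hcomp[folded E_def]

lemma nat_unit: "[Suc n] \<cdot>\<^bsub>K\<^esub> \<one>\<^bsub>K\<^esub> \<in> Units K"
  using field.field_Units[OF field] char_0[of "Suc n"] by simp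

lemma W_subquotient: "subquotient K Pa W0 JJ cW"
proof -
  have J0: "JJ \<subseteq> W0" using J_U by (auto simp: JJ_def W0_def \<iota>_simps \<phi>_simps)
  have Wup: "W0 \<subseteq> carrier Pa" by (auto simp: W0_def carrier_Pa)
  have z: "\<zero>\<^bsub>Pa\<^esub> \<in> JJ"
    using Pa.zero_closed T.J_zero by (simp add: JJ_def carrier_Pa path_simps(4))
  have ja: "f \<oplus>\<^bsub>Pa\<^esub> g \<in> JJ" if "f \<in> JJ" "g \<in> JJ" for f g
    using that Pa.a_closed[of f g] by (auto simp: JJ_def carrier_Pa Pa_add T.J_add)
  have js: "k \<odot>\<^bsub>Pa\<^esub> f \<in> JJ" if "k \<in> carrier K" "f \<in> JJ" for f k
    using that Pa.smult_closed[of k f] by (auto simp: JJ_def carrier_Pa path_smult T.J_smult)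
  have mult0: "fst ((f \<otimes>\<^bsub>Pa\<^esub> g) 0) = fst (f 0) \<otimes>\<^bsub>R\<^esub> fst (g 0)" if "f \<in> up E" "g \<in> up E" for f g
    using that by (simp add: Pa_mult up_E)
  show ?thesis
  proof
    show "W0 \<subseteq> carrier Pa" by (rule Wup)
    show "\<one>\<^bsub>Pa\<^esub> \<in> W0"
      using Pa.one_closed U_simps by (auto simp: W0_def carrier_Pa path_one \<iota>_simps \<phi>_simps)
    show "JJ \<subseteq> W0" "\<zero>\<^bsub>Pa\<^esub> \<in> JJ" by fact+
  next
    fix f g assume "f \<in> W0" "g \<in> W0"
    then show "f \<oplus>\<^bsub>Pa\<^esub> g \<in> W0" using Pa.a_closed[of f g]
      by (auto simp: W0_def carrier_Pa Pa_add U_simps \<iota>_simps \<phi>_simps up_E)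
  next
    fix f g assume f: "f \<in> W0" and g: "g \<in> W0"
    have u: "f \<in> up E" "g \<in> up E" using f g by (auto simp: W0_def)
    have fU: "fst (f k) \<in> U" if "k > 0" for k using f that by (cases k) (auto simp: W0_def)
    have gU: "fst (g k) \<in> U" if "k > 0" for k using g that by (cases k) (auto simp: W0_def)
    have "fst (f k) \<otimes>\<^bsub>R\<^esub> fst (g (Suc n - k)) \<in> U" for k n
      by (cases "k > 0") (auto intro: U_simps fU gU up_E u)
    then have "fst ((f \<otimes>\<^bsub>Pa\<^esub> g) (Suc n)) \<in> U" for n unfolding Pa_mult[OF u] fst_conv by (intro U_finsum) simp_all
    moreover have "snd ((f \<otimes>\<^bsub>Pa\<^esub> g) n) \<in> U" for n
      unfolding Pa_mult[OF u] snd_conv using f g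
      by (intro U_finsum U_simps(3) U_simps(4) U_simps(5)) (auto simp: W0_def up_E)
    ultimately show "f \<otimes>\<^bsub>Pa\<^esub> g \<in> W0"
      using f g u Pa.m_closed[of f g] by (auto simp: W0_def carrier_Pa mult0 up_E \<iota>_simps \<phi>_simps)
  next
    fix k f assume "k \<in> carrier K" "f \<in> W0"
    then show "k \<odot>\<^bsub>Pa\<^esub> f \<in> W0" using Pa.smult_closed[of k f]
      by (auto simp: W0_def carrier_Pa path_smult U_simps \<iota>_simps \<phi>_simps up_E)
  next
    fix f i assume f: "f \<in> W0"
    then have u: "f \<in> up E" by (simp add: W0_def)
    then have "hcomp Pa i f \<in> up E" using Pa.hcomp_closed[of f i] by (simp add: carrier_Pa)
    then show "hcomp Pa i f \<in> W0" using f
      by (auto simp: W0_def Pa_hcomp[OF u] U_simps \<iota>_simps \<phi>_simps up_E)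
  next
    fix f g assume "f \<in> JJ" "g \<in> JJ" then show "f \<oplus>\<^bsub>Pa\<^esub> g \<in> JJ" by (rule ja)
  next
    fix k f assume "k \<in> carrier K" "f \<in> JJ" then show "k \<odot>\<^bsub>Pa\<^esub> f \<in> JJ" by (rule js)
  next
    fix f g assume f: "f \<in> W0" and g: "g \<in> JJ"
    have u: "f \<in> up E" "g \<in> up E" using f g by (auto simp: W0_def JJ_def)
    have gJ: "fst (g k) \<in> J" for k using g T.J_zero by (cases k) (auto simp: JJ_def)
    have "fst ((f \<otimes>\<^bsub>Pa\<^esub> g) n) \<in> J" for n
      unfolding Pa_mult[OF u] fst_conv by (intro J_finsum T.J_lmult gJ up_E u) simp
    moreover have "snd ((f \<otimes>\<^bsub>Pa\<^esub> g) n) \<in> J" for n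
      unfolding Pa_mult[OF u] snd_conv using g
      by (intro J_finsum T.J_add T.J_lmult gJ up_E u R.twist_closed) (auto simp: JJ_def)
    ultimately show "f \<otimes>\<^bsub>Pa\<^esub> g \<in> JJ"
      using g u Pa.m_closed[of f g] by (auto simp: JJ_def carrier_Pa mult0 up_E)
  next
    fix f g assume f: "f \<in> JJ" and g: "g \<in> W0"
    have u: "f \<in> up E" "g \<in> up E" using f g by (auto simp: W0_def JJ_def)
    have fJ: "fst (f k) \<in> J" for k using f T.J_zero by (cases k) (auto simp: JJ_def)
    have "fst ((f \<otimes>\<^bsub>Pa\<^esub> g) n) \<in> J" for n
      unfolding Pa_mult[OF u] fst_conv by (intro J_finsum T.J_rmult fJ up_E u) simp
    moreover have "snd ((f \<otimes>\<^bsub>Pa\<^esub> g) n) \<in> J" for n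
      unfolding Pa_mult[OF u] snd_conv using f
      by (intro J_finsum T.J_add T.J_rmult fJ up_E u J_twist) (auto simp: JJ_def)
    ultimately show "f \<otimes>\<^bsub>Pa\<^esub> g \<in> JJ"
      using f u Pa.m_closed[of f g] by (auto simp: JJ_def carrier_Pa mult0 up_E)
  next
    fix f i assume f: "f \<in> JJ"
    then have u: "f \<in> up E" by (simp add: JJ_def)
    then have "hcomp Pa i f \<in> up E" using Pa.hcomp_closed[of f i] by (simp add: carrier_Pa)
    then show "hcomp Pa i f \<in> JJ" using f by (auto simp: JJ_def Pa_hcomp[OF u] T.J_hcomp)
  next
    fix f g assume "f \<in> W0" "g \<in> W0"
    then show "cW f = cW g \<longleftrightarrow> f \<ominus>\<^bsub>Pa\<^esub> g \<in> JJ"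
      by (intro Pa.quotient_rep_eq_iff z ja js J0 Wup)
  qed
qed

sublocale W: dg_subquotient K Pa W0 JJ cW
proof (intro dg_subquotient.intro W_subquotient dg_subquotient_axioms.intro Pa.graded_dga_axioms)
  fix f assume f: "f \<in> W0"
  then have "path_diff K R f \<in> up E" using R.path_diff_up[of f] by (simp add: W0_def E_def)
  then show "differential Pa f \<in> W0"
    using f by (auto simp: W0_def path_simps(2) path_diff_def U_simps U_minus \<iota>_simps \<phi>_simps up_E)
next
  fix f assume f: "f \<in> JJ"
  then have "path_diff K R f \<in> up E" using R.path_diff_up[of f] by (simp add: JJ_def E_def)
  moreover have "fst (path_diff K R f 0) = \<zero>\<^bsub>R\<^esub>" using f by (simp add: JJ_def path_diff_def)
  moreover have "fst (path_diff K R f (Suc n)) \<in> J" for n using f by (simp add: JJ_def path_diff_def T.J_d)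
  moreover have "snd (path_diff K R f n) \<in> J" for n
    unfolding path_diff_def snd_conv by (intro J_minus T.J_smult T.J_d) (use f in \<open>auto simp: JJ_def\<close>)
  ultimately show "differential Pa f \<in> JJ" by (simp add: JJ_def path_simps(2))
qed

lemma cT_eq: "\<lbrakk>x \<in> carrier R; y \<in> carrier R\<rbrakk> \<Longrightarrow> cT x = cT y \<longleftrightarrow> x \<ominus>\<^bsub>R\<^esub> y \<in> J"
  by (rule T.c_eq_iff)

lemma cW_eq: "\<lbrakk>f \<in> W0; g \<in> W0\<rbrakk> \<Longrightarrow> cW f = cW g \<longleftrightarrow> f \<ominus>\<^bsub>Pa\<^esub> g \<in> JJ"
  by (rule W.c_eq_iff)

lemma path_end_split:
  assumes f: "f \<in> up E"
  obtains N where "\<forall>k>N. f k = (\<zero>\<^bsub>R\<^esub>, \<zero>\<^bsub>R\<^esub>)"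
    "R.path_end f = (\<Oplus>\<^bsub>R\<^esub>k\<in>{..N}. fst (f (Suc k))) \<oplus>\<^bsub>R\<^esub> fst (f 0)"
proof -
  obtain N where N: "\<forall>k>N. f k = (\<zero>\<^bsub>R\<^esub>, \<zero>\<^bsub>R\<^esub>)" using f unfolding E_def up_eps_iff by blast
  have "R.path_end f = (\<Oplus>\<^bsub>R\<^esub>k\<in>{..Suc N}. fst (f k))"
    by (rule R.path_end_eq) (use f N in \<open>auto simp: E_def\<close>)
  also have "\<dots> = (\<Oplus>\<^bsub>R\<^esub>k\<in>{..N}. fst (f (Suc k))) \<oplus>\<^bsub>R\<^esub> fst (f 0)"
    using f by (intro R.finsum_Suc2) (auto simp: up_E)
  finally show thesis using that N by blast
qed

lemma path_end_U: "f \<in> W0 \<Longrightarrow> \<phi> (R.path_end f) = \<iota> (fst (f 0))"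
proof -
  assume f: "f \<in> W0"
  then have u: "f \<in> up E" by (simp add: W0_def)
  obtain N where N: "R.path_end f = (\<Oplus>\<^bsub>R\<^esub>k\<in>{..N}. fst (f (Suc k))) \<oplus>\<^bsub>R\<^esub> fst (f 0)"
    by (rule path_end_split[OF u])
  have "(\<Oplus>\<^bsub>R\<^esub>k\<in>{..N}. fst (f (Suc k))) \<in> U" by (rule U_finsum) (use f in \<open>auto simp: W0_def\<close>)
  then show ?thesis using f up_E[OF u] unfolding N by (simp add: U_def \<phi>_simps W0_def \<iota>_simps)
qed

lemma path_end_J: "f \<in> JJ \<Longrightarrow> R.path_end f \<in> J"
proof -
  assume f: "f \<in> JJ"
  then have u: "f \<in> up E" by (simp add: JJ_def)
  obtain N where N: "R.path_end f = (\<Oplus>\<^bsub>R\<^esub>k\<in>{..N}. fst (f (Suc k))) \<oplus>\<^bsub>R\<^esub> fst (f 0)"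
    by (rule path_end_split[OF u])
  show ?thesis unfolding N by (intro T.J_add J_finsum) (use f T.J_zero in \<open>auto simp: JJ_def\<close>)
qed

definition ev :: "(nat \<Rightarrow> 'u \<times> 'u) \<Rightarrow> 'u" where "ev y = cT (R.path_end (inv_into W0 cW y))"
definition st :: "(nat \<Rightarrow> 'u \<times> 'u) \<Rightarrow> 'u" where "st y = fst (inv_into W0 cW y 0)"

lemma cT_dghom: "cT \<in> dghom K R T.Q"
  using T.c_dghom[OF R.id_dghom] R.grade_closed by auto

lemma ev: "ev \<in> dghom K W.Q T.Q" "f \<in> W0 \<Longrightarrow> ev (cW f) = cT (R.path_end f)"
proof -
  have e: "(\<lambda>f. cT (R.path_end f)) \<in> dghom K Pa T.Q" by (rule dghom_comp[OF R.path_end_dghom cT_dghom])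
  have z: "cT (R.path_end f) = \<zero>\<^bsub>T.Q\<^esub>" if "f \<in> JJ" for f
    using path_end_J[OF that] T.J_carrier cT_eq[of "R.path_end f" "\<zero>\<^bsub>R\<^esub>"] by (simp add: T.zero_Q a_minus_def)
  show "ev \<in> dghom K W.Q T.Q" using W.factor_dghom[OF e T.graded_comm_algebra_Q z] by (simp add: ev_def[abs_def])
  show "f \<in> W0 \<Longrightarrow> ev (cW f) = cT (R.path_end f)"
    using W.factor_ghom(2)[OF dghom_ghom[OF e] T.graded_comm_algebra_Q z] by (simp add: ev_def)
qed

lemma st: "st \<in> dghom K W.Q R" "f \<in> W0 \<Longrightarrow> st (cW f) = fst (f 0)"
proof -
  have z: "R.path_start f = \<zero>\<^bsub>R\<^esub>" if "f \<in> JJ" for f using that by (simp add: JJ_def R.path_start_def)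
  show "st \<in> dghom K W.Q R"
    using W.factor_dghom[OF R.path_start_dghom R.graded_comm_algebra_axioms z]
    by (simp add: st_def[abs_def] R.path_start_def)
  show "f \<in> W0 \<Longrightarrow> st (cW f) = fst (f 0)"
    using W.factor_ghom(2)[OF dghom_ghom[OF R.path_start_dghom] R.graded_comm_algebra_axioms z]
    by (simp add: st_def R.path_start_def)
qed

text \<open>
  The fundamental theorem of calculus: \<open>\<beta>\<close> is the integral over \<open>[0, 1]\<close> of the \<open>dt\<close>-part of a form \<open>f\<close>
  that is a cocycle modulo \<open>JJ\<close>, and its differential is the difference of the end points, modulo \<open>J\<close>.
\<close>

lemma integrate:
  assumes f: "f \<in> W0" "f \<in> grade Pa i" and cocycle: "path_diff K R f \<in> JJ"
    and N: "\<forall>k>N. f k = (\<zero>\<^bsub>R\<^esub>, \<zero>\<^bsub>R\<^esub>)"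
    "R.path_end f = (\<Oplus>\<^bsub>R\<^esub>k\<in>{..N}. fst (f (Suc k))) \<oplus>\<^bsub>R\<^esub> fst (f 0)"
  defines "\<beta> \<equiv> (\<Oplus>\<^bsub>R\<^esub>k\<in>{..N}. inv\<^bsub>K\<^esub> ([Suc k] \<cdot>\<^bsub>K\<^esub> \<one>\<^bsub>K\<^esub>) \<odot>\<^bsub>R\<^esub> snd (f k))"
  shows "\<beta> \<in> grade R (i - 1)" "\<beta> \<in> U" "R.path_end f \<ominus>\<^bsub>R\<^esub> (fst (f 0) \<oplus>\<^bsub>R\<^esub> differential R \<beta>) \<in> J"
    "inv\<^bsub>K\<^esub> ([Suc k] \<cdot>\<^bsub>K\<^esub> \<one>\<^bsub>K\<^esub>) \<odot>\<^bsub>R\<^esub> differential R (snd (f k)) \<ominus>\<^bsub>R\<^esub> fst (f (Suc k)) \<in> J"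
proof -
  define \<kappa> where "\<kappa> k = [Suc k] \<cdot>\<^bsub>K\<^esub> \<one>\<^bsub>K\<^esub>" for k
  have \<kappa>: "\<kappa> k \<in> Units K" "\<kappa> k \<in> carrier K" "inv\<^bsub>K\<^esub> \<kappa> k \<in> carrier K" for k
    using nat_unit[of k] by (auto simp: \<kappa>_def)
  have u: "f \<in> up E" using f by (simp add: W0_def)
  have gr: "snd (f k) \<in> grade R (i - 1)" for k using f(2) by (simp add: path_simps)
  have "(\<Oplus>\<^bsub>R\<^esub>k\<in>F. inv\<^bsub>K\<^esub> \<kappa> k \<odot>\<^bsub>R\<^esub> snd (f k)) \<in> grade R (i - 1)" if "finite F" for F
    using that
    by (intro R.finsum_in) (auto intro: R.grade_closed R.grade_add R.grade_smult[OF \<kappa>(3) gr])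
  then show "\<beta> \<in> grade R (i - 1)" by (simp add: \<beta>_def \<kappa>_def)
  have "(\<Oplus>\<^bsub>R\<^esub>k\<in>{..N}. inv\<^bsub>K\<^esub> \<kappa> k \<odot>\<^bsub>R\<^esub> snd (f k)) \<in> U"
    by (intro U_finsum U_simps(6) \<kappa>(3)) (use f in \<open>auto simp: W0_def\<close>)
  then show "\<beta> \<in> U" by (simp add: \<beta>_def \<kappa>_def)
  have t: "inv\<^bsub>K\<^esub> \<kappa> k \<odot>\<^bsub>R\<^esub> differential R (snd (f k)) \<ominus>\<^bsub>R\<^esub> fst (f (Suc k)) \<in> J" for k
  proof -
    have "\<kappa> k \<odot>\<^bsub>R\<^esub> fst (f (Suc k)) \<ominus>\<^bsub>R\<^esub> differential R (snd (f k)) \<in> J"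
      using cocycle by (simp add: JJ_def path_diff_def \<kappa>_def)
    then have "\<ominus>\<^bsub>R\<^esub> (inv\<^bsub>K\<^esub> \<kappa> k \<odot>\<^bsub>R\<^esub> (\<kappa> k \<odot>\<^bsub>R\<^esub> fst (f (Suc k)) \<ominus>\<^bsub>R\<^esub> differential R (snd (f k)))) \<in> J"
      by (intro T.J_neg T.J_smult \<kappa>)
    also have "\<ominus>\<^bsub>R\<^esub> (inv\<^bsub>K\<^esub> \<kappa> k \<odot>\<^bsub>R\<^esub> (\<kappa> k \<odot>\<^bsub>R\<^esub> fst (f (Suc k)) \<ominus>\<^bsub>R\<^esub> differential R (snd (f k))))
      = inv\<^bsub>K\<^esub> \<kappa> k \<odot>\<^bsub>R\<^esub> differential R (snd (f k)) \<ominus>\<^bsub>R\<^esub> fst (f (Suc k))"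
      using \<kappa>[of k] up_E[OF u] R.d_closed
      by (simp add: a_minus_def R.smult_r_distr R.smult_r_minus R.smult_assoc1[symmetric] R.smult_one R.minus_add R.a_comm)
    finally show ?thesis .
  qed
  then show "inv\<^bsub>K\<^esub> ([Suc k] \<cdot>\<^bsub>K\<^esub> \<one>\<^bsub>K\<^esub>) \<odot>\<^bsub>R\<^esub> differential R (snd (f k)) \<ominus>\<^bsub>R\<^esub> fst (f (Suc k)) \<in> J"
    by (simp add: \<kappa>_def)
  let ?a = "\<Oplus>\<^bsub>R\<^esub>k\<in>{..N}. fst (f (Suc k))"
  have ac: "?a \<in> carrier R" using up_E[OF u] by (intro R.finsum_closed) auto
  have dc: "inv\<^bsub>K\<^esub> \<kappa> k \<odot>\<^bsub>R\<^esub> differential R (snd (f k)) \<in> carrier R" for k using \<kappa> up_E[OF u] R.d_closed by simp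
  have d\<beta>: "differential R \<beta> = (\<Oplus>\<^bsub>R\<^esub>k\<in>{..N}. inv\<^bsub>K\<^esub> \<kappa> k \<odot>\<^bsub>R\<^esub> differential R (snd (f k)))"
  proof -
    have "differential R \<beta> = (\<Oplus>\<^bsub>R\<^esub>k\<in>{..N}. differential R (inv\<^bsub>K\<^esub> \<kappa> k \<odot>\<^bsub>R\<^esub> snd (f k)))"
      unfolding \<beta>_def \<kappa>_def[symmetric]
      by (rule R.additive_finsum[of "differential R"]) (use \<kappa> up_E[OF u] in \<open>auto simp: R.d_closed R.d_add\<close>)
    then show ?thesis using \<kappa> up_E[OF u] by (simp add: R.d_smult)
  qed
  have "(\<Oplus>\<^bsub>R\<^esub>k\<in>{..N}. inv\<^bsub>K\<^esub> \<kappa> k \<odot>\<^bsub>R\<^esub> differential R (snd (f k)) \<ominus>\<^bsub>R\<^esub> fst (f (Suc k))) \<in> J"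
    by (rule J_finsum) (use t in auto)
  also have "(\<Oplus>\<^bsub>R\<^esub>k\<in>{..N}. inv\<^bsub>K\<^esub> \<kappa> k \<odot>\<^bsub>R\<^esub> differential R (snd (f k)) \<ominus>\<^bsub>R\<^esub> fst (f (Suc k)))
      = differential R \<beta> \<oplus>\<^bsub>R\<^esub> (\<Oplus>\<^bsub>R\<^esub>k\<in>{..N}. \<ominus>\<^bsub>R\<^esub> fst (f (Suc k)))"
    unfolding d\<beta> a_minus_def using dc up_E[OF u] by (intro R.finsum_addf) auto
  also have "(\<Oplus>\<^bsub>R\<^esub>k\<in>{..N}. \<ominus>\<^bsub>R\<^esub> fst (f (Suc k))) = \<ominus>\<^bsub>R\<^esub> ?a"
    by (rule R.additive_finsum[of "\<lambda>x. \<ominus>\<^bsub>R\<^esub> x", symmetric]) (use up_E[OF u] in \<open>auto simp: R.minus_add\<close>)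
  finally have "\<ominus>\<^bsub>R\<^esub> (differential R \<beta> \<oplus>\<^bsub>R\<^esub> \<ominus>\<^bsub>R\<^esub> ?a) \<in> J" by (rule T.J_neg)
  moreover have "differential R \<beta> \<in> carrier R" unfolding d\<beta> using dc by (intro R.finsum_closed) auto
  ultimately show "R.path_end f \<ominus>\<^bsub>R\<^esub> (fst (f 0) \<oplus>\<^bsub>R\<^esub> differential R \<beta>) \<in> J"
    unfolding N(2) using ac up_E(1)[OF u, of 0] R.diff_add_diff[of ?a "fst (f 0)" "differential R \<beta>" "fst (f 0)"]
    by (simp add: R.minus_add a_minus_def R.a_ac R.r_neg)
qed

text \<open>
  Let \<open>f\<close> be a form that is a cocycle modulo \<open>JJ\<close>, with starting point \<open>s\<close>, and let \<open>r\<close> be an element whose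
  differential is the end point of \<open>f\<close>, modulo \<open>J\<close>. By \<open>integrate\<close>, \<open>s\<close> is the differential of
  \<open>r - \<beta>\<close> modulo \<open>J\<close>, and, as \<open>J\<close> is acyclic, exactly the differential of \<open>\<rho> = r - \<beta> + j\<close> with
  \<open>j\<close> in \<open>J\<close>. By the assumption \<open>correct\<close>, \<open>\<rho> - d \<nu>\<close> is a valid starting point of a path. The
  primitive \<open>f'\<close> of \<open>f\<close> with this starting point has as function part the antiderivative of the
  \<open>dt\<close>-part of \<open>f\<close>. The term \<open>d(t \<nu>)\<close> is added to it: it moves the end point by
  \<open>d \<nu>\<close>, back to \<open>r\<close> modulo \<open>J\<close>.
\<close>

lemma acyclic_surjection_ev: "acyclic_surjection W.Q T.Q ev"
  unfolding acyclic_surjection_def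
proof (intro allI impI, elim conjE)
  fix n w t
  assume w: "w \<in> grade W.Q (n + 1)" "differential W.Q w = \<zero>\<^bsub>W.Q\<^esub>" and t: "t \<in> grade T.Q n" "differential T.Q t = ev w"
  obtain f where f: "f \<in> W0" "f \<in> grade Pa (n + 1)" "w = cW f" using w(1) by auto
  obtain r where r: "r \<in> carrier R" "r \<in> grade R n" "t = cT r" using t(1) by auto
  have u: "f \<in> up E" using f by (simp add: W0_def)
  have dW: "differential Pa f \<in> W0" by (rule W.W_d[OF f(1)])
  have "cW (differential Pa f) = cW \<zero>\<^bsub>Pa\<^esub>" using w(2) f by (simp add: W.d_Q W.zero_Q)
  then have "differential Pa f \<ominus>\<^bsub>Pa\<^esub> \<zero>\<^bsub>Pa\<^esub> \<in> JJ" using cW_eq[OF dW W.W_zero] by simp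
  then have cocycle: "path_diff K R f \<in> JJ" using W.W_carrier[OF dW] by (simp add: a_minus_def path_simps(2))
  have "cT (differential R r) = cT (R.path_end f)" using t(2) r f by (simp add: T.d_Q ev)
  moreover have pc: "R.path_end f \<in> carrier R"
    using ghom_closed[OF dghom_ghom[OF R.path_end_dghom]] u by (simp add: carrier_Pa)
  ultimately have rJ: "differential R r \<ominus>\<^bsub>R\<^esub> R.path_end f \<in> J" using cT_eq R.d_closed r by simp
  obtain N where N: "\<forall>k>N. f k = (\<zero>\<^bsub>R\<^esub>, \<zero>\<^bsub>R\<^esub>)"
    "R.path_end f = (\<Oplus>\<^bsub>R\<^esub>k\<in>{..N}. fst (f (Suc k))) \<oplus>\<^bsub>R\<^esub> fst (f 0)" by (rule path_end_split[OF u])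
  define \<kappa> where "\<kappa> k = [Suc k] \<cdot>\<^bsub>K\<^esub> \<one>\<^bsub>K\<^esub>" for k
  have \<kappa>: "\<kappa> k \<in> Units K" "\<kappa> k \<in> carrier K" "inv\<^bsub>K\<^esub> \<kappa> k \<in> carrier K" for k
    using nat_unit[of k] by (auto simp: \<kappa>_def)
  define \<beta> where "\<beta> = (\<Oplus>\<^bsub>R\<^esub>k\<in>{..N}. inv\<^bsub>K\<^esub> \<kappa> k \<odot>\<^bsub>R\<^esub> snd (f k))"
  note int = integrate[OF f(1,2) cocycle N, folded \<kappa>_def, folded \<beta>_def]
  have \<beta>: "\<beta> \<in> grade R n" "\<beta> \<in> U" "\<beta> \<in> carrier R" using int(1,2) U_simps(1) by auto
  let ?s = "fst (f 0)"
  have s: "?s \<in> grade R (n + 1)" "?s \<in> carrier R" using f(2) up_E[OF u] by (simp_all add: path_simps)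
  have ds: "differential R ?s = \<zero>\<^bsub>R\<^esub>" using cocycle by (simp add: JJ_def path_diff_def)
  let ?x = "r \<ominus>\<^bsub>R\<^esub> \<beta>"
  have x: "?x \<in> grade R n" "?x \<in> carrier R" using r \<beta> R.grade_minus by auto
  have dx: "differential R ?x = differential R r \<ominus>\<^bsub>R\<^esub> differential R \<beta>" using r \<beta> by (simp add: R.d_minus)
  let ?j = "?s \<ominus>\<^bsub>R\<^esub> differential R ?x"
  have "\<ominus>\<^bsub>R\<^esub> ((differential R r \<ominus>\<^bsub>R\<^esub> R.path_end f) \<oplus>\<^bsub>R\<^esub> (R.path_end f \<ominus>\<^bsub>R\<^esub> (?s \<oplus>\<^bsub>R\<^esub> differential R \<beta>))) \<in> J"
    by (intro T.J_neg T.J_add rJ int(3))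
  also have "\<ominus>\<^bsub>R\<^esub> ((differential R r \<ominus>\<^bsub>R\<^esub> R.path_end f) \<oplus>\<^bsub>R\<^esub> (R.path_end f \<ominus>\<^bsub>R\<^esub> (?s \<oplus>\<^bsub>R\<^esub> differential R \<beta>))) = ?j"
    unfolding dx using pc s R.d_closed[OF r(1)] R.d_closed[OF \<beta>(3)] by algebra
  finally have "?j \<in> J" .
  moreover have "?j \<in> grade R (n + 1)" by (intro R.grade_minus s R.d_grade x)
  ultimately have "?j \<in> H (n + 1)" using J_homogeneous by blast
  moreover have "differential R ?j = \<zero>\<^bsub>R\<^esub>"
    using R.d_minus[OF s(2) R.d_closed[OF x(2)]] ds R.d_d[OF x(2)] by (simp add: a_minus_def)
  ultimately obtain j where j: "j \<in> H n" "differential R j = ?j" using H_acyclic[of ?j "n + 1"] by auto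
  have jc: "j \<in> grade R n" "j \<in> carrier R" "j \<in> J"
    using R.H_simps(1)[OF H j(1)] R.grade_closed J_homogeneous j(1) by blast+
  let ?\<rho> = "?x \<oplus>\<^bsub>R\<^esub> j"
  have \<rho>: "?\<rho> \<in> grade R n" "?\<rho> \<in> carrier R" using x jc R.grade_add by auto
  have d\<rho>: "differential R ?\<rho> = ?s"
  proof -
    have "differential R ?\<rho> = differential R ?x \<oplus>\<^bsub>R\<^esub> ?j" using x jc j by (simp add: R.d_add)
    also have "\<dots> = ?s" using s R.d_closed[OF x(2)] by algebra
    finally show ?thesis .
  qed
  have "\<phi> (differential R ?\<rho>) = \<iota> (differential R ?\<rho>)" unfolding d\<rho> using f(1) by (simp add: W0_def)
  from correct[OF \<rho>(1) this] obtain \<nu> where \<nu>: "\<nu> \<in> grade R (n - 1)" "\<phi> \<nu> = \<zero>\<^bsub>B\<^esub>"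
    "\<phi> (?\<rho> \<ominus>\<^bsub>R\<^esub> differential R \<nu>) = \<iota> (?\<rho> \<ominus>\<^bsub>R\<^esub> differential R \<nu>)" by blast
  have \<nu>c: "\<nu> \<in> carrier R" "\<nu> \<in> U" "differential R \<nu> \<in> grade R n" "differential R \<nu> \<in> carrier R" "differential R \<nu> \<in> U"
    using \<nu> R.grade_closed R.d_grade[OF \<nu>(1)] R.d_closed U_simps(8)[of \<nu>] by (auto simp: U_def)
  let ?s' = "?\<rho> \<ominus>\<^bsub>R\<^esub> differential R \<nu>"
  have s': "?s' \<in> grade R n" "?s' \<in> carrier R" "differential R ?s' = ?s"
    using \<rho> \<nu>c R.grade_minus[OF \<rho>(1) \<nu>c(3)] d\<rho> s(2) R.d_d[OF \<nu>c(1)] R.d_minus[OF \<rho>(2) \<nu>c(4)]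
    by (simp_all add: a_minus_def)
  \<comment> \<open>The primitive \<open>f'\<close>: \<open>a'\<close> are its coefficients at positive powers of \<open>t\<close>, \<open>b'\<close> those of \<open>dt\<close>.\<close>
  define a' where "a' k = inv\<^bsub>K\<^esub> \<kappa> k \<odot>\<^bsub>R\<^esub> snd (f k) \<oplus>\<^bsub>R\<^esub> (if k = 0 then differential R \<nu> else \<zero>\<^bsub>R\<^esub>)" for k
  define b' where "b' k = (if k = 0 then \<nu> else \<zero>\<^bsub>R\<^esub>)" for k :: nat
  define f' where "f' k = ((case k of 0 \<Rightarrow> ?s' | Suc k \<Rightarrow> a' k), b' k)" for k
  have f0: "f' 0 = (?s', \<nu>)" "fst (f' (Suc k)) = a' k" "snd (f' k) = b' k" for k by (simp_all add: f'_def b'_def)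
  have fb: "snd (f k) \<in> grade R n" "snd (f k) \<in> carrier R" "snd (f k) \<in> U" for k
    using f up_E[OF u] by (simp_all add: path_simps W0_def)
  have a': "a' k \<in> grade R n" "a' k \<in> carrier R" "a' k \<in> U" for k
    using fb[of k] \<kappa> \<nu>c U_simps by (auto simp: a'_def intro!: R.grade_add R.grade_smult)
  have b': "b' k \<in> grade R (n - 1)" "b' k \<in> carrier R" "b' k \<in> U" for k
    using \<nu> \<nu>c U_simps(2) by (auto simp: b'_def)
  have z: "f' k = (\<zero>\<^bsub>R\<^esub>, \<zero>\<^bsub>R\<^esub>)" if "k > Suc N" for k
    using that N(1) \<kappa> by (cases k) (auto simp: f'_def a'_def b'_def)
  have up': "f' \<in> up E"
    unfolding E_def up_eps_iff
  proof
    show "\<forall>n. fst (f' n) \<in> carrier R \<and> snd (f' n) \<in> carrier R"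
      using s' a' b' by (auto simp: f'_def split: nat.splits)
    show "\<exists>n. \<forall>k>n. f' k = (\<zero>\<^bsub>R\<^esub>, \<zero>\<^bsub>R\<^esub>)" using z by blast
  qed
  have f'W: "f' \<in> W0" using up' \<nu>(3) a' b' by (simp add: W0_def f0)
  have f'g: "f' \<in> grade Pa n"
    using up' s' a' b' by (auto simp: path_simps E_def f'_def split: nat.splits)
  have d1: "differential Pa f' \<in> W0" by (rule W.W_d[OF f'W])
  have minus: "g \<ominus>\<^bsub>Pa\<^esub> f = (\<lambda>n. (fst (g n) \<ominus>\<^bsub>R\<^esub> fst (f n), snd (g n) \<ominus>\<^bsub>R\<^esub> snd (f n)))" if "g \<in> up E" for g
  proof -
    have "\<ominus>\<^bsub>Pa\<^esub> f = (\<lambda>n. (\<ominus>\<^bsub>R\<^esub> fst (f n), \<ominus>\<^bsub>R\<^esub> snd (f n)))"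
      using R.path_signed[of f 1] u by (simp add: signed_def E_def)
    moreover have "\<ominus>\<^bsub>Pa\<^esub> f \<in> up E" using Pa.a_inv_closed[of f] u by (simp add: carrier_Pa)
    ultimately show ?thesis using that by (simp add: a_minus_def Pa_add)
  qed
  have pd: "path_diff K R f' \<in> up E" using R.path_diff_up up' by (simp add: E_def)
  have "path_diff K R f' \<ominus>\<^bsub>Pa\<^esub> f \<in> JJ"
  proof -
    have up: "path_diff K R f' \<ominus>\<^bsub>Pa\<^esub> f \<in> up E"
      using Pa.minus_closed[of "path_diff K R f'" f] pd u by (simp add: carrier_Pa)
    have 0: "differential R ?s' \<ominus>\<^bsub>R\<^esub> ?s = \<zero>\<^bsub>R\<^esub>" using s' s by (simp add: a_minus_def R.r_neg)
    have 1: "differential R (a' k) \<ominus>\<^bsub>R\<^esub> fst (f (Suc k)) \<in> J" for k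
    proof -
      have "differential R (a' k) = inv\<^bsub>K\<^esub> \<kappa> k \<odot>\<^bsub>R\<^esub> differential R (snd (f k))"
        using \<kappa> fb[of k] \<nu>c R.d_closed by (simp add: a'_def R.d_add R.d_smult R.d_d)
      then show ?thesis using int(4)[of k] by simp
    qed
    have 2: "(\<kappa> k \<odot>\<^bsub>R\<^esub> a' k \<ominus>\<^bsub>R\<^esub> differential R (b' k)) \<ominus>\<^bsub>R\<^esub> snd (f k) = \<zero>\<^bsub>R\<^esub>" for k
    proof -
      have k1: "\<kappa> 0 \<odot>\<^bsub>R\<^esub> differential R \<nu> = differential R \<nu>" using \<nu>c by (simp add: \<kappa>_def R.smult_one)
      have "\<kappa> k \<odot>\<^bsub>R\<^esub> a' k = snd (f k) \<oplus>\<^bsub>R\<^esub> differential R (b' k)"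
        using \<kappa>[of k] fb[of k] \<nu>c k1
        by (auto simp: a'_def b'_def R.smult_r_distr R.smult_assoc1[symmetric] R.smult_one)
      then show ?thesis using fb(2)[of k] R.d_closed[OF b'(2)[of k]]
        by (simp add: a_minus_def R.a_assoc R.r_neg)
    qed
    show ?thesis
      using up 0 1 2[unfolded \<kappa>_def] T.J_zero unfolding JJ_def minus[OF pd] by (simp add: path_diff_def f0)
  qed
  then have "differential W.Q (cW f') = w"
    using cW_eq[OF d1 f(1)] f'W f(3) by (simp add: W.d_Q path_simps(2))
  moreover have "ev (cW f') = t"
  proof -
    have sum: "(\<Oplus>\<^bsub>R\<^esub>k\<in>{..N}. fst (f' (Suc k))) = \<beta> \<oplus>\<^bsub>R\<^esub> differential R \<nu>"
    proof -
      have "(\<Oplus>\<^bsub>R\<^esub>k\<in>{..N}. fst (f' (Suc k)))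
        = \<beta> \<oplus>\<^bsub>R\<^esub> (\<Oplus>\<^bsub>R\<^esub>k\<in>{..N}. if k = 0 then differential R \<nu> else \<zero>\<^bsub>R\<^esub>)"
        unfolding f0 a'_def \<beta>_def using \<kappa> fb \<nu>c by (intro R.finsum_addf) auto
      also have "(\<Oplus>\<^bsub>R\<^esub>k\<in>{..N}. if k = 0 then differential R \<nu> else \<zero>\<^bsub>R\<^esub>) = differential R \<nu>"
        using R.finsum_singleton[of 0 "{..N}" "\<lambda>_. differential R \<nu>"] \<nu>c by (simp add: eq_commute[of 0])
      finally show ?thesis .
    qed
    have "R.path_end f' = (\<Oplus>\<^bsub>R\<^esub>k\<in>{..Suc N}. fst (f' k))"
      by (rule R.path_end_eq) (use up' z in \<open>auto simp: E_def\<close>)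
    also have "\<dots> = (\<Oplus>\<^bsub>R\<^esub>k\<in>{..N}. fst (f' (Suc k))) \<oplus>\<^bsub>R\<^esub> fst (f' 0)"
      using up' by (intro R.finsum_Suc2) (auto simp: up_E)
    also have "\<dots> = (\<beta> \<oplus>\<^bsub>R\<^esub> differential R \<nu>) \<oplus>\<^bsub>R\<^esub> ?s'" unfolding sum by (simp add: f0)
    also have "\<dots> = r \<oplus>\<^bsub>R\<^esub> j" using \<beta> \<nu>c r jc by algebra
    finally have "R.path_end f' = r \<oplus>\<^bsub>R\<^esub> j" .
    then have "R.path_end f' \<ominus>\<^bsub>R\<^esub> r = j" using r(1) jc(2) by simp algebra
    then have "cT (R.path_end f') = cT r"
      using cT_eq[of "R.path_end f'" r] jc(3) r ghom_closed[OF dghom_ghom[OF R.path_end_dghom]] up' by (simp add: carrier_Pa)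
    then show ?thesis using ev(2)[OF f'W] r by simp
  qed
  moreover have "cW f' \<in> grade W.Q n" using f'W f'g by simp
  ultimately show "\<exists>w'\<in>grade W.Q n. differential W.Q w' = w \<and> ev w' = t" by blast
qed

lemma carrier_W_code:
  assumes inf: "infinite (UNIV :: 'u set)"
  obtains code :: "(nat \<Rightarrow> 'u \<times> 'u) \<Rightarrow> 'u" where "inj_on code (carrier W.Q)"
proof -
  obtain p :: "'u \<times> 'u \<Rightarrow> 'u" where p: "inj p" by (rule infinite_pair_injection[OF inf])
  obtain code :: "(nat \<Rightarrow> 'u \<times> 'u) \<Rightarrow> 'u" where
    code: "inj_on code {f. \<exists>n. \<forall>m>n. f m = (\<zero>\<^bsub>R\<^esub>, \<zero>\<^bsub>R\<^esub>)}"
    by (rule finite_support_injection[OF inf p])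
  have "cW f \<in> W0" if "f \<in> W0" for f
    using that W.J_add W.J_smult W.J_zero W.J_sub W.W_closed by (intro Pa.quotient_rep_in) auto
  moreover have "W0 \<subseteq> {f. \<exists>n. \<forall>m>n. f m = (\<zero>\<^bsub>R\<^esub>, \<zero>\<^bsub>R\<^esub>)}" by (auto simp: W0_def E_def up_eps_iff)
  ultimately have "carrier W.Q \<subseteq> {f. \<exists>n. \<forall>m>n. f m = (\<zero>\<^bsub>R\<^esub>, \<zero>\<^bsub>R\<^esub>)}" unfolding W.carrier_Q by blast
  then show thesis using that[of code] inj_on_subset[OF code] by blast
qed

definition const_path :: "'u \<Rightarrow> (nat \<Rightarrow> 'u \<times> 'u)" where
  "const_path x = (\<lambda>n. if n = 0 then (x, \<zero>\<^bsub>R\<^esub>) else (\<zero>\<^bsub>R\<^esub>, \<zero>\<^bsub>R\<^esub>))"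

lemma const_path_up: "x \<in> carrier R \<Longrightarrow> const_path x \<in> up E"
  by (auto simp: const_path_def E_def up_eps_iff)

lemma const_path_dghom: "const_path \<in> dghom K R Pa"
proof -
  have "const_path \<in> ghom K R Pa"
  proof (rule ghomI)
    fix x y assume x: "x \<in> carrier R" and y: "y \<in> carrier R"
    show "const_path (x \<otimes>\<^bsub>R\<^esub> y) = const_path x \<otimes>\<^bsub>Pa\<^esub> const_path y"
    proof
      fix n
      have "(\<Oplus>\<^bsub>R\<^esub>k\<in>{..n}. fst (const_path x k) \<otimes>\<^bsub>R\<^esub> fst (const_path y (n - k)))
        = (\<Oplus>\<^bsub>R\<^esub>k\<in>{..n}. if k = 0 then (if n = 0 then x \<otimes>\<^bsub>R\<^esub> y else \<zero>\<^bsub>R\<^esub>) else \<zero>\<^bsub>R\<^esub>)"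
        by (rule R.finsum_cong') (use x y in \<open>auto simp: const_path_def\<close>)
      also have "\<dots> = (if n = 0 then x \<otimes>\<^bsub>R\<^esub> y else \<zero>\<^bsub>R\<^esub>)"
        using R.finsum_singleton[of 0 "{..n}" "\<lambda>_. if n = 0 then x \<otimes>\<^bsub>R\<^esub> y else \<zero>\<^bsub>R\<^esub>"] x y
        by (auto simp: eq_commute[of 0])
      finally have 1: "(\<Oplus>\<^bsub>R\<^esub>k\<in>{..n}. fst (const_path x k) \<otimes>\<^bsub>R\<^esub> fst (const_path y (n - k))) = (if n = 0 then x \<otimes>\<^bsub>R\<^esub> y else \<zero>\<^bsub>R\<^esub>)" .
      have 2: "(\<Oplus>\<^bsub>R\<^esub>k\<in>{..n}. (snd (const_path x k) \<otimes>\<^bsub>R\<^esub> fst (const_path y (n - k)))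
          \<oplus>\<^bsub>R\<^esub> (twist R (- 1) (fst (const_path x k)) \<otimes>\<^bsub>R\<^esub> snd (const_path y (n - k)))) = (\<Oplus>\<^bsub>R\<^esub>k\<in>{..n}. \<zero>\<^bsub>R\<^esub>)"
        by (rule R.finsum_cong') (use x y in \<open>auto simp: const_path_def\<close>)
      show "const_path (x \<otimes>\<^bsub>R\<^esub> y) n = (const_path x \<otimes>\<^bsub>Pa\<^esub> const_path y) n"
        unfolding Pa_mult[OF const_path_up[OF x] const_path_up[OF y]] 1 2 by (simp add: const_path_def)
    qed
    show "const_path (x \<oplus>\<^bsub>R\<^esub> y) = const_path x \<oplus>\<^bsub>Pa\<^esub> const_path y"
      unfolding Pa_add[OF const_path_up[OF x] const_path_up[OF y]] by (auto simp: const_path_def)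
  next
    fix i x assume "x \<in> grade R i"
    then show "const_path x \<in> grade Pa i"
      using const_path_up[OF R.grade_closed] by (auto simp: path_simps const_path_def E_def)
  next
    fix x assume "x \<in> carrier R"
    then show "const_path x \<in> carrier Pa" by (simp add: carrier_Pa const_path_up)
  qed (auto simp: const_path_def path_one path_smult)
  then show ?thesis
    by (auto simp: dghom_def path_simps(2) path_diff_def const_path_def a_minus_def)
qed

text \<open>
  The quotient map \<open>R \<rightarrow> R/J\<close> is lifted through evaluation at \<open>1\<close> to a map \<open>\<sigma>\<close> into the algebra of paths
  that is the constant path \<open>k p\<close> on \<open>g p\<close>; and \<open>h x\<close> is the starting point of \<open>\<sigma> x\<close>. For a
  cocycle \<open>z\<close>, the path \<open>\<sigma> z\<close> shows that \<open>h z\<close> and \<open>z\<close> differ by a coboundary modulo \<open>J\<close>, so that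
  \<open>z\<close> is a coboundary modulo \<open>J\<close> if \<open>h z\<close> is one; and \<open>J\<close> is acyclic.
\<close>

theorem lifted_endomorphism:
  fixes P :: "('k, 'u, 'w) dga_scheme"
  assumes inf: "infinite (UNIV :: 'u set)" and P: "cdga K P" and cof: "cofibration K P R g"
    and g: "g \<in> dghom K P R" and k: "k \<in> dghom K P R"
    and k_fix: "\<And>p. p \<in> carrier P \<Longrightarrow> \<phi> (k p) = \<iota> (k p)"
    and gk: "\<And>p. p \<in> carrier P \<Longrightarrow> g p \<ominus>\<^bsub>R\<^esub> k p \<in> total_ideal R H"
  obtains h where "h \<in> dghom K R R" "\<And>p. p \<in> carrier P \<Longrightarrow> h (g p) = k p"
    "\<And>x. x \<in> carrier R \<Longrightarrow> \<iota> (h x) = \<phi> x"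
    "\<And>i z y. \<lbrakk>z \<in> grade R i; differential R z = \<zero>\<^bsub>R\<^esub>; y \<in> grade R (i - 1); h z = differential R y\<rbrakk>
      \<Longrightarrow> \<exists>y'\<in>grade R (i - 1). differential R y' = z"
proof -
  interpret P: cdga K P by (rule P)
  obtain code :: "(nat \<Rightarrow> 'u \<times> 'u) \<Rightarrow> 'u" where code: "inj_on code (carrier W.Q)" by (rule carrier_W_code[OF inf])
  have kc: "k p \<in> carrier R" if "p \<in> carrier P" for p using ghom_closed[OF dghom_ghom[OF k] that] .
  have kW: "const_path (k p) \<in> W0" if "p \<in> carrier P" for p
    using const_path_up[OF kc[OF that]] k_fix[OF that] U_simps(2) by (simp add: W0_def const_path_def)
  have k': "(\<lambda>p. cW (const_path (k p))) \<in> dghom K P W.Q"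
    by (rule W.c_dghom[OF dghom_comp[OF k const_path_dghom]]) (use kW P.grade_closed in auto)
  have pe: "R.path_end (const_path x) = x" if "x \<in> carrier R" for x
    using R.path_end_eq[of "const_path x" 0] const_path_up[OF that] that by (simp add: E_def const_path_def)
  obtain \<sigma> where \<sigma>: "\<sigma> \<in> dghom K R W.Q" "\<And>a. a \<in> carrier P \<Longrightarrow> \<sigma> (g a) = cW (const_path (k a))"
    "\<And>y. y \<in> carrier R \<Longrightarrow> ev (\<sigma> y) = cT y"
  proof (rule cofibration_lifting[OF cof inf W.graded_dga_Q T.graded_dga_Q code k' ev(1) cT_dghom _ acyclic_surjection_ev])
    fix a assume a: "a \<in> carrier P"
    have "k a \<ominus>\<^bsub>R\<^esub> g a = \<ominus>\<^bsub>R\<^esub> (g a \<ominus>\<^bsub>R\<^esub> k a)"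
      using kc[OF a] ghom_closed[OF dghom_ghom[OF g] a] by algebra
    then have "k a \<ominus>\<^bsub>R\<^esub> g a \<in> J" using T.J_neg gk[OF a] by (simp add: J_def)
    then show "ev (cW (const_path (k a))) = cT (g a)"
      using ev(2)[OF kW[OF a]] pe[OF kc[OF a]] cT_eq kc[OF a] ghom_closed[OF dghom_ghom[OF g] a] by simp
  qed (rule that)
  have repr: "\<exists>f\<in>W0. f \<in> grade Pa i \<and> \<sigma> x = cW f \<and> R.path_end f \<ominus>\<^bsub>R\<^esub> x \<in> J" if x: "x \<in> grade R i" for x i
  proof -
    obtain f where f: "f \<in> W0" "f \<in> grade Pa i" "\<sigma> x = cW f"
      using ghom_grade[OF dghom_ghom[OF \<sigma>(1)] x] by auto
    have "cT (R.path_end f) = cT x" using \<sigma>(3)[OF R.grade_closed[OF x]] ev(2)[OF f(1)] f(3) by simp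
    then have "R.path_end f \<ominus>\<^bsub>R\<^esub> x \<in> J"
      using cT_eq ghom_closed[OF dghom_ghom[OF R.path_end_dghom]] f(1) R.grade_closed[OF x] W.W_carrier by blast
    then show ?thesis using f by blast
  qed
  have fix_hom: "\<iota> (st (\<sigma> x)) = \<phi> x" if x: "x \<in> grade R i" for x i
  proof -
    obtain f where f: "f \<in> W0" "\<sigma> x = cW f" "R.path_end f \<ominus>\<^bsub>R\<^esub> x \<in> J" using repr[OF x] by blast
    have c: "R.path_end f \<in> carrier R" "x \<in> carrier R"
      using ghom_closed[OF dghom_ghom[OF R.path_end_dghom]] f(1) R.grade_closed[OF x] W.W_carrier by blast+
    have "\<phi> (R.path_end f \<ominus>\<^bsub>R\<^esub> x) = \<zero>\<^bsub>B\<^esub>" using f(3) J_U by (auto simp: U_def)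
    then have "\<phi> (R.path_end f) = \<phi> x"
      using c ghom_minus[OF dghom_ghom[OF \<phi>] R.ring_axioms B.ring_axioms c] by (simp add: B.minus_eq_zero_iff \<phi>_simps)
    then show ?thesis using path_end_U[OF f(1)] st(2)[OF f(1)] f(2) by simp
  qed
  show thesis
  proof (rule that)
    show h: "(\<lambda>x. st (\<sigma> x)) \<in> dghom K R R" by (rule dghom_comp[OF \<sigma>(1) st(1)])
    show "st (\<sigma> (g p)) = k p" if "p \<in> carrier P" for p
      using \<sigma>(2)[OF that] st(2)[OF kW[OF that]] by (simp add: const_path_def)
    show "\<iota> (st (\<sigma> x)) = \<phi> x" if "x \<in> carrier R" for x
      using that
    proof (induction rule: R.graded_induct)
      case zero
      then show ?case
        using ghom_zero[OF dghom_ghom[OF h] R.ring_axioms R.ring_axioms] by (simp add: \<iota>_simps \<phi>_simps)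
    next
      case (hom i x)
      then show ?case by (rule fix_hom)
    next
      case (add x y)
      then show ?case using ghom_add[OF dghom_ghom[OF h]] ghom_closed[OF dghom_ghom[OF h]]
        by (simp add: \<iota>_simps(3) \<phi>_simps(3))
    qed
    fix i z y
    assume z: "z \<in> grade R i" "differential R z = \<zero>\<^bsub>R\<^esub>" and y: "y \<in> grade R (i - 1)" "st (\<sigma> z) = differential R y"
    note zc = R.grade_closed[OF z(1)] and yc = R.grade_closed[OF y(1)]
    obtain f where f: "f \<in> W0" "f \<in> grade Pa i" "\<sigma> z = cW f" "R.path_end f \<ominus>\<^bsub>R\<^esub> z \<in> J" using repr[OF z(1)] by blast
    have u: "f \<in> up E" using f by (simp add: W0_def)
    have dW: "differential Pa f \<in> W0" by (rule W.W_d[OF f(1)])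
    have "differential W.Q (\<sigma> z) = \<zero>\<^bsub>W.Q\<^esub>"
      using dghom_d[OF \<sigma>(1) zc] z(2) ghom_zero[OF dghom_ghom[OF \<sigma>(1)] R.ring_axioms W.ring_Q] by simp
    then have "cW (differential Pa f) = cW \<zero>\<^bsub>Pa\<^esub>" using f by (simp add: W.d_Q W.zero_Q)
    then have "differential Pa f \<ominus>\<^bsub>Pa\<^esub> \<zero>\<^bsub>Pa\<^esub> \<in> JJ" using cW_eq[OF dW W.W_zero] by simp
    then have cocycle: "path_diff K R f \<in> JJ" using W.W_carrier[OF dW] by (simp add: a_minus_def path_simps(2))
    obtain N where N: "\<forall>k>N. f k = (\<zero>\<^bsub>R\<^esub>, \<zero>\<^bsub>R\<^esub>)"
      "R.path_end f = (\<Oplus>\<^bsub>R\<^esub>k\<in>{..N}. fst (f (Suc k))) \<oplus>\<^bsub>R\<^esub> fst (f 0)" by (rule path_end_split[OF u])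
    obtain \<beta> where \<beta>: "\<beta> \<in> grade R (i - 1)" "R.path_end f \<ominus>\<^bsub>R\<^esub> (fst (f 0) \<oplus>\<^bsub>R\<^esub> differential R \<beta>) \<in> J"
      using integrate(1,3)[OF f(1,2) cocycle N] by blast
    note \<beta>c = R.grade_closed[OF \<beta>(1)]
    have f0: "fst (f 0) = differential R y" using y(2) st(2)[OF f(1)] f(3) by simp
    let ?v = "y \<oplus>\<^bsub>R\<^esub> \<beta>"
    have v: "?v \<in> grade R (i - 1)" "?v \<in> carrier R" using y(1) \<beta>(1) R.grade_add yc \<beta>c by auto
    have pc: "R.path_end f \<in> carrier R" using ghom_closed[OF dghom_ghom[OF R.path_end_dghom]] u by (simp add: carrier_Pa)
    have dv: "differential R ?v = differential R y \<oplus>\<^bsub>R\<^esub> differential R \<beta>" using yc \<beta>c by (simp add: R.d_add)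
    have "(R.path_end f \<ominus>\<^bsub>R\<^esub> differential R ?v) \<ominus>\<^bsub>R\<^esub> (R.path_end f \<ominus>\<^bsub>R\<^esub> z) \<in> J"
      using J_minus[OF \<beta>(2) f(4)] by (simp add: dv f0)
    also have "(R.path_end f \<ominus>\<^bsub>R\<^esub> differential R ?v) \<ominus>\<^bsub>R\<^esub> (R.path_end f \<ominus>\<^bsub>R\<^esub> z) = z \<ominus>\<^bsub>R\<^esub> differential R ?v"
      using pc zc R.d_closed[OF v(2)] by algebra
    finally have J: "z \<ominus>\<^bsub>R\<^esub> differential R ?v \<in> J" .
    have dvg: "differential R ?v \<in> grade R i" using R.d_grade[OF v(1)] by simp
    have "z \<ominus>\<^bsub>R\<^esub> differential R ?v \<in> H i"
      using J J_homogeneous[OF R.grade_minus[OF z(1) dvg]] by blast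
    moreover have "differential R (z \<ominus>\<^bsub>R\<^esub> differential R ?v) = \<zero>\<^bsub>R\<^esub>"
      using R.d_minus[OF zc R.d_closed[OF v(2)]] z(2) R.d_d[OF v(2)] by (simp add: a_minus_def)
    ultimately obtain j where j: "j \<in> H (i - 1)" "differential R j = z \<ominus>\<^bsub>R\<^esub> differential R ?v" using H_acyclic by blast
    have jg: "j \<in> grade R (i - 1)" "j \<in> carrier R" using R.H_simps(1)[OF H j(1)] R.grade_closed by auto
    have "differential R (?v \<oplus>\<^bsub>R\<^esub> j) = differential R ?v \<oplus>\<^bsub>R\<^esub> (z \<ominus>\<^bsub>R\<^esub> differential R ?v)"
      using v jg j by (simp add: R.d_add)
    also have "\<dots> = z" using zc R.d_closed[OF v(2)] by algebra
    finally show "\<exists>y'\<in>grade R (i - 1). differential R y' = z" using R.grade_add[OF v(1) jg(1)] by blast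
  qed
qed

end

section \<open>Idempotents and their kernels in cohomology\<close>

context graded_dga
begin

lemma coboundaries_cocycles: "coboundaries A i \<subseteq> cocycles A i"
proof
  fix x assume "x \<in> coboundaries A i"
  then obtain y where y: "y \<in> grade A (i - 1)" "x = differential A y" by (auto simp: coboundaries_def)
  then show "x \<in> cocycles A i" using d_grade[OF y(1)] d_d[OF grade_closed[OF y(1)]] by (simp add: cocycles_def)
qed

lemma cocycles_closed: "z \<in> cocycles A i \<Longrightarrow> z \<in> carrier A"
  using grade_closed by (auto simp: cocycles_def)

lemma coboundaries_closed: "b \<in> coboundaries A i \<Longrightarrow> b \<in> carrier A"
  using coboundaries_cocycles cocycles_closed by blast

lemma coboundaries_add: "\<lbrakk>x \<in> coboundaries A i; y \<in> coboundaries A i\<rbrakk> \<Longrightarrow> x \<oplus>\<^bsub>A\<^esub> y \<in> coboundaries A i"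
  unfolding coboundaries_def by (auto simp flip: d_add simp: grade_closed intro!: imageI grade_add)

lemma coboundaries_neg: "x \<in> coboundaries A i \<Longrightarrow> \<ominus>\<^bsub>A\<^esub> x \<in> coboundaries A i"
  unfolding coboundaries_def by (auto simp flip: d_neg simp: grade_closed intro!: imageI grade_neg)

lemma coboundaries_zero: "\<zero>\<^bsub>A\<^esub> \<in> coboundaries A i"
  unfolding coboundaries_def by (rule image_eqI[of _ _ "\<zero>\<^bsub>A\<^esub>"]) simp_all

lemma coset_memD: "y \<in> coboundaries A i +>\<^bsub>A\<^esub> x \<longleftrightarrow> (\<exists>b\<in>coboundaries A i. y = b \<oplus>\<^bsub>A\<^esub> x)"
  by (auto simp: a_r_coset_def r_coset_def)

lemma coset_eq_iff:
  assumes x: "x \<in> carrier A" and y: "y \<in> carrier A"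
  shows "coboundaries A i +>\<^bsub>A\<^esub> x = coboundaries A i +>\<^bsub>A\<^esub> y \<longleftrightarrow> x \<ominus>\<^bsub>A\<^esub> y \<in> coboundaries A i"
proof
  assume e: "coboundaries A i +>\<^bsub>A\<^esub> x = coboundaries A i +>\<^bsub>A\<^esub> y"
  have "x \<in> coboundaries A i +>\<^bsub>A\<^esub> x" unfolding coset_memD
    using coboundaries_zero x by (intro bexI[of _ "\<zero>\<^bsub>A\<^esub>"]) simp_all
  then obtain b where b: "b \<in> coboundaries A i" "x = b \<oplus>\<^bsub>A\<^esub> y" unfolding e coset_memD by blast
  then show "x \<ominus>\<^bsub>A\<^esub> y \<in> coboundaries A i"
    using coboundaries_closed[OF b(1)] y by (simp add: a_minus_def a_assoc r_neg)
next
  assume b: "x \<ominus>\<^bsub>A\<^esub> y \<in> coboundaries A i"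
  show "coboundaries A i +>\<^bsub>A\<^esub> x = coboundaries A i +>\<^bsub>A\<^esub> y"
  proof (intro equalityI subsetI)
    fix z assume "z \<in> coboundaries A i +>\<^bsub>A\<^esub> x"
    then obtain c where c: "c \<in> coboundaries A i" "z = c \<oplus>\<^bsub>A\<^esub> x" unfolding coset_memD by blast
    have "z = (c \<oplus>\<^bsub>A\<^esub> (x \<ominus>\<^bsub>A\<^esub> y)) \<oplus>\<^bsub>A\<^esub> y" unfolding c(2)
      using coboundaries_closed[OF c(1)] x y by algebra
    then show "z \<in> coboundaries A i +>\<^bsub>A\<^esub> y" unfolding coset_memD using coboundaries_add[OF c(1) b] by blast
  next
    fix z assume "z \<in> coboundaries A i +>\<^bsub>A\<^esub> y"
    then obtain c where c: "c \<in> coboundaries A i" "z = c \<oplus>\<^bsub>A\<^esub> y" unfolding coset_memD by blast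
    have "z = (c \<oplus>\<^bsub>A\<^esub> \<ominus>\<^bsub>A\<^esub> (x \<ominus>\<^bsub>A\<^esub> y)) \<oplus>\<^bsub>A\<^esub> x" unfolding c(2)
      using coboundaries_closed[OF c(1)] x y by algebra
    then show "z \<in> coboundaries A i +>\<^bsub>A\<^esub> x" unfolding coset_memD
      using coboundaries_add[OF c(1) coboundaries_neg[OF b]] by blast
  qed
qed

lemma carrier_cohomology:
  "carrier (cohomology A i) = {coboundaries A i +>\<^bsub>A\<^esub> z | z. z \<in> cocycles A i}"
  by (auto simp: cohomology_def A_FactGroup_def FactGroup_def RCOSETS_def a_r_coset_def r_coset_def)

lemma comm_group_cohomology: "comm_group (cohomology A i)"
proof -
  let ?Z = "A\<lparr>carrier := cocycles A i\<rparr>"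
  have Z: "abelian_group ?Z"
  proof (rule abelian_groupI, goal_cases)
    case (1 x y)
    then show ?case using cocycles_closed[of x i] cocycles_closed[of y i]
      by (simp add: cocycles_def grade_add d_add)
  next
    case (6 x)
    then have "\<ominus>\<^bsub>A\<^esub> x \<in> cocycles A i" "x \<in> carrier A"
      using cocycles_closed[of x i] by (simp_all add: cocycles_def grade_neg d_neg)
    then show ?case using l_neg by auto
  qed (auto simp: cocycles_closed a_ac cocycles_def[of A i] grade_closed)
  interpret Z: abelian_group ?Z by (rule Z)
  have neg: "\<ominus>\<^bsub>?Z\<^esub> x = \<ominus>\<^bsub>A\<^esub> x" if "x \<in> cocycles A i" for x
    using that cocycles_closed[OF that] grade_neg[of x i]
    by (intro Z.minus_equality) (simp_all add: l_neg cocycles_def d_neg)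
  have "additive_subgroup (coboundaries A i) ?Z"
  proof (rule additive_subgroupI, rule Z.add.subgroupI, goal_cases)
    case 1
    then show ?case using coboundaries_cocycles by simp
  next
    case 2
    then show ?case using coboundaries_zero by blast
  next
    case (3 x)
    then show ?case unfolding a_inv_def[of ?Z, symmetric] neg[OF subsetD[OF coboundaries_cocycles 3]]
      by (rule coboundaries_neg)
  next
    case (4 x y)
    then show ?case using coboundaries_add by simp
  qed
  then have "abelian_subgroup (coboundaries A i) ?Z" using Z by (rule abelian_subgroupI3)
  then show ?thesis unfolding cohomology_def by (rule abelian_subgroup.a_factorgroup_is_comm_group)
qed

lemma cohomology_map_coset:
  assumes f: "f \<in> dghom K A A" and z: "z \<in> cocycles A i"
  shows "cohomology_map A i f (coboundaries A i +>\<^bsub>A\<^esub> z) = coboundaries A i +>\<^bsub>A\<^esub> f z"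
proof -
  note c = ghom_closed[OF dghom_ghom[OF f]]
  have "coboundaries A i +>\<^bsub>A\<^esub> f y = coboundaries A i +>\<^bsub>A\<^esub> f z" if y: "y \<in> coboundaries A i +>\<^bsub>A\<^esub> z" for y
  proof -
    obtain b where b: "b \<in> grade A (i - 1)" "y = differential A b \<oplus>\<^bsub>A\<^esub> z"
      using y unfolding coset_memD by (auto simp: coboundaries_def)
    have bc: "b \<in> carrier A" "z \<in> carrier A" using b(1) z by (simp_all add: grade_closed cocycles_closed)
    have "f y = differential A (f b) \<oplus>\<^bsub>A\<^esub> f z"
      using b(2) bc by (simp add: ghom_add[OF dghom_ghom[OF f]] d_closed dghom_d[OF f])
    then have "f y \<ominus>\<^bsub>A\<^esub> f z = differential A (f b)"
      using bc c by (simp add: a_minus_def a_assoc r_neg d_closed)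
    moreover have "differential A (f b) \<in> coboundaries A i"
      using ghom_grade[OF dghom_ghom[OF f] b(1)] by (simp add: coboundaries_def)
    ultimately have "f y \<ominus>\<^bsub>A\<^esub> f z \<in> coboundaries A i" by simp
    then show ?thesis using bc c b(2) by (subst coset_eq_iff) (simp_all add: d_closed)
  qed
  moreover have "z \<in> coboundaries A i +>\<^bsub>A\<^esub> z" unfolding coset_memD
    using coboundaries_zero cocycles_closed[OF z] by (intro bexI[of _ "\<zero>\<^bsub>A\<^esub>"]) simp_all
  ultimately show ?thesis unfolding cohomology_map_def by blast
qed

text \<open>
  A cocycle \<open>z\<close> in the kernel of \<open>e\<close> has the same image in cohomology as \<open>0\<close>, so it is the differential of some
  \<open>y\<close>; then it is also the differential of \<open>y - e y\<close>, which lies in the kernel.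
\<close>

lemma weak_equivalence_kernel:
  assumes e: "e \<in> dghom K A A" and idem: "\<And>x. x \<in> carrier A \<Longrightarrow> e (e x) = e x"
    and we: "weak_equivalence A A e"
    and z: "z \<in> grade A i" "e z = \<zero>\<^bsub>A\<^esub>" "differential A z = \<zero>\<^bsub>A\<^esub>"
  shows "\<exists>y\<in>grade A (i - 1). e y = \<zero>\<^bsub>A\<^esub> \<and> differential A y = z"
proof -
  note c = ghom_closed[OF dghom_ghom[OF e]]
  have zc: "z \<in> cocycles A i" "z \<in> carrier A" using z grade_closed[OF z(1)] by (simp_all add: cocycles_def)
  have 0: "\<zero>\<^bsub>A\<^esub> \<in> cocycles A i" by (simp add: cocycles_def)
  have e0: "e \<zero>\<^bsub>A\<^esub> = \<zero>\<^bsub>A\<^esub>" by (rule ghom_zero[OF dghom_ghom[OF e] ring_axioms ring_axioms])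
  have "inj_on (cohomology_map A i e) (carrier (cohomology A i))"
    using we by (auto simp: weak_equivalence_def iso_def bij_betw_def)
  then have "coboundaries A i +>\<^bsub>A\<^esub> z = coboundaries A i +>\<^bsub>A\<^esub> \<zero>\<^bsub>A\<^esub>"
    by (rule inj_onD) (use zc(1) 0 in \<open>auto simp: cohomology_map_coset[OF e] carrier_cohomology z(2) e0\<close>)
  then have "z \<in> coboundaries A i" using zc by (simp add: coset_eq_iff a_minus_def)
  then obtain y where y: "y \<in> grade A (i - 1)" "z = differential A y" by (auto simp: coboundaries_def)
  have yc: "y \<in> carrier A" using y(1) by (rule grade_closed)
  have "differential A (e y) = \<zero>\<^bsub>A\<^esub>" using dghom_d[OF e yc] y(2) z(2) by simp
  then have "differential A (y \<ominus>\<^bsub>A\<^esub> e y) = z" using yc c[OF yc] y(2) zc(2) by (simp only: d_minus) (simp add: a_minus_def)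
  moreover have "e (y \<ominus>\<^bsub>A\<^esub> e y) = \<zero>\<^bsub>A\<^esub>"
    using yc c[OF yc] idem[OF yc]
    by (subst ghom_minus[OF dghom_ghom[OF e] ring_axioms ring_axioms]) (simp_all add: a_minus_def r_neg)
  moreover have "y \<ominus>\<^bsub>A\<^esub> e y \<in> grade A (i - 1)"
    using y(1) ghom_grade[OF dghom_ghom[OF e] y(1)] by (simp add: a_minus_def grade_add grade_neg)
  ultimately show ?thesis by blast
qed

text \<open>
  If \<open>z\<close> is a cocycle, then \<open>e z - z\<close> is a cocycle in the kernel of \<open>e\<close>, hence a coboundary. So
  \<open>e\<close> induces the identity on cohomology.
\<close>

lemma weak_equivalenceI:
  assumes e: "e \<in> dghom K A A" and idem: "\<And>x. x \<in> carrier A \<Longrightarrow> e (e x) = e x"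
    and acyclic: "\<And>i z. \<lbrakk>z \<in> grade A i; e z = \<zero>\<^bsub>A\<^esub>; differential A z = \<zero>\<^bsub>A\<^esub>\<rbrakk>
      \<Longrightarrow> \<exists>y\<in>grade A (i - 1). differential A y = z"
  shows "weak_equivalence A A e"
proof -
  note c = ghom_closed[OF dghom_ghom[OF e]]
  have id: "cohomology_map A i e X = X" if X: "X \<in> carrier (cohomology A i)" for X i
  proof -
    obtain z where z: "z \<in> cocycles A i" "X = coboundaries A i +>\<^bsub>A\<^esub> z" using X by (auto simp: carrier_cohomology)
    have zg: "z \<in> grade A i" "differential A z = \<zero>\<^bsub>A\<^esub>" "z \<in> carrier A"
      using z(1) cocycles_closed[OF z(1)] by (simp_all add: cocycles_def)
    have "\<exists>y\<in>grade A (i - 1). differential A y = e z \<ominus>\<^bsub>A\<^esub> z"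
    proof (rule acyclic)
      show "e z \<ominus>\<^bsub>A\<^esub> z \<in> grade A i"
        using zg(1) ghom_grade[OF dghom_ghom[OF e] zg(1)] by (simp add: a_minus_def grade_add grade_neg)
      show "e (e z \<ominus>\<^bsub>A\<^esub> z) = \<zero>\<^bsub>A\<^esub>"
        using zg(3) c idem
        by (subst ghom_minus[OF dghom_ghom[OF e] ring_axioms ring_axioms]) (simp_all add: a_minus_def r_neg)
      show "differential A (e z \<ominus>\<^bsub>A\<^esub> z) = \<zero>\<^bsub>A\<^esub>"
      proof -
        have "differential A (e z) = \<zero>\<^bsub>A\<^esub>"
          using zg(2) dghom_d[OF e zg(3)] ghom_zero[OF dghom_ghom[OF e] ring_axioms ring_axioms] by simp
        then show ?thesis using zg(2,3) c by (subst d_minus) (simp_all add: a_minus_def)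
      qed
    qed
    then have "e z \<ominus>\<^bsub>A\<^esub> z \<in> coboundaries A i" by (auto simp: coboundaries_def intro: rev_image_eqI)
    then show ?thesis using cohomology_map_coset[OF e z(1)] z(2) coset_eq_iff[OF c[OF zg(3)] zg(3)] by simp
  qed
  show ?thesis unfolding weak_equivalence_def
  proof
    fix i
    interpret H: comm_group "cohomology A i" by (rule comm_group_cohomology)
    have "cohomology_map A i e \<in> hom (cohomology A i) (cohomology A i)"
      by (rule homI) (simp_all add: id)
    moreover have "bij_betw (cohomology_map A i e) (carrier (cohomology A i)) (carrier (cohomology A i))"
      by (auto simp: bij_betw_def inj_on_def id intro: rev_image_eqI)
    ultimately show "cohomology_map A i e \<in> iso (cohomology A i) (cohomology A i)"
      by (simp add: iso_def)
  qed
qed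

end

section \<open>Base change along a surjection\<close>

lemma base_change_universal:
  fixes P X Z :: "('k, 'u) under_dga" and W :: "('k, 'u) dga"
  assumes bc: "base_change K A P X Z \<iota>" and W: "cdga K W" and \<phi>: "\<phi> \<in> dghom K X W" and \<psi>: "\<psi> \<in> dghom K P W"
    and com: "\<And>a. a \<in> carrier A \<Longrightarrow> \<phi> (unit_map X a) = \<psi> (unit_map P a)"
  obtains \<theta> where "\<theta> \<in> dghom K Z W" "\<And>x. x \<in> carrier X \<Longrightarrow> \<theta> (\<iota> x) = \<phi> x"
    "\<And>p. p \<in> carrier P \<Longrightarrow> \<theta> (unit_map Z p) = \<psi> p"
    "\<And>\<sigma> z. \<lbrakk>\<sigma> \<in> dghom K Z W; \<And>x. x \<in> carrier X \<Longrightarrow> \<sigma> (\<iota> x) = \<phi> x;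
      \<And>p. p \<in> carrier P \<Longrightarrow> \<sigma> (unit_map Z p) = \<psi> p; z \<in> carrier Z\<rbrakk> \<Longrightarrow> \<sigma> z = \<theta> z"
proof -
  have u: "\<forall>W :: ('k, 'u) dga. \<forall>\<phi> \<psi>. cdga K W \<and> \<phi> \<in> dghom K X W \<and> \<psi> \<in> dghom K P W \<and>
      (\<forall>a\<in>carrier A. \<phi> (unit_map X a) = \<psi> (unit_map P a)) \<longrightarrow>
      (\<exists>\<theta>\<in>dghom K Z W. (\<forall>x\<in>carrier X. \<theta> (\<iota> x) = \<phi> x) \<and> (\<forall>p\<in>carrier P. \<theta> (unit_map Z p) = \<psi> p) \<and>
        (\<forall>\<theta>'\<in>dghom K Z W. (\<forall>x\<in>carrier X. \<theta>' (\<iota> x) = \<phi> x) \<and> (\<forall>p\<in>carrier P. \<theta>' (unit_map Z p) = \<psi> p) \<longrightarrow>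
          (\<forall>z\<in>carrier Z. \<theta>' z = \<theta> z)))"
    using bc unfolding base_change_def cdga_hom_eq_dghom by (elim conjE)
  have c: "\<forall>a\<in>carrier A. \<phi> (unit_map X a) = \<psi> (unit_map P a)" using com by simp
  note u[THEN spec[of _ W], THEN spec[of _ \<phi>], THEN spec[of _ \<psi>], THEN mp, OF conjI[OF W conjI[OF \<phi> conjI[OF \<psi> c]]]]
  then show thesis
    by (elim bexE conjE) (rule that, blast+)
qed

lemma base_change_exists:
  fixes P X Z :: "('k, 'u) under_dga" and W :: "('k, 'u) dga"
  assumes bc: "base_change K A P X Z \<iota>" and W: "cdga K W" and \<phi>: "\<phi> \<in> dghom K X W" and \<psi>: "\<psi> \<in> dghom K P W"
    and com: "\<And>a. a \<in> carrier A \<Longrightarrow> \<phi> (unit_map X a) = \<psi> (unit_map P a)"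
  obtains \<theta> where "\<theta> \<in> dghom K Z W" "\<And>x. x \<in> carrier X \<Longrightarrow> \<theta> (\<iota> x) = \<phi> x"
    "\<And>p. p \<in> carrier P \<Longrightarrow> \<theta> (unit_map Z p) = \<psi> p"
proof (rule base_change_universal[OF bc W \<phi> \<psi>], goal_cases)
  case (1 a)
  then show ?case by (intro com)
next
  case (2 \<theta>)
  show thesis by (rule that[of \<theta>]) (rule 2(2), rule 2(3), assumption, rule 2(4), assumption)
qed

lemma base_change_unique:
  fixes P X Z :: "('k, 'u) under_dga" and W :: "('k, 'u) dga"
  assumes bc: "base_change K A P X Z \<iota>" and W: "cdga K W" and \<theta>: "\<theta> \<in> dghom K Z W" "\<theta>' \<in> dghom K Z W"
    and eq: "\<And>x. x \<in> carrier X \<Longrightarrow> \<theta> (\<iota> x) = \<theta>' (\<iota> x)"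
      "\<And>p. p \<in> carrier P \<Longrightarrow> \<theta> (unit_map Z p) = \<theta>' (unit_map Z p)" and z: "z \<in> carrier Z"
  shows "\<theta> z = \<theta>' z"
proof -
  have \<iota>: "\<iota> \<in> dghom K X Z" and u: "unit_map Z \<in> dghom K P Z"
    and com: "\<And>a. a \<in> carrier A \<Longrightarrow> \<iota> (unit_map X a) = unit_map Z (unit_map P a)"
    using bc unfolding base_change_def under_obj_def cdga_hom_eq_dghom by auto
  obtain \<tau> where t: "\<And>\<sigma> z. \<lbrakk>\<sigma> \<in> dghom K Z W; \<And>x. x \<in> carrier X \<Longrightarrow> \<sigma> (\<iota> x) = \<theta> (\<iota> x);
      \<And>p. p \<in> carrier P \<Longrightarrow> \<sigma> (unit_map Z p) = \<theta> (unit_map Z p); z \<in> carrier Z\<rbrakk> \<Longrightarrow> \<sigma> z = \<tau> z"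
  proof (rule base_change_universal[OF bc W dghom_comp[OF \<iota> \<theta>(1)] dghom_comp[OF u \<theta>(1)]], goal_cases)
    case (1 a)
    then show ?case by (simp add: com)
  next
    case (2 \<tau>)
    show thesis by (rule that[of \<tau>]) (rule 2(5))
  qed
  have "\<theta> z = \<tau> z" by (rule t[OF \<theta>(1) refl refl z])
  moreover have "\<theta>' z = \<tau> z" by (rule t[OF \<theta>(2) eq(1)[symmetric] eq(2)[symmetric] z])
  ultimately show ?thesis by simp
qed

lemma (in dg_subquotient) cdga_Q:
  assumes "cdga K A" shows "cdga K Q"
proof -
  interpret A: cdga K A by fact
  interpret Q: graded_dga K Q by (rule graded_dga_Q)
  show ?thesis
  proof
    fix i :: int assume "i > 0"
    then show "grade Q i = {\<zero>\<^bsub>Q\<^esub>}" using A.nonpositive[of i] W_zero by (auto simp: zero_Q)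
  qed (blast intro: Q.d_grade Q.d_add Q.d_smult Q.d_d Q.d_leibniz)+
qed

lemma (in abelian_group) additive_span_closed:
  assumes "T \<subseteq> carrier G" "x \<in> additive_span G T" shows "x \<in> carrier G"
  using assms(2) by induction (use assms(1) in auto)

text \<open>
  The image of \<open>\<iota>\<close> is a dg subalgebra through which both canonical maps factor. By the universal property the
  identity of \<open>Z\<close> factors through it.
\<close>

lemma base_change_surjective:
  assumes bc: "base_change K A B X Z \<iota>" and surj: "unit_map B ` carrier A = carrier B"
  shows "\<iota> ` carrier X = carrier Z"
proof -
  have X: "cdga K X" and Z: "cdga K Z" and \<iota>: "\<iota> \<in> dghom K X Z" and u: "unit_map Z \<in> dghom K B Z" "unit_map X \<in> dghom K A X"
    and B: "cdga K B"
    and com: "\<And>a. a \<in> carrier A \<Longrightarrow> \<iota> (unit_map X a) = unit_map Z (unit_map B a)"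
    using bc unfolding base_change_def under_obj_def cdga_hom_eq_dghom by auto
  interpret X: cdga K X by (rule X)
  interpret Z: cdga K Z by (rule Z)
  interpret B: cdga K B by (rule B)
  note \<iota>_simps = ghom_closed[OF dghom_ghom[OF \<iota>]] ghom_mult[OF dghom_ghom[OF \<iota>], symmetric]
    ghom_add[OF dghom_ghom[OF \<iota>], symmetric] ghom_one[OF dghom_ghom[OF \<iota>], symmetric]
    ghom_smult[OF dghom_ghom[OF \<iota>], symmetric] dghom_d[OF \<iota>, symmetric]
    ghom_hcomp[OF dghom_ghom[OF \<iota>] X.graded_comm_algebra_axioms Z.graded_comm_algebra_axioms, symmetric]
  have \<iota>0: "\<iota> \<zero>\<^bsub>X\<^esub> = \<zero>\<^bsub>Z\<^esub>" by (rule ghom_zero[OF dghom_ghom[OF \<iota>] X.ring_axioms Z.ring_axioms])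
  have im: "\<iota> x \<in> \<iota> ` carrier X" if "x \<in> carrier X" for x using that by (rule imageI)
  interpret W: dg_subquotient K Z "\<iota> ` carrier X" "{\<zero>\<^bsub>Z\<^esub>}" "\<lambda>x. x"
  proof (unfold_locales, goal_cases)
    case 1
    then show ?case using \<iota>_simps(1) by blast
  next
    case 2
    show ?case unfolding \<iota>_simps(4) by (rule im) simp
  next
    case (3 x y)
    then show ?case by (elim imageE) (simp add: \<iota>_simps(3) im)
  next
    case (4 x y)
    then show ?case by (elim imageE) (simp add: \<iota>_simps(2) im)
  next
    case (5 k x)
    then show ?case by (elim imageE) (simp add: \<iota>_simps(5) im)
  next
    case (6 x i)
    then show ?case by (elim imageE) (simp add: \<iota>_simps(7) im)
  next
    case 7
    then show ?case using im[of "\<zero>\<^bsub>X\<^esub>"] \<iota>0 by simp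
  next
    case (11 x y)
    then show ?case using \<iota>_simps(1) by auto
  next
    case (12 x y)
    then show ?case using \<iota>_simps(1) by auto
  next
    case (14 x y)
    then show ?case using \<iota>_simps(1) by (elim imageE) (simp add: Z.minus_eq_zero_iff)
  next
    case (15 x)
    then show ?case by (elim imageE) (simp add: \<iota>_simps(6) im X.d_closed)
  qed simp_all
  interpret V: dg_subquotient K Z "carrier Z" "{\<zero>\<^bsub>Z\<^esub>}" "\<lambda>x. x"
    by (intro dg_subquotient.intro dg_subquotient_axioms.intro Z.graded_dga_axioms Z.subquotient_inj) (auto simp: Z.d_closed)
  have uW: "unit_map Z ` carrier B \<subseteq> \<iota> ` carrier X"
  proof
    fix z assume "z \<in> unit_map Z ` carrier B"
    then obtain a where "a \<in> carrier A" "z = unit_map Z (unit_map B a)" unfolding surj[symmetric] by blast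
    then show "z \<in> \<iota> ` carrier X" using im[OF ghom_closed[OF dghom_ghom[OF u(2)], of a]] com[of a] by simp
  qed
  obtain \<theta> where \<theta>: "\<theta> \<in> dghom K Z W.Q" "\<And>x. x \<in> carrier X \<Longrightarrow> \<theta> (\<iota> x) = \<iota> x"
    "\<And>p. p \<in> carrier B \<Longrightarrow> \<theta> (unit_map Z p) = unit_map Z p"
  proof (rule base_change_exists[OF bc W.cdga_Q[OF Z]])
    show "\<iota> \<in> dghom K X W.Q" using W.c_dghom[OF \<iota>] X.grade_closed by (simp add: subset_iff)
    show "unit_map Z \<in> dghom K B W.Q" using W.c_dghom[OF u(1) uW] B.grade_closed by (simp add: subset_iff)
    show "\<iota> (unit_map X a) = unit_map Z (unit_map B a)" if "a \<in> carrier A" for a using that by (rule com)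
  qed (rule that)
  have "(\<lambda>y. inv_into (\<iota> ` carrier X) (\<lambda>x. x) y) \<in> dghom K W.Q Z"
    by (rule W.factor_dghom[OF Z.id_dghom]) (auto intro: Z.graded_comm_algebra_axioms)
  from dghom_comp[OF \<theta>(1) this] have \<theta>': "(\<lambda>z. inv_into (\<iota> ` carrier X) (\<lambda>x. x) (\<theta> z)) \<in> dghom K Z Z" .
  have \<theta>W: "\<theta> z \<in> \<iota> ` carrier X" if "z \<in> carrier Z" for z using ghom_closed[OF dghom_ghom[OF \<theta>(1)] that] by simp
  have inv: "inv_into (\<iota> ` carrier X) (\<lambda>x. x) y = y" if "y \<in> \<iota> ` carrier X" for y
    using f_inv_into_f[of y "\<lambda>x. x" "\<iota> ` carrier X"] that by simp
  have \<theta>2: "(\<lambda>z. inv_into (\<iota> ` carrier X) (\<lambda>x. x) (\<theta> z)) \<in> dghom K Z V.Q"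
  proof (rule V.c_dghom[OF \<theta>'])
    show "(\<lambda>z. inv_into (\<iota> ` carrier X) (\<lambda>x. x) (\<theta> z)) ` carrier Z \<subseteq> carrier Z"
      using ghom_closed[OF dghom_ghom[OF \<theta>']] by (rule image_subsetI)
  qed (use Z.grade_closed in blast)
  have id: "(\<lambda>z. z) \<in> dghom K Z V.Q"
    using V.c_dghom[OF Z.id_dghom] Z.grade_closed by (simp add: subset_iff)
  have "z \<in> \<iota> ` carrier X" if z: "z \<in> carrier Z" for z
  proof -
    have "inv_into (\<iota> ` carrier X) (\<lambda>x. x) (\<theta> z) = z"
      using z
    proof (rule base_change_unique[OF bc V.cdga_Q[OF Z] \<theta>2 id, rotated 2])
      fix p assume "p \<in> carrier B"
      then show "inv_into (\<iota> ` carrier X) (\<lambda>x. x) (\<theta> (unit_map Z p)) = unit_map Z p"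
        using \<theta>(3) uW inv by auto
    qed (use \<theta>(2) inv in auto)
    then show ?thesis using inv[OF \<theta>W[OF z]] \<theta>W[OF z] by simp
  qed
  then show ?thesis using \<iota>_simps(1) by blast
qed

text \<open>
  The quotient of \<open>X\<close> by the ideal generated by the kernel of \<open>A \<rightarrow> B\<close> receives compatible maps from \<open>X\<close> and
  from \<open>B\<close>, hence a map from \<open>Z\<close>. So the kernel of \<open>\<iota>\<close> is contained in that ideal.
\<close>

lemma base_change_kernel:
  assumes bc: "base_change K A B X Z \<iota>" and surj: "unit_map B ` carrier A = carrier B"
    and x: "x \<in> carrier X" "\<iota> x = \<zero>\<^bsub>Z\<^esub>"
  shows "x \<in> additive_span X {unit_map X a \<otimes>\<^bsub>X\<^esub> y | a y i. a \<in> grade A i \<and> unit_map B a = \<zero>\<^bsub>B\<^esub> \<and> y \<in> carrier X}"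
    (is "x \<in> additive_span X ?T")
proof -
  have X: "cdga K X" and Z: "cdga K Z" and A: "cdga K A" and B: "cdga K B" and \<iota>: "\<iota> \<in> dghom K X Z"
    and uX: "unit_map X \<in> dghom K A X" and uB: "unit_map B \<in> dghom K A B"
    and com: "\<And>a. a \<in> carrier A \<Longrightarrow> \<iota> (unit_map X a) = unit_map Z (unit_map B a)"
    using bc unfolding base_change_def under_obj_def cdga_hom_eq_dghom by auto
  interpret X: cdga K X by (rule X)
  interpret Z: cdga K Z by (rule Z)
  interpret A: cdga K A by (rule A)
  interpret B: cdga K B by (rule B)
  note uXg = dghom_ghom[OF uX] and uBg = dghom_ghom[OF uB]
  define G where "G i = unit_map X ` {a \<in> grade A i. unit_map B a = \<zero>\<^bsub>B\<^esub>}" for i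
  define H where "H = (\<lambda>i. {x. ideal_gen X G i x})"
  have Gg: "G i \<subseteq> grade X i" for i using ghom_grade[OF uXg] by (auto simp: G_def)
  have H: "graded_ideal X H" unfolding H_def by (rule X.graded_ideal_gen) (rule Gg)
  have uB0: "unit_map B \<zero>\<^bsub>A\<^esub> = \<zero>\<^bsub>B\<^esub>" by (rule ghom_zero[OF uBg A.ring_axioms B.ring_axioms])
  have dG: "differential X g \<in> G (i + 1)" if g: "g \<in> G i" for g i
  proof -
    obtain a where a: "a \<in> grade A i" "unit_map B a = \<zero>\<^bsub>B\<^esub>" "g = unit_map X a" using g unfolding G_def by blast
    have "unit_map B (differential A a) = \<zero>\<^bsub>B\<^esub>" using dghom_d[OF uB A.grade_closed[OF a(1)]] a(2) by simp
    then show ?thesis unfolding G_def a(3) dghom_d[OF uX A.grade_closed[OF a(1)], symmetric]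
      using A.d_grade[OF a(1)] by (intro imageI) simp
  qed
  have dH: "differential X x \<in> H (i + 1)" if "x \<in> H i" for x i
    using that X.ideal_gen_d[of G, OF Gg] dG by (auto simp: H_def intro: ideal_gen.base)
  let ?J = "total_ideal X H"
  let ?c = "quotient_rep X (carrier X) ?J"
  interpret T: dg_subquotient K X "carrier X" ?J ?c by (rule X.total_ideal_dg_subquotient[OF H dH])
  have GJ: "unit_map X a \<in> ?J" if a: "a \<in> carrier A" "unit_map B a = \<zero>\<^bsub>B\<^esub>" for a
  proof -
    have "hcomp X i (unit_map X a) \<in> H i" for i
    proof -
      have "hcomp X i (unit_map X a) = unit_map X (hcomp A i a)"
        using ghom_hcomp[OF uXg A.graded_comm_algebra_axioms X.graded_comm_algebra_axioms a(1)] by simp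
      moreover have "unit_map B (hcomp A i a) = \<zero>\<^bsub>B\<^esub>"
        using ghom_hcomp[OF uBg A.graded_comm_algebra_axioms B.graded_comm_algebra_axioms a(1)] a(2) by simp
      ultimately have "hcomp X i (unit_map X a) \<in> G i" using A.hcomp_grade[OF a(1)] by (simp add: G_def)
      then show ?thesis by (simp add: H_def ideal_gen.base)
    qed
    then show ?thesis using ghom_closed[OF uXg a(1)] by (simp add: total_ideal_def)
  qed
  define s where "s = inv_into (carrier A) (unit_map B)"
  have s: "s b \<in> carrier A" "unit_map B (s b) = b" if "b \<in> carrier B" for b
    using that surj inv_into_into[of b "unit_map B" "carrier A"] f_inv_into_f[of b "unit_map B" "carrier A"]
    by (auto simp: s_def)
  define \<psi> where "\<psi> b = ?c (unit_map X (s b))" for b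
  have \<psi>: "\<psi> (unit_map B a) = ?c (unit_map X a)" if a: "a \<in> carrier A" for a
  proof -
    have sa: "s (unit_map B a) \<in> carrier A" "unit_map B (s (unit_map B a)) = unit_map B a"
      using s ghom_closed[OF uBg a] by auto
    have "unit_map B (s (unit_map B a) \<ominus>\<^bsub>A\<^esub> a) = \<zero>\<^bsub>B\<^esub>"
      using sa a ghom_closed[OF uBg]
      by (subst ghom_minus[OF uBg A.ring_axioms B.ring_axioms]) (simp_all add: a_minus_def B.r_neg)
    then have "unit_map X (s (unit_map B a) \<ominus>\<^bsub>A\<^esub> a) \<in> ?J" using sa(1) a by (intro GJ) auto
    then show ?thesis unfolding \<psi>_def using sa(1) a ghom_closed[OF uXg]
      by (subst T.c_eq_iff) (simp_all add: ghom_minus[OF uXg A.ring_axioms X.ring_axioms])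
  qed
  have onB: "\<exists>a\<in>carrier A. b = unit_map B a" if "b \<in> carrier B" for b using that surj by blast
  have \<psi>_hom: "\<psi> \<in> dghom K B T.Q"
  proof -
    have g: "\<psi> \<in> ghom K B T.Q"
    proof (rule ghomI, goal_cases)
      case (1 b)
      then show ?case using s(1) ghom_closed[OF uXg] by (auto simp: \<psi>_def)
    next
      case (2 b b')
      then obtain a a' where a: "a \<in> carrier A" "b = unit_map B a" "a' \<in> carrier A" "b' = unit_map B a'" using onB by meson
      have "\<psi> (b \<otimes>\<^bsub>B\<^esub> b') = \<psi> (unit_map B (a \<otimes>\<^bsub>A\<^esub> a'))" using a by (simp add: ghom_mult[OF uBg])
      also have "\<dots> = \<psi> b \<otimes>\<^bsub>T.Q\<^esub> \<psi> b'" using a by (simp add: \<psi> ghom_mult[OF uXg] ghom_closed[OF uXg] T.Q_simps)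
      finally show ?case .
    next
      case (3 b b')
      then obtain a a' where a: "a \<in> carrier A" "b = unit_map B a" "a' \<in> carrier A" "b' = unit_map B a'" using onB by meson
      have "\<psi> (b \<oplus>\<^bsub>B\<^esub> b') = \<psi> (unit_map B (a \<oplus>\<^bsub>A\<^esub> a'))" using a by (simp add: ghom_add[OF uBg])
      also have "\<dots> = \<psi> b \<oplus>\<^bsub>T.Q\<^esub> \<psi> b'" using a by (simp add: \<psi> ghom_add[OF uXg] ghom_closed[OF uXg] T.Q_simps)
      finally show ?case .
    next
      case 4
      then show ?case using \<psi>[of "\<one>\<^bsub>A\<^esub>"] by (simp add: ghom_one[OF uBg] ghom_one[OF uXg] T.Q_simps)
    next
      case (5 k b)
      then obtain a where a: "a \<in> carrier A" "b = unit_map B a" using onB by meson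
      have "\<psi> (k \<odot>\<^bsub>B\<^esub> b) = \<psi> (unit_map B (k \<odot>\<^bsub>A\<^esub> a))" using a 5 by (simp add: ghom_smult[OF uBg])
      also have "\<dots> = k \<odot>\<^bsub>T.Q\<^esub> \<psi> b" using a 5 by (simp add: \<psi> ghom_smult[OF uXg] ghom_closed[OF uXg] T.Q_simps)
      finally show ?case .
    next
      case (6 i b)
      then obtain a where a: "a \<in> carrier A" "b = unit_map B a" using onB[OF B.grade_closed] by meson
      have "b = hcomp B i (unit_map B a)" using B.hcomp_homogeneous[OF 6] a(2) by simp
      also have "\<dots> = unit_map B (hcomp A i a)"
        using ghom_hcomp[OF uBg A.graded_comm_algebra_axioms B.graded_comm_algebra_axioms a(1)] by simp
      finally have "\<psi> b = ?c (unit_map X (hcomp A i a))" using a(1) by (simp add: \<psi>)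
      then show ?case using ghom_grade[OF uXg A.hcomp_grade[OF a(1)]] X.grade_closed by auto
    qed
    have "\<psi> (differential B b) = differential T.Q (\<psi> b)" if "b \<in> carrier B" for b
    proof -
      obtain a where a: "a \<in> carrier A" "b = unit_map B a" using onB \<open>b \<in> carrier B\<close> by meson
      have "\<psi> (differential B b) = \<psi> (unit_map B (differential A a))" using a by (simp add: dghom_d[OF uB])
      also have "\<dots> = differential T.Q (\<psi> b)"
        using a by (simp add: \<psi> A.d_closed dghom_d[OF uX] ghom_closed[OF uXg] T.d_Q)
      finally show ?thesis .
    qed
    with g show ?thesis by (simp add: dghom_def)
  qed
  have c_hom: "?c \<in> dghom K X T.Q" using T.c_dghom[OF X.id_dghom] X.grade_closed by (simp add: subset_iff)
  obtain \<theta> where \<theta>: "\<theta> \<in> dghom K Z T.Q" "\<And>x. x \<in> carrier X \<Longrightarrow> \<theta> (\<iota> x) = ?c x"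
    by (rule base_change_exists[OF bc T.cdga_Q[OF X] c_hom \<psi>_hom]) (rule \<psi>[symmetric], assumption, rule that)
  have "?c x = \<theta> (\<iota> x)" using \<theta>(2)[OF x(1)] by (rule sym)
  also have "\<dots> = \<theta> (\<iota> \<zero>\<^bsub>X\<^esub>)" using x(2) ghom_zero[OF dghom_ghom[OF \<iota>] X.ring_axioms Z.ring_axioms] by simp
  also have "\<dots> = ?c \<zero>\<^bsub>X\<^esub>" using \<theta>(2) by simp
  finally have "?c x = ?c \<zero>\<^bsub>X\<^esub>" .
  then have xJ: "x \<in> ?J" using T.c_eq_iff[of x "\<zero>\<^bsub>X\<^esub>"] x(1) by (simp add: a_minus_def)
  have Tc: "?T \<subseteq> carrier X" using ghom_closed[OF uXg] A.grade_closed by auto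
  have span_mult: "b \<otimes>\<^bsub>X\<^esub> y \<in> additive_span X ?T" if y: "y \<in> additive_span X ?T" and b: "b \<in> grade X j" for b j y
    using y
  proof induction
    case zero
    then show ?case using X.grade_closed[OF b] by (simp add: additive_span.zero)
  next
    case (base y)
    then obtain a w i where a: "a \<in> grade A i" "unit_map B a = \<zero>\<^bsub>B\<^esub>" "w \<in> carrier X" "y = unit_map X a \<otimes>\<^bsub>X\<^esub> w" by blast
    have ug: "unit_map X a \<in> grade X i" "unit_map X a \<in> carrier X" "b \<in> carrier X"
      using ghom_grade[OF uXg a(1)] b X.grade_closed by auto
    have "b \<otimes>\<^bsub>X\<^esub> y = (b \<otimes>\<^bsub>X\<^esub> unit_map X a) \<otimes>\<^bsub>X\<^esub> w" using a ug by (simp add: X.m_assoc)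
    also have "\<dots> = unit_map X a \<otimes>\<^bsub>X\<^esub> signed X (j * i) (b \<otimes>\<^bsub>X\<^esub> w)"
      unfolding X.graded_comm[OF b ug(1)] using ug a(3) by (simp add: signed_def X.m_assoc X.l_minus X.r_minus)
    finally have "b \<otimes>\<^bsub>X\<^esub> y = unit_map X a \<otimes>\<^bsub>X\<^esub> signed X (j * i) (b \<otimes>\<^bsub>X\<^esub> w)" .
    moreover have "signed X (j * i) (b \<otimes>\<^bsub>X\<^esub> w) \<in> carrier X" using a(3) ug(3) by (simp add: signed_def)
    ultimately have "b \<otimes>\<^bsub>X\<^esub> y \<in> ?T" using a(1,2) by blast
    then show ?case by (rule additive_span.base)
  next
    case (add y z)
    have c: "y \<in> carrier X" "z \<in> carrier X" "b \<in> carrier X"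
      by (rule X.additive_span_closed[OF Tc], fact)+ (rule X.grade_closed[OF b])
    show ?case unfolding X.r_distr[OF c] by (rule additive_span.add[OF add.IH])
  qed
  have gen: "y \<in> additive_span X ?T" if "ideal_gen X G i y" for i y using that
  proof induction
    case (zero i)
    show ?case by (rule additive_span.zero)
  next
    case (mult a j i y)
    show ?case by (rule span_mult[OF mult.IH mult.hyps(1)])
  next
    case (add i y z)
    show ?case by (rule additive_span.add[OF add.IH])
  next
    case (base y i)
    then obtain a where a: "a \<in> grade A i" "unit_map B a = \<zero>\<^bsub>B\<^esub>" "y = unit_map X a" by (auto simp: G_def)
    then have "y = unit_map X a \<otimes>\<^bsub>X\<^esub> \<one>\<^bsub>X\<^esub>" using ghom_closed[OF uXg A.grade_closed[OF a(1)]] by simp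
    then have "y \<in> ?T" using a(1,2) X.one_closed by blast
    then show ?case by (rule additive_span.base)
  qed
  have "ideal_gen X G i (hcomp X i x)" for i using xJ by (simp add: total_ideal_def H_def)
  from gen[OF this] have h: "hcomp X i x \<in> additive_span X ?T" for i .
  have "finsum X (\<lambda>i. hcomp X i x) {i. hcomp X i x \<noteq> \<zero>\<^bsub>X\<^esub>} \<in> additive_span X ?T"
    using X.hcomp_props(2)[OF x(1)] subsetI[OF X.additive_span_closed[OF Tc]] additive_span.zero additive_span.add h
    by (rule X.finsum_in)
  then show ?thesis unfolding X.hcomp_props(3)[OF x(1), symmetric] .
qed

section \<open>Nilpotent ideals in dg Artin algebras\<close>

fun products :: "('a, 'm) ring_scheme \<Rightarrow> 'a set \<Rightarrow> nat \<Rightarrow> 'a set" where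
  "products R T 0 = {\<one>\<^bsub>R\<^esub>}"
| "products R T (Suc n) = {p \<otimes>\<^bsub>R\<^esub> t | p t. p \<in> products R T n \<and> t \<in> T}"

lemma (in ring) products_closed: "T \<subseteq> carrier R \<Longrightarrow> p \<in> products R T n \<Longrightarrow> p \<in> carrier R"
proof (induction n arbitrary: p)
  case (Suc n)
  from Suc.prems(2) obtain q t where "q \<in> products R T n" "t \<in> T" "p = q \<otimes> t" by auto
  then show ?case using Suc by auto
qed simp

lemma (in ring) products_vanish_mono:
  assumes T: "T \<subseteq> carrier R" and "products R T n \<subseteq> {\<zero>}"
  shows "products R T (n + m) \<subseteq> {\<zero>}"
proof (induction m)
  case (Suc m)
  show ?case
  proof
    fix x assume "x \<in> products R T (n + Suc m)"
    then obtain p t where "p \<in> products R T (n + m)" "t \<in> T" "x = p \<otimes> t" by auto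
    then show "x \<in> {\<zero>}" using Suc.IH T by (auto simp: subset_iff)
  qed
qed (use assms(2) in simp)

lemma (in cring) proper_ideal_in_maximal:
  assumes I: "ideal I R" and proper: "\<one> \<notin> I"
  obtains M where "maximalideal M R" "I \<subseteq> M"
proof -
  let ?P = "{J. ideal J R \<and> \<one> \<notin> J \<and> I \<subseteq> J}"
  have "\<exists>M\<in>?P. \<forall>J\<in>?P. M \<subseteq> J \<longrightarrow> J = M"
  proof (rule subset_Zorn_nonempty)
    show "?P \<noteq> {}" using assms by blast
    fix C assume C: "C \<noteq> {}" "subset.chain ?P C"
    then have P: "ideal J R" "\<one> \<notin> J" "I \<subseteq> J" if "J \<in> C" for J
      using that unfolding subset.chain_def by blast+
    have common: "\<exists>J\<in>C. a \<in> J \<and> b \<in> J" if ab: "a \<in> \<Union>C" "b \<in> \<Union>C" for a b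
    proof -
      obtain X Y where X: "X \<in> C" "a \<in> X" and Y: "Y \<in> C" "b \<in> Y" using ab by auto
      have "X \<subseteq> Y \<or> Y \<subseteq> X" using C(2) X(1) Y(1) by (simp add: subset_chain_def)
      then show ?thesis using X Y by auto
    qed
    have "ideal (\<Union>C) R"
    proof (rule idealI[OF ring_axioms], rule add.subgroupI, goal_cases)
      case 1
      show ?case using ideal.Icarr[OF P(1)] by auto
    next
      case 2
      obtain J where J: "J \<in> C" using C(1) by auto
      then show ?case using additive_subgroup.zero_closed[OF ideal.axioms(1)[OF P(1)[OF J]]] by auto
    next
      case (3 a)
      then obtain J where J: "J \<in> C" "a \<in> J" by blast
      then show ?case using additive_subgroup.a_inv_closed[OF ideal.axioms(1)[OF P(1)[OF J(1)]] J(2)]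
        by (auto simp: a_inv_def)
    next
      case (4 a b)
      then obtain J where J: "J \<in> C" "a \<in> J" "b \<in> J" using common by blast
      then show ?case using additive_subgroup.a_closed[OF ideal.axioms(1)[OF P(1)[OF J(1)]] J(2,3)] by auto
    next
      case (5 a x)
      then show ?case using ideal.I_l_closed[OF P(1)] by auto
    next
      case (6 a x)
      then show ?case using ideal.I_r_closed[OF P(1)] by auto
    qed
    then show "\<Union>C \<in> ?P" using C(1) P(2,3) by auto
  qed
  then obtain M where MP: "M \<in> ?P" and "\<forall>J\<in>?P. M \<subseteq> J \<longrightarrow> J = M" by (rule bexE)
  then have max: "J = M" if "ideal J R" "\<one> \<notin> J" "I \<subseteq> J" "M \<subseteq> J" for J using that by simp
  have M: "ideal M R" "\<one> \<notin> M" "I \<subseteq> M" using MP by simp_all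
  have "maximalideal M R"
  proof (rule maximalidealI[OF M(1)])
    show "carrier R \<noteq> M" using M(2) by auto
    fix J assume J: "ideal J R" "M \<subseteq> J" "J \<subseteq> carrier R"
    show "J = M \<or> J = carrier R"
    proof (cases "\<one> \<in> J")
      case True
      then show ?thesis using ideal.one_imp_carrier[OF J(1)] by simp
    next
      case False
      then show ?thesis using max[OF J(1)] J(2) M(3) by blast
    qed
  qed
  then show thesis using M(3) by (rule that)
qed

text \<open>
  The unique maximal ideal contains every proper ideal, in particular \<open>q\<close>. If \<open>1 - q\<close> were not a unit, it
  would generate a proper ideal, and the maximal ideal would contain \<open>1\<close>.
\<close>

lemma (in cring) local_one_minus_unit:
  assumes local: "\<And>M'. maximalideal M' R \<Longrightarrow> M' = M"
    and I: "ideal I R" "\<one> \<notin> I" and q: "q \<in> I"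
  shows "\<one> \<ominus> q \<in> Units R"
proof (rule ccontr)
  assume n: "\<one> \<ominus> q \<notin> Units R"
  have qc: "q \<in> carrier R" using ideal.Icarr[OF I(1) q] .
  then have c: "\<one> \<ominus> q \<in> carrier R" by simp
  have "\<one> \<notin> PIdl (\<one> \<ominus> q)"
  proof
    assume "\<one> \<in> PIdl (\<one> \<ominus> q)"
    then obtain x where "x \<in> carrier R" "\<one> = x \<otimes> (\<one> \<ominus> q)" by (auto simp: cgenideal_def)
    then show False using n c unfolding Units_def by (metis (mono_tags, lifting) m_comm mem_Collect_eq)
  qed
  then obtain M1 where M1: "maximalideal M1 R" "PIdl (\<one> \<ominus> q) \<subseteq> M1"
    by (rule proper_ideal_in_maximal[OF cgenideal_ideal[OF c]])
  obtain M2 where M2: "maximalideal M2 R" "I \<subseteq> M2" by (rule proper_ideal_in_maximal[OF I])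
  have eq: "M1 = M" "M2 = M" using local M1(1) M2(1) by auto
  interpret M: maximalideal M R using M1(1) eq by simp
  have "\<one> \<ominus> q \<in> M" "q \<in> M" using M1(2) M2(2) q cgenideal_self[OF c] eq by auto
  then have "(\<one> \<ominus> q) \<oplus> q \<in> M" by (rule M.a_closed)
  moreover have "(\<one> \<ominus> q) \<oplus> q = \<one>" using qc by algebra
  ultimately have "\<one> \<in> M" by simp
  then show False using M.one_imp_carrier M.I_notcarr by simp
qed

text \<open>
  The powers of \<open>I\<close> stabilise, at the \<open>n\<close>-th power, say. If the stable power is not \<open>0\<close>, elements \<open>q\<^sub>0, q\<^sub>1, \<dots>\<close>
  of \<open>I\<close> can be chosen successively such that no product \<open>x\<^sub>k = q\<^sub>0 \<cdots> q\<^sub>k\<^sub>-\<^sub>1\<close> annihilates the stable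
  power. The principal ideals of the \<open>x\<^sub>k\<close> stabilise too, which gives \<open>x\<^sub>k = x\<^sub>k q\<^sub>k r\<close> for some \<open>k\<close>
  and \<open>r\<close>. As \<open>1 - q\<^sub>k r\<close> is a unit, \<open>x\<^sub>k = 0\<close>, a contradiction.
\<close>

lemma artinian_products_vanish:
  assumes art: "artinian_ring R" and I: "ideal I R" and unit: "\<And>q. q \<in> I \<Longrightarrow> \<one>\<^bsub>R\<^esub> \<ominus>\<^bsub>R\<^esub> q \<in> Units R"
  obtains n where "products R I n \<subseteq> {\<zero>\<^bsub>R\<^esub>}"
proof -
  interpret R: cring R using art by (simp add: artinian_ring_def)
  interpret I: ideal I R by fact
  have Ic: "I \<subseteq> carrier R" using I.Icarr by blast
  have pc: "p \<in> carrier R" if "p \<in> products R I n" for p n using R.products_closed[OF Ic that] .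
  have stable: "\<exists>n. \<forall>m\<ge>n. C m = C n" if "\<And>n. ideal (C n) R" "\<And>n. C (Suc n) \<subseteq> C n" for C :: "nat \<Rightarrow> 'a set"
    using art that by (simp add: artinian_ring_def)
  have suc: "products R I (Suc n) \<subseteq> Idl\<^bsub>R\<^esub> (products R I n)" for n
  proof
    fix x assume "x \<in> products R I (Suc n)"
    then obtain p t where p: "p \<in> products R I n" "t \<in> I" "x = p \<otimes>\<^bsub>R\<^esub> t" by auto
    have sub: "products R I n \<subseteq> carrier R" using pc by blast
    interpret J: ideal "Idl\<^bsub>R\<^esub> (products R I n)" R by (rule R.genideal_ideal[OF sub])
    show "x \<in> Idl\<^bsub>R\<^esub> (products R I n)" using R.genideal_self[OF sub] p Ic J.I_r_closed by blast
  qed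
  have id: "ideal (Idl\<^bsub>R\<^esub> (products R I n)) R" for n by (rule R.genideal_ideal) (use pc in blast)
  have "\<exists>n. \<forall>m\<ge>n. Idl\<^bsub>R\<^esub> (products R I m) = Idl\<^bsub>R\<^esub> (products R I n)"
    by (rule stable[OF id]) (rule R.genideal_minimal[OF id suc])
  then obtain n where n: "Idl\<^bsub>R\<^esub> (products R I (Suc n)) = Idl\<^bsub>R\<^esub> (products R I n)" by (metis le_Suc_eq le_refl)
  define dead where "dead x n \<longleftrightarrow> (\<forall>p\<in>products R I n. x \<otimes>\<^bsub>R\<^esub> p = \<zero>\<^bsub>R\<^esub>)" for x n
  have dead_Idl: "x \<otimes>\<^bsub>R\<^esub> p = \<zero>\<^bsub>R\<^esub>" if x: "x \<in> carrier R" "dead x m" and p: "p \<in> Idl\<^bsub>R\<^esub> (products R I m)" for x p m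
  proof -
    have "ideal {p \<in> carrier R. x \<otimes>\<^bsub>R\<^esub> p = \<zero>\<^bsub>R\<^esub>} R"
    proof (rule idealI[OF R.ring_axioms], rule R.add.subgroupI, goal_cases)
      case 3
      then show ?case using x(1) by (simp add: R.r_minus flip: a_inv_def)
    next
      case (6 a y)
      then show ?case using x(1) by (auto simp: R.m_assoc[symmetric])
    next
      case (5 a y)
      then show ?case using x(1) R.m_lcomm[of x y a] by simp
    qed (use x(1) in \<open>auto simp: R.r_distr intro: exI[of _ "\<zero>\<^bsub>R\<^esub>"]\<close>)
    then have "Idl\<^bsub>R\<^esub> (products R I m) \<subseteq> {p \<in> carrier R. x \<otimes>\<^bsub>R\<^esub> p = \<zero>\<^bsub>R\<^esub>}"
      by (rule R.genideal_minimal) (use x(2) pc in \<open>auto simp: dead_def\<close>)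
    then show ?thesis using p by blast
  qed
  have "dead \<one>\<^bsub>R\<^esub> n"
  proof (rule ccontr)
    assume alive: "\<not> dead \<one>\<^bsub>R\<^esub> n"
    have step: "\<exists>q\<in>I. \<not> dead (x \<otimes>\<^bsub>R\<^esub> q) n" if x: "x \<in> carrier R" "\<not> dead x n" for x
    proof -
      have "\<not> dead x (Suc n)"
      proof
        assume d: "dead x (Suc n)"
        have "dead x n" unfolding dead_def
        proof
          fix p assume "p \<in> products R I n"
          then have "p \<in> Idl\<^bsub>R\<^esub> (products R I (Suc n))"
            unfolding n using R.genideal_self[of "products R I n"] pc by blast
          then show "x \<otimes>\<^bsub>R\<^esub> p = \<zero>\<^bsub>R\<^esub>" by (rule dead_Idl[OF x(1) d])
        qed
        with x(2) show False by simp
      qed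
      then obtain p t where p: "p \<in> products R I n" "t \<in> I" "x \<otimes>\<^bsub>R\<^esub> (p \<otimes>\<^bsub>R\<^esub> t) \<noteq> \<zero>\<^bsub>R\<^esub>"
        unfolding dead_def by auto
      have "(x \<otimes>\<^bsub>R\<^esub> t) \<otimes>\<^bsub>R\<^esub> p = x \<otimes>\<^bsub>R\<^esub> (p \<otimes>\<^bsub>R\<^esub> t)"
        using x(1) pc[OF p(1)] I.Icarr[OF p(2)] by (simp add: R.m_ac)
      then show ?thesis using p unfolding dead_def by metis
    qed
    have "\<exists>f. \<forall>k. (f k \<in> carrier R \<and> \<not> dead (f k) n) \<and> (\<exists>q\<in>I. f (Suc k) = f k \<otimes>\<^bsub>R\<^esub> q)"
    proof (rule dependent_nat_choice)
      show "\<exists>x. x \<in> carrier R \<and> \<not> dead x n" using alive by blast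
      fix x assume x: "x \<in> carrier R \<and> \<not> dead x n"
      then obtain q where q: "q \<in> I" "\<not> dead (x \<otimes>\<^bsub>R\<^esub> q) n" using step by blast
      show "\<exists>y. (y \<in> carrier R \<and> \<not> dead y n) \<and> (\<exists>q\<in>I. y = x \<otimes>\<^bsub>R\<^esub> q)"
        using x q I.Icarr[OF q(1)] by (intro exI[of _ "x \<otimes>\<^bsub>R\<^esub> q"] conjI bexI[of _ q]) simp_all
    qed
    then obtain f where f: "\<And>k. f k \<in> carrier R" "\<And>k. \<not> dead (f k) n" "\<And>k. \<exists>q\<in>I. f (Suc k) = f k \<otimes>\<^bsub>R\<^esub> q" by blast
    have "\<exists>k. \<forall>m\<ge>k. PIdl\<^bsub>R\<^esub> (f m) = PIdl\<^bsub>R\<^esub> (f k)"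
    proof (rule stable)
      show "ideal (PIdl\<^bsub>R\<^esub> (f k)) R" for k by (rule R.cgenideal_ideal[OF f(1)])
      show "PIdl\<^bsub>R\<^esub> (f (Suc k)) \<subseteq> PIdl\<^bsub>R\<^esub> (f k)" for k
      proof -
        obtain q where q: "q \<in> I" "f (Suc k) = f k \<otimes>\<^bsub>R\<^esub> q" using f(3) by blast
        interpret J: ideal "PIdl\<^bsub>R\<^esub> (f k)" R by (rule R.cgenideal_ideal[OF f(1)])
        have "f (Suc k) \<in> PIdl\<^bsub>R\<^esub> (f k)" unfolding q(2)
          by (rule J.I_r_closed[OF R.cgenideal_self[OF f(1)] I.Icarr[OF q(1)]])
        then show ?thesis by (rule R.cgenideal_minimal[OF J.is_ideal])
      qed
    qed
    then obtain k where "PIdl\<^bsub>R\<^esub> (f (Suc k)) = PIdl\<^bsub>R\<^esub> (f k)" by (metis le_Suc_eq le_refl)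
    then have "f k \<in> PIdl\<^bsub>R\<^esub> (f (Suc k))" using R.cgenideal_self[OF f(1)[of k]] by simp
    then obtain r where r: "r \<in> carrier R" "f k = r \<otimes>\<^bsub>R\<^esub> f (Suc k)" by (auto simp: cgenideal_def)
    obtain q where q: "q \<in> I" "f (Suc k) = f k \<otimes>\<^bsub>R\<^esub> q" using f(3) by blast
    have qr: "q \<otimes>\<^bsub>R\<^esub> r \<in> I" by (rule I.I_r_closed[OF q(1) r(1)])
    let ?u = "\<one>\<^bsub>R\<^esub> \<ominus>\<^bsub>R\<^esub> q \<otimes>\<^bsub>R\<^esub> r"
    have fk: "f k = f k \<otimes>\<^bsub>R\<^esub> (q \<otimes>\<^bsub>R\<^esub> r)"
      using r(2) f(1)[of k] r(1) I.Icarr[OF q(1)] unfolding q(2) by (simp add: R.m_ac)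
    have "f k \<otimes>\<^bsub>R\<^esub> ?u = f k \<ominus>\<^bsub>R\<^esub> f k \<otimes>\<^bsub>R\<^esub> (q \<otimes>\<^bsub>R\<^esub> r)"
      using f(1)[of k] I.Icarr[OF qr] by (simp add: a_minus_def R.r_distr R.r_minus)
    also have "\<dots> = \<zero>\<^bsub>R\<^esub>" using f(1)[of k] by (simp flip: fk add: a_minus_def R.r_neg)
    finally have "f k \<otimes>\<^bsub>R\<^esub> ?u = \<zero>\<^bsub>R\<^esub>" .
    then have "f k \<otimes>\<^bsub>R\<^esub> ?u \<otimes>\<^bsub>R\<^esub> inv\<^bsub>R\<^esub> ?u = \<zero>\<^bsub>R\<^esub>" using unit[OF qr] by simp
    then have "f k = \<zero>\<^bsub>R\<^esub>" using unit[OF qr] f(1)[of k] R.Units_closed[OF unit[OF qr]]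
      by (simp add: R.m_assoc)
    then show False using f(2)[of k] pc by (simp add: dead_def)
  qed
  then have "products R I n \<subseteq> {\<zero>\<^bsub>R\<^esub>}" using pc by (auto simp: dead_def)
  then show thesis by (rule that)
qed

lemma dg_artin_one_nonzero:
  assumes "dg_artin K A" shows "\<one>\<^bsub>A\<^esub> \<noteq> \<zero>\<^bsub>A\<^esub>"
proof
  assume e: "\<one>\<^bsub>A\<^esub> = \<zero>\<^bsub>A\<^esub>"
  let ?A0 = "A\<lparr>carrier := grade A 0\<rparr>"
  obtain M where M: "maximalideal M ?A0" using assms by (auto simp: dg_artin_def Let_def)
  interpret M: maximalideal M ?A0 by fact
  have "\<one>\<^bsub>?A0\<^esub> \<in> M" using additive_subgroup.zero_closed[OF M.additive_subgroup_axioms] by (simp add: e)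
  then show False using M.one_imp_carrier M.I_notcarr by simp
qed

text \<open>
  In a product of homogeneous elements of the kernel, the factors of degree \<open>0\<close> can be collected in front; if there
  are many of them, their product vanishes because \<open>A\<^sup>0\<close> is Artin. Each of the other factors lowers
  the degree, and \<open>A\<close> vanishes in low degrees because it is finitely generated over \<open>A\<^sup>0\<close>.
\<close>

theorem dg_artin_products_vanish:
  assumes A: "dg_artin K A" and B: "graded_comm_algebra K B" "\<one>\<^bsub>B\<^esub> \<noteq> \<zero>\<^bsub>B\<^esub>" and u: "u \<in> ghom K A B"
  obtains n where "products A (\<Union>i. {a \<in> grade A i. u a = \<zero>\<^bsub>B\<^esub>}) n \<subseteq> {\<zero>\<^bsub>A\<^esub>}"
proof -
  interpret A: cdga K A using A by (simp add: dg_artin_def)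
  interpret B: graded_comm_algebra K B by (rule B)
  let ?A0 = "A\<lparr>carrier := grade A 0\<rparr>"
  let ?T = "\<Union>i. {a \<in> grade A i. u a = \<zero>\<^bsub>B\<^esub>}"
  define I0 where "I0 = {a \<in> grade A 0. u a = \<zero>\<^bsub>B\<^esub>}"
  have art: "artinian_ring ?A0" using A by (simp add: dg_artin_def Let_def)
  then interpret A0: cring ?A0 by (simp add: artinian_ring_def)
  obtain M where "\<forall>M'. maximalideal M' ?A0 \<longrightarrow> M' = M" using A by (auto simp: dg_artin_def Let_def)
  then have local: "M' = M" if "maximalideal M' ?A0" for M' using that by simp
  note u_simps = ghom_add[OF u] ghom_mult[OF u] ghom_closed[OF u]
    ghom_neg[OF u A.ring_axioms B.ring_axioms] ghom_zero[OF u A.ring_axioms B.ring_axioms]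
  have neg0: "\<ominus>\<^bsub>?A0\<^esub> a = \<ominus>\<^bsub>A\<^esub> a" if "a \<in> grade A 0" for a
    using that A.grade_closed[OF that] by (intro A0.minus_equality) (simp_all add: A.l_neg A.grade_neg)
  have I0: "ideal I0 ?A0"
  proof (rule idealI[OF A0.ring_axioms], rule A0.add.subgroupI, goal_cases)
    case 1
    then show ?case by (auto simp: I0_def)
  next
    case 2
    then show ?case using u_simps(5) A.grade_zero[of 0] unfolding I0_def by blast
  next
    case (3 a)
    then have "a \<in> grade A 0" "u a = \<zero>\<^bsub>B\<^esub>" by (auto simp: I0_def)
    then show ?case unfolding a_inv_def[of ?A0, symmetric] neg0[OF \<open>a \<in> grade A 0\<close>]
      using A.grade_closed[of a 0] by (simp add: I0_def A.grade_neg u_simps(4))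
  next
    case (4 a b)
    then show ?case using A.grade_closed[of a 0] A.grade_closed[of b 0] by (simp add: I0_def A.grade_add u_simps(1))
  next
    case (5 a b)
    then show ?case using A.grade_closed[of a 0] A.grade_closed[of b 0] A.mult_grade[of b 0 a 0]
      by (simp add: I0_def u_simps(2,3))
  next
    case (6 a b)
    then show ?case using A.grade_closed[of a 0] A.grade_closed[of b 0] A.mult_grade[of a 0 b 0]
      by (simp add: I0_def u_simps(2,3))
  qed
  have one: "\<one>\<^bsub>?A0\<^esub> \<notin> I0" using B(2) ghom_one[OF u] by (simp add: I0_def)
  obtain N where N: "products ?A0 I0 N \<subseteq> {\<zero>\<^bsub>?A0\<^esub>}"
    by (rule artinian_products_vanish[OF art I0 A0.local_one_minus_unit[OF local I0 one]])
  have p0: "products ?A0 I0 n = products A I0 n" for n by (induction n) auto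
  have I0c: "I0 \<subseteq> carrier A" using A.grade_closed by (auto simp: I0_def)
  have van: "products A I0 p \<subseteq> {\<zero>\<^bsub>A\<^esub>}" if "p \<ge> N" for p
    using A.products_vanish_mono[OF I0c, of N "p - N"] N p0 that by simp
  obtain S where S: "finite S" "S \<subseteq> (\<Union>i. grade A i)"
    "\<And>x. x \<in> carrier A \<Longrightarrow> \<exists>c\<in>S \<rightarrow> grade A 0. x = (\<Oplus>\<^bsub>A\<^esub>s\<in>S. c s \<otimes>\<^bsub>A\<^esub> s)"
    using A unfolding dg_artin_def by blast
  define deg where "deg s = (SOME i. s \<in> grade A i)" for s
  have deg: "s \<in> grade A (deg s)" if "s \<in> S" for s
    using that S(2) unfolding deg_def by (metis UN_E someI_ex subsetD)
  obtain D :: nat where D: "\<And>s. s \<in> S \<Longrightarrow> - int D \<le> deg s"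
  proof -
    have "\<forall>s\<in>S. - int (\<Sum>s\<in>S. nat (- deg s)) \<le> deg s"
    proof
      fix s assume "s \<in> S"
      then have "nat (- deg s) \<le> (\<Sum>s\<in>S. nat (- deg s))" using S(1) by (intro member_le_sum) auto
      then show "- int (\<Sum>s\<in>S. nat (- deg s)) \<le> deg s" by linarith
    qed
    then show thesis using that by blast
  qed
  have low: "x = \<zero>\<^bsub>A\<^esub>" if x: "x \<in> grade A i" and i: "i < - int D" for x i
  proof -
    obtain c where c: "c \<in> S \<rightarrow> grade A 0" "x = (\<Oplus>\<^bsub>A\<^esub>s\<in>S. c s \<otimes>\<^bsub>A\<^esub> s)" using S(3)[OF A.grade_closed[OF x]] by blast
    have "(\<Oplus>\<^bsub>A\<^esub>s\<in>S. c s \<otimes>\<^bsub>A\<^esub> s) \<in> {y \<in> carrier A. hcomp A i y = \<zero>\<^bsub>A\<^esub>}"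
    proof (rule A.finsum_in[OF S(1)])
      fix s assume s: "s \<in> S"
      have g: "c s \<otimes>\<^bsub>A\<^esub> s \<in> grade A (deg s)" using A.mult_grade[of "c s" 0 s "deg s"] c(1) deg[OF s] s by auto
      have "deg s \<noteq> i" using D[OF s] i by linarith
      then show "c s \<otimes>\<^bsub>A\<^esub> s \<in> {y \<in> carrier A. hcomp A i y = \<zero>\<^bsub>A\<^esub>}"
        using A.hcomp_homogeneous[OF g] A.grade_closed[OF g] by simp
    qed (auto simp: A.hcomp_add)
    then show ?thesis using A.hcomp_homogeneous[OF x] unfolding c(2)[symmetric] by simp
  qed
  have split: "\<exists>p j s b. n \<le> p + j \<and> s \<in> products A I0 p \<and> b \<in> grade A (- int j) \<and> a = s \<otimes>\<^bsub>A\<^esub> b"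
    if "a \<in> products A ?T n" for a n
    using that
  proof (induction n arbitrary: a)
    case 0
    then have "a = \<one>\<^bsub>A\<^esub> \<otimes>\<^bsub>A\<^esub> \<one>\<^bsub>A\<^esub>" by simp
    then show ?case using A.one_grade by (intro exI[of _ 0] exI[of _ "\<one>\<^bsub>A\<^esub>"]) simp
  next
    case (Suc n)
    then obtain a' t i where a: "a' \<in> products A ?T n" "t \<in> grade A i" "u t = \<zero>\<^bsub>B\<^esub>" "a = a' \<otimes>\<^bsub>A\<^esub> t" by auto
    obtain p j s b where IH: "n \<le> p + j" "s \<in> products A I0 p" "b \<in> grade A (- int j)" "a' = s \<otimes>\<^bsub>A\<^esub> b"
      using Suc.IH[OF a(1)] by blast
    have cl: "s \<in> carrier A" "b \<in> carrier A" "t \<in> carrier A"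
      using A.products_closed[OF I0c IH(2)] A.grade_closed IH(3) a(2) by auto
    show ?case
    proof (cases "i < 0")
      case True
      have "b \<otimes>\<^bsub>A\<^esub> t \<in> grade A (- int (j + nat (- i)))" using A.mult_grade[OF IH(3) a(2)] True by simp
      moreover have "a = s \<otimes>\<^bsub>A\<^esub> (b \<otimes>\<^bsub>A\<^esub> t)" unfolding a(4) IH(4) using cl by (rule A.m_assoc)
      moreover have "Suc n \<le> p + (j + nat (- i))" using IH(1) True by simp
      ultimately show ?thesis using IH(2) by blast
    next
      case False
      then have t0: "t \<in> grade A 0" using a(2) A.nonpositive[of i] by (cases "i = 0") auto
      have "b \<otimes>\<^bsub>A\<^esub> t = t \<otimes>\<^bsub>A\<^esub> b" using A.graded_comm[OF IH(3) t0] by simp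
      then have "a = (s \<otimes>\<^bsub>A\<^esub> t) \<otimes>\<^bsub>A\<^esub> b" unfolding a(4) IH(4) using cl by (simp add: A.m_assoc)
      moreover have "s \<otimes>\<^bsub>A\<^esub> t \<in> products A I0 (Suc p)" using IH(2) t0 a(3) by (auto simp: I0_def)
      moreover have "Suc n \<le> Suc p + j" using IH(1) by simp
      ultimately show ?thesis using IH(3) by blast
    qed
  qed
  have "products A ?T (N + D + 1) \<subseteq> {\<zero>\<^bsub>A\<^esub>}"
  proof
    fix a assume "a \<in> products A ?T (N + D + 1)"
    then obtain p j s b where s: "N + D + 1 \<le> p + j" "s \<in> products A I0 p" "b \<in> grade A (- int j)" "a = s \<otimes>\<^bsub>A\<^esub> b"
      using split by blast
    have "s \<in> carrier A" "b \<in> carrier A" using A.products_closed[OF I0c s(2)] A.grade_closed[OF s(3)] by auto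
    moreover have "s = \<zero>\<^bsub>A\<^esub> \<or> b = \<zero>\<^bsub>A\<^esub>"
    proof (cases "p \<ge> N")
      case True
      then show ?thesis using van s(2) by blast
    next
      case False
      then have "- int j < - int D" using s(1) by linarith
      then show ?thesis using low[OF s(3)] by blast
    qed
    ultimately show "a \<in> {\<zero>\<^bsub>A\<^esub>}" using s(4) by auto
  qed
  then show thesis by (rule that)
qed

section \<open>Fitting decomposition of an endomorphism\<close>

locale additive_endomorphism = abelian_group G for G :: "('a, 'm) ring_scheme" (structure) +
  fixes h :: "'a \<Rightarrow> 'a"
  assumes h_closed [simp]: "x \<in> carrier G \<Longrightarrow> h x \<in> carrier G"
    and h_add: "\<lbrakk>x \<in> carrier G; y \<in> carrier G\<rbrakk> \<Longrightarrow> h (x \<oplus> y) = h x \<oplus> h y"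
begin

definition cpl :: "'a \<Rightarrow> 'a" where "cpl x = x \<ominus> h x"

lemma h_zero [simp]: "h \<zero> = \<zero>"
  using h_add[of \<zero> \<zero>] by (metis add.r_cancel_one h_closed l_zero zero_closed)

lemma h_neg: "x \<in> carrier G \<Longrightarrow> h (\<ominus> x) = \<ominus> h x"
  using h_add[of "\<ominus> x" x] by (intro minus_equality[symmetric]) (simp_all add: l_neg)

lemma h_minus: "\<lbrakk>x \<in> carrier G; y \<in> carrier G\<rbrakk> \<Longrightarrow> h (x \<ominus> y) = h x \<ominus> h y"
  by (simp add: a_minus_def h_add h_neg)

lemma cpl_closed [simp]: "x \<in> carrier G \<Longrightarrow> cpl x \<in> carrier G"
  by (simp add: cpl_def)

lemma cpl_add: "\<lbrakk>x \<in> carrier G; y \<in> carrier G\<rbrakk> \<Longrightarrow> cpl (x \<oplus> y) = cpl x \<oplus> cpl y"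
  by (simp add: cpl_def a_minus_def h_add minus_add a_ac)

lemma h_cpl: "x \<in> carrier G \<Longrightarrow> h (cpl x) = cpl (h x)"
  by (simp add: cpl_def h_minus)

lemma h_plus_cpl: "x \<in> carrier G \<Longrightarrow> h x \<oplus> cpl x = x"
  by (simp add: cpl_def a_minus_def a_lcomm r_neg)

lemma pow_closed [simp]: "x \<in> carrier G \<Longrightarrow> (h ^^ n) x \<in> carrier G"
  and cpl_pow_closed [simp]: "x \<in> carrier G \<Longrightarrow> (cpl ^^ n) x \<in> carrier G"
  by (induction n) simp_all

lemma pow_add: "\<lbrakk>x \<in> carrier G; y \<in> carrier G\<rbrakk> \<Longrightarrow> (h ^^ n) (x \<oplus> y) = (h ^^ n) x \<oplus> (h ^^ n) y"
  and cpl_pow_add: "\<lbrakk>x \<in> carrier G; y \<in> carrier G\<rbrakk> \<Longrightarrow> (cpl ^^ n) (x \<oplus> y) = (cpl ^^ n) x \<oplus> (cpl ^^ n) y"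
  by (induction n) (simp_all add: h_add cpl_add)

lemma pow_zero [simp]: "(h ^^ n) \<zero> = \<zero>"
  by (induction n) simp_all

lemma cpl_pow_zero [simp]: "(cpl ^^ n) \<zero> = \<zero>"
  by (induction n) (simp_all add: cpl_def a_minus_def)

lemma pow_cpl: "x \<in> carrier G \<Longrightarrow> (h ^^ n) (cpl x) = cpl ((h ^^ n) x)"
  by (induction n) (simp_all add: h_cpl)

lemma h_cpl_pow: "x \<in> carrier G \<Longrightarrow> h ((cpl ^^ n) x) = (cpl ^^ n) (h x)"
  by (induction n) (simp_all add: h_cpl)

lemma pow_cpl_pow: "x \<in> carrier G \<Longrightarrow> (h ^^ n) ((cpl ^^ m) x) = (cpl ^^ m) ((h ^^ n) x)"
  by (induction n) (simp_all add: h_cpl_pow)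

lemma comp_pow: "x \<in> carrier G \<Longrightarrow> ((\<lambda>x. h (cpl x)) ^^ n) x = (h ^^ n) ((cpl ^^ n) x)"
  by (induction n) (simp_all add: pow_cpl)

text \<open>
  \<open>x = h x + cpl x\<close>, and both summands satisfy the hypotheses with one exponent lowered.
\<close>

lemma kernels_disjoint:
  "\<lbrakk>x \<in> carrier G; (h ^^ a) x = \<zero>; (cpl ^^ b) x = \<zero>\<rbrakk> \<Longrightarrow> x = \<zero>"
proof (induction a arbitrary: b x)
  case (Suc a)
  note outer = Suc.IH
  from Suc.prems show ?case
  proof (induction b arbitrary: x)
    case (Suc b)
    have "h x = \<zero>"
    proof (rule outer)
      show "(h ^^ a) (h x) = \<zero>" using Suc.prems by (simp add: funpow_swap1)
      show "(cpl ^^ Suc b) (h x) = \<zero>" using h_cpl_pow[of x "Suc b"] Suc.prems by simp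
    qed (use Suc.prems in simp)
    moreover have "cpl x = \<zero>"
    proof (rule Suc.IH)
      show "(h ^^ Suc a) (cpl x) = \<zero>" using pow_cpl[of x "Suc a"] Suc.prems by (simp add: cpl_def a_minus_def)
      show "(cpl ^^ b) (cpl x) = \<zero>" using Suc.prems by (simp add: funpow_swap1)
    qed (use Suc.prems in simp)
    ultimately show ?case using h_plus_cpl[of x] Suc.prems by simp
  qed simp
qed simp

lemma images_span:
  "x \<in> carrier G \<Longrightarrow> \<exists>u\<in>carrier G. \<exists>v\<in>carrier G. x = (h ^^ a) u \<oplus> (cpl ^^ b) v"
proof (induction a arbitrary: b x)
  case 0
  then show ?case by (intro bexI[of _ x] bexI[of _ \<zero>]) (simp_all add: cpl_pow_zero)
next
  case (Suc a)
  note outer = Suc.IH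
  from Suc.prems show ?case
  proof (induction b arbitrary: x)
    case 0
    then show ?case by (intro bexI[of _ \<zero>] bexI[of _ x]) simp_all
  next
    case (Suc b)
    obtain u v where u: "u \<in> carrier G" "v \<in> carrier G" "x = (h ^^ a) u \<oplus> (cpl ^^ Suc b) v"
      using outer[OF Suc.prems] by blast
    obtain u' v' where u': "u' \<in> carrier G" "v' \<in> carrier G" "x = (h ^^ Suc a) u' \<oplus> (cpl ^^ b) v'"
      using Suc.IH[OF Suc.prems] by blast
    have 1: "h x = (h ^^ Suc a) u \<oplus> (cpl ^^ Suc b) (h v)"
      using arg_cong[OF u(3), of h] u(1,2) h_cpl_pow[of v "Suc b"] by (simp add: h_add)
    have 2: "cpl x = (h ^^ Suc a) (cpl u') \<oplus> (cpl ^^ Suc b) v'"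
      using arg_cong[OF u'(3), of cpl] u'(1,2) pow_cpl[of u' "Suc a"] by (simp add: cpl_add)
    have "x = (h ^^ Suc a) (u \<oplus> cpl u') \<oplus> (cpl ^^ Suc b) (h v \<oplus> v')"
    proof -
      have "x = h x \<oplus> cpl x" using h_plus_cpl[OF Suc.prems] by simp
      also have "\<dots> = ((h ^^ Suc a) u \<oplus> (h ^^ Suc a) (cpl u')) \<oplus> ((cpl ^^ Suc b) (h v) \<oplus> (cpl ^^ Suc b) v')"
        unfolding 1 2 using pow_closed[of u "Suc a"] pow_closed[of "cpl u'" "Suc a"] cpl_pow_closed[of "h v" "Suc b"]
          cpl_pow_closed[of v' "Suc b"] u(1,2) u'(1,2) by (simp only: a_ac a_closed cpl_closed h_closed)
      also have "\<dots> = (h ^^ Suc a) (u \<oplus> cpl u') \<oplus> (cpl ^^ Suc b) (h v \<oplus> v')"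
        using u(1,2) u'(1,2) pow_add[of u "cpl u'" "Suc a"] cpl_pow_add[of "h v" v' "Suc b"] by simp
      finally show ?thesis .
    qed
    moreover have "u \<oplus> cpl u' \<in> carrier G" "h v \<oplus> v' \<in> carrier G" using u(1,2) u'(1,2) by simp_all
    ultimately show ?case by (intro bexI)
  qed
qed

end

text \<open>
  Let \<open>H = h^k\<close>. By the assumption \<open>H (1 - h)^k = 0\<close>, so \<open>kernels_disjoint\<close> and \<open>images_span\<close> show that
  \<open>R\<close> is the direct sum of the image and the kernel of \<open>H\<close>. The projection \<open>f\<close> to the image sends \<open>x\<close> to the
  element of the image with the same value under \<open>H\<close> as \<open>x\<close>. This characterisation is respected by all
  operations, since \<open>H\<close> is a dg morphism, so \<open>f\<close> is one.
\<close>

theorem fitting_idempotent: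
  assumes R: "graded_dga K R" and h: "h \<in> dghom K R R"
    and nil: "\<And>x. x \<in> carrier R \<Longrightarrow> ((\<lambda>x. h (x \<ominus>\<^bsub>R\<^esub> h x)) ^^ k) x = \<zero>\<^bsub>R\<^esub>"
  obtains f where "f \<in> dghom K R R"
    "\<And>x. x \<in> carrier R \<Longrightarrow> \<exists>u\<in>carrier R. f x = (h ^^ k) u"
    "\<And>x. x \<in> carrier R \<Longrightarrow> (h ^^ k) (f x) = (h ^^ k) x"
    "\<And>x u. \<lbrakk>x \<in> carrier R; u \<in> carrier R; (h ^^ k) ((h ^^ k) u) = (h ^^ k) x\<rbrakk> \<Longrightarrow> f x = (h ^^ k) u"
proof -
  interpret R: graded_dga K R by (rule R)
  interpret E: additive_endomorphism R h
    by unfold_locales (simp_all add: ghom_closed[OF dghom_ghom[OF h]] ghom_add[OF dghom_ghom[OF h]])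
  let ?H = "h ^^ k"
  have nil': "?H ((E.cpl ^^ k) x) = \<zero>\<^bsub>R\<^esub>" if "x \<in> carrier R" for x
    using nil[OF that] E.comp_pow[OF that, of k] by (simp add: E.cpl_def)
  have H: "?H \<in> dghom K R R"
  proof (induction k)
    case 0
    then show ?case using R.id_dghom by (simp add: id_def)
  next
    case (Suc n)
    then show ?case using dghom_comp[OF Suc h] by (simp add: comp_def)
  qed
  note Hg = dghom_ghom[OF H]
  define s where "s x = (SOME u. u \<in> carrier R \<and> ?H (?H u) = ?H x)" for x
  have s: "s x \<in> carrier R \<and> ?H (?H (s x)) = ?H x" if x: "x \<in> carrier R" for x
    unfolding s_def
  proof (rule someI_ex)
    obtain u v where u: "u \<in> carrier R" "v \<in> carrier R" "x = ?H u \<oplus>\<^bsub>R\<^esub> (E.cpl ^^ k) v"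
      using E.images_span[OF x] by blast
    then have "?H x = ?H (?H u)" using nil'[OF u(2)] by (simp add: E.pow_add)
    then show "\<exists>u. u \<in> carrier R \<and> ?H (?H u) = ?H x" using u(1) by auto
  qed
  have inj: "?H u = ?H v" if u: "u \<in> carrier R" "v \<in> carrier R" "?H (?H u) = ?H (?H v)" for u v
  proof -
    have w: "u \<ominus>\<^bsub>R\<^esub> v \<in> carrier R" using u by simp
    have "?H (u \<ominus>\<^bsub>R\<^esub> v) = \<zero>\<^bsub>R\<^esub>"
    proof (rule E.kernels_disjoint)
      show "?H (?H (u \<ominus>\<^bsub>R\<^esub> v)) = \<zero>\<^bsub>R\<^esub>"
        using u by (simp add: ghom_minus[OF Hg R.ring_axioms R.ring_axioms] R.minus_eq_zero_iff)
      show "(E.cpl ^^ k) (?H (u \<ominus>\<^bsub>R\<^esub> v)) = \<zero>\<^bsub>R\<^esub>"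
        using nil'[OF w] E.pow_cpl_pow[OF w, of k k] by simp
    qed (use w in simp)
    then show ?thesis using u by (simp add: ghom_minus[OF Hg R.ring_axioms R.ring_axioms] R.minus_eq_zero_iff)
  qed
  define f where "f x = ?H (s x)" for x
  have f: "f x \<in> carrier R" "\<exists>u\<in>carrier R. f x = ?H u" "?H (f x) = ?H x" if "x \<in> carrier R" for x
    using s[OF that] by (auto simp: f_def)
  have f_eq: "f x = ?H u" if "x \<in> carrier R" "u \<in> carrier R" "?H (?H u) = ?H x" for x u
    unfolding f_def using conjunct1[OF s[OF that(1)]] that(2) trans[OF conjunct2[OF s[OF that(1)]] that(3)[symmetric]]
    by (rule inj)
  have fg: "f \<in> ghom K R R"
  proof (rule ghomI, goal_cases)
    case (1 x)
    then show ?case by (rule f)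
  next
    case (2 x y)
    have "f (x \<otimes>\<^bsub>R\<^esub> y) = ?H (s x \<otimes>\<^bsub>R\<^esub> s y)"
      using 2 s[of x] s[of y] by (intro f_eq) (simp_all add: ghom_mult[OF Hg])
    then show ?case using 2 s[of x] s[of y] by (simp add: f_def ghom_mult[OF Hg])
  next
    case (3 x y)
    have "f (x \<oplus>\<^bsub>R\<^esub> y) = ?H (s x \<oplus>\<^bsub>R\<^esub> s y)"
      using 3 s[of x] s[of y] by (intro f_eq) (simp_all add: ghom_add[OF Hg])
    then show ?case using 3 s[of x] s[of y] by (simp add: f_def ghom_add[OF Hg])
  next
    case 4
    have "f \<one>\<^bsub>R\<^esub> = ?H \<one>\<^bsub>R\<^esub>" by (rule f_eq) (simp_all add: ghom_one[OF Hg])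
    then show ?case by (simp add: ghom_one[OF Hg])
  next
    case (5 c x)
    have "f (c \<odot>\<^bsub>R\<^esub> x) = ?H (c \<odot>\<^bsub>R\<^esub> s x)"
      using 5 s[of x] by (intro f_eq) (simp_all add: ghom_smult[OF Hg])
    then show ?case using 5 s[of x] by (simp add: f_def ghom_smult[OF Hg])
  next
    case (6 i x)
    have x: "x \<in> carrier R" by (rule R.grade_closed[OF 6])
    note hc = ghom_hcomp[OF Hg R.graded_comm_algebra_axioms R.graded_comm_algebra_axioms]
    have "f x = ?H (hcomp R i (s x))"
    proof (rule f_eq[OF x])
      have "?H (?H (hcomp R i (s x))) = hcomp R i (?H x)" using s[OF x] by (simp add: hc)
      then show "?H (?H (hcomp R i (s x))) = ?H x" using R.hcomp_homogeneous[OF ghom_grade[OF Hg 6]] by simp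
    qed (use s[OF x] in simp)
    then show ?case using ghom_grade[OF Hg R.hcomp_grade] s[OF x] by simp
  qed
  have "f (differential R x) = differential R (f x)" if x: "x \<in> carrier R" for x
  proof -
    have "f (differential R x) = ?H (differential R (s x))"
      using x s[OF x] by (intro f_eq) (simp_all add: R.d_closed dghom_d[OF H])
    then show ?thesis using s[OF x] by (simp add: f_def dghom_d[OF H])
  qed
  with fg have "f \<in> dghom K R R" by (simp add: dghom_def)
  then show thesis using f(2,3) f_eq by (rule that)
qed

text \<open>
  By linearity the \<open>m\<close>-th power of \<open>\<eta>\<close> takes values in the span of the products of \<open>m\<close> elements of
  \<open>T\<close>.
\<close>

lemma linear_into_nilpotent_ideal:
  assumes A: "ring A" and X: "ring X" and u: "u \<in> ghom K A X" and T: "T \<subseteq> carrier A" "products A T n \<subseteq> {\<zero>\<^bsub>A\<^esub>}"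
    and closed: "\<And>x. x \<in> carrier X \<Longrightarrow> \<eta> x \<in> carrier X"
    and add: "\<And>x y. \<lbrakk>x \<in> carrier X; y \<in> carrier X\<rbrakk> \<Longrightarrow> \<eta> (x \<oplus>\<^bsub>X\<^esub> y) = \<eta> x \<oplus>\<^bsub>X\<^esub> \<eta> y"
    and linear: "\<And>a x. \<lbrakk>a \<in> carrier A; x \<in> carrier X\<rbrakk> \<Longrightarrow> \<eta> (u a \<otimes>\<^bsub>X\<^esub> x) = u a \<otimes>\<^bsub>X\<^esub> \<eta> x"
    and into: "\<And>x. x \<in> carrier X \<Longrightarrow> \<eta> x \<in> additive_span X {u t \<otimes>\<^bsub>X\<^esub> y | t y. t \<in> T \<and> y \<in> carrier X}"
    and x: "x \<in> carrier X"
  shows "(\<eta> ^^ n) x = \<zero>\<^bsub>X\<^esub>"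
proof -
  interpret A: ring A by (rule A)
  interpret X: ring X by (rule X)
  define G where "G m = {u p \<otimes>\<^bsub>X\<^esub> y | p y. p \<in> products A T m \<and> y \<in> carrier X}" for m
  define S where "S = {u t \<otimes>\<^bsub>X\<^esub> y | t y. t \<in> T \<and> y \<in> carrier X}"
  note uc = ghom_closed[OF u]
  have pc: "p \<in> carrier A" if "p \<in> products A T m" for p m using A.products_closed[OF T(1) that] .
  have Gc: "G m \<subseteq> carrier X" for m using pc uc by (auto simp: G_def)
  have Sc: "S \<subseteq> carrier X" using T(1) uc by (auto simp: S_def)
  have \<eta>0: "\<eta> \<zero>\<^bsub>X\<^esub> = \<zero>\<^bsub>X\<^esub>"
    using add[of "\<zero>\<^bsub>X\<^esub>" "\<zero>\<^bsub>X\<^esub>"] closed[of "\<zero>\<^bsub>X\<^esub>"] by (metis X.add.r_cancel_one X.l_zero X.zero_closed)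
  have mult: "u p \<otimes>\<^bsub>X\<^esub> w \<in> additive_span X (G (Suc m))" if p: "p \<in> products A T m" and w: "w \<in> additive_span X S" for p w m
    using w
  proof induction
    case zero
    then show ?case using uc[OF pc[OF p]] by (simp add: additive_span.zero)
  next
    case (base w)
    then obtain t y where t: "t \<in> T" "y \<in> carrier X" "w = u t \<otimes>\<^bsub>X\<^esub> y" unfolding S_def by blast
    have tc: "t \<in> carrier A" using t(1) T(1) by blast
    have "u p \<otimes>\<^bsub>X\<^esub> w = u (p \<otimes>\<^bsub>A\<^esub> t) \<otimes>\<^bsub>X\<^esub> y"
      using pc[OF p] tc t(2) uc by (simp add: t(3) ghom_mult[OF u] X.m_assoc)
    moreover have "p \<otimes>\<^bsub>A\<^esub> t \<in> products A T (Suc m)" using p t(1) by auto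
    ultimately have "u p \<otimes>\<^bsub>X\<^esub> w \<in> G (Suc m)" using t(2) unfolding G_def by blast
    then show ?case by (rule additive_span.base)
  next
    case (add v w)
    have "v \<in> carrier X" "w \<in> carrier X" by (rule X.additive_span_closed[OF Sc], fact)+
    then show ?case using additive_span.add[OF add.IH] uc[OF pc[OF p]] by (simp add: X.r_distr)
  qed
  have step: "\<eta> x \<in> additive_span X (G (Suc m))" if x: "x \<in> additive_span X (G m)" for x m
    using x
  proof induction
    case zero
    then show ?case by (simp add: \<eta>0 additive_span.zero)
  next
    case (base x)
    then obtain p y where p: "p \<in> products A T m" "y \<in> carrier X" "x = u p \<otimes>\<^bsub>X\<^esub> y" unfolding G_def by blast
    show ?case unfolding p(3) linear[OF pc[OF p(1)] p(2)]
      by (rule mult[OF p(1)]) (use into[OF p(2)] in \<open>simp add: S_def\<close>)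
  next
    case (add v w)
    have "v \<in> carrier X" "w \<in> carrier X" by (rule X.additive_span_closed[OF Gc], fact)+
    then show ?case using additive_span.add[OF add.IH] by (simp add: assms(7))
  qed
  have pow: "(\<eta> ^^ m) x \<in> additive_span X (G m)" for m
  proof (induction m)
    case 0
    have "x = u \<one>\<^bsub>A\<^esub> \<otimes>\<^bsub>X\<^esub> x" using x by (simp add: ghom_one[OF u])
    then have "x \<in> G 0" unfolding G_def using x by auto
    then show ?case by (simp add: additive_span.base)
  next
    case (Suc m)
    then show ?case using step by simp
  qed
  have "y = \<zero>\<^bsub>X\<^esub>" if "y \<in> additive_span X (G n)" for y
    using that
  proof induction
    case (base y)
    then show ?case using T(2) ghom_zero[OF u A X] by (auto simp: G_def subset_iff)
  qed simp_all
  then show ?thesis using pow by blast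
qed

text \<open>
  The field has characteristic \<open>0\<close>, so its multiples of the unit of a nonzero algebra are infinitely many.
\<close>

lemma infinite_universe:
  fixes A :: "('k, 'u, 'z) dga_scheme"
  assumes K: "field K" "\<And>n :: nat. n > 0 \<Longrightarrow> [n] \<cdot>\<^bsub>K\<^esub> \<one>\<^bsub>K\<^esub> \<noteq> \<zero>\<^bsub>K\<^esub>"
    and A: "graded_comm_algebra K A" "\<one>\<^bsub>A\<^esub> \<noteq> \<zero>\<^bsub>A\<^esub>"
  shows "infinite (UNIV :: 'u set)"
proof
  assume fin: "finite (UNIV :: 'u set)"
  interpret A: graded_comm_algebra K A by (rule A)
  define c where "c n = [n] \<cdot>\<^bsub>K\<^esub> \<one>\<^bsub>K\<^esub>" for n :: nat
  have cc: "c n \<in> carrier K" for n by (simp add: c_def)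
  have "\<not> inj (\<lambda>n. c n \<odot>\<^bsub>A\<^esub> \<one>\<^bsub>A\<^esub>)"
    using fin finite_subset[OF subset_UNIV] finite_imageD infinite_UNIV_nat by blast
  then obtain m n where mn: "m < n" "c m \<odot>\<^bsub>A\<^esub> \<one>\<^bsub>A\<^esub> = c n \<odot>\<^bsub>A\<^esub> \<one>\<^bsub>A\<^esub>"
    unfolding inj_on_def by (metis linorder_neqE_nat)
  then obtain l where l: "l > 0" "n = m + l" by (metis less_imp_add_positive)
  have "c n = c m \<oplus>\<^bsub>K\<^esub> c l" unfolding l(2) by (simp add: c_def A.R.add.nat_pow_mult)
  then have "c m \<odot>\<^bsub>A\<^esub> \<one>\<^bsub>A\<^esub> = c m \<odot>\<^bsub>A\<^esub> \<one>\<^bsub>A\<^esub> \<oplus>\<^bsub>A\<^esub> c l \<odot>\<^bsub>A\<^esub> \<one>\<^bsub>A\<^esub>"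
    using mn(2) cc by (simp add: A.smult_l_distr)
  then have 0: "c l \<odot>\<^bsub>A\<^esub> \<one>\<^bsub>A\<^esub> = \<zero>\<^bsub>A\<^esub>"
    using A.add.r_cancel_one'[of "c m \<odot>\<^bsub>A\<^esub> \<one>\<^bsub>A\<^esub>" "c l \<odot>\<^bsub>A\<^esub> \<one>\<^bsub>A\<^esub>"] cc by simp
  have u: "c l \<in> Units K" using K(2)[OF l(1)] cc[of l] by (simp add: field.field_Units[OF K(1)] c_def)
  have "(inv\<^bsub>K\<^esub> (c l) \<otimes>\<^bsub>K\<^esub> c l) \<odot>\<^bsub>A\<^esub> \<one>\<^bsub>A\<^esub> = \<zero>\<^bsub>A\<^esub>"
    using A.smult_assoc1[of "inv\<^bsub>K\<^esub> (c l)" "c l" "\<one>\<^bsub>A\<^esub>"] cc u 0 by simp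
  then show False using A(2) u by (simp add: A.smult_one)
qed

section \<open>Lifting trivial idempotents\<close>

text \<open>
  For the assumption \<open>correct\<close>: if the differential of \<open>\<rho>\<close> lies in the equaliser of \<open>f \<iota>\<close> and \<open>\<iota>\<close>, then
  \<open>\<iota> \<rho> - f (\<iota> \<rho>)\<close> is a cocycle in the acyclic kernel of \<open>f\<close>. A primitive in this kernel lifts to the
  required element \<open>\<nu>\<close> of \<open>R\<close>.
\<close>

lemma idempotent_kernel_path_lifting:
  fixes R :: "('k, 'u, 'y) dga_scheme" and RB :: "('k, 'u, 'z) dga_scheme"
  assumes K: "field K" "\<And>n :: nat. n > 0 \<Longrightarrow> [n] \<cdot>\<^bsub>K\<^esub> \<one>\<^bsub>K\<^esub> \<noteq> \<zero>\<^bsub>K\<^esub>"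
    and R: "cdga K R" and RB: "cdga K RB" and \<iota>: "\<iota> \<in> dghom K R RB" and surj: "\<iota> ` carrier R = carrier RB"
    and f: "f \<in> dghom K RB RB" "\<And>x. x \<in> carrier RB \<Longrightarrow> f (f x) = f x" "weak_equivalence RB RB f"
    and H: "graded_ideal R H" and dH: "\<And>i x. x \<in> H i \<Longrightarrow> differential R x \<in> H (i + 1)"
    and fH: "\<And>i x. x \<in> H i \<Longrightarrow> f (\<iota> x) = \<zero>\<^bsub>RB\<^esub>"
    and acyc: "\<And>i x. \<lbrakk>x \<in> H i; differential R x = \<zero>\<^bsub>R\<^esub>\<rbrakk> \<Longrightarrow> \<exists>y\<in>H (i - 1). differential R y = x"
  shows "path_lifting K R RB \<iota> (\<lambda>x. f (\<iota> x)) H"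
proof (intro path_lifting.intro path_lifting_axioms.intro R RB K \<iota> dghom_comp[OF \<iota> f(1)] H dH fH acyc)
  interpret R: cdga K R by (rule R)
  interpret RB: cdga K RB by (rule RB)
  fix n \<rho> assume \<rho>: "\<rho> \<in> grade R n" "f (\<iota> (differential R \<rho>)) = \<iota> (differential R \<rho>)"
  note \<iota>g = dghom_ghom[OF \<iota>] and fg = dghom_ghom[OF f(1)]
  have \<rho>c: "\<rho> \<in> carrier R" by (rule R.grade_closed[OF \<rho>(1)])
  have c: "\<iota> \<rho> \<in> carrier RB" "f (\<iota> \<rho>) \<in> carrier RB" using \<rho>c by (simp_all add: ghom_closed[OF \<iota>g] ghom_closed[OF fg])
  let ?c = "\<iota> \<rho> \<ominus>\<^bsub>RB\<^esub> f (\<iota> \<rho>)"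
  have "?c \<in> grade RB n"
    using ghom_grade[OF \<iota>g \<rho>(1)] ghom_grade[OF fg ghom_grade[OF \<iota>g \<rho>(1)]] by (simp add: a_minus_def RB.grade_add RB.grade_neg)
  moreover have "f ?c = \<zero>\<^bsub>RB\<^esub>" using c f(2)[OF c(1)]
    by (subst ghom_minus[OF fg RB.ring_axioms RB.ring_axioms]) (simp_all add: a_minus_def RB.r_neg)
  moreover have "differential RB ?c = \<zero>\<^bsub>RB\<^esub>"
  proof -
    have "differential RB (f (\<iota> \<rho>)) = differential RB (\<iota> \<rho>)"
      using \<rho>(2) by (simp add: dghom_d[OF \<iota> \<rho>c] dghom_d[OF f(1) c(1)])
    then show ?thesis using c by (subst RB.d_minus) (simp_all add: a_minus_def RB.d_closed RB.r_neg)
  qed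
  ultimately obtain y where y: "y \<in> grade RB (n - 1)" "f y = \<zero>\<^bsub>RB\<^esub>" "differential RB y = ?c"
    using RB.weak_equivalence_kernel[OF f] by blast
  obtain x where x: "x \<in> carrier R" "y = \<iota> x" using RB.grade_closed[OF y(1)] surj by blast
  let ?\<nu> = "hcomp R (n - 1) x"
  have \<nu>g: "?\<nu> \<in> grade R (n - 1)" by (rule R.hcomp_grade[OF x(1)])
  have \<nu>c: "?\<nu> \<in> carrier R" by (rule R.grade_closed[OF \<nu>g])
  have \<iota>\<nu>: "\<iota> ?\<nu> = y"
    using ghom_hcomp[OF \<iota>g R.graded_comm_algebra_axioms RB.graded_comm_algebra_axioms x(1)] RB.hcomp_homogeneous[OF y(1)]
    by (simp add: x(2))
  have "\<iota> (\<rho> \<ominus>\<^bsub>R\<^esub> differential R ?\<nu>) = \<iota> \<rho> \<ominus>\<^bsub>RB\<^esub> ?c"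
    using \<rho>c \<nu>c dghom_d[OF \<iota> \<nu>c]
    by (subst ghom_minus[OF \<iota>g R.ring_axioms RB.ring_axioms]) (simp_all add: R.d_closed \<iota>\<nu> y(3))
  also have "\<dots> = f (\<iota> \<rho>)" using c by algebra
  finally have e: "\<iota> (\<rho> \<ominus>\<^bsub>R\<^esub> differential R ?\<nu>) = f (\<iota> \<rho>)" .
  show "\<exists>\<nu>\<in>grade R (n - 1). f (\<iota> \<nu>) = \<zero>\<^bsub>RB\<^esub> \<and>
      f (\<iota> (\<rho> \<ominus>\<^bsub>R\<^esub> differential R \<nu>)) = \<iota> (\<rho> \<ominus>\<^bsub>R\<^esub> differential R \<nu>)"
    by (rule bexI[OF _ \<nu>g]) (simp add: e \<iota>\<nu> y(2) f(2)[OF c(1)])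
qed

theorem theorem6p12:
  fixes K :: "('k, 'm) ring_scheme"
    and A :: "('k, 'u) dga"
    and B P\<^sub>A R\<^sub>A P\<^sub>B R\<^sub>B :: "('k, 'u) under_dga"
    and \<iota>\<^sub>P \<iota>\<^sub>R g\<^sub>A e\<^sub>A g\<^sub>B e\<^sub>B f\<^sub>B :: "'u \<Rightarrow> 'u"
  assumes "field K" and "\<And>n :: nat. n > 0 \<Longrightarrow> [n] \<cdot>\<^bsub>K\<^esub> \<one>\<^bsub>K\<^esub> \<noteq> \<zero>\<^bsub>K\<^esub>"
    and "dg_artin K A" and "dg_artin K B"
    and "under_obj K A B" and "unit_map B ` carrier A = carrier B"
    and "flat K A P\<^sub>A" and "flat K A R\<^sub>A"
    and "g\<^sub>A \<in> under_hom K A P\<^sub>A R\<^sub>A" and "cofibration K P\<^sub>A R\<^sub>A g\<^sub>A"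
    and "trivial_idempotent K A P\<^sub>A e\<^sub>A"
    and "base_change K A B P\<^sub>A P\<^sub>B \<iota>\<^sub>P" and "base_change K A B R\<^sub>A R\<^sub>B \<iota>\<^sub>R"
    and "base_change_map K B P\<^sub>A P\<^sub>B \<iota>\<^sub>P R\<^sub>B \<iota>\<^sub>R g\<^sub>A g\<^sub>B"
    and "base_change_map K B P\<^sub>A P\<^sub>B \<iota>\<^sub>P P\<^sub>B \<iota>\<^sub>P e\<^sub>A e\<^sub>B"
    and "trivial_idempotent K B R\<^sub>B f\<^sub>B"
    and "\<forall>x\<in>carrier P\<^sub>B. f\<^sub>B (g\<^sub>B x) = g\<^sub>B (e\<^sub>B x)"
  shows "\<exists>f\<^sub>A. trivial_idempotent K A R\<^sub>A f\<^sub>A \<and>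
      base_change_map K B R\<^sub>A R\<^sub>B \<iota>\<^sub>R R\<^sub>B \<iota>\<^sub>R f\<^sub>A f\<^sub>B \<and>
      (\<forall>x\<in>carrier P\<^sub>A. f\<^sub>A (g\<^sub>A x) = g\<^sub>A (e\<^sub>A x))"
proof -
  have cd: "cdga K A" "cdga K B" "cdga K P\<^sub>A" "cdga K R\<^sub>A" "cdga K P\<^sub>B" "cdga K R\<^sub>B"
    using assms(5,12,13) by (auto simp: base_change_def under_obj_def)
  interpret A: cdga K A by (rule cd)
  interpret B: cdga K B by (rule cd)
  interpret P: cdga K P\<^sub>A by (rule cd)
  interpret R: cdga K R\<^sub>A by (rule cd)
  interpret PB: cdga K P\<^sub>B by (rule cd)
  interpret RB: cdga K R\<^sub>B by (rule cd)
  have uB: "unit_map B \<in> dghom K A B" and uP: "unit_map P\<^sub>A \<in> dghom K A P\<^sub>A" and uR: "unit_map R\<^sub>A \<in> dghom K A R\<^sub>A"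
    and \<iota>P: "\<iota>\<^sub>P \<in> dghom K P\<^sub>A P\<^sub>B" and \<iota>: "\<iota>\<^sub>R \<in> dghom K R\<^sub>A R\<^sub>B"
    using assms(5,12,13) by (auto simp: base_change_def under_obj_def cdga_hom_eq_dghom)
  have g: "g\<^sub>A \<in> dghom K P\<^sub>A R\<^sub>A" and gu: "\<And>a. a \<in> carrier A \<Longrightarrow> g\<^sub>A (unit_map P\<^sub>A a) = unit_map R\<^sub>A a"
    using assms(9) by (auto simp: under_hom_def cdga_hom_eq_dghom)
  have e: "e\<^sub>A \<in> dghom K P\<^sub>A P\<^sub>A" "\<And>x. x \<in> carrier P\<^sub>A \<Longrightarrow> e\<^sub>A (e\<^sub>A x) = e\<^sub>A x" "weak_equivalence P\<^sub>A P\<^sub>A e\<^sub>A"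
    and eu: "\<And>a. a \<in> carrier A \<Longrightarrow> e\<^sub>A (unit_map P\<^sub>A a) = unit_map P\<^sub>A a"
    using assms(11) by (auto simp: trivial_idempotent_def under_hom_def cdga_hom_eq_dghom)
  have f: "f\<^sub>B \<in> dghom K R\<^sub>B R\<^sub>B" "\<And>x. x \<in> carrier R\<^sub>B \<Longrightarrow> f\<^sub>B (f\<^sub>B x) = f\<^sub>B x" "weak_equivalence R\<^sub>B R\<^sub>B f\<^sub>B"
    and fu: "f\<^sub>B \<in> under_hom K B R\<^sub>B R\<^sub>B"
    using assms(16) by (auto simp: trivial_idempotent_def under_hom_def cdga_hom_eq_dghom)
  have gB: "g\<^sub>B (\<iota>\<^sub>P p) = \<iota>\<^sub>R (g\<^sub>A p)" and eB: "e\<^sub>B (\<iota>\<^sub>P p) = \<iota>\<^sub>P (e\<^sub>A p)" if "p \<in> carrier P\<^sub>A" for p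
    using assms(14,15) that by (simp_all add: base_change_map_def)
  have gB0: "g\<^sub>B \<zero>\<^bsub>P\<^sub>B\<^esub> = \<zero>\<^bsub>R\<^sub>B\<^esub>"
    using assms(14) ghom_zero[OF dghom_ghom PB.ring_axioms RB.ring_axioms]
    by (auto simp: base_change_map_def under_hom_def cdga_hom_eq_dghom)
  note gg = dghom_ghom[OF g] and eg = dghom_ghom[OF e(1)] and fg = dghom_ghom[OF f(1)]
    and \<iota>g = dghom_ghom[OF \<iota>] and \<iota>Pg = dghom_ghom[OF \<iota>P]
  have fg_ge: "f\<^sub>B (\<iota>\<^sub>R (g\<^sub>A p)) = \<iota>\<^sub>R (g\<^sub>A (e\<^sub>A p))" if p: "p \<in> carrier P\<^sub>A" for p
  proof -
    have "f\<^sub>B (\<iota>\<^sub>R (g\<^sub>A p)) = f\<^sub>B (g\<^sub>B (\<iota>\<^sub>P p))" by (simp add: gB[OF p])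
    also have "\<dots> = g\<^sub>B (e\<^sub>B (\<iota>\<^sub>P p))" using assms(17) ghom_closed[OF \<iota>Pg p] by blast
    also have "\<dots> = \<iota>\<^sub>R (g\<^sub>A (e\<^sub>A p))" by (simp add: eB[OF p] gB[OF ghom_closed[OF eg p]])
    finally show ?thesis .
  qed
  have one: "\<one>\<^bsub>A\<^esub> \<noteq> \<zero>\<^bsub>A\<^esub>" "\<one>\<^bsub>B\<^esub> \<noteq> \<zero>\<^bsub>B\<^esub>" by (rule dg_artin_one_nonzero, fact)+
  have inf: "infinite (UNIV :: 'u set)" by (rule infinite_universe[OF assms(1,2) A.graded_comm_algebra_axioms one(1)])
  \<comment> \<open>The acyclic ideal \<open>J\<close>, given by its homogeneous parts \<open>H i\<close>.\<close>
  define N where "N i = {p \<in> grade P\<^sub>A i. e\<^sub>A p = \<zero>\<^bsub>P\<^sub>A\<^esub>}" for i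
  have e0: "e\<^sub>A \<zero>\<^bsub>P\<^sub>A\<^esub> = \<zero>\<^bsub>P\<^sub>A\<^esub>" by (rule ghom_zero[OF eg P.ring_axioms P.ring_axioms])
  have N: "graded_ideal P\<^sub>A N"
    unfolding graded_ideal_def N_def
    by (auto simp: e0 P.grade_add ghom_add[OF eg] ghom_mult[OF eg] P.grade_closed ghom_closed[OF eg] intro: P.mult_grade)
  have dN: "differential P\<^sub>A n \<in> N (i + 1)" if "n \<in> N i" for i n
    using that P.d_grade[of n i] dghom_d[OF e(1), of n] P.grade_closed[of n i] by (simp add: N_def)
  have Nacyc: "\<exists>n'\<in>N (i - 1). differential P\<^sub>A n' = n" if "n \<in> N i" "differential P\<^sub>A n = \<zero>\<^bsub>P\<^sub>A\<^esub>" for i n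
    using P.weak_equivalence_kernel[OF e, of n i] that by (auto simp: N_def)
  define H where "H i = {x. ideal_gen R\<^sub>A (\<lambda>i. g\<^sub>A ` N i) i x}" for i
  have gN: "g\<^sub>A ` N i \<subseteq> grade R\<^sub>A i" for i using ghom_grade[OF gg] by (auto simp: N_def)
  have H: "graded_ideal R\<^sub>A H" unfolding H_def by (rule R.graded_ideal_gen) (rule gN)
  have dH: "differential R\<^sub>A x \<in> H (i + 1)" if "x \<in> H i" for i x
  proof -
    have "differential R\<^sub>A y \<in> g\<^sub>A ` N (i + 1)" if y: "y \<in> g\<^sub>A ` N i" for y i
    proof -
      obtain n where n: "n \<in> N i" "y = g\<^sub>A n" using y by blast
      have "differential R\<^sub>A y = g\<^sub>A (differential P\<^sub>A n)" using n dghom_d[OF g] P.grade_closed[of n i] by (simp add: N_def)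
      then show ?thesis using dN[OF n(1)] by simp
    qed
    then show ?thesis using that R.ideal_gen_d[of "\<lambda>i. g\<^sub>A ` N i", OF gN] by (simp add: H_def)
  qed
  have Hacyc: "\<exists>y\<in>H (i - 1). differential R\<^sub>A y = x" if "x \<in> H i" "differential R\<^sub>A x = \<zero>\<^bsub>R\<^sub>A\<^esub>" for i x
    using cofibration_ideal_acyclic[OF assms(1,2) inf cd(3,4) g assms(10) N dN Nacyc, of i x] that by (auto simp: H_def)
  have fH: "f\<^sub>B (\<iota>\<^sub>R x) = \<zero>\<^bsub>R\<^sub>B\<^esub>" if "x \<in> H i" for i x
  proof -
    have z: "f\<^sub>B (\<iota>\<^sub>R \<zero>\<^bsub>R\<^sub>A\<^esub>) = \<zero>\<^bsub>R\<^sub>B\<^esub>"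
      using ghom_zero[OF ghom_comp[OF \<iota>g fg] R.ring_axioms RB.ring_axioms] .
    have "ideal_gen R\<^sub>A (\<lambda>i. g\<^sub>A ` N i) i x" using that by (simp add: H_def)
    then show ?thesis
    proof induction
      case (base x i)
      then obtain n where n: "n \<in> grade P\<^sub>A i" "e\<^sub>A n = \<zero>\<^bsub>P\<^sub>A\<^esub>" "x = g\<^sub>A n" by (auto simp: N_def)
      then show ?case using fg_ge[OF P.grade_closed[OF n(1)]] ghom_zero[OF ghom_comp[OF gg \<iota>g] P.ring_axioms RB.ring_axioms]
        by simp
    next
      case (mult a j i x)
      have "x \<in> carrier R\<^sub>A" "a \<in> carrier R\<^sub>A"
        using R.grade_closed R.ideal_gen_grade[of "\<lambda>i. g\<^sub>A ` N i", OF gN mult.hyps(2)] mult.hyps(1) by auto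
      then show ?case using mult.IH ghom_mult[OF ghom_comp[OF \<iota>g fg]] ghom_closed[OF ghom_comp[OF \<iota>g fg]] by simp
    next
      case (add i x y)
      have "x \<in> carrier R\<^sub>A" "y \<in> carrier R\<^sub>A"
        using R.grade_closed R.ideal_gen_grade[of "\<lambda>i. g\<^sub>A ` N i", OF gN] add.hyps by blast+
      then show ?case using add.IH ghom_add[OF ghom_comp[OF \<iota>g fg]] by simp
    qed (rule z)
  qed
  have surj: "\<iota>\<^sub>R ` carrier R\<^sub>A = carrier R\<^sub>B" by (rule base_change_surjective[OF assms(13,6)])
  interpret L: path_lifting K R\<^sub>A R\<^sub>B \<iota>\<^sub>R "\<lambda>x. f\<^sub>B (\<iota>\<^sub>R x)" H
    by (rule idempotent_kernel_path_lifting[OF assms(1,2) cd(4,6) \<iota> surj f H dH fH Hacyc])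
  obtain h where h: "h \<in> dghom K R\<^sub>A R\<^sub>A" and hg: "\<And>p. p \<in> carrier P\<^sub>A \<Longrightarrow> h (g\<^sub>A p) = g\<^sub>A (e\<^sub>A p)"
    and \<iota>h: "\<And>x. x \<in> carrier R\<^sub>A \<Longrightarrow> \<iota>\<^sub>R (h x) = f\<^sub>B (\<iota>\<^sub>R x)"
    and h_inj: "\<And>i z y. \<lbrakk>z \<in> grade R\<^sub>A i; differential R\<^sub>A z = \<zero>\<^bsub>R\<^sub>A\<^esub>; y \<in> grade R\<^sub>A (i - 1); h z = differential R\<^sub>A y\<rbrakk>
      \<Longrightarrow> \<exists>y'\<in>grade R\<^sub>A (i - 1). differential R\<^sub>A y' = z"
  proof (rule L.lifted_endomorphism[OF inf cd(3) assms(10) g dghom_comp[OF e(1) g]], goal_cases)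
    case (1 p)
    then show ?case using fg_ge[OF ghom_closed[OF eg 1(2)]] e(2)[OF 1(2)] by simp
  next
    case (2 p)
    have ep: "e\<^sub>A p \<in> carrier P\<^sub>A" by (rule ghom_closed[OF eg 2(2)])
    have q: "p \<ominus>\<^bsub>P\<^sub>A\<^esub> e\<^sub>A p \<in> carrier P\<^sub>A" "e\<^sub>A (p \<ominus>\<^bsub>P\<^sub>A\<^esub> e\<^sub>A p) = \<zero>\<^bsub>P\<^sub>A\<^esub>"
      using 2(2) ep e(2)[OF 2(2)] by (simp_all add: ghom_minus[OF eg P.ring_axioms P.ring_axioms] P.minus_eq_zero_iff)
    have "hcomp R\<^sub>A i (g\<^sub>A (p \<ominus>\<^bsub>P\<^sub>A\<^esub> e\<^sub>A p)) \<in> H i" for i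
    proof -
      have "hcomp P\<^sub>A i (p \<ominus>\<^bsub>P\<^sub>A\<^esub> e\<^sub>A p) \<in> N i"
        using P.hcomp_grade[OF q(1)] ghom_hcomp[OF eg P.graded_comm_algebra_axioms P.graded_comm_algebra_axioms q(1)] q(2)
        by (simp add: N_def)
      then have "g\<^sub>A (hcomp P\<^sub>A i (p \<ominus>\<^bsub>P\<^sub>A\<^esub> e\<^sub>A p)) \<in> H i" by (simp add: H_def ideal_gen.base)
      then show ?thesis
        using ghom_hcomp[OF gg P.graded_comm_algebra_axioms R.graded_comm_algebra_axioms q(1)] by simp
    qed
    then show ?case using 2(2) ep ghom_closed[OF gg]
      by (simp add: total_ideal_def ghom_minus[OF gg P.ring_axioms R.ring_axioms])
  next
    case (3 h)
    show ?case by (rule 3(1)[of h]) (rule 3(2), rule 3(3), assumption, rule 3(4), assumption, rule 3(5))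
  qed
  note hg' = dghom_ghom[OF h]
  have hu: "h (unit_map R\<^sub>A a) = unit_map R\<^sub>A a" if "a \<in> carrier A" for a
    using hg[OF ghom_closed[OF dghom_ghom[OF uP] that]] by (simp add: gu[OF that] eu[OF that])
  define T where "T = (\<Union>i. {a \<in> grade A i. unit_map B a = \<zero>\<^bsub>B\<^esub>})"
  obtain n where n: "products A T n \<subseteq> {\<zero>\<^bsub>A\<^esub>}"
    unfolding T_def by (rule dg_artin_products_vanish[OF assms(3) B.graded_comm_algebra_axioms one(2) dghom_ghom[OF uB]])
  have Tc: "T \<subseteq> carrier A" using A.grade_closed by (auto simp: T_def)
  define \<eta> where "\<eta> x = h (x \<ominus>\<^bsub>R\<^sub>A\<^esub> h x)" for x
  have hc: "h x \<in> carrier R\<^sub>A" if "x \<in> carrier R\<^sub>A" for x using that by (rule ghom_closed[OF hg'])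
  have \<eta>: "\<eta> x = h x \<ominus>\<^bsub>R\<^sub>A\<^esub> h (h x)" if "x \<in> carrier R\<^sub>A" for x
    using that hc unfolding \<eta>_def by (simp add: ghom_minus[OF hg' R.ring_axioms R.ring_axioms])
  have nil: "(\<eta> ^^ Suc n) x = \<zero>\<^bsub>R\<^sub>A\<^esub>" if x: "x \<in> carrier R\<^sub>A" for x
  proof (rule linear_into_nilpotent_ideal[OF A.ring_axioms R.ring_axioms dghom_ghom[OF uR] Tc _ _ _ _ _ x])
    show "products A T (Suc n) \<subseteq> {\<zero>\<^bsub>A\<^esub>}" using A.products_vanish_mono[OF Tc n, of 1] by simp
    show "\<eta> x \<in> carrier R\<^sub>A" if "x \<in> carrier R\<^sub>A" for x using that hc by (simp add: \<eta>)
    show "\<eta> (x \<oplus>\<^bsub>R\<^sub>A\<^esub> y) = \<eta> x \<oplus>\<^bsub>R\<^sub>A\<^esub> \<eta> y" if "x \<in> carrier R\<^sub>A" "y \<in> carrier R\<^sub>A" for x y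
      using that hc by (simp add: \<eta> ghom_add[OF hg'] a_minus_def R.minus_add R.a_ac)
    show "\<eta> (unit_map R\<^sub>A a \<otimes>\<^bsub>R\<^sub>A\<^esub> x) = unit_map R\<^sub>A a \<otimes>\<^bsub>R\<^sub>A\<^esub> \<eta> x" if "a \<in> carrier A" "x \<in> carrier R\<^sub>A" for a x
      using that hc ghom_closed[OF dghom_ghom[OF uR]]
      by (simp add: \<eta> ghom_mult[OF hg'] hu a_minus_def R.r_distr R.r_minus)
    show "\<eta> x \<in> additive_span R\<^sub>A {unit_map R\<^sub>A t \<otimes>\<^bsub>R\<^sub>A\<^esub> y |t y. t \<in> T \<and> y \<in> carrier R\<^sub>A}" if x: "x \<in> carrier R\<^sub>A" for x
    proof -
      have "\<iota>\<^sub>R (\<eta> x) = \<zero>\<^bsub>R\<^sub>B\<^esub>"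
        using x hc ghom_closed[OF \<iota>g] ghom_closed[OF fg]
        by (simp add: \<eta> ghom_minus[OF \<iota>g R.ring_axioms RB.ring_axioms] \<iota>h f(2) RB.minus_eq_zero_iff)
      moreover have "\<eta> x \<in> carrier R\<^sub>A" using x hc by (simp add: \<eta>)
      ultimately have "\<eta> x \<in> additive_span R\<^sub>A {unit_map R\<^sub>A a \<otimes>\<^bsub>R\<^sub>A\<^esub> y | a y i.
          a \<in> grade A i \<and> unit_map B a = \<zero>\<^bsub>B\<^esub> \<and> y \<in> carrier R\<^sub>A}"
        by (intro base_change_kernel[OF assms(13,6)])
      moreover have "{unit_map R\<^sub>A a \<otimes>\<^bsub>R\<^sub>A\<^esub> y | a y i. a \<in> grade A i \<and> unit_map B a = \<zero>\<^bsub>B\<^esub> \<and> y \<in> carrier R\<^sub>A}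
        = {unit_map R\<^sub>A t \<otimes>\<^bsub>R\<^sub>A\<^esub> y |t y. t \<in> T \<and> y \<in> carrier R\<^sub>A}" unfolding T_def by blast
      ultimately show ?thesis by simp
    qed
  qed
  \<comment> \<open>A positive exponent, since the reduction of \<open>h^0\<close> is the identity and not the idempotent over \<open>B\<close>.\<close>
  let ?k = "Suc n"
  let ?H = "h ^^ ?k"
  obtain F where F: "F \<in> dghom K R\<^sub>A R\<^sub>A" and F_im: "\<And>x. x \<in> carrier R\<^sub>A \<Longrightarrow> \<exists>u\<in>carrier R\<^sub>A. F x = ?H u"
    and HF: "\<And>x. x \<in> carrier R\<^sub>A \<Longrightarrow> ?H (F x) = ?H x"
    and F_eq: "\<And>x u. \<lbrakk>x \<in> carrier R\<^sub>A; u \<in> carrier R\<^sub>A; ?H (?H u) = ?H x\<rbrakk> \<Longrightarrow> F x = ?H u"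
    by (rule fitting_idempotent[OF R.graded_dga_axioms h nil[unfolded \<eta>_def]]) (assumption, rule that)
  have Fc: "F x \<in> carrier R\<^sub>A" if "x \<in> carrier R\<^sub>A" for x using that by (rule ghom_closed[OF dghom_ghom[OF F]])
  have hnc: "(h ^^ m) x \<in> carrier R\<^sub>A" if "x \<in> carrier R\<^sub>A" for m x using that by (induction m) (simp_all add: hc)
  have idem: "F (F x) = F x" if x: "x \<in> carrier R\<^sub>A" for x
  proof -
    obtain u where u: "u \<in> carrier R\<^sub>A" "F x = ?H u" using F_im[OF x] by blast
    have "F (F x) = ?H u" by (rule F_eq[OF Fc[OF x] u(1)]) (simp only: u(2))
    then show ?thesis using u(2) by simp
  qed
  have fix_im: "F x = y" if "x \<in> carrier R\<^sub>A" "y \<in> carrier R\<^sub>A" "h y = y" "h x = y" for x y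
  proof -
    have y: "(h ^^ m) y = y" for m using that(3) by (induction m) simp_all
    have "?H x = y" using y[of n] that(4) by (simp add: funpow_swap1)
    then show ?thesis using F_eq[OF that(1,2)] y[of ?k] by simp
  qed
  have Fg: "F (g\<^sub>A p) = g\<^sub>A (e\<^sub>A p)" if p: "p \<in> carrier P\<^sub>A" for p
  proof (rule fix_im)
    show "h (g\<^sub>A (e\<^sub>A p)) = g\<^sub>A (e\<^sub>A p)" using hg[OF ghom_closed[OF eg p]] e(2)[OF p] by simp
  qed (use p hg ghom_closed[OF eg] ghom_closed[OF gg] in auto)
  have Fu: "F (unit_map R\<^sub>A a) = unit_map R\<^sub>A a" if "a \<in> carrier A" for a
    using that hu ghom_closed[OF dghom_ghom[OF uR]] by (intro fix_im) auto
  have \<iota>H: "\<iota>\<^sub>R ((h ^^ Suc m) x) = f\<^sub>B (\<iota>\<^sub>R x)" if x: "x \<in> carrier R\<^sub>A" for m x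
  proof (induction m)
    case 0
    then show ?case using \<iota>h[OF x] by simp
  next
    case (Suc m)
    have "\<iota>\<^sub>R ((h ^^ Suc (Suc m)) x) = f\<^sub>B (\<iota>\<^sub>R ((h ^^ Suc m) x))" using \<iota>h[OF hnc[OF x, of "Suc m"]] by simp
    then show ?case using Suc f(2)[OF ghom_closed[OF \<iota>g x]] by simp
  qed
  have \<iota>F: "f\<^sub>B (\<iota>\<^sub>R x) = \<iota>\<^sub>R (F x)" if x: "x \<in> carrier R\<^sub>A" for x
  proof -
    obtain u where u: "u \<in> carrier R\<^sub>A" "F x = ?H u" using F_im[OF x] by blast
    have "f\<^sub>B (\<iota>\<^sub>R x) = \<iota>\<^sub>R (?H (F x))" using \<iota>H[OF x] HF[OF x] by simp
    also have "\<dots> = f\<^sub>B (\<iota>\<^sub>R (F x))" by (rule \<iota>H[OF Fc[OF x]])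
    also have "\<dots> = f\<^sub>B (f\<^sub>B (\<iota>\<^sub>R u))" using \<iota>H[OF u(1)] u(2) by simp
    also have "\<dots> = \<iota>\<^sub>R (F x)" using f(2)[OF ghom_closed[OF \<iota>g u(1)]] \<iota>H[OF u(1)] u(2) by simp
    finally show ?thesis .
  qed
  have coboundary: "\<exists>y\<in>grade R\<^sub>A (i - 1). differential R\<^sub>A y = z"
    if "z \<in> grade R\<^sub>A i" "differential R\<^sub>A z = \<zero>\<^bsub>R\<^sub>A\<^esub>" "(h ^^ m) z = \<zero>\<^bsub>R\<^sub>A\<^esub>" for i z m
    using that
  proof (induction m arbitrary: z)
    case 0
    then show ?case by (intro bexI[of _ "\<zero>\<^bsub>R\<^sub>A\<^esub>"]) simp_all
  next
    case (Suc m)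
    have zc: "z \<in> carrier R\<^sub>A" by (rule R.grade_closed[OF Suc.prems(1)])
    have "differential R\<^sub>A (h z) = \<zero>\<^bsub>R\<^sub>A\<^esub>"
      using dghom_d[OF h zc] Suc.prems(2) ghom_zero[OF hg' R.ring_axioms R.ring_axioms] by simp
    moreover have "(h ^^ m) (h z) = \<zero>\<^bsub>R\<^sub>A\<^esub>" using Suc.prems(3) by (simp add: funpow_swap1)
    ultimately obtain y where "y \<in> grade R\<^sub>A (i - 1)" "differential R\<^sub>A y = h z"
      using Suc.IH[OF ghom_grade[OF hg' Suc.prems(1)]] by blast
    then show ?case using h_inj[OF Suc.prems(1,2)] by simp
  qed
  have "weak_equivalence R\<^sub>A R\<^sub>A F"
  proof (rule R.weak_equivalenceI[OF F idem])
    fix i z assume z: "z \<in> grade R\<^sub>A i" "F z = \<zero>\<^bsub>R\<^sub>A\<^esub>" "differential R\<^sub>A z = \<zero>\<^bsub>R\<^sub>A\<^esub>"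
    have "(h ^^ m) \<zero>\<^bsub>R\<^sub>A\<^esub> = \<zero>\<^bsub>R\<^sub>A\<^esub>" for m
      using ghom_zero[OF hg' R.ring_axioms R.ring_axioms] by (induction m) simp_all
    then have "?H z = \<zero>\<^bsub>R\<^sub>A\<^esub>" using HF[OF R.grade_closed[OF z(1)]] z(2) by metis
    then show "\<exists>y\<in>grade R\<^sub>A (i - 1). differential R\<^sub>A y = z" by (rule coboundary[OF z(1,3)])
  qed
  then have "trivial_idempotent K A R\<^sub>A F"
    using F Fu idem by (simp add: trivial_idempotent_def under_hom_def cdga_hom_eq_dghom)
  moreover have "base_change_map K B R\<^sub>A R\<^sub>B \<iota>\<^sub>R R\<^sub>B \<iota>\<^sub>R F f\<^sub>B"
    using fu \<iota>F by (simp add: base_change_map_def)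
  ultimately show ?thesis using Fg by blast
qed

end
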